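(* Fix $x_0\in\mathbb{R}^d$, $\alpha\in[0,1)$, and a noisy gradient oracle with scale parameter (NGOS) $\mathcal{G}_\sigma=(\mathcal{L},\Sigma,\mathcal{Z}_\sigma)$ satisfying the NGOS assumption (Well-Behaved and Bounded Moments). For $\eta>0$, let $x^\eta_k$ be the SGDM trajectory with hyperparameter schedule $\{(\eta_k,\beta_k)\}_{k\ge 0}$ scaled by $\eta$ with index $\alpha$, noise scale $\sigma\le \eta^{-1/2}$ and initialization $(m_0,x_0)$, where $m_0$ has all moments bounded (for each $m\ge1$ there is a constant $C_m\ge 0$ with $\mathbb{E}\|m_0\|_2^m\le C_m$). Let $z^\eta_k$ be the SGD trajectory with $z^\eta_0=x_0$, the same noise scale $\sigma$, and learning rates $$\bar\eta_k=\sum_{s=k}^\infty \eta_s\Big(\prod_{\tau=k+1}^s\beta_\tau\Big)(1-\beta_k).$$ Then $x^\eta_k$ is an order-$(1-\alpha)/2$ weak approximation of $z^\eta_k$. In particular, for a constant schedule $\eta_k=\eta$, $\beta_k=\beta$ (scaled by $\eta$ with index $\alpha$) one has $\bar\eta_k=\eta$, and SGD and SGDM with the same learning rate $\eta$ weakly approximate each other at distance $O(\sqrt{\eta/(1-\beta)})$; that is, for every $T>0$ and every test function $h$ as in the definition of weak approximation, $\max_{0\le k\le\lfloor T/\eta\rfloor}|\mathbb{E}h(x_k^\eta)-\mathbb{E}h(z_k^\eta)|=O(\sqrt{\eta/(1-\beta)})$.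
   Context: NGOS: a tuple $\mathcal{G}_\sigma=(\mathcal{L},\Sigma,\mathcal{Z}_\sigma)$, with $\mathcal{L}:\mathbb{R}^d\to\mathbb{R}$; for scale $\sigma>0$ and input $\theta\in\mathbb{R}^d$ it returns (with fresh randomness at every call) $g=\nabla\mathcal{L}(\theta)+\sigma v$, where $v\sim\mathcal{Z}_\sigma(\theta)$ has mean zero and covariance matrix $\Sigma(\theta)$, which does not depend on $\sigma$. Write $g\sim\mathcal{G}_\sigma(\theta)$. NGOS assumption. (Well-Behaved) $\nabla\mathcal{L}$ is Lipschitz and $C^\infty$; $\Sigma^{1/2}$ is bounded, Lipschitz and $C^\infty$; all partial derivatives of $\nabla\mathcal{L}$ and $\Sigma^{1/2}$ up to and including third order have polynomial growth. (Bounded Moments) For all integers $m\ge1$ and all $\sigma$ there is a constant $C_{2m}$ independent of $\sigma$ with $(\mathbb{E}_{v\sim\mathcal{Z}_\sigma(\theta)}\|v\|_2^{2m})^{1/(2m)}\le C_{2m}(1+\|\theta\|_2)$ for all $\theta\in\mathbb{R}^d$. SGD with learning rates $\{\bar\eta_k\}$: $z_{k+1}=z_k-\bar\eta_kg_k$, $g_k\sim\mathcal{G}_\sigma(z_k)$. SGDM with schedule $\{(\eta_k,\beta_k)\}$, $\beta_k\in(0,1)$: $m_{k+1}=\beta_km_k+(1-\beta_k)g_k$, $x_{k+1}=x_k-\eta_km_{k+1}$, $g_k\sim\mathcal{G}_\sigma(x_k)$. A (family of) schedule(s) is scaled by $\eta$ with index $\alpha$ if there are constants $\eta_{\max},\lambda_{\min},\lambda_{\max}$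 independent of $\eta$ such that for all $k$: $0\le\eta_k/\eta<\eta_{\max}$ and $0<\lambda_{\min}\le(1-\beta_k)/\eta^\alpha\le\lambda_{\max}<1$. A function $g:\mathbb{R}^d\to\mathbb{R}^m$ has polynomial growth if $\|g(x)\|_2\le k_1(1+\|x\|_2^{k_2})$ for some constants $k_1,k_2>0$ and all $x$; it has all-order polynomial-growing derivatives if it is $C^\infty$ and all its derivatives (of every order $\ge0$) have polynomial growth. Order-$\gamma$ weak approximation: two families of discrete trajectories $x^\eta_k,y^\eta_k$ are order-$\gamma$ weak approximations of each other if there is $\eta_{\rm thr}>0$ such that for any $T>0$, any $h$ with all-order polynomial-growing derivatives, and any $\eta\le\eta_{\rm thr}$, there is a constant $C_{h,T}$ independent of $\eta$ with $\max_{k=0,\dots,\lfloor T/\eta\rfloor}|\mathbb{E}h(x^\eta_k)-\mathbb{E}h(y^\eta_k)|\le C_{h,T}\,\eta^\gamma$. *)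

theory Defs
  imports "HOL-Probability.Probability"
begin

section \<open>Smoothness and polynomial growth\<close>

definition directional_derivative ::
  "'a \<Rightarrow> ('a::euclidean_space \<Rightarrow> 'b::real_normed_vector) \<Rightarrow> 'a \<Rightarrow> 'b" where
  "directional_derivative v f = (\<lambda>x. frechet_derivative f (at x) v)"

primrec C_k :: "nat \<Rightarrow> ('a::euclidean_space \<Rightarrow> 'b::real_normed_vector) \<Rightarrow> bool" where
  "C_k 0 f \<longleftrightarrow> continuous_on UNIV f"
| "C_k (Suc n) f \<longleftrightarrow>
     (\<forall>x. f differentiable (at x)) \<and> (\<forall>v. C_k n (directional_derivative v f))"

definition C_infinity :: "('a::euclidean_space \<Rightarrow> 'b::real_normed_vector) \<Rightarrow> bool" where
  "C_infinity f \<longleftrightarrow> (\<forall>n. C_k n f)"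

(* The iterated partial derivative along the list bs of standard basis vectors. *)
definition partial_derivative ::
  "'a list \<Rightarrow> ('a::euclidean_space \<Rightarrow> 'b::real_normed_vector) \<Rightarrow> 'a \<Rightarrow> 'b" where
  "partial_derivative bs f = foldr directional_derivative bs f"

definition polynomial_growth :: "('a::real_normed_vector \<Rightarrow> 'b::real_normed_vector) \<Rightarrow> bool" where
  "polynomial_growth f \<longleftrightarrow>
     (\<exists>k1>0. \<exists>k2>0. \<forall>x. norm (f x) \<le> k1 * (1 + norm x powr k2))"

definition partials_polynomial_growth ::
  "nat \<Rightarrow> ('a::euclidean_space \<Rightarrow> 'b::real_normed_vector) \<Rightarrow> bool" where
  "partials_polynomial_growth n f \<longleftrightarrow>
     (\<forall>bs. set bs \<subseteq> Basis \<and> length bs = n \<longrightarrow> polynomial_growth (partial_derivative bs f))"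

definition test_function :: "('a::euclidean_space \<Rightarrow> 'b::real_normed_vector) \<Rightarrow> bool" where
  "test_function h \<longleftrightarrow> C_infinity h \<and> (\<forall>n. partials_polynomial_growth n h)"


section \<open>Noisy gradient oracles with scale parameter\<close>

definition gradient :: "('a::euclidean_space \<Rightarrow> real) \<Rightarrow> 'a \<Rightarrow> 'a" where
  "gradient f x = (THE D. GDERIV f x :> D)"

definition covariance_matrix :: "(real ^ 'n) measure \<Rightarrow> real ^ 'n ^ 'n" where
  "covariance_matrix M =
     (\<chi> i j. \<integral>v. (v $ i - (\<integral>w. w \<partial>M) $ i) * (v $ j - (\<integral>w. w \<partial>M) $ j) \<partial>M)"

(* Z \<sigma> \<theta> is the noise law at scale \<sigma> and input \<theta>. Membership in the function space to
   prob_algebra says that it is a Borel probability measure depending measurably on \<theta>,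
   so that expectations over the iterates make sense. Square integrability is needed because
   Bochner integrals of non-integrable functions are 0. *)
definition NGOS ::
  "(real ^ 'n \<Rightarrow> real) \<Rightarrow> (real ^ 'n \<Rightarrow> real ^ 'n ^ 'n)
    \<Rightarrow> (real \<Rightarrow> real ^ 'n \<Rightarrow> (real ^ 'n) measure) \<Rightarrow> bool" where
  "NGOS L \<Sigma> Z \<longleftrightarrow>
     (\<forall>\<theta>. L differentiable (at \<theta>)) \<and>
     (\<forall>\<sigma>>0. Z \<sigma> \<in> borel \<rightarrow>\<^sub>M prob_algebra borel \<and>
        (\<forall>\<theta>. integrable (Z \<sigma> \<theta>) (\<lambda>v. (norm v)\<^sup>2) \<and>
             (\<integral>v. v \<partial>Z \<sigma> \<theta>) = 0 \<and>
             covariance_matrix (Z \<sigma> \<theta>) = \<Sigma> \<theta>))"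

definition oracle_law ::
  "(real ^ 'n \<Rightarrow> real) \<Rightarrow> (real \<Rightarrow> real ^ 'n \<Rightarrow> (real ^ 'n) measure) \<Rightarrow> real \<Rightarrow> real ^ 'n
    \<Rightarrow> (real ^ 'n) measure" where
  "oracle_law L Z \<sigma> \<theta> = distr (Z \<sigma> \<theta>) borel (\<lambda>v. gradient L \<theta> + \<sigma> *\<^sub>R v)"

definition is_psd_sqrt :: "real ^ 'n ^ 'n \<Rightarrow> real ^ 'n ^ 'n \<Rightarrow> bool" where
  "is_psd_sqrt B A \<longleftrightarrow> transpose B = B \<and> (\<forall>x. 0 \<le> x \<bullet> (B *v x)) \<and> B ** B = A"

(* S is \<Sigma> to the power 1/2; the positive semidefinite square root of a covariance matrix
   exists and is unique, so the existential quantifier involves no choice. The norm of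
   real ^ 'n ^ 'n is the Frobenius norm. *)
definition well_behaved ::
  "(real ^ 'n \<Rightarrow> real) \<Rightarrow> (real ^ 'n \<Rightarrow> real ^ 'n ^ 'n) \<Rightarrow> bool" where
  "well_behaved L \<Sigma> \<longleftrightarrow>
     (\<exists>C. C-lipschitz_on UNIV (gradient L)) \<and>
     C_infinity (gradient L) \<and>
     (\<forall>n\<le>3. partials_polynomial_growth n (gradient L)) \<and>
     (\<exists>S. (\<forall>\<theta>. is_psd_sqrt (S \<theta>) (\<Sigma> \<theta>)) \<and>
          bounded (range S) \<and>
          (\<exists>C. C-lipschitz_on UNIV S) \<and>
          C_infinity S \<and>
          (\<forall>n\<le>3. partials_polynomial_growth n S))"

definition bounded_moments :: "(real \<Rightarrow> real ^ 'n \<Rightarrow> (real ^ 'n) measure) \<Rightarrow> bool" where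
  "bounded_moments Z \<longleftrightarrow>
     (\<forall>m\<ge>1. \<exists>C. \<forall>\<sigma>>0. \<forall>\<theta>.
        integrable (Z \<sigma> \<theta>) (\<lambda>v. norm v ^ (2 * m)) \<and>
        root (2 * m) (\<integral>v. norm v ^ (2 * m) \<partial>Z \<sigma> \<theta>) \<le> C * (1 + norm \<theta>))"


section \<open>Trajectories\<close>

(* The conditional distribution of Y given the sub-\<sigma>-algebra F is \<kappa>. *)
definition has_conditional_law ::
  "'w measure \<Rightarrow> 'w measure \<Rightarrow> ('w \<Rightarrow> 'b::topological_space) \<Rightarrow> ('w \<Rightarrow> 'b measure) \<Rightarrow> bool" where
  "has_conditional_law M F Y \<kappa> \<longleftrightarrow>
     (\<forall>A\<in>sets F. \<forall>B\<in>sets borel.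
        emeasure M (A \<inter> (Y -` B \<inter> space M)) = (\<integral>\<^sup>+\<omega>\<in>A. emeasure (\<kappa> \<omega>) B \<partial>M))"

(* The g k are successive answers of the oracle to the queries x k, each drawn with fresh
   randomness: F k is the information available before the k-th call. *)
definition oracle_answers ::
  "'w measure \<Rightarrow> (nat \<Rightarrow> 'w measure) \<Rightarrow> (real ^ 'n \<Rightarrow> (real ^ 'n) measure)
    \<Rightarrow> (nat \<Rightarrow> 'w \<Rightarrow> real ^ 'n) \<Rightarrow> (nat \<Rightarrow> 'w \<Rightarrow> real ^ 'n) \<Rightarrow> bool" where
  "oracle_answers M F G x g \<longleftrightarrow>
     filtration (space M) F \<and> (\<forall>k. subalgebra M (F k)) \<and>
     (\<forall>k. x k \<in> borel_measurable (F k) \<and>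
          g k \<in> borel_measurable (F (Suc k)) \<and>
          has_conditional_law M (F k) (g k) (\<lambda>\<omega>. G (x k \<omega>)))"

definition SGD_trajectory ::
  "'w measure \<Rightarrow> (real ^ 'n \<Rightarrow> (real ^ 'n) measure) \<Rightarrow> (nat \<Rightarrow> real) \<Rightarrow> real ^ 'n
    \<Rightarrow> (nat \<Rightarrow> 'w \<Rightarrow> real ^ 'n) \<Rightarrow> bool" where
  "SGD_trajectory M G lr z0 z \<longleftrightarrow>
     prob_space M \<and>
     (\<exists>F g. oracle_answers M F G z g \<and>
        (\<forall>\<omega>\<in>space M. z 0 \<omega> = z0 \<and>
           (\<forall>k. z (Suc k) \<omega> = z k \<omega> - lr k *\<^sub>R g k \<omega>)))"

definition SGDM_trajectory ::
  "'w measure \<Rightarrow> (real ^ 'n \<Rightarrow> (real ^ 'n) measure) \<Rightarrow> (nat \<Rightarrow> real) \<Rightarrow> (nat \<Rightarrow> real)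
    \<Rightarrow> ('w \<Rightarrow> real ^ 'n) \<Rightarrow> real ^ 'n \<Rightarrow> (nat \<Rightarrow> 'w \<Rightarrow> real ^ 'n) \<Rightarrow> bool" where
  "SGDM_trajectory M G lr \<beta> m0 x0 x \<longleftrightarrow>
     prob_space M \<and>
     (\<exists>F g m. oracle_answers M F G x g \<and>
        m0 \<in> borel_measurable (F 0) \<and>
        (\<forall>\<omega>\<in>space M. m 0 \<omega> = m0 \<omega> \<and> x 0 \<omega> = x0 \<and>
           (\<forall>k. m (Suc k) \<omega> = \<beta> k *\<^sub>R m k \<omega> + (1 - \<beta> k) *\<^sub>R g k \<omega> \<and>
                x (Suc k) \<omega> = x k \<omega> - lr k *\<^sub>R m (Suc k) \<omega>)))"


section \<open>Schedules and weak approximation\<close>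

(* A family of schedules indexed by \<eta> in the interval (0, \<eta>0]. The index set is bounded
   because for \<alpha> > 0 no family with \<beta> k in (0, 1) satisfies the bounds for all \<eta> > 0. *)
definition scaled_schedules ::
  "real \<Rightarrow> real \<Rightarrow> (real \<Rightarrow> nat \<Rightarrow> real) \<Rightarrow> (real \<Rightarrow> nat \<Rightarrow> real) \<Rightarrow> bool" where
  "scaled_schedules \<eta>0 \<alpha> lr \<beta> \<longleftrightarrow>
     (\<exists>emax lmin lmax. 0 < lmin \<and> lmax < 1 \<and>
        (\<forall>\<eta>\<in>{0<..\<eta>0}. \<forall>k.
           0 < \<beta> \<eta> k \<and> \<beta> \<eta> k < 1 \<and>
           0 \<le> lr \<eta> k / \<eta> \<and> lr \<eta> k / \<eta> < emax \<and>
           lmin \<le> (1 - \<beta> \<eta> k) / \<eta> powr \<alpha> \<and> (1 - \<beta> \<eta> k) / \<eta> powr \<alpha> \<le> lmax))"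

(* The summation index is j = s - k. *)
definition averaged_lr :: "(nat \<Rightarrow> real) \<Rightarrow> (nat \<Rightarrow> real) \<Rightarrow> nat \<Rightarrow> real" where
  "averaged_lr lr \<beta> k = (\<Sum>j. lr (k + j) * (\<Prod>\<tau>=k+1..k+j. \<beta> \<tau>) * (1 - \<beta> k))"

(* Weak approximation at distance O(r \<eta>) of the families x \<eta>, y \<eta>, which may live on
   different probability spaces. *)
definition weak_approximation_rate ::
  "(real \<Rightarrow> real) \<Rightarrow> (real \<Rightarrow> 'w measure) \<Rightarrow> (real \<Rightarrow> nat \<Rightarrow> 'w \<Rightarrow> 'a::euclidean_space)
    \<Rightarrow> (real \<Rightarrow> 'u measure) \<Rightarrow> (real \<Rightarrow> nat \<Rightarrow> 'u \<Rightarrow> 'a) \<Rightarrow> bool" where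
  "weak_approximation_rate r M x N y \<longleftrightarrow>
     (\<exists>\<eta>thr>0. \<forall>T>0. \<forall>h :: 'a \<Rightarrow> real. test_function h \<longrightarrow>
        (\<exists>C. \<forall>\<eta>. 0 < \<eta> \<and> \<eta> \<le> \<eta>thr \<longrightarrow>
           (MAX k\<in>{0..nat \<lfloor>T / \<eta>\<rfloor>}.
              \<bar>(\<integral>\<omega>. h (x \<eta> k \<omega>) \<partial>M \<eta>) - (\<integral>\<omega>. h (y \<eta> k \<omega>) \<partial>N \<eta>)\<bar>) \<le> C * r \<eta>))"

definition weak_approximation ::
  "real \<Rightarrow> (real \<Rightarrow> 'w measure) \<Rightarrow> (real \<Rightarrow> nat \<Rightarrow> 'w \<Rightarrow> 'a::euclidean_space)
    \<Rightarrow> (real \<Rightarrow> 'u measure) \<Rightarrow> (real \<Rightarrow> nat \<Rightarrow> 'u \<Rightarrow> 'a) \<Rightarrow> bool" where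
  "weak_approximation \<gamma> M x N y \<longleftrightarrow> weak_approximation_rate (\<lambda>\<eta>. \<eta> powr \<gamma>) M x N y"

end

(*
  Momentum is removed by the change of variables y_k = x_k - d_k m_k, where d_k m_k is the
  displacement that the current momentum still causes if all later gradients vanish.  Then
  y_(k+1) = y_k - a_k g_k with exactly the averaged learning rate a_k, and the only trace of momentum
  is that g_k is queried at x_k instead of y_k.  With eta = e^2 and 1 - beta of order kappa^2, the
  momentum has size kappa/e, so that |x_k - y_k| = O(e/kappa) = O(eta^((1 - alpha)/2)).

  SGD and the y-process are both compared with one smooth Markov chain, in which the oracle noise is
  replaced by a random column of the square root of Sigma with a random sign, rescaled so that the
  covariance is unchanged.  Its backward evolution u of a test function has derivatives up to order
  three of polynomial growth, uniformly over the O(1/eta) steps, because along the chain the third-order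
  jets of curves have moments growing by a factor 1 + O(eta) per step.  A third-order Taylor expansion
  of u then shows that each step costs O(e^3 + eta |x_k - y_k|), and the errors telescope.
*)

theory Submission
  imports Defs
begin

section \<open>Third-order jets\<close>

text \<open>The chain is interposed because the noise law depends on the query point only
  measurably, so the expected value of a test function after several SGD steps need not be
  differentiable in the starting point. Given the state, the chain matches the oracle in mean and
  covariance, and a second-order expansion sees nothing else. The random sign is essential. In one
  step a jet moves by O(e), which would be ruinous over O(1/e^2) steps; averaging over the two signs
  cancels this order and leaves growth 1 + O(e^2). Squares of derivatives are propagated, since
  Cauchy-Schwarz turns them into averages of weights, where the cancellation takes place. The sizes
  come from the following count. The momentum averages about 1/kappa^2 gradients with noise at most
  of order 1/e, hence has order kappa/e, while a unit of momentum still causes a displacement of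
  order (e/kappa)^2. The product is e/kappa. A step costs e^2 (e/kappa) for the displaced query and
  e^3 for the Taylor error, which is no larger because kappa is at most 1.\<close>

definition jet3 ::
  "('a::euclidean_space \<Rightarrow> 'b::real_normed_vector) \<Rightarrow> ('a \<Rightarrow> 'a \<Rightarrow> 'b) \<Rightarrow> ('a \<Rightarrow> 'a \<Rightarrow> 'a \<Rightarrow> 'b)
    \<Rightarrow> ('a \<Rightarrow> 'a \<Rightarrow> 'a \<Rightarrow> 'a \<Rightarrow> 'b) \<Rightarrow> bool" where
  "jet3 f f1 f2 f3 \<longleftrightarrow>
     (\<forall>x. (f has_derivative f1 x) (at x)) \<and>
     (\<forall>x v. ((\<lambda>x. f1 x v) has_derivative f2 x v) (at x)) \<and>
     (\<forall>x v w. ((\<lambda>x. f2 x v w) has_derivative f3 x v w) (at x))"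

lemma jet3I:
  assumes "\<And>x. (f has_derivative f1 x) (at x)"
    and "\<And>x v. ((\<lambda>x. f1 x v) has_derivative f2 x v) (at x)"
    and "\<And>x v w. ((\<lambda>x. f2 x v w) has_derivative f3 x v w) (at x)"
  shows "jet3 f f1 f2 f3"
  using assms unfolding jet3_def by blast

lemma jet3D:
  assumes "jet3 f f1 f2 f3"
  shows "(f has_derivative f1 x) (at x)"
    and "((\<lambda>x. f1 x v) has_derivative f2 x v) (at x)"
    and "((\<lambda>x. f2 x v w) has_derivative f3 x v w) (at x)"
  using assms unfolding jet3_def by blast+

text \<open>Uniqueness of the derivative: \<open>\<lambda>x. g x (u + v)\<close> can be
  differentiated as it stands or after splitting it by linearity, and likewise for scalar multiples.
  This yields multilinearity of all derivatives in a jet, although each of them is given direction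
  by direction.\<close>

lemma linear_family_derivative:
  fixes g :: "'a::euclidean_space \<Rightarrow> 'c::real_vector \<Rightarrow> 'b::real_normed_vector"
  assumes lin: "\<And>x. linear (g x)"
    and der: "\<And>x v. ((\<lambda>x. g x v) has_derivative g' x v) (at x)"
  shows "linear (\<lambda>v. g' x v w)"
proof
  fix u v and r :: real
  have "((\<lambda>x. g x (u + v)) has_derivative (\<lambda>w. g' x u w + g' x v w)) (at x)"
    unfolding linear_add[OF lin] by (intro has_derivative_add der)
  from has_derivative_unique[OF der this] show "g' x (u + v) w = g' x u w + g' x v w"
    by metis
  have "((\<lambda>x. g x (r *\<^sub>R u)) has_derivative (\<lambda>w. r *\<^sub>R g' x u w)) (at x)"
    unfolding linear_scale[OF lin] by (intro has_derivative_scaleR_right der)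
  from has_derivative_unique[OF der this] show "g' x (r *\<^sub>R u) w = r *\<^sub>R g' x u w"
    by metis
qed

lemma jet3_linear:
  assumes "jet3 f f1 f2 f3"
  shows "linear (\<lambda>v. f1 x v)"
    and "linear (\<lambda>v. f2 x v w)" "linear (\<lambda>w. f2 x v w)"
    and "linear (\<lambda>v. f3 x v w z)" "linear (\<lambda>w. f3 x v w z)" "linear (\<lambda>z. f3 x v w z)"
proof -
  note d = jet3D[OF assms]
  show 1: "linear (\<lambda>v. f1 x v)" for x
    using d(1) has_derivative_linear by blast
  show 2: "linear (\<lambda>w. f2 x v w)" for x v
    using d(2) has_derivative_linear by blast
  show "linear (\<lambda>z. f3 x v w z)"
    using d(3) has_derivative_linear by blast
  show 3: "linear (\<lambda>v. f2 x v w)" for x w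
    by (rule linear_family_derivative[OF 1 d(2)])
  show "linear (\<lambda>v. f3 x v w z)"
    by (rule linear_family_derivative[OF 3 d(3)])
  show "linear (\<lambda>w. f3 x v w z)"
    by (rule linear_family_derivative[OF 2 d(3)])
qed

lemma linear_basis_expansion:
  fixes f :: "'a::euclidean_space \<Rightarrow> 'b::real_vector"
  assumes "linear f"
  shows "f v = (\<Sum>i\<in>Basis. (v \<bullet> i) *\<^sub>R f i)"
proof -
  have "f v = f (\<Sum>i\<in>Basis. (v \<bullet> i) *\<^sub>R i)" by (simp add: euclidean_representation)
  then show ?thesis
    by (simp add: linear_sum[OF assms] linear_scale[OF assms])
qed

text \<open>Only the maps \<open>\<lambda>x. f1 x v\<close> with \<open>v\<close> fixed are known to
  be differentiable. Expanding the moving argument \<open>q x\<close> in the standard basis reduces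
  the claim to product rules for scalar factors.\<close>

lemma has_derivative_apply_linear:
  fixes f1 :: "'b::real_normed_vector \<Rightarrow> 'a::euclidean_space \<Rightarrow> 'c::real_normed_vector"
  assumes lin: "\<And>x. linear (f1 x)" "\<And>x w. linear (\<lambda>v. f2 x v w)"
    and d: "\<And>x v. ((\<lambda>x. f1 x v) has_derivative f2 x v) (at x)"
    and p: "(p has_derivative p') (at x)" and q: "(q has_derivative q') (at x)"
  shows "((\<lambda>x. f1 (p x) (q x)) has_derivative (\<lambda>w. f2 (p x) (q x) (p' w) + f1 (p x) (q' w))) (at x)"
proof -
  have c: "((\<lambda>x. f1 (p x) i) has_derivative (\<lambda>w. f2 (p x) i (p' w))) (at x)" for i
    using has_derivative_compose[OF p d, of i] .
  have "((\<lambda>x. \<Sum>i\<in>Basis. (q x \<bullet> i) *\<^sub>R f1 (p x) i) has_derivative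
     (\<lambda>w. \<Sum>i\<in>Basis. (q x \<bullet> i) *\<^sub>R f2 (p x) i (p' w) + (q' w \<bullet> i) *\<^sub>R f1 (p x) i)) (at x)"
    by (intro has_derivative_sum has_derivative_scaleR c has_derivative_inner_left q)
  then show ?thesis
    unfolding sum.distrib linear_basis_expansion[OF lin(1), symmetric]
      linear_basis_expansion[OF lin(2), symmetric] .
qed

lemma has_derivative_apply_bilinear:
  fixes f2 :: "'b::real_normed_vector \<Rightarrow> 'a::euclidean_space \<Rightarrow> 'd::euclidean_space \<Rightarrow> 'c::real_normed_vector"
  assumes lin: "\<And>x w. linear (\<lambda>v. f2 x v w)" "\<And>x v. linear (\<lambda>w. f2 x v w)"
      "\<And>x w z. linear (\<lambda>v. f3 x v w z)" "\<And>x v z. linear (\<lambda>w. f3 x v w z)"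
    and d: "\<And>x v w. ((\<lambda>x. f2 x v w) has_derivative f3 x v w) (at x)"
    and p: "(p has_derivative p') (at x)" and q: "(q has_derivative q') (at x)"
    and r: "(r has_derivative r') (at x)"
  shows "((\<lambda>x. f2 (p x) (q x) (r x)) has_derivative
    (\<lambda>w. f3 (p x) (q x) (r x) (p' w) + f2 (p x) (q' w) (r x) + f2 (p x) (q x) (r' w))) (at x)"
proof -
  have c: "((\<lambda>x. f2 (p x) (q x) j) has_derivative
      (\<lambda>w. f3 (p x) (q x) j (p' w) + f2 (p x) (q' w) j)) (at x)" for j
    by (rule has_derivative_apply_linear[where ?f1.0="\<lambda>x v. f2 x v j" and ?f2.0="\<lambda>x v. f3 x v j"])
       (use lin d p q in auto)
  have "((\<lambda>x. \<Sum>j\<in>Basis. (r x \<bullet> j) *\<^sub>R f2 (p x) (q x) j) has_derivative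
     (\<lambda>w. \<Sum>j\<in>Basis. (r x \<bullet> j) *\<^sub>R (f3 (p x) (q x) j (p' w) + f2 (p x) (q' w) j)
        + (r' w \<bullet> j) *\<^sub>R f2 (p x) (q x) j)) (at x)"
    by (intro has_derivative_sum has_derivative_scaleR c has_derivative_inner_left r)
  then show ?thesis
    unfolding sum.distrib scaleR_add_right linear_basis_expansion[OF lin(2), symmetric]
      linear_basis_expansion[OF lin(4), symmetric] .
qed

text \<open>Second and third derivative of \<open>f \<circ> \<gamma>\<close> at \<open>0\<close> for a curve \<open>\<gamma>\<close> whose value and first three
  derivatives at \<open>0\<close> are \<open>x, v, w, z\<close>. In this form the chain rule needs no symmetry of \<open>f2\<close>.\<close>

definition jv2 where "jv2 f1 f2 x v w = f1 x w + f2 x v v"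
definition jv3 where "jv3 f1 f2 f3 x v w z = f1 x z + 2 *\<^sub>R f2 x w v + f2 x v w + f3 x v v v"

text \<open>Functoriality of jets of curves: pushing a curve through \<open>F\<close> and then its
  jet through \<open>f\<close> agrees with pushing it through the composition. Later estimates
  follow one jet along a step of the chain and never meet the expanded third derivative of a
  composition.\<close>

lemma jet3_compose:
  assumes f: "jet3 f f1 f2 f3" and F: "jet3 F F1 F2 F3"
  obtains g1 g2 g3 where "jet3 (\<lambda>x. f (F x)) g1 g2 g3"
    and "\<And>x v w z. jv3 g1 g2 g3 x v w z =
      jv3 f1 f2 f3 (F x) (F1 x v) (jv2 F1 F2 x v w) (jv3 F1 F2 F3 x v w z)"
proof
  note df = jet3D[OF f] and dF = jet3D[OF F]
  note lf = jet3_linear[OF f] and lF = jet3_linear[OF F]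
  show "jet3 (\<lambda>x. f (F x)) (\<lambda>x v. f1 (F x) (F1 x v))
     (\<lambda>x v w. f2 (F x) (F1 x v) (F1 x w) + f1 (F x) (F2 x v w))
     (\<lambda>x v w z. (f3 (F x) (F1 x v) (F1 x w) (F1 x z) + f2 (F x) (F2 x v z) (F1 x w)
         + f2 (F x) (F1 x v) (F2 x w z))
       + (f2 (F x) (F2 x v w) (F1 x z) + f1 (F x) (F3 x v w z)))"
  proof (rule jet3I)
    show "((\<lambda>x. f (F x)) has_derivative (\<lambda>v. f1 (F x) (F1 x v))) (at x)" for x
      using has_derivative_compose[OF dF(1) df(1)] .
    show "((\<lambda>x. f1 (F x) (F1 x v)) has_derivative
       (\<lambda>w. f2 (F x) (F1 x v) (F1 x w) + f1 (F x) (F2 x v w))) (at x)" for x v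
      by (rule has_derivative_apply_linear[OF lf(1,2) df(2) dF(1,2)])
    show "((\<lambda>x. f2 (F x) (F1 x v) (F1 x w) + f1 (F x) (F2 x v w)) has_derivative
       (\<lambda>z. (f3 (F x) (F1 x v) (F1 x w) (F1 x z) + f2 (F x) (F2 x v z) (F1 x w)
         + f2 (F x) (F1 x v) (F2 x w z))
       + (f2 (F x) (F2 x v w) (F1 x z) + f1 (F x) (F3 x v w z)))) (at x)" for x v w
      by (intro has_derivative_add has_derivative_apply_bilinear[OF lf(2,3,4,5) df(3) dF(1,2,2)]
          has_derivative_apply_linear[OF lf(1,2) df(2) dF(1,3)])
  qed
  show "jv3 (\<lambda>x v. f1 (F x) (F1 x v))
     (\<lambda>x v w. f2 (F x) (F1 x v) (F1 x w) + f1 (F x) (F2 x v w))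
     (\<lambda>x v w z. (f3 (F x) (F1 x v) (F1 x w) (F1 x z) + f2 (F x) (F2 x v z) (F1 x w)
         + f2 (F x) (F1 x v) (F2 x w z))
       + (f2 (F x) (F2 x v w) (F1 x z) + f1 (F x) (F3 x v w z))) x v w z =
      jv3 f1 f2 f3 (F x) (F1 x v) (jv2 F1 F2 x v w) (jv3 F1 F2 F3 x v w z)" for x v w z
    unfolding jv3_def jv2_def
    by (simp add: linear_add[OF lf(1)] linear_add[OF lf(2)] linear_add[OF lf(3)]
        linear_scale[OF lf(1)] scaleR_add_right scaleR_2 algebra_simps)
qed

lemma jet3_add:
  assumes "jet3 f f1 f2 f3" "jet3 g g1 g2 g3"
  shows "jet3 (\<lambda>x. f x + g x) (\<lambda>x v. f1 x v + g1 x v) (\<lambda>x v w. f2 x v w + g2 x v w)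
    (\<lambda>x v w z. f3 x v w z + g3 x v w z)"
  by (intro jet3I has_derivative_add jet3D[OF assms(1)] jet3D[OF assms(2)])

lemma jet3_bounded_linear:
  assumes "bounded_linear T" "jet3 f f1 f2 f3"
  shows "jet3 (\<lambda>x. T (f x)) (\<lambda>x v. T (f1 x v)) (\<lambda>x v w. T (f2 x v w)) (\<lambda>x v w z. T (f3 x v w z))"
  by (intro jet3I bounded_linear.has_derivative[OF assms(1)] jet3D[OF assms(2)])

lemmas jet3_scaleR = jet3_bounded_linear[OF bounded_linear_scaleR_right]

lemma jet3_sum:
  assumes "\<And>i. i \<in> I \<Longrightarrow> jet3 (f i) (f1 i) (f2 i) (f3 i)"
  shows "jet3 (\<lambda>x. \<Sum>i\<in>I. f i x) (\<lambda>x v. \<Sum>i\<in>I. f1 i x v) (\<lambda>x v w. \<Sum>i\<in>I. f2 i x v w)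
    (\<lambda>x v w z. \<Sum>i\<in>I. f3 i x v w z)"
  using assms by (intro jet3I has_derivative_sum) (auto dest: jet3D)

lemma jet3_ident: "jet3 (\<lambda>x. x) (\<lambda>x v. v) (\<lambda>x v w. 0) (\<lambda>x v w z. 0)"
  by (intro jet3I has_derivative_ident has_derivative_const)

section \<open>Symmetric perturbations and the weight of a jet\<close>

text \<open>A perturbation of order \<open>e\<close> that averages out to order \<open>e\<^sup>2\<close> over the two signs. The multiplicative
  form makes the notion stable under sums and products.\<close>

definition symm_perturbed :: "real \<Rightarrow> real \<Rightarrow> real \<Rightarrow> real \<Rightarrow> real \<Rightarrow> real \<Rightarrow> bool" where
  "symm_perturbed C e A Q Qp Qm \<longleftrightarrow>
     0 \<le> Q \<and> Q \<le> A \<and> \<bar>Qp - Q\<bar> \<le> C * e * A \<and> \<bar>Qm - Q\<bar> \<le> C * e * A \<and>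
     \<bar>Qp + Qm - 2 * Q\<bar> \<le> C * e\<^sup>2 * A"

lemma symm_perturbed_weaken:
  assumes "symm_perturbed C e A Q Qp Qm" "A \<le> B" "C \<le> D" "0 \<le> C" "0 \<le> e"
  shows "symm_perturbed D e B Q Qp Qm"
proof -
  have A: "0 \<le> A" using assms(1) by (auto simp: symm_perturbed_def)
  have "C * e * A \<le> D * e * B" "C * e\<^sup>2 * A \<le> D * e\<^sup>2 * B"
    using assms A by (auto intro!: mult_mono)
  then show ?thesis using assms unfolding symm_perturbed_def by linarith
qed

lemma symm_perturbed_const: "0 \<le> Q \<Longrightarrow> symm_perturbed 0 e Q Q Q Q"
  by (simp add: symm_perturbed_def)

lemma symm_perturbed_add:
  assumes "symm_perturbed C e A Q Qp Qm" "symm_perturbed D e B R Rp Rm" "0 \<le> C" "0 \<le> D" "0 \<le> e"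
  shows "symm_perturbed (C + D) e (A + B) (Q + R) (Qp + Rp) (Qm + Rm)"
proof -
  have AB: "0 \<le> A" "0 \<le> B" using assms by (auto simp: symm_perturbed_def)
  have "C * x * A + D * x * B \<le> (C + D) * x * (A + B)" if "x \<ge> 0" for x
    using AB assms that by (simp add: algebra_simps)
  from this[of e] this[of "e\<^sup>2"] show ?thesis
    using assms unfolding symm_perturbed_def by (smt (verit) zero_le_power2)
qed

text \<open>The increment of a product consists of two parts linear in the increments of the
  factors, which inherit the cancellation between the signs, and the product of both increments,
  which is already of order \<open>e^2\<close>. The latter occurs once for each sign, hence
  \<open>2 * C * D\<close>.\<close>

lemma symm_perturbed_mult:
  assumes Q: "symm_perturbed C e A Q Qp Qm" and R: "symm_perturbed D e B R Rp Rm"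
    and "0 \<le> C" "0 \<le> D" "0 \<le> e" "e \<le> 1"
  shows "symm_perturbed (C + D + 2 * C * D) e (A * B) (Q * R) (Qp * Rp) (Qm * Rm)"
proof -
  have AB: "0 \<le> A" "0 \<le> B" "0 \<le> Q" "0 \<le> R" "Q \<le> A" "R \<le> B"
    using Q R by (auto simp: symm_perturbed_def)
  have e2: "e\<^sup>2 \<le> e" using assms by (simp add: power2_eq_square mult_left_le)
  have crossp: "\<bar>(Qp - Q) * (Rp - R)\<bar> \<le> C * D * e\<^sup>2 * (A * B)"
  proof -
    have "\<bar>(Qp - Q) * (Rp - R)\<bar> \<le> (C * e * A) * (D * e * B)"
      unfolding abs_mult using Q R by (intro mult_mono) (auto simp: symm_perturbed_def)
    then show ?thesis by (simp add: power2_eq_square mult_ac)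
  qed
  have crossm: "\<bar>(Qm - Q) * (Rm - R)\<bar> \<le> C * D * e\<^sup>2 * (A * B)"
  proof -
    have "\<bar>(Qm - Q) * (Rm - R)\<bar> \<le> (C * e * A) * (D * e * B)"
      unfolding abs_mult using Q R by (intro mult_mono) (auto simp: symm_perturbed_def)
    then show ?thesis by (simp add: power2_eq_square mult_ac)
  qed
  have lin: "\<bar>Q * d\<bar> \<le> D * x * (A * B)" if "\<bar>d\<bar> \<le> D * x * B" "x \<ge> 0" for d x
  proof -
    have "\<bar>Q * d\<bar> \<le> A * (D * x * B)"
      unfolding abs_mult using AB that by (intro mult_mono) auto
    then show ?thesis by (simp add: mult_ac)
  qed
  have lin': "\<bar>d * R\<bar> \<le> C * x * (A * B)" if "\<bar>d\<bar> \<le> C * x * A" "x \<ge> 0" for d x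
  proof -
    have "\<bar>d * R\<bar> \<le> (C * x * A) * B"
      unfolding abs_mult using AB that by (intro mult_mono) auto
    then show ?thesis by (simp add: mult_ac)
  qed
  have ee: "C * D * e\<^sup>2 * (A * B) \<le> C * D * e * (A * B)"
    using AB assms e2 by (intro mult_right_mono mult_left_mono) auto
  have cd: "0 \<le> C * D * x * (A * B)" if "x \<ge> 0" for x using AB assms that by simp
  have first: "\<bar>P * S - Q * R\<bar> \<le> (C + D + 2 * C * D) * e * (A * B)"
    if "\<bar>(P - Q) * (S - R)\<bar> \<le> C * D * e\<^sup>2 * (A * B)" "\<bar>P - Q\<bar> \<le> C * e * A" "\<bar>S - R\<bar> \<le> D * e * B"
    for P S
  proof -
    have "P * S - Q * R = (P - Q) * (S - R) + Q * (S - R) + (P - Q) * R" by (simp add: algebra_simps)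
    moreover have "(C + D + 2 * C * D) * e * (A * B) =
      C * e * (A * B) + D * e * (A * B) + 2 * (C * D * e * (A * B))" by (simp add: algebra_simps)
    ultimately show ?thesis
      using that(1) lin[OF that(3)] lin'[OF that(2)] ee assms cd[of e] by linarith
  qed
  have "Qp * Rp + Qm * Rm - 2 * (Q * R) =
    (Qp - Q) * (Rp - R) + (Qm - Q) * (Rm - R) + Q * (Rp + Rm - 2 * R) + (Qp + Qm - 2 * Q) * R"
    by (simp add: algebra_simps)
  moreover have "\<bar>Q * (Rp + Rm - 2 * R)\<bar> \<le> D * e\<^sup>2 * (A * B)"
    using R by (intro lin) (auto simp: symm_perturbed_def)
  moreover have "\<bar>(Qp + Qm - 2 * Q) * R\<bar> \<le> C * e\<^sup>2 * (A * B)"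
    using Q by (intro lin') (auto simp: symm_perturbed_def)
  moreover have "(C + D + 2 * C * D) * e\<^sup>2 * (A * B) =
      C * e\<^sup>2 * (A * B) + D * e\<^sup>2 * (A * B) + 2 * (C * D * e\<^sup>2 * (A * B))" by (simp add: algebra_simps)
  ultimately have "\<bar>Qp * Rp + Qm * Rm - 2 * (Q * R)\<bar> \<le> (C + D + 2 * C * D) * e\<^sup>2 * (A * B)"
    using crossp crossm by linarith
  moreover have "Q * R \<le> A * B" using AB by (intro mult_mono) auto
  moreover have "\<bar>Qp * Rp - Q * R\<bar> \<le> (C + D + 2 * C * D) * e * (A * B)"
    by (rule first[OF crossp]) (use Q R in \<open>auto simp: symm_perturbed_def\<close>)
  moreover have "\<bar>Qm * Rm - Q * R\<bar> \<le> (C + D + 2 * C * D) * e * (A * B)"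
    by (rule first[OF crossm]) (use Q R in \<open>auto simp: symm_perturbed_def\<close>)
  ultimately show ?thesis
    unfolding symm_perturbed_def using AB by simp
qed

lemma symm_perturbed_power:
  assumes "0 \<le> C"
  shows "\<exists>D\<ge>0. \<forall>e A Q Qp Qm. 0 \<le> e \<longrightarrow> e \<le> 1 \<longrightarrow> symm_perturbed C e A Q Qp Qm \<longrightarrow>
    symm_perturbed D e (A ^ n) (Q ^ n) (Qp ^ n) (Qm ^ n)"
proof (induction n)
  case 0
  then show ?case by (auto intro!: exI[of _ 0] symm_perturbed_const)
next
  case (Suc n)
  then obtain D where D: "D \<ge> 0" "\<And>e A Q Qp Qm. 0 \<le> e \<Longrightarrow> e \<le> 1 \<Longrightarrow> symm_perturbed C e A Q Qp Qm \<Longrightarrow>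
    symm_perturbed D e (A ^ n) (Q ^ n) (Qp ^ n) (Qm ^ n)" by blast
  then show ?case using assms
    by (intro exI[of _ "C + D + 2 * C * D"]) (auto intro!: symm_perturbed_mult)
qed

text \<open>In the sum over the two signs the inner product of \<open>u\<close> with
  \<open>d *\<^sub>R \<zeta>\<close> cancels. What is left is the inner product with
  \<open>a *\<^sub>R \<beta>\<close>, where \<open>a\<close> has order \<open>e^2\<close>, and
  squares of the two increments.\<close>

lemma symm_perturbed_norm_square:
  fixes u \<beta> \<zeta> :: "'a::real_inner"
  assumes A: "(norm u)\<^sup>2 \<le> A" "(norm \<beta>)\<^sup>2 \<le> K * A" "(norm \<zeta>)\<^sup>2 \<le> K * A"
    and a: "\<bar>a\<bar> \<le> K * e\<^sup>2" and d: "\<bar>d\<bar> \<le> K * e" and e: "0 \<le> e" "e \<le> 1" and K: "1 \<le> K"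
  shows "symm_perturbed (8 * K ^ 4) e A ((norm u)\<^sup>2)
    ((norm (u + a *\<^sub>R \<beta> + d *\<^sub>R \<zeta>))\<^sup>2) ((norm (u + a *\<^sub>R \<beta> - d *\<^sub>R \<zeta>))\<^sup>2)"
proof -
  have A0: "0 \<le> A" using A(1) by (meson order_trans zero_le_power2)
  have e2: "e\<^sup>2 \<le> e" using e by (simp add: power2_eq_square mult_left_le)
  define r where "r = sqrt A"
  have r: "0 \<le> r" "r\<^sup>2 = A" using A0 by (auto simp: r_def)
  have rr: "r * r = A" using r by (simp add: power2_eq_square)
  have nu: "norm u \<le> r" using A(1) unfolding r_def by (simp add: real_le_rsqrt)
  have le: "norm v \<le> K * r" if "(norm v)\<^sup>2 \<le> K * A" for v :: 'a
  proof -
    have "K * A \<le> (K * r)\<^sup>2"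
      unfolding power_mult_distrib r using K A0 by (intro mult_right_mono) (auto simp: power2_eq_square)
    with that have "(norm v)\<^sup>2 \<le> (K * r)\<^sup>2" by linarith
    then show ?thesis using K r(1) by (auto intro: power2_le_imp_le)
  qed
  have nb: "norm \<beta> \<le> K * r" and nz: "norm \<zeta> \<le> K * r" using A le by auto
  have na: "norm (a *\<^sub>R \<beta>) \<le> K * e\<^sup>2 * (K * r)" unfolding norm_scaleR
    by (rule mult_mono) (use a nb K e in auto)
  have nd: "norm (d *\<^sub>R \<zeta>) \<le> K * e * (K * r)" unfolding norm_scaleR
    by (rule mult_mono) (use d nz K e in auto)
  have na': "norm (a *\<^sub>R \<beta>) \<le> K * e * (K * r)"
    using na e2 K r by (smt (verit) mult_left_mono mult_right_mono mult_nonneg_nonneg)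
  have K24: "K\<^sup>2 * (x * A) \<le> K ^ 4 * (x * A)" if "0 \<le> x" for x
    using K that A0 by (intro mult_right_mono power_increasing) auto
  have h: "\<bar>(norm (u + t))\<^sup>2 - (norm u)\<^sup>2\<bar> \<le> 8 * K ^ 4 * e * A"
    if t: "norm t \<le> 2 * (K * e * (K * r))" for t
  proof -
    have eq: "(norm (u + t))\<^sup>2 - (norm u)\<^sup>2 = 2 * (u \<bullet> t) + (norm t)\<^sup>2"
      by (simp add: power2_norm_eq_inner inner_add_left inner_add_right inner_commute)
    have "\<bar>u \<bullet> t\<bar> \<le> norm u * norm t" by (rule Cauchy_Schwarz_ineq2)
    also have "\<dots> \<le> r * (2 * (K * e * (K * r)))" using nu t r by (intro mult_mono) auto
    also have "\<dots> = 2 * K\<^sup>2 * e * A" by (simp add: power2_eq_square rr[symmetric] mult_ac)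
    finally have 1: "\<bar>u \<bullet> t\<bar> \<le> 2 * (K\<^sup>2 * (e * A))" by (simp add: mult.assoc)
    have "(norm t)\<^sup>2 \<le> (2 * (K * e * (K * r)))\<^sup>2" using t by (intro power_mono) auto
    also have "\<dots> = 4 * K ^ 4 * e\<^sup>2 * A" by (simp add: r(2)[symmetric] power_mult_distrib power2_eq_square power4_eq_xxxx mult_ac)
    also have "\<dots> \<le> 4 * K ^ 4 * e * A" using e2 A0 K by (intro mult_right_mono mult_left_mono) auto
    finally have 2: "(norm t)\<^sup>2 \<le> 4 * (K ^ 4 * (e * A))" by (simp add: mult.assoc)
    have "\<bar>2 * (u \<bullet> t) + (norm t)\<^sup>2\<bar> \<le> 8 * (K ^ 4 * (e * A))"
      using 1 2 K24[OF e(1)] zero_le_power2[of "norm t"] by linarith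
    then show ?thesis unfolding eq by (simp add: mult.assoc)
  qed
  have p: "\<bar>(norm (u + a *\<^sub>R \<beta> + d *\<^sub>R \<zeta>))\<^sup>2 - (norm u)\<^sup>2\<bar> \<le> 8 * K ^ 4 * e * A"
    using h[of "a *\<^sub>R \<beta> + d *\<^sub>R \<zeta>"] na' nd norm_triangle_ineq[of "a *\<^sub>R \<beta>" "d *\<^sub>R \<zeta>"]
    by (simp add: add.assoc)
  have m: "\<bar>(norm (u + a *\<^sub>R \<beta> - d *\<^sub>R \<zeta>))\<^sup>2 - (norm u)\<^sup>2\<bar> \<le> 8 * K ^ 4 * e * A"
    using h[of "a *\<^sub>R \<beta> - d *\<^sub>R \<zeta>"] na' nd norm_triangle_ineq4[of "a *\<^sub>R \<beta>" "d *\<^sub>R \<zeta>"]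
    by (simp add: algebra_simps)
  have eq: "(norm (u + a *\<^sub>R \<beta> + d *\<^sub>R \<zeta>))\<^sup>2 + (norm (u + a *\<^sub>R \<beta> - d *\<^sub>R \<zeta>))\<^sup>2 - 2 * (norm u)\<^sup>2 =
    4 * (u \<bullet> (a *\<^sub>R \<beta>)) + 2 * (norm (a *\<^sub>R \<beta>))\<^sup>2 + 2 * (norm (d *\<^sub>R \<zeta>))\<^sup>2"
    unfolding power2_norm_eq_inner
    by (simp add: inner_add_left inner_add_right inner_diff_left inner_diff_right inner_commute)
  have sq: "(norm t)\<^sup>2 \<le> K ^ 4 * e\<^sup>2 * A" if "norm t \<le> K * e * (K * r)" for t :: 'a
  proof -
    have "(norm t)\<^sup>2 \<le> (K * e * (K * r))\<^sup>2" using that by (intro power_mono) auto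
    then show ?thesis
      by (simp add: r(2)[symmetric] power_mult_distrib power2_eq_square power4_eq_xxxx mult_ac)
  qed
  have "\<bar>u \<bullet> (a *\<^sub>R \<beta>)\<bar> \<le> norm u * norm (a *\<^sub>R \<beta>)" by (rule Cauchy_Schwarz_ineq2)
  also have "\<dots> \<le> r * (K * e\<^sup>2 * (K * r))" using nu na r by (intro mult_mono) auto
  also have "\<dots> = K\<^sup>2 * (e\<^sup>2 * A)" by (simp add: power2_eq_square rr[symmetric] mult_ac)
  also have "\<dots> \<le> K ^ 4 * e\<^sup>2 * A" using K24[of "e\<^sup>2"] by (simp add: mult.assoc)
  finally have "\<bar>(norm (u + a *\<^sub>R \<beta> + d *\<^sub>R \<zeta>))\<^sup>2 + (norm (u + a *\<^sub>R \<beta> - d *\<^sub>R \<zeta>))\<^sup>2 - 2 * (norm u)\<^sup>2\<bar>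
    \<le> 8 * K ^ 4 * e\<^sup>2 * A"
    unfolding eq using sq[OF na'] sq[OF nd]
    using zero_le_power2[of "norm (a *\<^sub>R \<beta>)"] zero_le_power2[of "norm (d *\<^sub>R \<zeta>)"] by linarith
  with p m A show ?thesis unfolding symm_perturbed_def by simp
qed


text \<open>The rule for sums adds the reference sizes and so leaves a multiple of the quantity as
  its bound. Moving that multiple into the constant makes the quantity its own reference again,
  which is what a growth factor \<open>1 + O(e^2)\<close> requires.\<close>

lemma symm_perturbed_rescale:
  assumes "symm_perturbed C e (k * Q) Q Qp Qm" "1 \<le> k"
  shows "symm_perturbed (k * C) e Q Q Qp Qm"
  using assms by (simp add: symm_perturbed_def mult_ac)

definition rho :: "'a::real_normed_vector \<Rightarrow> real" where
  "rho x = 1 + (norm x)\<^sup>2"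

lemma rho_ge_1 [simp]: "1 \<le> rho x" "0 \<le> rho x" "0 < rho x"
  by (auto simp: rho_def add_pos_nonneg)

lemma rho_power_ge_1 [simp]: "1 \<le> rho x ^ n" "0 \<le> rho x ^ n"
  by auto

text \<open>The second summands absorb the terms that mix derivatives of different orders, so that each weight
  is reproduced up to a factor \<open>1 + O(e\<^sup>2)\<close>.\<close>

definition jet_weight2 :: "nat \<Rightarrow> 'a::real_normed_vector \<Rightarrow> 'a \<Rightarrow> 'a \<Rightarrow> real" where
  "jet_weight2 q x v w = (norm w)\<^sup>2 + rho x ^ (2 * q) * ((norm v)\<^sup>2)\<^sup>2"

definition jet_weight3 :: "nat \<Rightarrow> 'a::real_normed_vector \<Rightarrow> 'a \<Rightarrow> 'a \<Rightarrow> 'a \<Rightarrow> real" where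
  "jet_weight3 q x v w z = (norm z)\<^sup>2 + rho x ^ (2 * q) * ((norm v)\<^sup>2 * jet_weight2 q x v w)"

text \<open>The first derivative is bounded outright: a bound growing in \<open>x\<close> would
  destroy the growth factor \<open>1 + O(e^2)\<close> already for first-order jets. Higher
  derivatives may grow like \<open>rho x ^ q\<close>, because the powers of \<open>rho x\<close> in
  the jet weights absorb this.\<close>

definition coefficient ::
  "real \<Rightarrow> nat \<Rightarrow> ('a::euclidean_space \<Rightarrow> 'b::real_normed_vector) \<Rightarrow> ('a \<Rightarrow> 'a \<Rightarrow> 'b) \<Rightarrow> ('a \<Rightarrow> 'a \<Rightarrow> 'a \<Rightarrow> 'b)
    \<Rightarrow> ('a \<Rightarrow> 'a \<Rightarrow> 'a \<Rightarrow> 'a \<Rightarrow> 'b) \<Rightarrow> bool" where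
  "coefficient K q f f1 f2 f3 \<longleftrightarrow> jet3 f f1 f2 f3 \<and>
     (\<forall>x. norm (f x) \<le> K * (1 + norm x)) \<and>
     (\<forall>x v. norm (f1 x v) \<le> K * norm v) \<and>
     (\<forall>x v w. norm (f2 x v w) \<le> K * rho x ^ q * norm v * norm w) \<and>
     (\<forall>x v w z. norm (f3 x v w z) \<le> K * rho x ^ q * norm v * norm w * norm z)"

lemma square_sum_le:
  fixes a b c :: real
  shows "(a + b)\<^sup>2 \<le> 2 * (a\<^sup>2 + b\<^sup>2)" "(a + b + c)\<^sup>2 \<le> 3 * (a\<^sup>2 + b\<^sup>2 + c\<^sup>2)"
  using sum_squares_bound[of a b] sum_squares_bound[of a c] sum_squares_bound[of b c]
  by (auto simp: power2_eq_square algebra_simps)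

text \<open>The factors \<open>rho x ^ (2 * q)\<close> in the weights are the squared growth of the
  second and third derivatives, so each order of the jet is controlled by the weight of the same
  order.\<close>

lemma coefficient_jet_bounds:
  assumes c: "coefficient K q f f1 f2 f3"
  shows "(norm (f x))\<^sup>2 \<le> 2 * K\<^sup>2 * rho x"
    and "(norm (f1 x v))\<^sup>2 \<le> K\<^sup>2 * (norm v)\<^sup>2"
    and "(norm (jv2 f1 f2 x v w))\<^sup>2 \<le> 2 * K\<^sup>2 * jet_weight2 q x v w"
    and "(norm (jv3 f1 f2 f3 x v w z))\<^sup>2 \<le> 27 * K\<^sup>2 * jet_weight3 q x v w z"
proof -
  note b = c[unfolded coefficient_def]
  have "(norm (f x))\<^sup>2 \<le> (K * (1 + norm x))\<^sup>2" using b by (intro power_mono) auto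
  also have "\<dots> \<le> K\<^sup>2 * (2 * rho x)"
    unfolding power_mult_distrib rho_def using square_sum_le(1)[of 1 "norm x"]
    by (intro mult_left_mono) auto
  finally show "(norm (f x))\<^sup>2 \<le> 2 * K\<^sup>2 * rho x" by (simp add: mult_ac)
  have "(norm (f1 x v))\<^sup>2 \<le> (K * norm v)\<^sup>2" using b by (intro power_mono) auto
  then show "(norm (f1 x v))\<^sup>2 \<le> K\<^sup>2 * (norm v)\<^sup>2" by (simp add: power_mult_distrib)
  have "norm (jv2 f1 f2 x v w) \<le> norm (f1 x w) + norm (f2 x v v)"
    unfolding jv2_def by (rule norm_triangle_ineq)
  also have "\<dots> \<le> K * norm w + K * (rho x ^ q * (norm v)\<^sup>2)"
    using b by (intro add_mono) (auto simp: power2_eq_square mult.assoc)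
  finally have "(norm (jv2 f1 f2 x v w))\<^sup>2 \<le> (K * norm w + K * (rho x ^ q * (norm v)\<^sup>2))\<^sup>2"
    by (intro power_mono) auto
  also have "\<dots> \<le> 2 * ((K * norm w)\<^sup>2 + (K * (rho x ^ q * (norm v)\<^sup>2))\<^sup>2)" by (rule square_sum_le)
  also have "\<dots> = 2 * K\<^sup>2 * jet_weight2 q x v w"
    unfolding jet_weight2_def power_even_eq[of "rho x"] by (simp add: power2_eq_square algebra_simps)
  finally show "(norm (jv2 f1 f2 x v w))\<^sup>2 \<le> 2 * K\<^sup>2 * jet_weight2 q x v w" .
  have "norm (jv3 f1 f2 f3 x v w z) \<le>
      norm (f1 x z) + norm (2 *\<^sub>R f2 x w v) + norm (f2 x v w) + norm (f3 x v v v)"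
    unfolding jv3_def
    using norm_triangle_ineq[of "f1 x z + 2 *\<^sub>R f2 x w v + f2 x v w" "f3 x v v v"]
      norm_triangle_ineq[of "f1 x z + 2 *\<^sub>R f2 x w v" "f2 x v w"]
      norm_triangle_ineq[of "f1 x z" "2 *\<^sub>R f2 x w v"] by linarith
  also have "\<dots> \<le> K * norm z + 2 * (K * rho x ^ q * norm w * norm v) + K * rho x ^ q * norm v * norm w
      + K * rho x ^ q * norm v * norm v * norm v"
    using b by (intro add_mono) auto
  also have "\<dots> = K * norm z + 3 * K * (rho x ^ q * norm v * norm w) + K * (rho x ^ q * norm v * norm v * norm v)"
    by (simp add: algebra_simps)
  finally have "(norm (jv3 f1 f2 f3 x v w z))\<^sup>2 \<le>
    (K * norm z + 3 * K * (rho x ^ q * norm v * norm w) + K * (rho x ^ q * norm v * norm v * norm v))\<^sup>2"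
    by (intro power_mono) auto
  also have "\<dots> \<le> 3 * ((K * norm z)\<^sup>2 + (3 * K * (rho x ^ q * norm v * norm w))\<^sup>2
      + (K * (rho x ^ q * norm v * norm v * norm v))\<^sup>2)" by (rule square_sum_le)
  also have "\<dots> = 3 * K\<^sup>2 * ((norm z)\<^sup>2 + 9 * (rho x ^ (2 * q) * ((norm v)\<^sup>2 * (norm w)\<^sup>2))
      + 1 * (rho x ^ (2 * q) * ((norm v)\<^sup>2 * ((norm v)\<^sup>2)\<^sup>2)))"
    unfolding power_even_eq[of "rho x"] by (simp add: power2_eq_square algebra_simps)
  \<comment> \<open>In \<open>jet_weight3\<close> the term containing only \<open>v\<close> carries
    \<open>rho x ^ (2 * q)\<close> twice, so one factor that is at least 1 is inserted here.\<close>
  also have "\<dots> \<le> 3 * K\<^sup>2 * (9 * (norm z)\<^sup>2 + 9 * (rho x ^ (2 * q) * ((norm v)\<^sup>2 * (norm w)\<^sup>2))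
      + (9 * rho x ^ (2 * q)) * (rho x ^ (2 * q) * ((norm v)\<^sup>2 * ((norm v)\<^sup>2)\<^sup>2)))"
    by (intro mult_left_mono add_mono mult_right_mono order_refl)
       (use rho_power_ge_1(1)[of x "2 * q"] in \<open>linarith | simp\<close>)+
  also have "\<dots> = 27 * K\<^sup>2 * jet_weight3 q x v w z"
    by (simp add: jet_weight3_def jet_weight2_def algebra_simps)
  finally show "(norm (jv3 f1 f2 f3 x v w z))\<^sup>2 \<le> 27 * K\<^sup>2 * jet_weight3 q x v w z" .
qed

lemma jet_weight_nonneg [simp]: "0 \<le> jet_weight2 q x v w" "0 \<le> jet_weight3 q x v w z"
  by (auto simp: jet_weight2_def jet_weight3_def)

text \<open>The weight is assembled from squared norms by the rules for sums, products and powers,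
  and at every stage the weight of the same order serves as the reference size. The constant is
  fixed before the maps, the point and the jet, so it is the same for all noise directions and all
  steps.\<close>

lemma jet_weight_step:
  fixes K R :: real and q m :: nat
  assumes K: "1 \<le> K" and R: "0 \<le> R"
  obtains C where "0 \<le> C"
    "\<And>(b :: 'a::euclidean_space \<Rightarrow> 'a) b1 b2 b3 s s1 s2 s3 e a d x v w z.
      coefficient K q b b1 b2 b3 \<Longrightarrow> coefficient K q s s1 s2 s3 \<Longrightarrow> 0 \<le> e \<Longrightarrow> e \<le> 1 \<Longrightarrow>
      \<bar>a\<bar> \<le> R * e\<^sup>2 \<Longrightarrow> \<bar>d\<bar> \<le> R * e \<Longrightarrow>
      symm_perturbed C e (rho x ^ m) (rho x ^ m)
        (rho (x + a *\<^sub>R b x + d *\<^sub>R s x) ^ m) (rho (x + a *\<^sub>R b x - d *\<^sub>R s x) ^ m) \<and>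
      symm_perturbed C e (rho x ^ m * jet_weight3 q x v w z) (rho x ^ m * jet_weight3 q x v w z)
        (rho (x + a *\<^sub>R b x + d *\<^sub>R s x) ^ m * jet_weight3 q (x + a *\<^sub>R b x + d *\<^sub>R s x)
          (v + a *\<^sub>R b1 x v + d *\<^sub>R s1 x v) (w + a *\<^sub>R jv2 b1 b2 x v w + d *\<^sub>R jv2 s1 s2 x v w)
          (z + a *\<^sub>R jv3 b1 b2 b3 x v w z + d *\<^sub>R jv3 s1 s2 s3 x v w z))
        (rho (x + a *\<^sub>R b x - d *\<^sub>R s x) ^ m * jet_weight3 q (x + a *\<^sub>R b x - d *\<^sub>R s x)
          (v + a *\<^sub>R b1 x v - d *\<^sub>R s1 x v) (w + a *\<^sub>R jv2 b1 b2 x v w - d *\<^sub>R jv2 s1 s2 x v w)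
          (z + a *\<^sub>R jv3 b1 b2 b3 x v w z - d *\<^sub>R jv3 s1 s2 s3 x v w z))"
proof -
  \<comment> \<open>Dominates all constants of \<open>coefficient_jet_bounds\<close> as well as the
    step-size constant \<open>R\<close>, so that one instance of
    \<open>symm_perturbed_norm_square\<close> fits every order.\<close>
  define L where "L = 27 * K\<^sup>2 + R"
  have K2: "1 \<le> K\<^sup>2" using K by simp
  have L: "1 \<le> L" "2 * K\<^sup>2 \<le> L" "K\<^sup>2 \<le> L" "27 * K\<^sup>2 \<le> L" "R \<le> L" using K2 R by (auto simp: L_def)
  define c where "c = 8 * L ^ 4"
  have c: "0 \<le> c" using L by (simp add: c_def)
  obtain Dq where Dq: "Dq \<ge> 0" "\<And>e A Q Qp Qm. 0 \<le> e \<Longrightarrow> e \<le> 1 \<Longrightarrow> symm_perturbed c e A Q Qp Qm \<Longrightarrow>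
    symm_perturbed Dq e (A ^ (2 * q)) (Q ^ (2 * q)) (Qp ^ (2 * q)) (Qm ^ (2 * q))"
    using symm_perturbed_power[OF c] by blast
  obtain Dm where Dm: "Dm \<ge> 0" "\<And>e A Q Qp Qm. 0 \<le> e \<Longrightarrow> e \<le> 1 \<Longrightarrow> symm_perturbed c e A Q Qp Qm \<Longrightarrow>
    symm_perturbed Dm e (A ^ m) (Q ^ m) (Qp ^ m) (Qm ^ m)"
    using symm_perturbed_power[OF c] by blast
  obtain D2 where D2: "D2 \<ge> 0" "\<And>e A Q Qp Qm. 0 \<le> e \<Longrightarrow> e \<le> 1 \<Longrightarrow> symm_perturbed c e A Q Qp Qm \<Longrightarrow>
    symm_perturbed D2 e (A\<^sup>2) (Q\<^sup>2) (Qp\<^sup>2) (Qm\<^sup>2)"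
    using symm_perturbed_power[OF c] by blast
  \<comment> \<open>The constants follow the build-up of the weight: \<open>c1\<close> belongs to
    the second summand of \<open>jet_weight2\<close> and \<open>c2\<close> to the whole,
    \<open>c3\<close> to its product with \<open>(norm v)\<^sup>2\<close>, \<open>c4\<close> to the
    second summand of \<open>jet_weight3\<close> and \<open>c5\<close> to the whole, and
    \<open>c6\<close> includes the factor \<open>rho x ^ m\<close>.\<close>
  define c1 where "c1 = Dq + D2 + 2 * Dq * D2"
  define c2 where "c2 = 2 * (c + c1)"
  define c3 where "c3 = c + c2 + 2 * c * c2"
  define c4 where "c4 = Dq + c3 + 2 * Dq * c3"
  define c5 where "c5 = 2 * (c + c4)"
  define c6 where "c6 = Dm + c5 + 2 * Dm * c5"
  have pos: "0 \<le> c1" "0 \<le> c2" "0 \<le> c3" "0 \<le> c4" "0 \<le> c5" "0 \<le> c6"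
    using c Dq Dm D2 by (auto simp: c1_def c2_def c3_def c4_def c5_def c6_def)
  show thesis
  proof (rule that)
    show "0 \<le> Dm + c6" using Dm pos by simp
    fix b s :: "'a \<Rightarrow> 'a" and b1 b2 b3 s1 s2 s3 and e a d :: real and x v w z :: 'a
    assume b: "coefficient K q b b1 b2 b3" and s: "coefficient K q s s1 s2 s3"
      and e: "0 \<le> e" "e \<le> 1" and a: "\<bar>a\<bar> \<le> R * e\<^sup>2" and d: "\<bar>d\<bar> \<le> R * e"
    note bb = coefficient_jet_bounds[OF b] and ss = coefficient_jet_bounds[OF s]
    have a': "\<bar>a\<bar> \<le> L * e\<^sup>2"
      using a mult_right_mono[OF L(5), of "e\<^sup>2"] by simp
    have d': "\<bar>d\<bar> \<le> L * e"
      using d mult_right_mono[OF L(5), of e] e by simp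
    have basic: "symm_perturbed c e A ((norm u)\<^sup>2)
        ((norm (u + a *\<^sub>R \<beta> + d *\<^sub>R \<zeta>))\<^sup>2) ((norm (u + a *\<^sub>R \<beta> - d *\<^sub>R \<zeta>))\<^sup>2)"
      if "(norm u)\<^sup>2 \<le> A" "(norm \<beta>)\<^sup>2 \<le> k * A" "(norm \<zeta>)\<^sup>2 \<le> k * A" "k \<le> L" for u \<beta> \<zeta> :: 'a and A k
    proof -
      have "0 \<le> A" using that(1) by (meson order_trans zero_le_power2)
      then have "k * A \<le> L * A" using that(4) by (intro mult_right_mono)
      then show ?thesis unfolding c_def
        by (intro symm_perturbed_norm_square that(1) a' d' e L(1)) (use that in linarith)+
    qed
    define xp xm where x: "xp = x + a *\<^sub>R b x + d *\<^sub>R s x" "xm = x + a *\<^sub>R b x - d *\<^sub>R s x"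
    define vp vm where v: "vp = v + a *\<^sub>R b1 x v + d *\<^sub>R s1 x v" "vm = v + a *\<^sub>R b1 x v - d *\<^sub>R s1 x v"
    define wp wm where w: "wp = w + a *\<^sub>R jv2 b1 b2 x v w + d *\<^sub>R jv2 s1 s2 x v w"
      "wm = w + a *\<^sub>R jv2 b1 b2 x v w - d *\<^sub>R jv2 s1 s2 x v w"
    define zp zm where z: "zp = z + a *\<^sub>R jv3 b1 b2 b3 x v w z + d *\<^sub>R jv3 s1 s2 s3 x v w z"
      "zm = z + a *\<^sub>R jv3 b1 b2 b3 x v w z - d *\<^sub>R jv3 s1 s2 s3 x v w z"
    have "symm_perturbed c e (rho x) ((norm x)\<^sup>2) ((norm xp)\<^sup>2) ((norm xm)\<^sup>2)"
      unfolding x by (rule basic[OF _ bb(1) ss(1) L(2)]) (simp add: rho_def)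
    then have X: "symm_perturbed c e (rho x) (rho x) (rho xp) (rho xm)"
      unfolding symm_perturbed_def rho_def by simp
    note Xq = Dq(2)[OF e X] and Xm = Dm(2)[OF e X]
    have V: "symm_perturbed c e ((norm v)\<^sup>2) ((norm v)\<^sup>2) ((norm vp)\<^sup>2) ((norm vm)\<^sup>2)"
      unfolding v by (rule basic[OF order_refl bb(2) ss(2) L(3)])
    note V2 = D2(2)[OF e V]
    have "symm_perturbed c e (jet_weight2 q x v w) ((norm w)\<^sup>2) ((norm wp)\<^sup>2) ((norm wm)\<^sup>2)"
      unfolding w by (rule basic[OF _ bb(3) ss(3) L(2)]) (simp add: jet_weight2_def)
    from symm_perturbed_add[OF this symm_perturbed_weaken[OF symm_perturbed_mult[OF Xq V2 Dq(1) D2(1) e],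
          of "jet_weight2 q x v w" c1] c pos(1) e(1), folded jet_weight2_def mult_2]
    have "symm_perturbed (c + c1) e (2 * jet_weight2 q x v w) (jet_weight2 q x v w)
        (jet_weight2 q xp vp wp) (jet_weight2 q xm vm wm)"
      using e Dq(1) D2(1) by (simp add: c1_def jet_weight2_def)
    from symm_perturbed_rescale[OF this] have W: "symm_perturbed c2 e (jet_weight2 q x v w) (jet_weight2 q x v w)
        (jet_weight2 q xp vp wp) (jet_weight2 q xm vm wm)"
      by (simp add: c2_def)
    have VW: "symm_perturbed c4 e (rho x ^ (2 * q) * ((norm v)\<^sup>2 * jet_weight2 q x v w))
        (rho x ^ (2 * q) * ((norm v)\<^sup>2 * jet_weight2 q x v w))
        (rho xp ^ (2 * q) * ((norm vp)\<^sup>2 * jet_weight2 q xp vp wp))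
        (rho xm ^ (2 * q) * ((norm vm)\<^sup>2 * jet_weight2 q xm vm wm))"
      unfolding c4_def c3_def using pos c
      by (intro symm_perturbed_mult Xq V W Dq(1) e) (auto simp: c3_def)
    have "symm_perturbed c e (jet_weight3 q x v w z) ((norm z)\<^sup>2) ((norm zp)\<^sup>2) ((norm zm)\<^sup>2)"
      unfolding z by (rule basic[OF _ bb(4) ss(4) L(4)]) (simp add: jet_weight3_def)
    from symm_perturbed_add[OF this symm_perturbed_weaken[OF VW, of "jet_weight3 q x v w z" c4] c pos(4) e(1),
        folded jet_weight3_def mult_2]
    have "symm_perturbed (c + c4) e (2 * jet_weight3 q x v w z) (jet_weight3 q x v w z)
        (jet_weight3 q xp vp wp zp) (jet_weight3 q xm vm wm zm)"
      using pos(4) e by (simp add: jet_weight3_def)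
    from symm_perturbed_rescale[OF this]
    have Z: "symm_perturbed c5 e (jet_weight3 q x v w z) (jet_weight3 q x v w z)
        (jet_weight3 q xp vp wp zp) (jet_weight3 q xm vm wm zm)"
      by (simp add: c5_def)
    have XZ: "symm_perturbed c6 e (rho x ^ m * jet_weight3 q x v w z) (rho x ^ m * jet_weight3 q x v w z)
        (rho xp ^ m * jet_weight3 q xp vp wp zp) (rho xm ^ m * jet_weight3 q xm vm wm zm)"
      unfolding c6_def by (intro symm_perturbed_mult Xm Z Dm(1) pos e)
    have "symm_perturbed (Dm + c6) e (rho x ^ m) (rho x ^ m) (rho xp ^ m) (rho xm ^ m) \<and>
      symm_perturbed (Dm + c6) e (rho x ^ m * jet_weight3 q x v w z) (rho x ^ m * jet_weight3 q x v w z)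
        (rho xp ^ m * jet_weight3 q xp vp wp zp) (rho xm ^ m * jet_weight3 q xm vm wm zm)"
      using Dm(1) pos(6) e(1) symm_perturbed_weaken[OF Xm order_refl, of "Dm + c6"]
        symm_perturbed_weaken[OF XZ order_refl, of "Dm + c6"] by simp
    note this[unfolded x v w z]
    then show "symm_perturbed (Dm + c6) e (rho x ^ m) (rho x ^ m)
        (rho (x + a *\<^sub>R b x + d *\<^sub>R s x) ^ m) (rho (x + a *\<^sub>R b x - d *\<^sub>R s x) ^ m) \<and>
      symm_perturbed (Dm + c6) e (rho x ^ m * jet_weight3 q x v w z) (rho x ^ m * jet_weight3 q x v w z)
        (rho (x + a *\<^sub>R b x + d *\<^sub>R s x) ^ m * jet_weight3 q (x + a *\<^sub>R b x + d *\<^sub>R s x)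
          (v + a *\<^sub>R b1 x v + d *\<^sub>R s1 x v) (w + a *\<^sub>R jv2 b1 b2 x v w + d *\<^sub>R jv2 s1 s2 x v w)
          (z + a *\<^sub>R jv3 b1 b2 b3 x v w z + d *\<^sub>R jv3 s1 s2 s3 x v w z))
        (rho (x + a *\<^sub>R b x - d *\<^sub>R s x) ^ m * jet_weight3 q (x + a *\<^sub>R b x - d *\<^sub>R s x)
          (v + a *\<^sub>R b1 x v - d *\<^sub>R s1 x v) (w + a *\<^sub>R jv2 b1 b2 x v w - d *\<^sub>R jv2 s1 s2 x v w)
          (z + a *\<^sub>R jv3 b1 b2 b3 x v w z - d *\<^sub>R jv3 s1 s2 s3 x v w z))" .
  qed
qed

section \<open>Smooth Markov operators\<close>

text \<open>Squares are bounded because the square of an average is at most the average of the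
  squares: bounds at the branches of one step then become an average of weights, to which the
  cancellation between the signs applies. The form reproduces itself with only \<open>B\<close>
  changing.\<close>

definition weighted_jet_bound ::
  "nat \<Rightarrow> nat \<Rightarrow> real \<Rightarrow> ('a::euclidean_space \<Rightarrow> real) \<Rightarrow> bool" where
  "weighted_jet_bound q m B f \<longleftrightarrow> (\<exists>f1 f2 f3. jet3 f f1 f2 f3 \<and> (\<forall>x. (f x)\<^sup>2 \<le> B * rho x ^ m) \<and>
     (\<forall>x v w z. (jv3 f1 f2 f3 x v w z)\<^sup>2 \<le> B * (rho x ^ m * jet_weight3 q x v w z)))"

text \<open>The third derivative is bounded on the diagonal, which is the form in which both
  \<open>jv3\<close> and Taylor's formula along a segment contain it.\<close>

definition smooth_test ::
  "real \<Rightarrow> nat \<Rightarrow> ('a::euclidean_space \<Rightarrow> real) \<Rightarrow> ('a \<Rightarrow> 'a \<Rightarrow> real) \<Rightarrow> ('a \<Rightarrow> 'a \<Rightarrow> 'a \<Rightarrow> real)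
    \<Rightarrow> ('a \<Rightarrow> 'a \<Rightarrow> 'a \<Rightarrow> 'a \<Rightarrow> real) \<Rightarrow> bool" where
  "smooth_test B m f f1 f2 f3 \<longleftrightarrow> jet3 f f1 f2 f3 \<and>
     (\<forall>x. \<bar>f x\<bar> \<le> B * rho x ^ m) \<and>
     (\<forall>x v. \<bar>f1 x v\<bar> \<le> B * rho x ^ m * norm v) \<and>
     (\<forall>x v w. \<bar>f2 x v w\<bar> \<le> B * rho x ^ m * norm v * norm w) \<and>
     (\<forall>x v. \<bar>f3 x v v v\<bar> \<le> B * rho x ^ m * norm v ^ 3)"

lemma smooth_test_imp_weighted_jet_bound:
  assumes "smooth_test B m f f1 f2 f3"
  shows "weighted_jet_bound q (2 * m) (27 * B\<^sup>2) f"
proof -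
  note b = assms[unfolded smooth_test_def]
  have "(f x)\<^sup>2 \<le> 27 * B\<^sup>2 * rho x ^ (2 * m)" for x
  proof -
    have "(f x)\<^sup>2 \<le> (B * rho x ^ m)\<^sup>2" using b by (metis abs_ge_zero power2_abs power_mono)
    also have "\<dots> \<le> 27 * (B * rho x ^ m)\<^sup>2" by simp
    finally show ?thesis by (simp add: power_even_eq power_mult_distrib mult.assoc)
  qed
  moreover have "(jv3 f1 f2 f3 x v w z)\<^sup>2 \<le> 27 * B\<^sup>2 * (rho x ^ (2 * m) * jet_weight3 q x v w z)" for x v w z
  proof -
    let ?D = "B * rho x ^ m"
    have "\<bar>jv3 f1 f2 f3 x v w z\<bar> \<le> \<bar>f1 x z\<bar> + 2 * \<bar>f2 x w v\<bar> + \<bar>f2 x v w\<bar> + \<bar>f3 x v v v\<bar>"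
      unfolding jv3_def by simp
    also have "\<dots> \<le> ?D * norm z + 2 * (?D * norm w * norm v) + ?D * norm v * norm w + ?D * norm v ^ 3"
      using b by (intro add_mono mult_left_mono) auto
    also have "\<dots> = ?D * (norm z + 3 * (norm v * norm w) + norm v ^ 3)" by (simp add: algebra_simps)
    finally have "(jv3 f1 f2 f3 x v w z)\<^sup>2 \<le> (?D * (norm z + 3 * (norm v * norm w) + norm v ^ 3))\<^sup>2"
      by (metis abs_ge_zero power2_abs power_mono)
    also have "\<dots> = ?D\<^sup>2 * (norm z + 3 * (norm v * norm w) + norm v ^ 3)\<^sup>2" by (simp add: power_mult_distrib)
    also have "\<dots> \<le> ?D\<^sup>2 * (27 * jet_weight3 q x v w z)"
    proof (rule mult_left_mono)
      have "(norm z + 3 * (norm v * norm w) + norm v ^ 3)\<^sup>2 \<le>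
         3 * ((norm z)\<^sup>2 + (3 * (norm v * norm w))\<^sup>2 + (norm v ^ 3)\<^sup>2)" by (rule square_sum_le)
      also have "\<dots> \<le> 27 * ((norm z)\<^sup>2 + 1 * ((norm v)\<^sup>2 * (norm w)\<^sup>2) + 1 * (1 * ((norm v)\<^sup>2 * ((norm v)\<^sup>2)\<^sup>2)))"
        by (simp add: power_mult_distrib power_mult[symmetric] power_add[symmetric] del: power_mult)
      also have "\<dots> \<le> 27 * ((norm z)\<^sup>2 + rho x ^ (2 * q) * ((norm v)\<^sup>2 * (norm w)\<^sup>2)
          + rho x ^ (2 * q) * (rho x ^ (2 * q) * ((norm v)\<^sup>2 * ((norm v)\<^sup>2)\<^sup>2)))"
        by (intro mult_left_mono add_mono mult_mono order_refl) auto
      also have "\<dots> = 27 * jet_weight3 q x v w z"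
        by (simp add: jet_weight3_def jet_weight2_def algebra_simps)
      finally show "(norm z + 3 * (norm v * norm w) + norm v ^ 3)\<^sup>2 \<le> 27 * jet_weight3 q x v w z" .
    qed simp
    finally show ?thesis unfolding power_even_eq[of "rho x"] by (simp add: power_mult_distrib mult_ac)
  qed
  ultimately show ?thesis using b unfolding weighted_jet_bound_def by blast
qed

text \<open>Special jets isolate the derivatives: \<open>0, 0, z\<close> gives \<open>f1\<close>,
  the jet \<open>v, 0, 0\<close> gives \<open>f3\<close> on the diagonal, and \<open>v, w, 0\<close>
  gives a combination of \<open>f2 x w v\<close> and \<open>f2 x v w\<close>. Exchanging
  \<open>v\<close> and \<open>w\<close> in the last one separates the two values without symmetry of
  \<open>f2\<close>.\<close>

lemma weighted_jet_bound_imp_smooth_test: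
  assumes "weighted_jet_bound q (2 * m) B f" "0 \<le> B"
  shows "\<exists>f1 f2 f3. smooth_test (3 * sqrt B) (m + 2 * q) f f1 f2 f3"
proof -
  obtain f1 f2 f3 where j: "jet3 f f1 f2 f3" and f: "\<And>x. (f x)\<^sup>2 \<le> B * rho x ^ (2 * m)"
    and b: "\<And>x v w z. (jv3 f1 f2 f3 x v w z)\<^sup>2 \<le> B * (rho x ^ (2 * m) * jet_weight3 q x v w z)"
    using assms unfolding weighted_jet_bound_def by blast
  note l = jet3_linear[OF j]
  define D where "D x = sqrt B * rho x ^ m" for x :: 'a
  define E where "E x = sqrt B * rho x ^ (m + 2 * q)" for x :: 'a
  have D2: "(D x)\<^sup>2 = B * rho x ^ (2 * m)" for x
    using assms by (simp add: D_def power_mult_distrib power_even_eq)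
  have E2: "(E x)\<^sup>2 = B * rho x ^ (2 * m) * rho x ^ (2 * q) * rho x ^ (2 * q)" for x
    using assms by (simp add: E_def power_mult_distrib power_even_eq power_add power_mult_distrib power2_eq_square)
  have D0: "0 \<le> D x" and E0: "0 \<le> E x" for x using assms by (auto simp: D_def E_def)
  have DE: "D x \<le> E x" for x unfolding D_def E_def using assms by (intro mult_left_mono power_increasing) auto
  have sq: "\<bar>t\<bar> \<le> r" if "t\<^sup>2 \<le> r\<^sup>2" "0 \<le> r" for t r :: real
    using that by (metis abs_le_square_iff abs_of_nonneg)
  have b0: "\<bar>f x\<bar> \<le> D x" for x using f D2 D0 by (intro sq) auto
  have b1: "\<bar>f1 x z\<bar> \<le> D x * norm z" for x z
  proof (rule sq)
    show "(f1 x z)\<^sup>2 \<le> (D x * norm z)\<^sup>2"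
      using b[of x 0 0 z] by (simp add: jv3_def jet_weight3_def power_mult_distrib D2
          linear_0[OF l(2)] linear_0[OF l(4)] mult.assoc)
  qed (use D0 in simp)
  have b3: "\<bar>f3 x v v v\<bar> \<le> E x * norm v ^ 3" for x v
  proof (rule sq)
    have "(norm v ^ 3)\<^sup>2 = (norm v)\<^sup>2 * ((norm v)\<^sup>2)\<^sup>2" by (simp add: power2_eq_square power3_eq_cube)
    then show "(f3 x v v v)\<^sup>2 \<le> (E x * norm v ^ 3)\<^sup>2"
      using b[of x v 0 0] by (simp add: jv3_def jet_weight3_def jet_weight2_def power_mult_distrib E2
          linear_0[OF l(2)] linear_0[OF l(3)] linear_0[OF l(1)] mult_ac)
  qed (use E0 in simp)
  \<comment> \<open>Unit vectors first: the weight of \<open>v, w, 0\<close> mixes powers of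
    \<open>norm v\<close> and \<open>norm w\<close>, so a bound bilinear in the norms is obtained by
    homogeneity of \<open>f2\<close> afterwards.\<close>
  have u: "\<bar>2 * f2 x w v + f2 x v w\<bar> \<le> 3 * E x" if "norm v = 1" "norm w = 1" for x v w
  proof -
    have "jet_weight3 q x v w 0 = rho x ^ (2 * q) * (1 + rho x ^ (2 * q))"
      using that by (simp add: jet_weight3_def jet_weight2_def)
    also have "\<dots> \<le> rho x ^ (2 * q) * (rho x ^ (2 * q) + rho x ^ (2 * q))"
      by (intro mult_left_mono add_right_mono) auto
    also have "\<dots> \<le> 4 * (rho x ^ (2 * q) * rho x ^ (2 * q))" by (simp add: algebra_simps)
    finally have "B * (rho x ^ (2 * m) * jet_weight3 q x v w 0) \<le>
        B * (rho x ^ (2 * m) * (4 * (rho x ^ (2 * q) * rho x ^ (2 * q))))"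
      using assms by (intro mult_left_mono) auto
    with b[of x v w 0] have "(jv3 f1 f2 f3 x v w 0)\<^sup>2 \<le> (2 * E x)\<^sup>2"
      by (simp add: power_mult_distrib E2 mult_ac)
    then have "\<bar>jv3 f1 f2 f3 x v w 0\<bar> \<le> 2 * E x" using E0 by (intro sq) auto
    then show ?thesis using b3[of x v] that by (simp add: jv3_def linear_0[OF l(1)])
  qed
  \<comment> \<open>Twice the combination with \<open>v\<close> and \<open>w\<close> exchanged minus
    the combination itself equals \<open>3 * f2 x v w\<close>, hence
    \<open>3 * \<bar>f2 x v w\<bar> \<le> 9 * E x\<close>.\<close>
  have u2: "\<bar>f2 x v w\<bar> \<le> 3 * E x" if "norm v = 1" "norm w = 1" for x v w
    using u[OF that, of x] u[OF that(2,1), of x] by linarith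
  have b2: "\<bar>f2 x v w\<bar> \<le> 3 * E x * norm v * norm w" for x v w
  proof (cases "v = 0 \<or> w = 0")
    case True
    then show ?thesis using E0 by (auto simp: linear_0[OF l(2)] linear_0[OF l(3)])
  next
    case False
    have "f2 x v w = f2 x (norm v *\<^sub>R sgn v) (norm w *\<^sub>R sgn w)" using False by (simp add: sgn_div_norm)
    also have "\<dots> = norm v * norm w * f2 x (sgn v) (sgn w)"
      unfolding linear_scale[OF l(2)] linear_scale[OF l(3)] by simp
    finally have "\<bar>f2 x v w\<bar> = norm v * norm w * \<bar>f2 x (sgn v) (sgn w)\<bar>" by (simp add: abs_mult)
    also have "\<dots> \<le> norm v * norm w * (3 * E x)"
      using False by (intro mult_left_mono u2) (auto simp: norm_sgn)
    finally show ?thesis by (simp add: mult_ac)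
  qed
  have E_le: "E x \<le> 3 * E x" for x using E0[of x] by simp
  have "smooth_test (3 * sqrt B) (m + 2 * q) f f1 f2 f3"
    unfolding smooth_test_def using j
  proof (intro conjI allI)
    fix x v w :: 'a
    have eq: "3 * sqrt B * rho x ^ (m + 2 * q) = 3 * E x" by (simp add: E_def)
    show "\<bar>f x\<bar> \<le> 3 * sqrt B * rho x ^ (m + 2 * q)"
      unfolding eq using b0[of x] DE[of x] E_le[of x] by linarith
    have "D x * norm v \<le> 3 * E x * norm v" using DE[of x] E_le[of x] by (intro mult_right_mono) auto
    then show "\<bar>f1 x v\<bar> \<le> 3 * sqrt B * rho x ^ (m + 2 * q) * norm v"
      unfolding eq using b1[of x v] by linarith
    show "\<bar>f2 x v w\<bar> \<le> 3 * sqrt B * rho x ^ (m + 2 * q) * norm v * norm w"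
      unfolding eq by (rule b2)
    have "E x * norm v ^ 3 \<le> 3 * E x * norm v ^ 3" using E_le[of x] by (intro mult_right_mono) auto
    then show "\<bar>f3 x v v v\<bar> \<le> 3 * sqrt B * rho x ^ (m + 2 * q) * norm v ^ 3"
      unfolding eq using b3[of x v] by linarith
  qed
  then show ?thesis by blast
qed

text \<open>In the application \<open>b\<close> is the gradient of the loss and \<open>s i\<close>
  is the column \<open>i\<close> of the square root of the covariance matrix, so the noise
  directions are indexed by the standard basis of the state space.\<close>

locale diffusion =
  fixes K :: real and q :: nat
    and b :: "'a::euclidean_space \<Rightarrow> 'a" and b1 b2 b3
    and s :: "'a \<Rightarrow> 'a \<Rightarrow> 'a" and s1 s2 s3
  assumes K: "1 \<le> K"
    and drift: "coefficient K q b b1 b2 b3"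
    and noise: "\<And>i. i \<in> Basis \<Longrightarrow> coefficient K q (s i) (s1 i) (s2 i) (s3 i)"
begin

text \<open>Transition operator of the comparison chain. Each column is drawn with probability
  \<open>1 / DIM('a)\<close>, and the later choice \<open>d = a * sqrt (c * DIM('a))\<close>
  compensates for this in the covariance.\<close>

definition step :: "real \<Rightarrow> real \<Rightarrow> ('a \<Rightarrow> real) \<Rightarrow> 'a \<Rightarrow> real" where
  "step a d f x = (\<Sum>i\<in>Basis. f (x - a *\<^sub>R b x + d *\<^sub>R s i x) + f (x - a *\<^sub>R b x - d *\<^sub>R s i x)) / (2 * DIM('a))"

lemma step_weighted_jet_bound:
  assumes "0 \<le> R"
  obtains C where "0 \<le> C" "\<And>e a d B f. 0 \<le> e \<Longrightarrow> e \<le> 1 \<Longrightarrow> \<bar>a\<bar> \<le> R * e\<^sup>2 \<Longrightarrow> \<bar>d\<bar> \<le> R * e \<Longrightarrow>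
    0 \<le> B \<Longrightarrow> weighted_jet_bound q m B f \<Longrightarrow> weighted_jet_bound q m ((1 + C * e\<^sup>2) * B) (step a d f)"
proof -
  obtain C where C: "0 \<le> C" and Cstep:
    "\<And>(b :: 'a \<Rightarrow> 'a) b1 b2 b3 s s1 s2 s3 e a d x v w z.
      coefficient K q b b1 b2 b3 \<Longrightarrow> coefficient K q s s1 s2 s3 \<Longrightarrow> 0 \<le> e \<Longrightarrow> e \<le> 1 \<Longrightarrow>
      \<bar>a\<bar> \<le> R * e\<^sup>2 \<Longrightarrow> \<bar>d\<bar> \<le> R * e \<Longrightarrow>
      symm_perturbed C e (rho x ^ m) (rho x ^ m)
        (rho (x + a *\<^sub>R b x + d *\<^sub>R s x) ^ m) (rho (x + a *\<^sub>R b x - d *\<^sub>R s x) ^ m) \<and>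
      symm_perturbed C e (rho x ^ m * jet_weight3 q x v w z) (rho x ^ m * jet_weight3 q x v w z)
        (rho (x + a *\<^sub>R b x + d *\<^sub>R s x) ^ m * jet_weight3 q (x + a *\<^sub>R b x + d *\<^sub>R s x)
          (v + a *\<^sub>R b1 x v + d *\<^sub>R s1 x v) (w + a *\<^sub>R jv2 b1 b2 x v w + d *\<^sub>R jv2 s1 s2 x v w)
          (z + a *\<^sub>R jv3 b1 b2 b3 x v w z + d *\<^sub>R jv3 s1 s2 s3 x v w z))
        (rho (x + a *\<^sub>R b x - d *\<^sub>R s x) ^ m * jet_weight3 q (x + a *\<^sub>R b x - d *\<^sub>R s x)
          (v + a *\<^sub>R b1 x v - d *\<^sub>R s1 x v) (w + a *\<^sub>R jv2 b1 b2 x v w - d *\<^sub>R jv2 s1 s2 x v w)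
          (z + a *\<^sub>R jv3 b1 b2 b3 x v w z - d *\<^sub>R jv3 s1 s2 s3 x v w z))"
    using jet_weight_step[OF K assms, of q m, where 'a='a] by metis
  show thesis
  proof (rule that[OF C])
    fix e a d B :: real and f :: "'a \<Rightarrow> real"
    assume e: "0 \<le> e" "e \<le> 1" and a: "\<bar>a\<bar> \<le> R * e\<^sup>2" and d: "\<bar>d\<bar> \<le> R * e" and B: "0 \<le> B"
      and "weighted_jet_bound q m B f"
    then obtain f1 f2 f3 where j: "jet3 f f1 f2 f3" and fb: "\<And>x. (f x)\<^sup>2 \<le> B * rho x ^ m"
      and jb: "\<And>x v w z. (jv3 f1 f2 f3 x v w z)\<^sup>2 \<le> B * (rho x ^ m * jet_weight3 q x v w z)"
      unfolding weighted_jet_bound_def by blast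
    define F where "F i r x = x + (- a) *\<^sub>R b x + r *\<^sub>R s i x" for i r x
    define F1 where "F1 i r x v = v + (- a) *\<^sub>R b1 x v + r *\<^sub>R s1 i x v" for i r x v
    define F2 where "F2 i r x v w = 0 + (- a) *\<^sub>R b2 x v w + r *\<^sub>R s2 i x v w" for i r x v w
    define F3 where "F3 i r x v w z = 0 + (- a) *\<^sub>R b3 x v w z + r *\<^sub>R s3 i x v w z" for i r x v w z
    have jF: "jet3 (F i r) (F1 i r) (F2 i r) (F3 i r)" if "i \<in> Basis" for i r
      unfolding F_def F1_def F2_def F3_def
      using drift noise[OF that] unfolding coefficient_def
      by (intro jet3_add jet3_ident jet3_scaleR) auto
    have jv2F: "jv2 (F1 i r) (F2 i r) x v w = w + (- a) *\<^sub>R jv2 b1 b2 x v w + r *\<^sub>R jv2 (s1 i) (s2 i) x v w" for i r x v w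
      by (simp add: jv2_def F1_def F2_def scaleR_add_right)
    have jv3F: "jv3 (F1 i r) (F2 i r) (F3 i r) x v w z =
      z + (- a) *\<^sub>R jv3 b1 b2 b3 x v w z + r *\<^sub>R jv3 (s1 i) (s2 i) (s3 i) x v w z" for i r x v w z
      by (simp add: jv3_def F1_def F2_def F3_def scaleR_add_right scaleR_2)
    have "\<forall>i r. \<exists>g1 g2 g3. i \<in> Basis \<longrightarrow> jet3 (\<lambda>x. f (F i r x)) g1 g2 g3 \<and>
      (\<forall>x v w z. jv3 g1 g2 g3 x v w z = jv3 f1 f2 f3 (F i r x) (F1 i r x v)
         (jv2 (F1 i r) (F2 i r) x v w) (jv3 (F1 i r) (F2 i r) (F3 i r) x v w z))"
      using jet3_compose[OF j jF] by metis
    then obtain g1 g2 g3 where g: "\<And>i r. i \<in> Basis \<Longrightarrow> jet3 (\<lambda>x. f (F i r x)) (g1 i r) (g2 i r) (g3 i r)"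
      and gj: "\<And>i r x v w z. i \<in> Basis \<Longrightarrow> jv3 (g1 i r) (g2 i r) (g3 i r) x v w z = jv3 f1 f2 f3 (F i r x) (F1 i r x v)
         (jv2 (F1 i r) (F2 i r) x v w) (jv3 (F1 i r) (F2 i r) (F3 i r) x v w z)"
      by metis
    define c where "c = 1 / (2 * real DIM('a))"
    have c: "0 < c" by (simp add: c_def)
    have stp: "step a d f = (\<lambda>x. c *\<^sub>R (\<Sum>i\<in>Basis. f (F i d x) + f (F i (- d) x)))"
      by (simp add: fun_eq_iff step_def F_def c_def)
    let ?h1 = "\<lambda>x v. c *\<^sub>R (\<Sum>i\<in>Basis. g1 i d x v + g1 i (- d) x v)"
    let ?h2 = "\<lambda>x v w. c *\<^sub>R (\<Sum>i\<in>Basis. g2 i d x v w + g2 i (- d) x v w)"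
    let ?h3 = "\<lambda>x v w z. c *\<^sub>R (\<Sum>i\<in>Basis. g3 i d x v w z + g3 i (- d) x v w z)"
    have jstp: "jet3 (step a d f) ?h1 ?h2 ?h3"
      unfolding stp by (intro jet3_scaleR jet3_sum jet3_add g)
    have jvstp: "jv3 ?h1 ?h2 ?h3 x v w z =
      c *\<^sub>R (\<Sum>i\<in>Basis. jv3 (g1 i d) (g2 i d) (g3 i d) x v w z + jv3 (g1 i (- d)) (g2 i (- d)) (g3 i (- d)) x v w z)"
      for x v w z
      by (simp add: jv3_def sum.distrib sum_distrib_left algebra_simps)
    \<comment> \<open>Cauchy-Schwarz over the equally likely branches. The weights at the two
      branches of one column sum to at most \<open>2 * (1 + C * e\<^sup>2)\<close> times the weight
      at the start, by the part of \<open>symm_perturbed\<close> that adds the two signs.\<close>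
    have average: "(c *\<^sub>R (\<Sum>i\<in>Basis. P i + M i))\<^sup>2 \<le> (1 + C * e\<^sup>2) * B * A"
      if P: "\<And>i. i \<in> Basis \<Longrightarrow> (P i)\<^sup>2 \<le> B * Ap i" and M: "\<And>i. i \<in> Basis \<Longrightarrow> (M i)\<^sup>2 \<le> B * Am i"
        and sp: "\<And>i. i \<in> Basis \<Longrightarrow> symm_perturbed C e A A (Ap i) (Am i)" for P M Ap Am :: "'a \<Rightarrow> real" and A
    proof -
      have Ap: "Ap i + Am i \<le> 2 * ((1 + C * e\<^sup>2) * A)" if "i \<in> Basis" for i
      proof -
        have "0 \<le> C * e\<^sup>2 * A" using sp[OF that] C by (simp add: symm_perturbed_def)
        moreover have "Ap i + Am i \<le> 2 * A + C * e\<^sup>2 * A" using sp[OF that] unfolding symm_perturbed_def by linarith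
        ultimately show ?thesis by (simp add: algebra_simps)
      qed
      have "(\<Sum>i\<in>Basis. P i + M i)\<^sup>2 \<le> (\<Sum>i\<in>Basis. (P i + M i)\<^sup>2) * DIM('a)"
        by (rule sum_squared_le_sum_of_squares)
      also have "\<dots> \<le> (\<Sum>i\<in>(Basis::'a set). 2 * (2 * (B * ((1 + C * e\<^sup>2) * A)))) * DIM('a)"
      proof (intro mult_right_mono sum_mono)
        fix i :: 'a assume i: "i \<in> Basis"
        have "(P i + M i)\<^sup>2 \<le> 2 * ((P i)\<^sup>2 + (M i)\<^sup>2)" by (rule square_sum_le)
        also have "\<dots> \<le> 2 * (B * (Ap i + Am i))" using P[OF i] M[OF i] by (simp add: algebra_simps)
        also have "\<dots> \<le> 2 * (B * (2 * ((1 + C * e\<^sup>2) * A)))"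
          using Ap[OF i] B by (intro mult_left_mono) auto
        finally show "(P i + M i)\<^sup>2 \<le> 2 * (2 * (B * ((1 + C * e\<^sup>2) * A)))" by simp
      qed simp
      finally have "(\<Sum>i\<in>Basis. P i + M i)\<^sup>2 \<le> (2 * DIM('a))\<^sup>2 * ((1 + C * e\<^sup>2) * B * A)"
        by (simp add: power2_eq_square mult_ac)
      then have "c\<^sup>2 * (\<Sum>i\<in>Basis. P i + M i)\<^sup>2 \<le> c\<^sup>2 * ((2 * DIM('a))\<^sup>2 * ((1 + C * e\<^sup>2) * B * A))"
        by (intro mult_left_mono) auto
      also have "\<dots> = (c * (2 * DIM('a)))\<^sup>2 * ((1 + C * e\<^sup>2) * B * A)" by (simp add: power_mult_distrib)
      also have "c * (2 * DIM('a)) = 1" by (simp add: c_def)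
      finally show ?thesis by (simp add: power_mult_distrib)
    qed
    have a': "\<bar>- a\<bar> \<le> R * e\<^sup>2" using a by simp
    note sp = Cstep[OF drift noise e a' d]
    have "(step a d f x)\<^sup>2 \<le> (1 + C * e\<^sup>2) * B * rho x ^ m" for x
      unfolding stp by (rule average[where P="\<lambda>i. f (F i d x)" and M="\<lambda>i. f (F i (- d) x)"
            and Ap="\<lambda>i. rho (F i d x) ^ m" and Am="\<lambda>i. rho (F i (- d) x) ^ m"])
        (use fb sp in \<open>auto simp: F_def\<close>)
    moreover have "(jv3 ?h1 ?h2 ?h3 x v w z)\<^sup>2 \<le> (1 + C * e\<^sup>2) * B * (rho x ^ m * jet_weight3 q x v w z)" for x v w z
      unfolding jvstp
      by (rule average[where Ap="\<lambda>i. rho (F i d x) ^ m * jet_weight3 q (F i d x) (F1 i d x v)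
             (jv2 (F1 i d) (F2 i d) x v w) (jv3 (F1 i d) (F2 i d) (F3 i d) x v w z)"
          and Am="\<lambda>i. rho (F i (- d) x) ^ m * jet_weight3 q (F i (- d) x) (F1 i (- d) x v)
             (jv2 (F1 i (- d)) (F2 i (- d)) x v w) (jv3 (F1 i (- d)) (F2 i (- d)) (F3 i (- d)) x v w z)"])
        (use jb sp[where x=x and v=v and w=w and z=z] in \<open>auto simp: gj jv2F jv3F F_def F1_def\<close>)
    ultimately show "weighted_jet_bound q m ((1 + C * e\<^sup>2) * B) (step a d f)"
      unfolding weighted_jet_bound_def using jstp by blast
  qed
qed

text \<open>The expected value of \<open>h\<close> after \<open>j\<close> steps of the chain when
  the first of them uses the rates of time \<open>k\<close>. The earliest step is the outermost
  operator, since this is a backward evolution with rates that vary in time.\<close>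

fun evolve :: "(nat \<Rightarrow> real) \<Rightarrow> (nat \<Rightarrow> real) \<Rightarrow> ('a \<Rightarrow> real) \<Rightarrow> nat \<Rightarrow> nat \<Rightarrow> 'a \<Rightarrow> real" where
  "evolve a d h k 0 = h"
| "evolve a d h k (Suc j) = step (a k) (d k) (evolve a d h (Suc k) j)"

text \<open>Discrete Gronwall: \<open>j\<close> factors \<open>1 + C * e\<^sup>2\<close> stay below
  \<open>exp (C * T)\<close>. The induction runs on \<open>weighted_jet_bound\<close>, whose degree
  does not change; the loss of degree in returning to separate bounds on the derivatives occurs
  once, after the last step.\<close>

lemma evolve_smooth_test:
  assumes "smooth_test B m h h1 h2 h3" and "0 \<le> R"
  obtains B' m' where "0 \<le> B'" "\<And>e a d j k. 0 \<le> e \<Longrightarrow> e \<le> 1 \<Longrightarrow> (\<And>k. \<bar>a k\<bar> \<le> R * e\<^sup>2) \<Longrightarrow> (\<And>k. \<bar>d k\<bar> \<le> R * e) \<Longrightarrow>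
    real j * e\<^sup>2 \<le> T \<Longrightarrow> \<exists>f1 f2 f3. smooth_test B' m' (evolve a d h k j) f1 f2 f3"
proof -
  obtain C where C: "0 \<le> C" "\<And>e a d B f. 0 \<le> e \<Longrightarrow> e \<le> 1 \<Longrightarrow> \<bar>a\<bar> \<le> R * e\<^sup>2 \<Longrightarrow> \<bar>d\<bar> \<le> R * e \<Longrightarrow>
    0 \<le> B \<Longrightarrow> weighted_jet_bound q (2 * m) B f \<Longrightarrow> weighted_jet_bound q (2 * m) ((1 + C * e\<^sup>2) * B) (step a d f)"
    using step_weighted_jet_bound[OF assms(2), of "2 * m"] by metis
  define B1 where "B1 = 27 * B\<^sup>2"
  have B1: "0 \<le> B1" by (simp add: B1_def)
  show thesis
  proof (rule that)
    show "0 \<le> 3 * sqrt (exp (C * T) * B1)" using B1 by simp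
    fix e :: real and a d :: "nat \<Rightarrow> real" and j k :: nat
    assume e: "0 \<le> e" "e \<le> 1" and ad: "\<And>k. \<bar>a k\<bar> \<le> R * e\<^sup>2" "\<And>k. \<bar>d k\<bar> \<le> R * e" and T: "real j * e\<^sup>2 \<le> T"
    have g: "weighted_jet_bound q (2 * m) ((1 + C * e\<^sup>2) ^ j * B1) (evolve a d h k j)"
    proof (induction j arbitrary: k)
      case 0
      then show ?case using smooth_test_imp_weighted_jet_bound[OF assms(1)] by (simp add: B1_def)
    next
      case (Suc j)
      have "0 \<le> (1 + C * e\<^sup>2) ^ j * B1" using B1 C by simp
      from C(2)[OF e ad this Suc] show ?case by (simp add: mult_ac)
    qed
    have "(1 + C * e\<^sup>2) ^ j \<le> exp (C * e\<^sup>2) ^ j"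
      using C by (intro power_mono exp_ge_add_one_self) auto
    also have "\<dots> = exp (C * (real j * e\<^sup>2))" by (simp add: exp_of_nat_mult[symmetric] mult_ac)
    also have "\<dots> \<le> exp (C * T)" using T C by (simp add: mult_left_mono)
    finally have le: "(1 + C * e\<^sup>2) ^ j * B1 \<le> exp (C * T) * B1" using B1 by (intro mult_right_mono)
    have "weighted_jet_bound q (2 * m) (exp (C * T) * B1) (evolve a d h k j)"
    proof -
      have 1: "(1 + C * e\<^sup>2) ^ j * B1 * x \<le> exp (C * T) * B1 * x" if "0 \<le> x" for x
        using le that by (rule mult_right_mono)
      show ?thesis using g unfolding weighted_jet_bound_def
        by (meson 1 order_trans rho_power_ge_1(2) jet_weight_nonneg(2) mult_nonneg_nonneg)
    qed
    from weighted_jet_bound_imp_smooth_test[OF this]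
    show "\<exists>f1 f2 f3. smooth_test (3 * sqrt (exp (C * T) * B1)) (m + 2 * q) (evolve a d h k j) f1 f2 f3"
      using B1 by simp
  qed
qed

end

section \<open>Taylor and Lipschitz estimates for test functions and coefficients\<close>

lemma rho_le_square: "rho x \<le> (1 + norm x)\<^sup>2"
  by (simp add: rho_def power2_eq_square algebra_simps)

lemma rho_power_le: "norm x \<le> r \<Longrightarrow> rho x ^ m \<le> (1 + r) ^ (2 * m)"
proof -
  assume "norm x \<le> r"
  then have "(1 + norm x)\<^sup>2 \<le> (1 + r)\<^sup>2" by (intro power_mono) auto
  then have "rho x \<le> (1 + r)\<^sup>2" using rho_le_square[of x] by linarith
  then have "rho x ^ m \<le> ((1 + r)\<^sup>2) ^ m" by (intro power_mono) auto
  then show ?thesis by (simp add: power_mult)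
qed

lemma has_field_derivative_along_line:
  fixes f :: "'a::real_normed_vector \<Rightarrow> real"
  assumes "(f has_derivative f') (at (y + t *\<^sub>R u))"
  shows "((\<lambda>t. f (y + t *\<^sub>R u)) has_field_derivative f' u) (at t)"
proof -
  interpret f': linear f' using assms has_derivative_linear by blast
  have "((\<lambda>t. y + t *\<^sub>R u) has_derivative (\<lambda>h. h *\<^sub>R u)) (at t)"
    by (auto intro!: derivative_eq_intros)
  from has_derivative_compose[OF this assms]
  have "((\<lambda>t. f (y + t *\<^sub>R u)) has_derivative (\<lambda>h. f' (h *\<^sub>R u))) (at t)" .
  moreover have "(\<lambda>h. f' (h *\<^sub>R u)) = (*) (f' u)" by (auto simp: f'.scale)
  ultimately show ?thesis unfolding has_field_derivative_def by simp
qed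

lemma smooth_test_taylor:
  assumes f: "smooth_test B m f f1 f2 f3" and B: "0 \<le> B"
  shows "\<bar>f (y + u) - f y - f1 y u - f2 y u u / 2\<bar> \<le> B * (1 + norm y + norm u) ^ (2 * m) * norm u ^ 3"
proof -
  note b = f[unfolded smooth_test_def]
  have j: "jet3 f f1 f2 f3" using b by blast
  \<comment> \<open>Maclaurin's formula on the segment from \<open>y\<close> to
    \<open>y + u\<close>. Each \<open>D i\<close> is the derivative of its predecessor because a jet
    differentiates with the earlier directions held fixed.\<close>
  define D where "D i t = (if i = 0 then f (y + t *\<^sub>R u) else if i = 1 then f1 (y + t *\<^sub>R u) u
     else if i = 2 then f2 (y + t *\<^sub>R u) u u else f3 (y + t *\<^sub>R u) u u u)" for i :: nat and t
  have "DERIV (D i) t :> D (Suc i) t" if "i < 3" for i t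
  proof -
    have "i = 0 \<or> i = 1 \<or> i = 2" using that by linarith
    then consider "i = 0" | "i = 1" | "i = 2" by blast
    then show ?thesis
      using has_field_derivative_along_line[OF jet3D(1)[OF j]]
        has_field_derivative_along_line[OF jet3D(2)[OF j]]
        has_field_derivative_along_line[OF jet3D(3)[OF j]]
      by cases (auto simp: D_def[abs_def])
  qed
  then obtain t where t: "0 < t" "t < 1"
    and eq: "D 0 1 = (\<Sum>i<3. (D i 0 / fact i) * 1 ^ i) + (D 3 t / fact 3) * 1 ^ 3"
    using Maclaurin[of 1 3 D "D 0"] by auto
  have "f (y + u) - f y - f1 y u - f2 y u u / 2 = f3 (y + t *\<^sub>R u) u u u / 6"
    using eq by (simp add: D_def eval_nat_numeral)
  moreover have "\<bar>f3 (y + t *\<^sub>R u) u u u\<bar> \<le> B * (1 + norm y + norm u) ^ (2 * m) * norm u ^ 3"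
  proof -
    have "norm (y + t *\<^sub>R u) \<le> norm y + norm u"
      using norm_triangle_ineq[of y "t *\<^sub>R u"] t by (simp add: mult_le_cancel_right1)
        (smt (verit) mult_left_le_one_le norm_ge_zero)
    then have "rho (y + t *\<^sub>R u) ^ m \<le> (1 + (norm y + norm u)) ^ (2 * m)" by (rule rho_power_le)
    then have "B * rho (y + t *\<^sub>R u) ^ m * norm u ^ 3 \<le> B * (1 + (norm y + norm u)) ^ (2 * m) * norm u ^ 3"
      using B by (intro mult_right_mono mult_left_mono) auto
    then show ?thesis using b by (smt (verit) add.assoc)
  qed
  ultimately show ?thesis by (simp add: abs_if split: if_splits)
qed

lemma smooth_test_lipschitz:
  assumes f: "smooth_test B m f f1 f2 f3" and B: "0 \<le> B"
  shows "\<bar>f x - f y\<bar> \<le> B * (1 + norm x + norm y) ^ (2 * m) * norm (x - y)"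
proof -
  note b = f[unfolded smooth_test_def]
  have j: "jet3 f f1 f2 f3" using b by blast
  have "\<exists>t::real. 0 < t \<and> t < 1 \<and> f (y + 1 *\<^sub>R (x - y)) - f (y + 0 *\<^sub>R (x - y)) = (1 - 0) * f1 (y + t *\<^sub>R (x - y)) (x - y)"
    by (rule MVT2) (auto intro: has_field_derivative_along_line jet3D(1)[OF j])
  then obtain t :: real where t: "0 < t" "t < 1" and eq: "f x - f y = f1 (y + t *\<^sub>R (x - y)) (x - y)" by auto
  have "y + t *\<^sub>R (x - y) = (1 - t) *\<^sub>R y + t *\<^sub>R x" by (simp add: algebra_simps)
  then have "norm (y + t *\<^sub>R (x - y)) \<le> (1 - t) * norm y + t * norm x"
    using norm_triangle_ineq[of "(1 - t) *\<^sub>R y" "t *\<^sub>R x"] t by simp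
  also have "\<dots> \<le> norm x + norm y"
    using t mult_right_mono[of t 1 "norm x"] mult_right_mono[of "1 - t" 1 "norm y"] by simp
  finally have "rho (y + t *\<^sub>R (x - y)) ^ m \<le> (1 + (norm x + norm y)) ^ (2 * m)" by (rule rho_power_le)
  then have "B * rho (y + t *\<^sub>R (x - y)) ^ m * norm (x - y) \<le> B * (1 + (norm x + norm y)) ^ (2 * m) * norm (x - y)"
    using B by (intro mult_right_mono mult_left_mono) auto
  then show ?thesis unfolding eq using b by (smt (verit) add.assoc)
qed

lemma coefficient_lipschitz:
  assumes "coefficient K q f f1 f2 f3"
  shows "norm (f x - f y) \<le> K * norm (x - y)"
proof (rule differentiable_bound)
  show "(f has_derivative f1 x) (at x within UNIV)" for x
    using assms unfolding coefficient_def jet3_def by blast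
  show "onorm (f1 x) \<le> K" for x
    using assms unfolding coefficient_def by (intro onorm_le) blast
qed auto

section \<open>Second-order expansion of one step\<close>

context diffusion
begin

text \<open>The expected second-order Taylor increment at \<open>y\<close> when the gradient is
  queried at \<open>x\<close>, with \<open>c\<close> as the squared noise scale. The two points are
  kept apart because momentum moves \<open>y\<close> by gradients taken at \<open>x\<close>.\<close>

definition generator ::
  "real \<Rightarrow> real \<Rightarrow> ('a \<Rightarrow> 'a \<Rightarrow> real) \<Rightarrow> ('a \<Rightarrow> 'a \<Rightarrow> 'a \<Rightarrow> real) \<Rightarrow> 'a \<Rightarrow> 'a \<Rightarrow> real" where
  "generator a c f1 f2 y x =
     - a * f1 y (b x) + a\<^sup>2 / 2 * (f2 y (b x) (b x) + c * (\<Sum>i\<in>Basis. f2 y (s i x) (s i x)))"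

lemma drift_le: "norm (b x) \<le> K * (1 + norm x)"
  using drift unfolding coefficient_def by blast

lemma noise_le: "i \<in> Basis \<Longrightarrow> norm (s i x) \<le> K * (1 + norm x)"
  using noise unfolding coefficient_def by blast

text \<open>Adding the two signs removes the first-order noise term and the mixed terms of drift and
  noise, and \<open>dc\<close> turns the average over the columns into \<open>c\<close> times their
  sum. All displacements are of order \<open>e\<close>, so the Taylor remainders are of order
  \<open>e ^ 3\<close>.\<close>

lemma step_generator:
  fixes a c d e B R :: real
  assumes f: "smooth_test B m f f1 f2 f3" and B: "0 \<le> B" and R: "0 \<le> R"
    and e: "0 \<le> e" "e \<le> 1" and a: "\<bar>a\<bar> \<le> R * e\<^sup>2" and d: "\<bar>d\<bar> \<le> R * e"
    and dc: "d\<^sup>2 = a\<^sup>2 * c * DIM('a)"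
  shows "\<bar>step a d f y - f y - generator a c f1 f2 y y\<bar> \<le>
    B * (1 + 2 * R * K) ^ (2 * m) * (2 * R * K) ^ 3 * e ^ 3 * (1 + norm y) ^ (2 * m + 3)"
    (is "_ \<le> ?M")
proof -
  have j: "jet3 f f1 f2 f3" using f unfolding smooth_test_def by blast
  note l = jet3_linear[OF j]
  define u where "u i r = (- a) *\<^sub>R b y + r *\<^sub>R s i y" for i r
  define t where "t i r = f (y + u i r) - f y - f1 y (u i r) - f2 y (u i r) (u i r) / 2" for i r
  have ub: "\<bar>t i r\<bar> \<le> ?M" if i: "i \<in> Basis" and r: "\<bar>r\<bar> \<le> R * e" for i r
  proof -
    have e2: "R * e\<^sup>2 \<le> R * e" using e R by (intro mult_left_mono) (simp_all add: power2_eq_square mult_left_le)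
    have "norm (u i r) \<le> \<bar>a\<bar> * norm (b y) + \<bar>r\<bar> * norm (s i y)"
      unfolding u_def using norm_triangle_ineq[of "(- a) *\<^sub>R b y" "r *\<^sub>R s i y"] by simp
    also have "\<dots> \<le> (R * e) * (K * (1 + norm y)) + (R * e) * (K * (1 + norm y))"
      using drift_le noise_le[OF i] a r e2 R e by (intro add_mono mult_mono) auto
    finally have n: "norm (u i r) \<le> 2 * (R * K * (1 + norm y) * e)" by (simp add: algebra_simps)
    have RK: "0 \<le> R * K * (1 + norm y)" using R K by auto
    have "1 + norm y + norm (u i r) \<le> 1 + norm y + 2 * (R * K * (1 + norm y))"
      using n mult_left_mono[OF e(2) RK] by simp
    then have n': "1 + norm y + norm (u i r) \<le> (1 + 2 * R * K) * (1 + norm y)" by (simp add: algebra_simps)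
    have "\<bar>t i r\<bar> \<le> B * (1 + norm y + norm (u i r)) ^ (2 * m) * norm (u i r) ^ 3"
      unfolding t_def by (rule smooth_test_taylor[OF f B])
    also have "\<dots> \<le> B * ((1 + 2 * R * K) * (1 + norm y)) ^ (2 * m) * (2 * (R * K * (1 + norm y) * e)) ^ 3"
      using n n' B by (intro mult_mono power_mono) auto
    also have "2 * (R * K * (1 + norm y) * e) = (2 * R * K) * (e * (1 + norm y))" by (simp add: mult_ac)
    also have "B * ((1 + 2 * R * K) * (1 + norm y)) ^ (2 * m) * ((2 * R * K) * (e * (1 + norm y))) ^ 3 = ?M"
      unfolding power_mult_distrib[of "1 + 2 * R * K"] power_mult_distrib[of "2 * R * K"]
        power_mult_distrib[of e] power_add by (simp only: mult_ac)
    finally show ?thesis .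
  qed
  have yu: "y - a *\<^sub>R b y + d *\<^sub>R s i y = y + u i d" "y - a *\<^sub>R b y - d *\<^sub>R s i y = y + u i (- d)" for i
    by (simp_all add: u_def)
  have "f (y + u i d) + f (y + u i (- d)) =
    2 * f y - 2 * a * f1 y (b y) + a\<^sup>2 * f2 y (b y) (b y) + d\<^sup>2 * f2 y (s i y) (s i y) + (t i d + t i (- d))" for i
    unfolding t_def u_def linear_add[OF l(1)] linear_scale[OF l(1)] linear_add[OF l(2)] linear_scale[OF l(2)]
      linear_add[OF l(3)] linear_scale[OF l(3)]
    by (simp add: power2_eq_square field_simps)
  then have "step a d f y = (\<Sum>i\<in>(Basis::'a set).
    2 * f y - 2 * a * f1 y (b y) + a\<^sup>2 * f2 y (b y) (b y) + d\<^sup>2 * f2 y (s i y) (s i y) + (t i d + t i (- d))) / (2 * DIM('a))"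
    unfolding step_def yu by simp
  also have "\<dots> = f y + generator a c f1 f2 y y + (\<Sum>i\<in>Basis. t i d + t i (- d)) / (2 * DIM('a))"
    unfolding sum.distrib sum_subtractf sum_distrib_left[symmetric] dc
    by (simp add: generator_def field_simps)
  finally have eq: "step a d f y - f y - generator a c f1 f2 y y = (\<Sum>i\<in>Basis. t i d + t i (- d)) / (2 * DIM('a))"
    by simp
  have "\<bar>\<Sum>i\<in>Basis. t i d + t i (- d)\<bar> \<le> (\<Sum>i\<in>(Basis::'a set). ?M + ?M)"
    using ub[of _ d] ub[of _ "- d"] d
    by (intro order_trans[OF sum_abs] sum_mono order_trans[OF abs_triangle_ineq] add_mono) auto
  also have "\<dots> = ?M * (2 * DIM('a))" by simp
  finally show ?thesis unfolding eq by (simp add: abs_divide divide_le_eq)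
qed

text \<open>Moving the query point costs only order \<open>e^2\<close> per unit of distance even
  though the noise may be large: \<open>c\<close> can be of order \<open>1 / e^2\<close>, but it
  enters with the factor \<open>a\<^sup>2\<close>. The first-order part has the same order through
  the Lipschitz drift.\<close>

lemma generator_diff:
  fixes a c e B R :: real
  assumes f: "smooth_test B m f f1 f2 f3" and B: "0 \<le> B" and R: "0 \<le> R"
    and e: "0 \<le> e" "e \<le> 1" and a: "\<bar>a\<bar> \<le> R * e\<^sup>2" and c: "0 \<le> c" "a\<^sup>2 * c \<le> R\<^sup>2 * e\<^sup>2"
  shows "\<bar>generator a c f1 f2 y x - generator a c f1 f2 y y\<bar> \<le>
    2 * B * K\<^sup>2 * (R + R\<^sup>2 + R\<^sup>2 * DIM('a)) * e\<^sup>2 * (1 + norm x + norm y) ^ (2 * m + 1) * norm (x - y)"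
proof -
  have j: "jet3 f f1 f2 f3" using f unfolding smooth_test_def by blast
  note l = jet3_linear[OF j]
  define X where "X = 1 + norm x + norm y"
  define D where "D = 2 * B * K\<^sup>2 * X ^ (2 * m + 1) * norm (x - y)"
  have X: "1 \<le> X" by (simp add: X_def)
  have D0: "0 \<le> D" using B X by (simp add: D_def)
  have rX: "rho y ^ m \<le> X ^ (2 * m)" using rho_power_le[of y "norm x + norm y" m] by (simp add: X_def add.assoc)
  have BX: "B * rho y ^ m \<le> B * X ^ (2 * m)" "0 \<le> B * X ^ (2 * m)" using rX B X by (auto intro: mult_left_mono)
  have f1: "\<bar>f1 y v\<bar> \<le> B * X ^ (2 * m) * norm v" for v
  proof -
    have "\<bar>f1 y v\<bar> \<le> B * rho y ^ m * norm v" using f by (simp add: smooth_test_def)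
    also have "\<dots> \<le> B * X ^ (2 * m) * norm v" using BX by (intro mult_right_mono) auto
    finally show ?thesis .
  qed
  have f2: "\<bar>f2 y v w\<bar> \<le> B * X ^ (2 * m) * norm v * norm w" for v w
  proof -
    have "\<bar>f2 y v w\<bar> \<le> B * rho y ^ m * norm v * norm w" using f by (simp add: smooth_test_def)
    also have "\<dots> \<le> B * X ^ (2 * m) * norm v * norm w" using BX by (intro mult_right_mono) auto
    finally show ?thesis .
  qed
  have quad: "\<bar>f2 y (g x) (g x) - f2 y (g y) (g y)\<bar> \<le> D" if g: "coefficient K q g g1 g2 g3" for g g1 g2 g3
  proof -
    have gl: "norm (g x - g y) \<le> K * norm (x - y)" by (rule coefficient_lipschitz[OF g])
    have gx: "norm (g x) \<le> K * X" "norm (g y) \<le> K * X"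
    proof -
      have "norm (g z) \<le> K * (1 + norm z)" for z using g unfolding coefficient_def by blast
      moreover have "K * (1 + norm x) \<le> K * X" "K * (1 + norm y) \<le> K * X"
        using K by (auto simp: X_def intro!: mult_left_mono)
      ultimately show "norm (g x) \<le> K * X" "norm (g y) \<le> K * X" by (meson order_trans)+
    qed
    have "f2 y (g x) (g x) - f2 y (g y) (g y) = f2 y (g x - g y) (g x) + f2 y (g y) (g x - g y)"
      by (simp add: linear_diff[OF l(2)] linear_diff[OF l(3)])
    then have "\<bar>f2 y (g x) (g x) - f2 y (g y) (g y)\<bar> \<le> \<bar>f2 y (g x - g y) (g x)\<bar> + \<bar>f2 y (g y) (g x - g y)\<bar>"
      by linarith
    also have "\<dots> \<le> B * X ^ (2 * m) * norm (g x - g y) * norm (g x) + B * X ^ (2 * m) * norm (g y) * norm (g x - g y)"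
      by (intro add_mono f2)
    also have "\<dots> \<le> B * X ^ (2 * m) * (K * norm (x - y)) * (K * X) + B * X ^ (2 * m) * (K * X) * (K * norm (x - y))"
      using gl gx K X B by (intro add_mono mult_mono) auto
    also have "\<dots> = D" by (simp add: D_def power2_eq_square mult_ac)
    finally show ?thesis .
  qed
  have e2: "e\<^sup>2 * e\<^sup>2 \<le> e\<^sup>2" using e by (simp add: power2_eq_square mult_le_one mult_left_le)
  have "\<bar>a\<bar> * \<bar>f1 y (b x - b y)\<bar> \<le> (R * e\<^sup>2) * (B * X ^ (2 * m) * (K * norm (x - y)))"
  proof (intro mult_mono a)
    show "\<bar>f1 y (b x - b y)\<bar> \<le> B * X ^ (2 * m) * (K * norm (x - y))"
      using f1[of "b x - b y"] mult_left_mono[OF coefficient_lipschitz[OF drift, of x y] BX(2)] by linarith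
  qed (use R in auto)
  also have "\<dots> \<le> (R * e\<^sup>2) * D"
  proof (rule mult_left_mono)
    have "X ^ (2 * m) * K \<le> X ^ (2 * m + 1) * K\<^sup>2"
      using K X by (intro mult_mono power_increasing) (auto simp: power2_eq_square)
    then have "B * norm (x - y) * (X ^ (2 * m) * K) \<le> 2 * (B * norm (x - y) * (X ^ (2 * m + 1) * K\<^sup>2))"
      using B mult_left_mono[of "X ^ (2 * m) * K" "X ^ (2 * m + 1) * K\<^sup>2" "B * norm (x - y)"] X
      by (smt (verit) mult_nonneg_nonneg norm_ge_zero zero_le_power zero_le_power2)
    then show "B * X ^ (2 * m) * (K * norm (x - y)) \<le> D" by (simp add: D_def mult_ac)
  qed (use R in auto)
  finally have 1: "\<bar>a * f1 y (b x - b y)\<bar> \<le> R * e\<^sup>2 * D" by (simp add: abs_mult)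
  have "a\<^sup>2 \<le> (R * e\<^sup>2)\<^sup>2" using a by (metis abs_ge_zero power2_abs power_mono)
  also have "\<dots> \<le> R\<^sup>2 * e\<^sup>2" using e2 by (simp add: power_mult_distrib power2_eq_square[of "e\<^sup>2"] mult_left_mono)
  finally have a2: "a\<^sup>2 \<le> R\<^sup>2 * e\<^sup>2" .
  have 2: "a\<^sup>2 * \<bar>f2 y (b x) (b x) - f2 y (b y) (b y)\<bar> \<le> R\<^sup>2 * e\<^sup>2 * D"
    using a2 quad[OF drift] by (intro mult_mono) auto
  have "\<bar>\<Sum>i\<in>Basis. f2 y (s i x) (s i x) - f2 y (s i y) (s i y)\<bar> \<le> (\<Sum>i\<in>(Basis::'a set). D)"
    by (intro order_trans[OF sum_abs] sum_mono quad[OF noise])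
  then have 3: "a\<^sup>2 * c * \<bar>\<Sum>i\<in>Basis. f2 y (s i x) (s i x) - f2 y (s i y) (s i y)\<bar> \<le> R\<^sup>2 * e\<^sup>2 * (DIM('a) * D)"
    using c mult_mono[OF c(2), of _ "DIM('a) * D"] by simp
  have tri: "\<bar>- p + (q + r) / 2\<bar> \<le> \<bar>p\<bar> + (\<bar>q\<bar> + \<bar>r\<bar>)" for p q r :: real
    unfolding abs_le_iff using abs_ge_self[of p] abs_ge_minus_self[of p] abs_ge_self[of q] abs_ge_minus_self[of q]
      abs_ge_self[of r] abs_ge_minus_self[of r] abs_ge_zero[of q] abs_ge_zero[of r] by (simp add: field_simps)
  have eq: "generator a c f1 f2 y x - generator a c f1 f2 y y =
    - (a * f1 y (b x - b y)) + (a\<^sup>2 * (f2 y (b x) (b x) - f2 y (b y) (b y))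
      + a\<^sup>2 * c * (\<Sum>i\<in>Basis. f2 y (s i x) (s i x) - f2 y (s i y) (s i y))) / 2"
    unfolding generator_def linear_diff[OF l(1)] sum_subtractf by (simp add: field_simps)
  have "\<bar>generator a c f1 f2 y x - generator a c f1 f2 y y\<bar> \<le> \<bar>a * f1 y (b x - b y)\<bar> + (\<bar>a\<^sup>2 * (f2 y (b x) (b x) - f2 y (b y) (b y))\<bar>
      + \<bar>a\<^sup>2 * c * (\<Sum>i\<in>Basis. f2 y (s i x) (s i x) - f2 y (s i y) (s i y))\<bar>)"
    unfolding eq by (rule tri)
  also have "\<dots> \<le> R * e\<^sup>2 * D + (R\<^sup>2 * e\<^sup>2 * D + R\<^sup>2 * e\<^sup>2 * (DIM('a) * D))"
  proof (intro add_mono 1)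
    show "\<bar>a\<^sup>2 * (f2 y (b x) (b x) - f2 y (b y) (b y))\<bar> \<le> R\<^sup>2 * e\<^sup>2 * D"
      unfolding abs_mult abs_power2 by (rule 2)
    have "\<bar>a\<^sup>2 * c\<bar> = a\<^sup>2 * c" using c(1) by (intro abs_of_nonneg) simp
    then show "\<bar>a\<^sup>2 * c * (\<Sum>i\<in>Basis. f2 y (s i x) (s i x) - f2 y (s i y) (s i y))\<bar> \<le> R\<^sup>2 * e\<^sup>2 * (DIM('a) * D)"
      unfolding abs_mult[of "a\<^sup>2 * c"] using 3 by simp
  qed
  also have "\<dots> = (R + R\<^sup>2 + R\<^sup>2 * DIM('a)) * e\<^sup>2 * D" by (simp add: algebra_simps)
  finally show ?thesis by (simp add: D_def X_def mult_ac)
qed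

end

section \<open>Conditional laws and random variables with all moments\<close>

text \<open>The definition of a conditional law is the case in which \<open>A\<close> and
  \<open>p\<close> are indicators. Measurable induction extends it first in \<open>p\<close>, for a
  fixed indicator \<open>A\<close>, and then in \<open>A\<close>.\<close>

lemma has_conditional_law_nn_integral:
  fixes A :: "'w \<Rightarrow> ennreal" and Y :: "'w \<Rightarrow> 'b::topological_space"
  assumes sub: "subalgebra M F" and Y[measurable]: "Y \<in> borel_measurable M"
    and \<kappa>[measurable]: "\<kappa> \<in> F \<rightarrow>\<^sub>M subprob_algebra borel" and law: "has_conditional_law M F Y \<kappa>"
    and A: "A \<in> borel_measurable F" and p: "p \<in> borel_measurable borel"
  shows "(\<integral>\<^sup>+\<omega>. A \<omega> * p (Y \<omega>) \<partial>M) = (\<integral>\<^sup>+\<omega>. A \<omega> * (\<integral>\<^sup>+v. p v \<partial>\<kappa> \<omega>) \<partial>M)"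
proof -
  have FM: "f \<in> borel_measurable F \<Longrightarrow> f \<in> borel_measurable M" for f :: "'w \<Rightarrow> ennreal"
    using measurable_from_subalg[OF sub] .
  have \<kappa>p: "(\<lambda>\<omega>. \<integral>\<^sup>+v. p v \<partial>\<kappa> \<omega>) \<in> borel_measurable F" if "p \<in> borel_measurable borel" for p
    using measurable_compose[OF \<kappa> nn_integral_measurable_subprob_algebra[OF that]] .
  have sets_\<kappa>: "sets (\<kappa> \<omega>) = sets borel" if "\<omega> \<in> space M" for \<omega>
    using measurable_space[OF \<kappa>, of \<omega>] that sub by (simp add: subalgebra_def space_subprob_algebra)
  have pm: "q \<in> borel_measurable (\<kappa> \<omega>)" if "q \<in> borel_measurable borel" "\<omega> \<in> space M" for q :: "'b \<Rightarrow> ennreal" and \<omega>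
    using that measurable_cong_sets[OF sets_\<kappa>[OF that(2)] refl] by blast
  have ind: "(\<integral>\<^sup>+\<omega>. indicator S \<omega> * p (Y \<omega>) \<partial>M) = (\<integral>\<^sup>+\<omega>. indicator S \<omega> * (\<integral>\<^sup>+v. p v \<partial>\<kappa> \<omega>) \<partial>M)"
    if S: "S \<in> sets F" and p: "p \<in> borel_measurable borel" for S p
    using p
  proof (induction p rule: borel_measurable_induct)
    case (cong f g)
    then show ?case by (simp add: fun_eq_iff)
  next
    case (set B)
    have SM: "S \<in> sets M" using S sub by (auto simp: subalgebra_def)
    have "(\<integral>\<^sup>+\<omega>. indicator S \<omega> * indicator B (Y \<omega>) \<partial>M) = (\<integral>\<^sup>+\<omega>. indicator (S \<inter> (Y -` B \<inter> space M)) \<omega> \<partial>M)"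
      by (intro nn_integral_cong) (auto simp: indicator_def)
    also have "\<dots> = emeasure M (S \<inter> (Y -` B \<inter> space M))"
      using SM set measurable_sets[OF Y, of B] by (intro nn_integral_indicator) auto
    also have "\<dots> = (\<integral>\<^sup>+\<omega>\<in>S. emeasure (\<kappa> \<omega>) B \<partial>M)"
      using law S set unfolding has_conditional_law_def by auto
    also have "\<dots> = (\<integral>\<^sup>+\<omega>. indicator S \<omega> * (\<integral>\<^sup>+v. indicator B v \<partial>\<kappa> \<omega>) \<partial>M)"
      using set sets_\<kappa> by (intro nn_integral_cong) (simp add: mult.commute)
    finally show ?case .
  next
    case (mult f c)
    have "(\<integral>\<^sup>+\<omega>. indicator S \<omega> * (c * f (Y \<omega>)) \<partial>M) = c * (\<integral>\<^sup>+\<omega>. indicator S \<omega> * f (Y \<omega>) \<partial>M)"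
      using mult S FM[of "indicator S"] by (subst nn_integral_cmult[symmetric]) (auto simp: mult_ac)
    also have "\<dots> = c * (\<integral>\<^sup>+\<omega>. indicator S \<omega> * (\<integral>\<^sup>+v. f v \<partial>\<kappa> \<omega>) \<partial>M)" using mult by simp
    also have "\<dots> = (\<integral>\<^sup>+\<omega>. c * (indicator S \<omega> * (\<integral>\<^sup>+v. f v \<partial>\<kappa> \<omega>)) \<partial>M)"
      using FM[OF \<kappa>p[OF mult(2)]] S FM[of "indicator S"] by (subst nn_integral_cmult[symmetric]) auto
    also have "\<dots> = (\<integral>\<^sup>+\<omega>. indicator S \<omega> * (\<integral>\<^sup>+v. c * f v \<partial>\<kappa> \<omega>) \<partial>M)"
      by (intro nn_integral_cong) (simp add: nn_integral_cmult[OF pm[OF mult(2)]] mult_ac)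
    finally show ?case .
  next
    case (add g f)
    have "(\<integral>\<^sup>+\<omega>. indicator S \<omega> * (f (Y \<omega>) + g (Y \<omega>)) \<partial>M) =
        (\<integral>\<^sup>+\<omega>. indicator S \<omega> * f (Y \<omega>) \<partial>M) + (\<integral>\<^sup>+\<omega>. indicator S \<omega> * g (Y \<omega>) \<partial>M)"
      using add S FM[of "indicator S"] by (subst nn_integral_add[symmetric]) (auto simp: distrib_left)
    also have "\<dots> = (\<integral>\<^sup>+\<omega>. indicator S \<omega> * (\<integral>\<^sup>+v. f v \<partial>\<kappa> \<omega>) + indicator S \<omega> * (\<integral>\<^sup>+v. g v \<partial>\<kappa> \<omega>) \<partial>M)"
      using add S FM[of "indicator S"] FM[OF \<kappa>p[OF add(1)]] FM[OF \<kappa>p[OF add(3)]]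
      by (subst nn_integral_add) auto
    also have "\<dots> = (\<integral>\<^sup>+\<omega>. indicator S \<omega> * (\<integral>\<^sup>+v. f v + g v \<partial>\<kappa> \<omega>) \<partial>M)"
      by (intro nn_integral_cong) (simp add: nn_integral_add[OF pm[OF add(3)] pm[OF add(1)]] distrib_left)
    finally show ?case .
  next
    case (seq U)
    note Um = seq(1) and inc = seq(3)
    have "(\<integral>\<^sup>+\<omega>. indicator S \<omega> * (SUP i. U i) (Y \<omega>) \<partial>M) = (\<integral>\<^sup>+\<omega>. (SUP i. indicator S \<omega> * U i (Y \<omega>)) \<partial>M)"
      by (simp add: SUP_mult_left_ennreal image_image)
    also have "\<dots> = (SUP i. \<integral>\<^sup>+\<omega>. indicator S \<omega> * U i (Y \<omega>) \<partial>M)"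
      using inc Um S FM[of "indicator S"]
      by (intro nn_integral_monotone_convergence_SUP) (auto simp: incseq_def le_fun_def intro!: mult_left_mono)
    also have "\<dots> = (SUP i. \<integral>\<^sup>+\<omega>. indicator S \<omega> * (\<integral>\<^sup>+v. U i v \<partial>\<kappa> \<omega>) \<partial>M)" using seq by simp
    also have "\<dots> = (\<integral>\<^sup>+\<omega>. (SUP i. indicator S \<omega> * (\<integral>\<^sup>+v. U i v \<partial>\<kappa> \<omega>)) \<partial>M)"
    proof (rule nn_integral_monotone_convergence_SUP[symmetric])
      show "incseq (\<lambda>i \<omega>. indicator S \<omega> * (\<integral>\<^sup>+v. U i v \<partial>\<kappa> \<omega>))"
        using inc by (auto simp: incseq_def le_fun_def intro!: mult_left_mono nn_integral_mono)
      show "(\<lambda>\<omega>. indicator S \<omega> * (\<integral>\<^sup>+v. U i v \<partial>\<kappa> \<omega>)) \<in> borel_measurable M" for i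
        using S FM[of "indicator S"] FM[OF \<kappa>p[OF Um]] by auto
    qed
    also have "\<dots> = (\<integral>\<^sup>+\<omega>. indicator S \<omega> * (\<integral>\<^sup>+v. (SUP i. U i) v \<partial>\<kappa> \<omega>) \<partial>M)"
    proof (intro nn_integral_cong)
      fix \<omega> assume "\<omega> \<in> space M"
      then have "(\<integral>\<^sup>+v. (SUP i. U i v) \<partial>\<kappa> \<omega>) = (SUP i. \<integral>\<^sup>+v. U i v \<partial>\<kappa> \<omega>)"
        by (intro nn_integral_monotone_convergence_SUP inc pm Um)
      then show "(SUP i. indicator S \<omega> * (\<integral>\<^sup>+v. U i v \<partial>\<kappa> \<omega>)) = indicator S \<omega> * (\<integral>\<^sup>+v. (SUP i. U i) v \<partial>\<kappa> \<omega>)"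
        by (simp add: SUP_mult_left_ennreal image_image)
    qed
    finally show ?case .
  qed
  have mp: "(\<lambda>\<omega>. p (Y \<omega>)) \<in> borel_measurable M" using p by simp
  note mk = FM[OF \<kappa>p[OF p]]
  show ?thesis using A
  proof (induction A rule: borel_measurable_induct)
    case (cong f g)
    then have "\<And>\<omega>. \<omega> \<in> space M \<Longrightarrow> f \<omega> = g \<omega>" using sub by (auto simp: subalgebra_def)
    with cong show ?case by (simp cong: nn_integral_cong)
  next
    case (set S)
    then show ?case using ind[OF set p] by simp
  next
    case (mult f c)
    then show ?case using FM[OF mult(2)] mp mk by (simp add: mult.assoc nn_integral_cmult)
  next
    case (add f g)
    then show ?case using FM[OF add(1)] FM[OF add(3)] mp mk by (simp add: distrib_right nn_integral_add)
  next
    case (seq U)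
    have "(\<integral>\<^sup>+\<omega>. (SUP i. U i) \<omega> * r \<omega> \<partial>M) = (SUP i. \<integral>\<^sup>+\<omega>. U i \<omega> * r \<omega> \<partial>M)"
      if r: "r \<in> borel_measurable M" for r
    proof -
      have "(\<integral>\<^sup>+\<omega>. (SUP i. U i) \<omega> * r \<omega> \<partial>M) = (\<integral>\<^sup>+\<omega>. (SUP i. U i \<omega> * r \<omega>) \<partial>M)"
        by (simp add: SUP_mult_right_ennreal image_image)
      also have "\<dots> = (SUP i. \<integral>\<^sup>+\<omega>. U i \<omega> * r \<omega> \<partial>M)"
        using seq(3) r FM[OF seq(1)]
        by (intro nn_integral_monotone_convergence_SUP) (auto simp: incseq_def le_fun_def intro!: mult_right_mono)
      finally show ?thesis .
    qed
    from this[OF mp] this[OF mk] show ?case using seq by simp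
  qed
qed

text \<open>Finiteness is transferred through the nonnegative integral, so integrability on the side
  of the kernel is obtained as a conclusion.\<close>

lemma has_conditional_law_integral_nonneg:
  fixes A :: "'w \<Rightarrow> real" and Y :: "'w \<Rightarrow> 'b::topological_space"
  assumes sub: "subalgebra M F" and Y: "Y \<in> borel_measurable M"
    and \<kappa>: "\<kappa> \<in> F \<rightarrow>\<^sub>M subprob_algebra borel" and law: "has_conditional_law M F Y \<kappa>"
    and A: "A \<in> borel_measurable F" and p: "p \<in> borel_measurable borel"
    and int: "integrable M (\<lambda>\<omega>. A \<omega> * p (Y \<omega>))" and pint: "\<And>\<omega>. \<omega> \<in> space M \<Longrightarrow> integrable (\<kappa> \<omega>) p"
    and pos: "\<And>\<omega>. 0 \<le> A \<omega>" "\<And>v. 0 \<le> p v"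
  shows "integrable M (\<lambda>\<omega>. A \<omega> * (\<integral>v. p v \<partial>\<kappa> \<omega>)) \<and>
    (\<integral>\<omega>. A \<omega> * p (Y \<omega>) \<partial>M) = (\<integral>\<omega>. A \<omega> * (\<integral>v. p v \<partial>\<kappa> \<omega>) \<partial>M)"
proof -
  have "(\<integral>\<^sup>+\<omega>. ennreal (A \<omega> * p (Y \<omega>)) \<partial>M) = (\<integral>\<^sup>+\<omega>. ennreal (A \<omega>) * ennreal (p (Y \<omega>)) \<partial>M)"
    using pos by (simp add: ennreal_mult)
  also have "\<dots> = (\<integral>\<^sup>+\<omega>. ennreal (A \<omega>) * (\<integral>\<^sup>+v. ennreal (p v) \<partial>\<kappa> \<omega>) \<partial>M)"
    using A p by (intro has_conditional_law_nn_integral[OF sub Y \<kappa> law]) auto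
  also have "\<dots> = (\<integral>\<^sup>+\<omega>. ennreal (A \<omega> * (\<integral>v. p v \<partial>\<kappa> \<omega>)) \<partial>M)"
    using pos by (intro nn_integral_cong) (simp add: nn_integral_eq_integral[OF pint] ennreal_mult integral_nonneg)
  finally have eq: "(\<integral>\<^sup>+\<omega>. ennreal (A \<omega> * p (Y \<omega>)) \<partial>M) = (\<integral>\<^sup>+\<omega>. ennreal (A \<omega> * (\<integral>v. p v \<partial>\<kappa> \<omega>)) \<partial>M)" .
  have pm: "(\<lambda>\<omega>. \<integral>v. p v \<partial>\<kappa> \<omega>) \<in> borel_measurable M"
  proof -
    have "(\<lambda>\<omega>. enn2real (\<integral>\<^sup>+v. ennreal (p v) \<partial>\<kappa> \<omega>)) \<in> borel_measurable F"
      using measurable_compose[OF \<kappa> nn_integral_measurable_subprob_algebra[of "\<lambda>v. ennreal (p v)" borel]] p by auto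
    from measurable_from_subalg[OF sub this]
    moreover have "(\<lambda>\<omega>. enn2real (\<integral>\<^sup>+v. ennreal (p v) \<partial>\<kappa> \<omega>)) \<in> borel_measurable M \<longleftrightarrow>
        (\<lambda>\<omega>. \<integral>v. p v \<partial>\<kappa> \<omega>) \<in> borel_measurable M"
      using pos by (intro measurable_cong) (simp add: nn_integral_eq_integral[OF pint] integral_nonneg)
    ultimately show ?thesis by simp
  qed
  have m: "(\<lambda>\<omega>. A \<omega> * (\<integral>v. p v \<partial>\<kappa> \<omega>)) \<in> borel_measurable M"
    using measurable_from_subalg[OF sub A] pm by simp
  have nn: "0 \<le> A \<omega> * (\<integral>v. p v \<partial>\<kappa> \<omega>)" for \<omega> using pos by (simp add: integral_nonneg)
  have fin: "(\<integral>\<^sup>+\<omega>. ennreal (A \<omega> * p (Y \<omega>)) \<partial>M) < \<infinity>"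
    using int pos by (simp add: integrable_iff_bounded)
  have "integrable M (\<lambda>\<omega>. A \<omega> * (\<integral>v. p v \<partial>\<kappa> \<omega>))"
    using fin nn unfolding eq by (intro integrableI_bounded[OF m]) simp
  moreover have "(\<integral>\<omega>. A \<omega> * p (Y \<omega>) \<partial>M) = enn2real (\<integral>\<^sup>+\<omega>. ennreal (A \<omega> * p (Y \<omega>)) \<partial>M)"
    using pos by (intro integral_eq_nn_integral borel_measurable_integrable[OF int]) auto
  moreover have "(\<integral>\<omega>. A \<omega> * (\<integral>v. p v \<partial>\<kappa> \<omega>) \<partial>M) = enn2real (\<integral>\<^sup>+\<omega>. ennreal (A \<omega> * (\<integral>v. p v \<partial>\<kappa> \<omega>)) \<partial>M)"
    using nn by (intro integral_eq_nn_integral m) auto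
  ultimately show ?thesis using eq by simp
qed

lemma has_conditional_law_integral:
  fixes A :: "'w \<Rightarrow> real" and Y :: "'w \<Rightarrow> 'b::topological_space"
  assumes sub: "subalgebra M F" and Y: "Y \<in> borel_measurable M"
    and \<kappa>: "\<kappa> \<in> F \<rightarrow>\<^sub>M subprob_algebra borel" and law: "has_conditional_law M F Y \<kappa>"
    and A: "A \<in> borel_measurable F" and p: "p \<in> borel_measurable borel"
    and int: "integrable M (\<lambda>\<omega>. A \<omega> * p (Y \<omega>))" and pint: "\<And>\<omega>. \<omega> \<in> space M \<Longrightarrow> integrable (\<kappa> \<omega>) p"
  shows "(\<integral>\<omega>. A \<omega> * p (Y \<omega>) \<partial>M) = (\<integral>\<omega>. A \<omega> * (\<integral>v. p v \<partial>\<kappa> \<omega>) \<partial>M)"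
proof -
  \<comment> \<open>The signs \<open>r\<close> and \<open>t\<close> select the positive or the
    negative part of \<open>A\<close> and of \<open>p\<close>. All four products are dominated by
    the integrable product, so the nonnegative case applies to each of them.\<close>
  have part: "integrable M (\<lambda>\<omega>. max 0 (r * A \<omega>) * max 0 (t * p (Y \<omega>))) \<and>
     integrable M (\<lambda>\<omega>. max 0 (r * A \<omega>) * (\<integral>v. max 0 (t * p v) \<partial>\<kappa> \<omega>)) \<and>
    (\<integral>\<omega>. max 0 (r * A \<omega>) * max 0 (t * p (Y \<omega>)) \<partial>M) = (\<integral>\<omega>. max 0 (r * A \<omega>) * (\<integral>v. max 0 (t * p v) \<partial>\<kappa> \<omega>) \<partial>M)"
    if rt: "\<bar>r\<bar> = 1" "\<bar>t\<bar> = 1" for r t :: real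
  proof -
    have i: "integrable M (\<lambda>\<omega>. max 0 (r * A \<omega>) * max 0 (t * p (Y \<omega>)))"
    proof (rule Bochner_Integration.integrable_bound[OF int])
      show "(\<lambda>\<omega>. max 0 (r * A \<omega>) * max 0 (t * p (Y \<omega>))) \<in> borel_measurable M"
        using measurable_from_subalg[OF sub A] measurable_compose[OF Y p] by simp
      have "norm (max 0 (r * a) * max 0 (t * c)) \<le> norm (a * c)" for a c
      proof -
        have "\<bar>max 0 (r * a)\<bar> \<le> \<bar>r * a\<bar>" "\<bar>max 0 (t * c)\<bar> \<le> \<bar>t * c\<bar>" by auto
        then show ?thesis using rt by (simp add: abs_mult mult_mono)
      qed
      then show "AE \<omega> in M. norm (max 0 (r * A \<omega>) * max 0 (t * p (Y \<omega>))) \<le> norm (A \<omega> * p (Y \<omega>))" by simp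
    qed
    with has_conditional_law_integral_nonneg[OF sub Y \<kappa> law, of "\<lambda>\<omega>. max 0 (r * A \<omega>)" "\<lambda>v. max 0 (t * p v)"]
    show ?thesis using A p pint by auto
  qed
  have split: "a * c = max 0 (1 * a) * max 0 (1 * c) - max 0 (1 * a) * max 0 (- 1 * c)
      - max 0 (- 1 * a) * max 0 (1 * c) + max 0 (- 1 * a) * max 0 (- 1 * c)" for a c :: real
    by (auto simp: max_def mult_le_0_iff zero_le_mult_iff)
  have ps: "(\<integral>v. p v \<partial>\<kappa> \<omega>) = (\<integral>v. max 0 (1 * p v) \<partial>\<kappa> \<omega>) - (\<integral>v. max 0 (- 1 * p v) \<partial>\<kappa> \<omega>)" if "\<omega> \<in> space M" for \<omega>
  proof -
    have "(\<integral>v. max 0 (1 * p v) \<partial>\<kappa> \<omega>) - (\<integral>v. max 0 (- 1 * p v) \<partial>\<kappa> \<omega>) = (\<integral>v. max 0 (1 * p v) - max 0 (- 1 * p v) \<partial>\<kappa> \<omega>)"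
      using pint[OF that] by (intro Bochner_Integration.integral_diff[symmetric]) auto
    also have "\<dots> = (\<integral>v. p v \<partial>\<kappa> \<omega>)" by (intro Bochner_Integration.integral_cong) auto
    finally show ?thesis by simp
  qed
  define P where "P r t = (\<lambda>\<omega>. max 0 (r * A \<omega>) * max 0 (t * p (Y \<omega>)))" for r t
  define Q where "Q r t = (\<lambda>\<omega>. max 0 (r * A \<omega>) * (\<integral>v. max 0 (t * p v) \<partial>\<kappa> \<omega>))" for r t
  have PQ: "integrable M (P r t)" "integrable M (Q r t)" "integral\<^sup>L M (P r t) = integral\<^sup>L M (Q r t)"
    if "\<bar>r\<bar> = 1" "\<bar>t\<bar> = 1" for r t
    using part[OF that] by (auto simp: P_def Q_def)
  have "(\<integral>\<omega>. A \<omega> * p (Y \<omega>) \<partial>M) = (\<integral>\<omega>. P 1 1 \<omega> - P 1 (-1) \<omega> - P (-1) 1 \<omega> + P (-1) (-1) \<omega> \<partial>M)"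
    unfolding P_def by (intro Bochner_Integration.integral_cong refl split)
  also have "\<dots> = integral\<^sup>L M (P 1 1) - integral\<^sup>L M (P 1 (-1)) - integral\<^sup>L M (P (-1) 1) + integral\<^sup>L M (P (-1) (-1))"
    using PQ by simp
  also have "\<dots> = integral\<^sup>L M (Q 1 1) - integral\<^sup>L M (Q 1 (-1)) - integral\<^sup>L M (Q (-1) 1) + integral\<^sup>L M (Q (-1) (-1))"
    using PQ by simp
  also have "\<dots> = (\<integral>\<omega>. Q 1 1 \<omega> - Q 1 (-1) \<omega> - Q (-1) 1 \<omega> + Q (-1) (-1) \<omega> \<partial>M)"
    using PQ by simp
  also have "\<dots> = (\<integral>\<omega>. A \<omega> * (\<integral>v. p v \<partial>\<kappa> \<omega>) \<partial>M)"
  proof (intro Bochner_Integration.integral_cong refl)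
    fix \<omega> assume "\<omega> \<in> space M"
    have "A \<omega> = max 0 (1 * A \<omega>) - max 0 (- 1 * A \<omega>)" by auto
    then show "Q 1 1 \<omega> - Q 1 (-1) \<omega> - Q (-1) 1 \<omega> + Q (-1) (-1) \<omega> = A \<omega> * (\<integral>v. p v \<partial>\<kappa> \<omega>)"
      unfolding Q_def ps[OF \<open>\<omega> \<in> space M\<close>] by (simp add: algebra_simps max_def)
  qed
  finally show ?thesis .
qed

text \<open>A class closed under sums, products, powers and domination. Integrability of the
  polynomial expressions below then follows from their shape alone.\<close>

definition all_moments :: "'w measure \<Rightarrow> ('w \<Rightarrow> real) \<Rightarrow> bool" where
  "all_moments M f \<longleftrightarrow> f \<in> borel_measurable M \<and> (\<forall>p::nat. integrable M (\<lambda>\<omega>. \<bar>f \<omega>\<bar> ^ p))"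

lemma all_moments_measurable [measurable_dest]: "all_moments M f \<Longrightarrow> f \<in> borel_measurable M"
  by (simp add: all_moments_def)

lemma all_moments_bound:
  assumes "all_moments M f" "g \<in> borel_measurable M" "\<And>\<omega>. \<omega> \<in> space M \<Longrightarrow> \<bar>g \<omega>\<bar> \<le> \<bar>f \<omega>\<bar>"
  shows "all_moments M g"
  unfolding all_moments_def
proof (intro conjI allI)
  fix p :: nat
  show "integrable M (\<lambda>\<omega>. \<bar>g \<omega>\<bar> ^ p)"
  proof (rule Bochner_Integration.integrable_bound)
    show "integrable M (\<lambda>\<omega>. \<bar>f \<omega>\<bar> ^ p)" using assms(1) by (simp add: all_moments_def)
    show "AE \<omega> in M. norm (\<bar>g \<omega>\<bar> ^ p) \<le> norm (\<bar>f \<omega>\<bar> ^ p)"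
      using assms(3) by (intro AE_I2) (auto intro: power_mono)
  qed (use assms in simp)
qed (use assms in simp)

lemma all_moments_integrable:
  assumes "all_moments M f" shows "integrable M f"
proof -
  have "integrable M (\<lambda>\<omega>. \<bar>f \<omega>\<bar> ^ 1)" using assms unfolding all_moments_def by blast
  then show ?thesis using integrable_abs_cancel[of M f] all_moments_measurable[OF assms] by simp
qed

lemma power_sum_le:
  fixes a b :: real
  assumes "0 \<le> a" "0 \<le> b"
  shows "(a + b) ^ p \<le> 2 ^ p * (a ^ p + b ^ p)"
proof -
  have "(a + b) ^ p \<le> (2 * max a b) ^ p" using assms by (intro power_mono) auto
  also have "\<dots> = 2 ^ p * max a b ^ p" by (simp add: power_mult_distrib)
  also have "\<dots> \<le> 2 ^ p * (a ^ p + b ^ p)" using assms by (intro mult_left_mono) (auto simp: max_def)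
  finally show ?thesis .
qed

lemma all_moments_add:
  assumes f: "all_moments M f" and g: "all_moments M g"
  shows "all_moments M (\<lambda>\<omega>. f \<omega> + g \<omega>)"
  unfolding all_moments_def
proof (intro conjI allI)
  fix p :: nat
  show "integrable M (\<lambda>\<omega>. \<bar>f \<omega> + g \<omega>\<bar> ^ p)"
  proof (rule Bochner_Integration.integrable_bound)
    show "integrable M (\<lambda>\<omega>. 2 ^ p * (\<bar>f \<omega>\<bar> ^ p + \<bar>g \<omega>\<bar> ^ p))" using f g by (simp add: all_moments_def)
    have "\<bar>s + t\<bar> ^ p \<le> 2 ^ p * (\<bar>s\<bar> ^ p + \<bar>t\<bar> ^ p)" for s t :: real
      using power_sum_le[of "\<bar>s\<bar>" "\<bar>t\<bar>" p] power_mono[OF abs_triangle_ineq[of s t], of p] by simp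
    then show "AE \<omega> in M. norm (\<bar>f \<omega> + g \<omega>\<bar> ^ p) \<le> norm (2 ^ p * (\<bar>f \<omega>\<bar> ^ p + \<bar>g \<omega>\<bar> ^ p))"
      by (intro AE_I2) (simp add: order_trans[OF _ abs_ge_self])
  qed (use f g in simp)
qed (use f g in simp)

lemma all_moments_mult:
  assumes f: "all_moments M f" and g: "all_moments M g"
  shows "all_moments M (\<lambda>\<omega>. f \<omega> * g \<omega>)"
  unfolding all_moments_def
proof (intro conjI allI)
  fix p :: nat
  show "integrable M (\<lambda>\<omega>. \<bar>f \<omega> * g \<omega>\<bar> ^ p)"
  proof (rule Bochner_Integration.integrable_bound)
    show "integrable M (\<lambda>\<omega>. \<bar>f \<omega>\<bar> ^ (2 * p) + \<bar>g \<omega>\<bar> ^ (2 * p))"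
      using f g unfolding all_moments_def by (intro Bochner_Integration.integrable_add) blast+
    have "\<bar>s * t\<bar> ^ p \<le> \<bar>s\<bar> ^ (2 * p) + \<bar>t\<bar> ^ (2 * p)" for s t :: real
      using sum_squares_bound[of "\<bar>s\<bar> ^ p" "\<bar>t\<bar> ^ p"]
      by (simp add: abs_mult power_mult_distrib power_even_eq mult.assoc)
        (smt (verit) mult_nonneg_nonneg zero_le_power abs_ge_zero)
    then show "AE \<omega> in M. norm (\<bar>f \<omega> * g \<omega>\<bar> ^ p) \<le> norm (\<bar>f \<omega>\<bar> ^ (2 * p) + \<bar>g \<omega>\<bar> ^ (2 * p))"
      by (intro AE_I2) (simp add: order_trans[OF _ abs_ge_self])
  qed (use f g in simp)
qed (use f g in simp)

lemma (in finite_measure) all_moments_const: "all_moments M (\<lambda>_. c)"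
  by (simp add: all_moments_def)

lemma (in finite_measure) all_moments_power: "all_moments M f \<Longrightarrow> all_moments M (\<lambda>\<omega>. f \<omega> ^ n)"
proof (induction n)
  case (Suc n)
  then show ?case using all_moments_mult[of M f "\<lambda>\<omega>. f \<omega> ^ n"] by simp
qed (simp add: all_moments_const)

text \<open>Taylor's formula of order two for the power \<open>Suc n\<close> at \<open>N\<close>, by
  induction on the exponent. It will be applied to squared norms after and before a displacement;
  then \<open>t\<close> is the squared length of the displacement and \<open>S\<close> the square of
  the sum of both lengths.\<close>

lemma power_linearization:
  fixes A N S t :: real
  assumes "0 \<le> A" "A \<le> S" "0 \<le> N" "N \<le> S" "(A - N)\<^sup>2 \<le> 4 * t * S" "0 \<le> t"
  shows "A ^ Suc n \<le> N ^ Suc n + (real n + 1) * N ^ n * (A - N) + 4 * (real n)\<^sup>2 * S ^ n * t"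
proof (cases n)
  case (Suc k)
  have S: "0 \<le> S" using assms by linarith
  have "A ^ Suc n - N ^ Suc n - (n + 1) * N ^ n * (A - N) \<le> n\<^sup>2 * S ^ (n - 1) * (A - N)\<^sup>2"
    if "n \<ge> 1" for n :: nat
    using that
  proof (induction n rule: dec_induct)
    case base
    show ?case by (simp add: power2_eq_square algebra_simps)
  next
    case (step n)
    have n: "n = Suc (n - 1)" using step by simp
    have "A ^ Suc (Suc n) - N ^ Suc (Suc n) - (Suc n + 1) * N ^ Suc n * (A - N) =
        A * (A ^ Suc n - N ^ Suc n - (n + 1) * N ^ n * (A - N)) + (n + 1) * N ^ n * (A - N)\<^sup>2"
      by (simp add: power2_eq_square algebra_simps)
    also have "\<dots> \<le> S * (n\<^sup>2 * S ^ (n - 1) * (A - N)\<^sup>2) + (n + 1) * S ^ n * (A - N)\<^sup>2"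
    proof (intro add_mono mult_right_mono mult_left_mono power_mono)
      show "A * (A ^ Suc n - N ^ Suc n - (n + 1) * N ^ n * (A - N)) \<le> S * (n\<^sup>2 * S ^ (n - 1) * (A - N)\<^sup>2)"
      proof (rule order_trans[OF mult_left_mono[OF step.IH] mult_right_mono])
        show "0 \<le> real (n\<^sup>2) * S ^ (n - 1) * (A - N)\<^sup>2" using S by simp
      qed (use assms in auto)
    qed (use assms in auto)
    also have "S * (n\<^sup>2 * S ^ (n - 1) * (A - N)\<^sup>2) = n\<^sup>2 * S ^ n * (A - N)\<^sup>2"
      by (subst (2) n) simp
    also have "n\<^sup>2 * S ^ n * (A - N)\<^sup>2 + (n + 1) * S ^ n * (A - N)\<^sup>2 = (real (n\<^sup>2) + (n + 1)) * (S ^ n * (A - N)\<^sup>2)"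
      by (simp add: algebra_simps)
    \<comment> \<open>The constant \<open>n^2\<close> is propagated because
      \<open>n^2 + (n + 1) \<le> (n + 1)^2\<close>.\<close>
    also have "\<dots> \<le> real ((Suc n)\<^sup>2) * (S ^ n * (A - N)\<^sup>2)"
      using S by (intro mult_right_mono) (auto simp: power2_eq_square)
    finally show ?case by (simp add: mult.assoc)
  qed
  from this[of n] have "A ^ Suc n - N ^ Suc n - (n + 1) * N ^ n * (A - N) \<le> n\<^sup>2 * S ^ (n - 1) * (A - N)\<^sup>2"
    using Suc by simp
  also have "\<dots> \<le> n\<^sup>2 * S ^ (n - 1) * (4 * t * S)" using assms S by (intro mult_left_mono) auto
  also have "\<dots> = 4 * (real n)\<^sup>2 * S ^ n * t" using Suc by simp
  finally have "A ^ Suc n - N ^ Suc n - (real n + 1) * N ^ n * (A - N) \<le> 4 * (real n)\<^sup>2 * S ^ n * t"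
    by (simp add: add.commute)
  then show ?thesis by linarith
qed simp

text \<open>The term linear in \<open>d\<close> is kept exactly instead of being estimated by norms:
  under conditional expectation the large mean-zero noise drops out of it and the drift remains. The
  noise then enters only through terms at least quadratic in \<open>d\<close>.\<close>

lemma norm_power_perturbation:
  fixes u d :: "'a::real_inner"
  defines "D n \<equiv> 4 * (real n)\<^sup>2 * 4 ^ n"
  shows "norm (u + d) ^ (2 * n + 2) \<le> norm u ^ (2 * n + 2) + 2 * (real n + 1) * (norm u ^ (2 * n) * (u \<bullet> d))
    + (real n + 1 + D n) * (norm u ^ (2 * n) * (norm d)\<^sup>2) + D n * norm d ^ (2 * n + 2)"
proof -
  define S where "S = (norm u + norm d)\<^sup>2"
  have eq: "(norm (u + d))\<^sup>2 - (norm u)\<^sup>2 = 2 * (u \<bullet> d) + (norm d)\<^sup>2"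
    by (simp add: power2_norm_eq_inner inner_add_left inner_add_right inner_commute)
  have "\<bar>2 * (u \<bullet> d) + (norm d)\<^sup>2\<bar> \<le> 2 * (norm u * norm d) + (norm d)\<^sup>2"
    using Cauchy_Schwarz_ineq2[of u d] zero_le_power2[of "norm d"] by linarith
  also have "\<dots> \<le> 2 * norm d * (norm u + norm d)" by (simp add: power2_eq_square algebra_simps)
  finally have "(2 * (u \<bullet> d) + (norm d)\<^sup>2)\<^sup>2 \<le> (2 * norm d * (norm u + norm d))\<^sup>2"
    by (metis abs_ge_zero power2_abs power_mono)
  also have "\<dots> = 4 * (norm d)\<^sup>2 * S" by (simp add: S_def power_mult_distrib)
  finally have t: "((norm (u + d))\<^sup>2 - (norm u)\<^sup>2)\<^sup>2 \<le> 4 * (norm d)\<^sup>2 * S" unfolding eq .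
  have "((norm (u + d))\<^sup>2) ^ Suc n \<le> ((norm u)\<^sup>2) ^ Suc n
      + (real n + 1) * ((norm u)\<^sup>2) ^ n * ((norm (u + d))\<^sup>2 - (norm u)\<^sup>2) + 4 * (real n)\<^sup>2 * S ^ n * (norm d)\<^sup>2"
    by (rule power_linearization[OF _ _ _ _ t]) (auto simp: S_def intro!: power_mono norm_triangle_ineq)
  also have "4 * (real n)\<^sup>2 * S ^ n * (norm d)\<^sup>2 \<le> 4 * (real n)\<^sup>2 * (4 ^ n * (norm u ^ (2 * n) + norm d ^ (2 * n))) * (norm d)\<^sup>2"
  proof (intro mult_right_mono mult_left_mono)
    have "S ^ n = (norm u + norm d) ^ (2 * n)" by (simp add: S_def power_mult)
    also have "\<dots> \<le> 2 ^ (2 * n) * (norm u ^ (2 * n) + norm d ^ (2 * n))" by (rule power_sum_le) auto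
    finally show "S ^ n \<le> 4 ^ n * (norm u ^ (2 * n) + norm d ^ (2 * n))" by (simp add: power_mult)
  qed auto
  finally show ?thesis
    unfolding eq D_def power_mult[symmetric] mult_Suc_right
    by (simp add: algebra_simps power_add power2_eq_square)
qed

text \<open>Young's inequality with an arbitrarily small share \<open>\<tau>\<close> of
  \<open>s ^ N\<close>, by comparing \<open>X\<close> with \<open>\<tau> * s\<close>. The small
  share keeps the feedback below the contraction of the momentum.\<close>

lemma young_power:
  fixes s X \<tau> :: real
  assumes "0 \<le> s" "0 \<le> X" "0 < \<tau>" "\<tau> \<le> 1" "j < N"
  shows "s ^ j * X ^ (N - j) \<le> \<tau> * s ^ N + (1 / \<tau>) ^ N * X ^ N"
proof (cases "X \<le> \<tau> * s")
  case True
  have "s ^ j * X ^ (N - j) \<le> s ^ j * (\<tau> * s) ^ (N - j)"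
    using assms True by (intro mult_left_mono power_mono) auto
  also have "\<dots> = \<tau> ^ (N - j) * s ^ N"
    using assms by (simp add: power_mult_distrib mult.left_commute flip: power_add)
  also have "\<dots> \<le> \<tau> ^ 1 * s ^ N" using assms by (intro mult_right_mono power_decreasing) auto
  finally show ?thesis using assms by (smt (verit) mult_nonneg_nonneg power_one_right zero_le_power divide_nonneg_nonneg)
next
  case False
  then have "s \<le> X / \<tau>" using assms by (simp add: field_simps)
  then have "s ^ j * X ^ (N - j) \<le> (X / \<tau>) ^ j * X ^ (N - j)"
    using assms by (intro mult_right_mono power_mono) auto
  also have "\<dots> = (1 / \<tau>) ^ j * X ^ N"
    using assms by (simp add: power_divide flip: power_add)
  also have "\<dots> \<le> (1 / \<tau>) ^ N * X ^ N"
    using assms by (intro mult_right_mono power_increasing) auto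
  finally show ?thesis using assms by (smt (verit) mult_nonneg_nonneg zero_le_power)
qed

definition vector_moments :: "'w measure \<Rightarrow> ('w \<Rightarrow> 'a::euclidean_space) \<Rightarrow> bool" where
  "vector_moments M X \<longleftrightarrow> X \<in> borel_measurable M \<and> all_moments M (\<lambda>\<omega>. norm (X \<omega>))"

lemma vector_moments_measurable: "vector_moments M X \<Longrightarrow> X \<in> borel_measurable M"
  by (simp add: vector_moments_def)

lemma vector_moments_norm: "vector_moments M X \<Longrightarrow> all_moments M (\<lambda>\<omega>. norm (X \<omega>))"
  by (simp add: vector_moments_def)

lemma vector_moments_inner: "vector_moments M X \<Longrightarrow> all_moments M (\<lambda>\<omega>. X \<omega> \<bullet> i)"
  unfolding vector_moments_def
  by (rule all_moments_bound[where f="\<lambda>\<omega>. norm (X \<omega>) * norm i"])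
    (auto simp: Cauchy_Schwarz_ineq2 all_moments_def power_mult_distrib)

lemma vector_moments_add:
  assumes "vector_moments M X" "vector_moments M Y"
  shows "vector_moments M (\<lambda>\<omega>. X \<omega> + Y \<omega>)"
  unfolding vector_moments_def
proof
  show "(\<lambda>\<omega>. X \<omega> + Y \<omega>) \<in> borel_measurable M" using assms[THEN vector_moments_measurable] by simp
  then show "all_moments M (\<lambda>\<omega>. norm (X \<omega> + Y \<omega>))"
    by (intro all_moments_bound[OF all_moments_add[OF assms[THEN vector_moments_norm]]])
       (auto simp: norm_triangle_ineq)
qed

lemma vector_moments_scaleR:
  assumes "vector_moments M X"
  shows "vector_moments M (\<lambda>\<omega>. r *\<^sub>R X \<omega>)"
proof -
  have "integrable M (\<lambda>\<omega>. \<bar>r\<bar> ^ p * \<bar>norm (X \<omega>)\<bar> ^ p)" for p :: nat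
    using assms unfolding vector_moments_def all_moments_def by (intro integrable_mult_right) blast
  then show ?thesis
    using vector_moments_measurable[OF assms] unfolding vector_moments_def all_moments_def
    by (simp add: power_mult_distrib)
qed

section \<open>A single oracle call and its conditional moments\<close>

definition oracle_call ::
  "'w measure \<Rightarrow> 'w measure \<Rightarrow> ('a::euclidean_space \<Rightarrow> 'a measure) \<Rightarrow> ('w \<Rightarrow> 'a) \<Rightarrow> ('w \<Rightarrow> 'a) \<Rightarrow> bool" where
  "oracle_call M F G X Y \<longleftrightarrow> subalgebra M F \<and> X \<in> borel_measurable F \<and> Y \<in> borel_measurable M \<and>
     has_conditional_law M F Y (\<lambda>\<omega>. G (X \<omega>))"

context diffusion
begin

text \<open>What the error estimates take from the oracle: moments of the size of noise of scale
  \<open>1 / e\<close>, the mean \<open>b\<close>, and a second moment with covariance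
  \<open>c\<close> times the sum over the columns. The constants \<open>Mo\<close> do not depend on
  \<open>e\<close>, and this makes the final bound uniform in the learning rate.\<close>

definition oracle_kernel :: "(nat \<Rightarrow> real) \<Rightarrow> real \<Rightarrow> real \<Rightarrow> ('a \<Rightarrow> 'a measure) \<Rightarrow> bool" where
  "oracle_kernel Mo e c G \<longleftrightarrow> 0 < e \<and> G \<in> borel \<rightarrow>\<^sub>M prob_algebra borel \<and>
     (\<forall>x p. integrable (G x) (\<lambda>g. norm g ^ p) \<and> (\<integral>g. norm g ^ p \<partial>G x) \<le> Mo p * ((1 + norm x) / e) ^ p) \<and>
     (\<forall>x. \<forall>i\<in>Basis. (\<integral>g. g \<bullet> i \<partial>G x) = b x \<bullet> i) \<and>
     (\<forall>x. \<forall>i\<in>Basis. \<forall>j\<in>Basis. (\<integral>g. (g \<bullet> i) * (g \<bullet> j) \<partial>G x) =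
        (b x \<bullet> i) * (b x \<bullet> j) + c * (\<Sum>l\<in>Basis. (s l x \<bullet> i) * (s l x \<bullet> j)))"

context
  fixes M :: "'w measure" and F Mo e c G X Y
  assumes M: "prob_space M" and G: "oracle_kernel Mo e c G" and call: "oracle_call M F G X Y"
    and X: "vector_moments M X"
begin

interpretation prob_space M by (rule M)

lemma call_subalgebra: "subalgebra M F" and call_measurable: "Y \<in> borel_measurable M" "X \<in> borel_measurable F"
  and call_law: "has_conditional_law M F Y (\<lambda>\<omega>. G (X \<omega>))"
  using call by (auto simp: oracle_call_def)

lemma call_kernel: "(\<lambda>\<omega>. G (X \<omega>)) \<in> F \<rightarrow>\<^sub>M subprob_algebra borel"
  by (rule measurable_compose[OF call_measurable(2) measurable_prob_algebraD])
    (use G in \<open>simp add: oracle_kernel_def\<close>)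

lemma call_sets: "sets (G x) = sets borel"
proof -
  have "G x \<in> space (prob_algebra borel)" using G measurable_space[of G borel "prob_algebra borel" x]
    by (simp add: oracle_kernel_def)
  then show ?thesis by (auto simp: space_prob_algebra)
qed

lemma X_plus_1_moments: "all_moments M (\<lambda>\<omega>. 1 + norm (X \<omega>))"
  by (rule all_moments_add[OF all_moments_const vector_moments_norm[OF X]])

text \<open>The kernel bounds the moments of an answer polynomially in the query, so the property of
  having all moments passes from queries to answers and hence along the iterates.\<close>

lemma call_moments: "vector_moments M Y"
  unfolding vector_moments_def all_moments_def
proof (intro conjI allI)
  fix p :: nat
  have e: "0 < e" using G by (simp add: oracle_kernel_def)
  have b: "integrable (G x) (\<lambda>g. norm g ^ p)" "(\<integral>g. norm g ^ p \<partial>G x) \<le> Mo p * ((1 + norm x) / e) ^ p" for x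
    using G by (auto simp: oracle_kernel_def)
  have "(\<integral>\<^sup>+\<omega>. 1 * ennreal (norm (Y \<omega>) ^ p) \<partial>M) = (\<integral>\<^sup>+\<omega>. 1 * (\<integral>\<^sup>+v. ennreal (norm v ^ p) \<partial>G (X \<omega>)) \<partial>M)"
    by (rule has_conditional_law_nn_integral[OF call_subalgebra call_measurable(1) call_kernel call_law]) auto
  also have "\<dots> \<le> (\<integral>\<^sup>+\<omega>. ennreal (Mo p * ((1 + norm (X \<omega>)) / e) ^ p) \<partial>M)"
    by (intro nn_integral_mono) (simp add: nn_integral_eq_integral[OF b(1)] b(2) ennreal_leI)
  also have "\<dots> < \<infinity>"
  proof -
    define h where "h \<omega> = Mo p * ((1 + norm (X \<omega>)) / e) ^ p" for \<omega>
    have "integrable M (\<lambda>\<omega>. \<bar>1 + norm (X \<omega>)\<bar> ^ p)" using X_plus_1_moments unfolding all_moments_def by blast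
    then have h: "integrable M h" unfolding h_def by (simp add: power_divide)
    have "(\<integral>\<^sup>+\<omega>. ennreal (h \<omega>) \<partial>M) \<le> (\<integral>\<^sup>+\<omega>. ennreal (norm (h \<omega>)) \<partial>M)"
      by (intro nn_integral_mono ennreal_leI) auto
    also have "\<dots> < \<infinity>" using h by (simp add: integrable_iff_bounded)
    finally show ?thesis unfolding h_def .
  qed
  finally show "integrable M (\<lambda>\<omega>. \<bar>norm (Y \<omega>)\<bar> ^ p)"
    using call_measurable by (intro integrableI_bounded) auto
qed (use call_measurable in auto)

lemma call_integral:
  assumes A: "A \<in> borel_measurable F" "all_moments M A" and p: "p \<in> borel_measurable borel"
    and pY: "all_moments M (\<lambda>\<omega>. p (Y \<omega>))" and int: "\<And>x. integrable (G x) p"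
  shows "(\<integral>\<omega>. A \<omega> * p (Y \<omega>) \<partial>M) = (\<integral>\<omega>. A \<omega> * (\<integral>v. p v \<partial>G (X \<omega>)) \<partial>M)"
  by (rule has_conditional_law_integral[OF call_subalgebra call_measurable(1) call_kernel call_law A(1) p
        all_moments_integrable[OF all_moments_mult[OF A(2) pY]] int])

lemma call_norm_power:
  assumes A: "A \<in> borel_measurable F" "all_moments M A" "\<And>\<omega>. 0 \<le> A \<omega>"
  shows "(\<integral>\<omega>. A \<omega> * norm (Y \<omega>) ^ p \<partial>M) \<le> Mo p / e ^ p * (\<integral>\<omega>. A \<omega> * (1 + norm (X \<omega>)) ^ p \<partial>M)"
proof -
  have b: "integrable (G x) (\<lambda>g. norm g ^ p)" "(\<integral>g. norm g ^ p \<partial>G x) \<le> Mo p * ((1 + norm x) / e) ^ p" for x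
    using G by (auto simp: oracle_kernel_def)
  have i: "integrable M (\<lambda>\<omega>. A \<omega> * norm (Y \<omega>) ^ p)"
    by (intro all_moments_integrable all_moments_mult A all_moments_power vector_moments_norm call_moments)
  have i2: "integrable M (\<lambda>\<omega>. A \<omega> * (1 + norm (X \<omega>)) ^ p)"
    by (intro all_moments_integrable all_moments_mult A all_moments_power X_plus_1_moments)
  have *: "integrable M (\<lambda>\<omega>. A \<omega> * (\<integral>v. norm v ^ p \<partial>G (X \<omega>))) \<and>
     (\<integral>\<omega>. A \<omega> * norm (Y \<omega>) ^ p \<partial>M) = (\<integral>\<omega>. A \<omega> * (\<integral>v. norm v ^ p \<partial>G (X \<omega>)) \<partial>M)"
    by (rule has_conditional_law_integral_nonneg[OF call_subalgebra call_measurable(1) call_kernel call_law A(1) _ i b(1)])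
      (use A in auto)
  have "(\<integral>\<omega>. A \<omega> * (\<integral>v. norm v ^ p \<partial>G (X \<omega>)) \<partial>M) \<le> (\<integral>\<omega>. Mo p / e ^ p * (A \<omega> * (1 + norm (X \<omega>)) ^ p) \<partial>M)"
  proof (rule integral_mono)
    show "A \<omega> * (\<integral>v. norm v ^ p \<partial>G (X \<omega>)) \<le> Mo p / e ^ p * (A \<omega> * (1 + norm (X \<omega>)) ^ p)" for \<omega>
      using mult_left_mono[OF b(2)[of "X \<omega>"] A(3)[of \<omega>]] by (simp add: power_divide mult_ac)
  qed (use * i2 in auto)
  with * show ?thesis by simp
qed

lemma call_inner:
  assumes A: "A \<in> borel_measurable F" "all_moments M A" and i: "i \<in> Basis"
  shows "(\<integral>\<omega>. A \<omega> * (Y \<omega> \<bullet> i) \<partial>M) = (\<integral>\<omega>. A \<omega> * (b (X \<omega>) \<bullet> i) \<partial>M)"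
proof -
  have "integrable (G x) (\<lambda>g. g \<bullet> i)" for x
  proof (rule Bochner_Integration.integrable_bound)
    show "integrable (G x) (\<lambda>g. norm g ^ 1)" using G unfolding oracle_kernel_def by blast
    show "(\<lambda>g. g \<bullet> i) \<in> borel_measurable (G x)" by (simp add: measurable_cong_sets[OF call_sets refl])
  qed (use i Basis_le_norm in auto)
  from call_integral[OF A, of "\<lambda>g. g \<bullet> i", OF _ vector_moments_inner[OF call_moments] this]
  show ?thesis using G i by (simp add: oracle_kernel_def)
qed

lemma call_inner_inner:
  assumes A: "A \<in> borel_measurable F" "all_moments M A" and i: "i \<in> Basis" "j \<in> Basis"
  shows "(\<integral>\<omega>. A \<omega> * ((Y \<omega> \<bullet> i) * (Y \<omega> \<bullet> j)) \<partial>M) =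
    (\<integral>\<omega>. A \<omega> * ((b (X \<omega>) \<bullet> i) * (b (X \<omega>) \<bullet> j) + c * (\<Sum>l\<in>Basis. (s l (X \<omega>) \<bullet> i) * (s l (X \<omega>) \<bullet> j))) \<partial>M)"
proof -
  have "integrable (G x) (\<lambda>g. (g \<bullet> i) * (g \<bullet> j))" for x
  proof (rule Bochner_Integration.integrable_bound)
    show "integrable (G x) (\<lambda>g. norm g ^ 2)" using G unfolding oracle_kernel_def by blast
    show "(\<lambda>g. (g \<bullet> i) * (g \<bullet> j)) \<in> borel_measurable (G x)" by (simp add: measurable_cong_sets[OF call_sets refl])
    have "norm ((g \<bullet> i) * (g \<bullet> j)) \<le> norm (norm g ^ 2)" for g
      using i Basis_le_norm[of i g] Basis_le_norm[of j g] by (simp add: abs_mult power2_eq_square mult_mono)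
    then show "AE g in G x. norm ((g \<bullet> i) * (g \<bullet> j)) \<le> norm (norm g ^ 2)" by simp
  qed
  from call_integral[OF A, of "\<lambda>g. (g \<bullet> i) * (g \<bullet> j)",
      OF _ all_moments_mult[OF vector_moments_inner[OF call_moments] vector_moments_inner[OF call_moments]] this]
  show ?thesis using G i by (simp add: oracle_kernel_def)
qed

end

end

section \<open>Moment bounds for momentum runs\<close>

text \<open>\<open>A\<close> and \<open>B\<close> are moments of \<open>y\<close> and of the rescaled momentum. The contraction rate of \<open>B\<close> is only of
  order \<open>\<kappa>\<^sup>2\<close>, but the feedback of \<open>B\<close> into itself is of order \<open>e\<^sup>2\<close>, so \<open>B\<close> stays proportional to \<open>A\<close> without
  any smallness assumption on \<open>e\<close>.\<close>

lemma moment_recursion: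
  fixes A B :: "nat \<Rightarrow> real"
  assumes l: "0 < l" and D: "0 \<le> D" and \<kappa>: "l / 2 * \<kappa>\<^sup>2 \<le> 1"
    and A: "\<And>k. A (Suc k) \<le> (1 + e\<^sup>2) * A k + D * e\<^sup>2 * (1 + A k + B k)"
    and B: "\<And>k. B (Suc k) \<le> (1 - l / 2 * \<kappa>\<^sup>2) * B k + D * \<kappa>\<^sup>2 * (1 + A k) + D * e\<^sup>2 * B k"
    and init: "0 \<le> A0" "A 0 \<le> A0" "B 0 \<le> A0" and nn: "\<And>k. 0 \<le> A k" "\<And>k. 0 \<le> B k"
  defines "W \<equiv> 1 + 2 * D / l" defines "H \<equiv> 1 + D * (1 + W)"
  shows "1 + A k \<le> (1 + A0) * (1 + H * e\<^sup>2) ^ k \<and> B k \<le> W * ((1 + A0) * (1 + H * e\<^sup>2) ^ k)"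
proof -
  \<comment> \<open>\<open>W\<close> is large enough that the contraction of \<open>B\<close>
    outweighs the inflow from \<open>A\<close>; both have order \<open>\<kappa>\<^sup>2\<close>, so
    their ratio does not depend on \<open>\<kappa>\<close>. The remaining terms have order
    \<open>e^2\<close> and go into \<open>H\<close>.\<close>
  have W: "1 \<le> W" "D \<le> l / 2 * W" using l D by (auto simp: W_def field_simps)
  have H: "D \<le> H" "0 \<le> H" using W D by (auto simp: H_def algebra_simps)
  show ?thesis
  proof (induction k)
    case 0
    have *: "1 * (1 + A0) \<le> W * (1 + A0)" using W init by (intro mult_right_mono) auto
    have "B 0 \<le> 1 * (1 + A0)" using init by simp
    from order_trans[OF this *] show ?case using init by simp
  next
    case (Suc k)
    define Z where "Z = (1 + A0) * (1 + H * e\<^sup>2) ^ k"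
    have Z: "1 + A k \<le> Z" "B k \<le> W * Z" using Suc by (auto simp: Z_def)
    have Z0: "0 \<le> Z" using Z nn(1)[of k] by linarith
    have "1 + A (Suc k) \<le> 1 + ((1 + e\<^sup>2) * A k + D * e\<^sup>2 * (1 + A k + B k))" using A[of k] by simp
    also have "\<dots> \<le> (1 + e\<^sup>2) * (1 + A k) + D * e\<^sup>2 * (1 + A k + B k)" by (simp add: algebra_simps)
    also have "\<dots> \<le> (1 + e\<^sup>2) * Z + D * e\<^sup>2 * (Z + W * Z)"
      using Z D by (intro add_mono mult_left_mono) auto
    also have "\<dots> = Z * (1 + H * e\<^sup>2)" by (simp add: H_def algebra_simps)
    finally have 1: "1 + A (Suc k) \<le> Z * (1 + H * e\<^sup>2)" .
    have "B (Suc k) \<le> (1 - l / 2 * \<kappa>\<^sup>2) * (W * Z) + D * \<kappa>\<^sup>2 * Z + D * e\<^sup>2 * (W * Z)"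
      using B[of k] mult_left_mono[OF Z(2), of "1 - l / 2 * \<kappa>\<^sup>2"] mult_left_mono[OF Z(1), of "D * \<kappa>\<^sup>2"]
        mult_left_mono[OF Z(2), of "D * e\<^sup>2"] \<kappa> D by simp
    also have "\<dots> = (1 + D * e\<^sup>2) * (W * Z) + (D - l / 2 * W) * (\<kappa>\<^sup>2 * Z)" by (simp add: algebra_simps)
    also have "\<dots> \<le> (1 + D * e\<^sup>2) * (W * Z) + 0"
      using W Z0 by (intro add_mono order_refl mult_nonpos_nonneg) auto
    also have "\<dots> \<le> (1 + H * e\<^sup>2) * (W * Z)"
      using H W Z0 by (auto intro!: mult_right_mono)
    finally have "B (Suc k) \<le> W * (Z * (1 + H * e\<^sup>2))" by (simp add: mult_ac)
    with 1 show ?case by (simp add: Z_def mult_ac)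
  qed
qed

context diffusion
begin

text \<open>Used for the momentum-free variable with \<open>lam = e\<close> and for the rescaled
  momentum with \<open>lam = \<kappa>\<close>. The drift contributes \<open>\<bar>r\<bar>\<close>,
  at most of order \<open>lam\<^sup>2\<close> as \<open>e \<le> lam\<close>; the noise contributes
  \<open>r\<^sup>2 / e\<^sup>2\<close>, again of order \<open>lam\<^sup>2\<close>. The rate
  \<open>\<theta>\<close> is at choice, so that for the momentum it can be set below the contraction
  rate.\<close>

lemma moment_step:
  fixes R \<theta> :: real
  assumes R: "0 \<le> R" and \<theta>: "0 < \<theta>" and Mo: "\<And>p. 0 \<le> Mo p"
  shows "\<exists>C\<ge>0. \<forall>(M :: 'w measure) F G X Y u e lam c r. prob_space M \<longrightarrow> oracle_kernel Mo e c G \<longrightarrow>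
    oracle_call M F G X Y \<longrightarrow> u \<in> borel_measurable F \<longrightarrow> vector_moments M u \<longrightarrow> vector_moments M X \<longrightarrow>
    e \<le> lam \<longrightarrow> lam \<le> 1 \<longrightarrow> \<bar>r\<bar> \<le> R * lam * e \<longrightarrow>
    (\<integral>\<omega>. norm (u \<omega> + r *\<^sub>R Y \<omega>) ^ (2 * n + 2) \<partial>M) \<le>
      (1 + \<theta> * lam\<^sup>2) * (\<integral>\<omega>. norm (u \<omega>) ^ (2 * n + 2) \<partial>M) + C * lam\<^sup>2 * (\<integral>\<omega>. (1 + norm (X \<omega>)) ^ (2 * n + 2) \<partial>M)"
proof -
  define N where "N = 2 * n + 2"
  define D where "D = 4 * (real n)\<^sup>2 * 4 ^ n"
  define c1 where "c1 = 2 * (real n + 1) * R * K + (real n + 1 + D) * (R\<^sup>2 * Mo 2)"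
  \<comment> \<open>Chosen so that \<open>c1 * \<tau> \<le> \<theta>\<close>, where
    \<open>c1\<close> collects the coefficients of the mixed moments; the added 1 keeps the
    denominator positive.\<close>
  define \<tau> where "\<tau> = \<theta> / (c1 + 1 + \<theta>)"
  have D0: "0 \<le> D" by (simp add: D_def)
  have K0: "0 \<le> K" using K by simp
  have c1: "0 \<le> c1" using R K Mo[of 2] D0 by (simp add: c1_def)
  have \<tau>: "0 < \<tau>" "\<tau> \<le> 1" "c1 * \<tau> \<le> \<theta>" using \<theta> c1 by (auto simp: \<tau>_def field_simps add_pos_pos add_nonneg_pos)
  define C where "C = c1 * (1 / \<tau>) ^ N + D * R ^ N * Mo N"
  have C: "0 \<le> C" using c1 \<tau> D0 R Mo[of N] by (simp add: C_def)
  show ?thesis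
  proof (intro exI[of _ C] conjI C allI impI)
    fix M :: "'w measure" and F G and X Y u :: "'w \<Rightarrow> 'a" and e lam c r :: real
    assume M: "prob_space M" and G: "oracle_kernel Mo e c G" and call: "oracle_call M F G X Y"
      and uF: "u \<in> borel_measurable F" and u: "vector_moments M u" and X: "vector_moments M X"
      and e: "e \<le> lam" and lam: "lam \<le> 1" and r: "\<bar>r\<bar> \<le> R * lam * e"
    interpret prob_space M by (rule M)
    have e0: "0 < e" using G by (simp add: oracle_kernel_def)
    have lam0: "0 < lam" using e0 e by linarith
    have Y: "vector_moments M Y" by (rule call_moments[OF M G call X])
    have XF: "X \<in> borel_measurable F" using call by (simp add: oracle_call_def)
    note nu = vector_moments_norm[OF u] and nX = X_plus_1_moments[OF M G call X] and nY = vector_moments_norm[OF Y]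
    note mom = all_moments_mult all_moments_power all_moments_add all_moments_const nu nX nY
      vector_moments_inner[OF u] vector_moments_inner[OF Y]
    have int: "all_moments M f \<Longrightarrow> integrable M f" for f by (rule all_moments_integrable)
    define I where "I j = (\<integral>\<omega>. norm (u \<omega>) ^ j * (1 + norm (X \<omega>)) ^ (N - j) \<partial>M)" for j
    define U where "U = (\<integral>\<omega>. norm (u \<omega>) ^ N \<partial>M)"
    define V where "V = (\<integral>\<omega>. (1 + norm (X \<omega>)) ^ N \<partial>M)"
    have V0: "0 \<le> V" by (simp add: V_def integral_nonneg)
    have intN: "integrable M (\<lambda>\<omega>. norm (u \<omega>) ^ j * (1 + norm (X \<omega>)) ^ i)" for i j
      by (intro int mom)
    have U_int: "integrable M (\<lambda>\<omega>. norm (u \<omega>) ^ N)" and V_int: "integrable M (\<lambda>\<omega>. (1 + norm (X \<omega>)) ^ N)"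
      using intN[of N 0] intN[of 0 N] by simp_all
    have young: "I j \<le> \<tau> * U + (1 / \<tau>) ^ N * V" if "j < N" for j
    proof -
      have "I j \<le> (\<integral>\<omega>. \<tau> * norm (u \<omega>) ^ N + (1 / \<tau>) ^ N * (1 + norm (X \<omega>)) ^ N \<partial>M)"
        unfolding I_def using \<tau> that U_int V_int by (intro integral_mono intN young_power) auto
      then show ?thesis using U_int V_int by (simp add: U_def V_def)
    qed
    \<comment> \<open>Since \<open>u\<close> is known before the call, the answer may be replaced by
      its conditional mean. This is done coordinatewise, because \<open>call_inner\<close> is a
      statement about scalar factors.\<close>
    have cross: "(\<integral>\<omega>. norm (u \<omega>) ^ (2 * n) * (u \<omega> \<bullet> Y \<omega>) \<partial>M) = (\<integral>\<omega>. norm (u \<omega>) ^ (2 * n) * (u \<omega> \<bullet> b (X \<omega>)) \<partial>M)"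
      and cross_int: "integrable M (\<lambda>\<omega>. norm (u \<omega>) ^ (2 * n) * (u \<omega> \<bullet> Y \<omega>))"
      and cross_int': "integrable M (\<lambda>\<omega>. norm (u \<omega>) ^ (2 * n) * (u \<omega> \<bullet> b (X \<omega>)))"
    proof -
      have bX: "vector_moments M (\<lambda>\<omega>. b (X \<omega>))"
      proof -
        have "continuous_on UNIV b"
          using drift unfolding coefficient_def by (intro has_derivative_continuous_on[where f'=b1])
            (auto intro: has_derivative_at_withinI jet3D(1))
        then have "b \<in> borel_measurable borel" by (rule borel_measurable_continuous_onI)
        then have m: "(\<lambda>\<omega>. b (X \<omega>)) \<in> borel_measurable M"
          using vector_moments_measurable[OF X] by measurable
        moreover have "all_moments M (\<lambda>\<omega>. norm (b (X \<omega>)))"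
          by (rule all_moments_bound[OF all_moments_mult[OF all_moments_const[of K] nX]])
            (use m drift_le K0 in \<open>auto simp: abs_mult\<close>)
        ultimately show ?thesis by (simp add: vector_moments_def)
      qed
      have summand: "(\<integral>\<omega>. (norm (u \<omega>) ^ (2 * n) * (u \<omega> \<bullet> i)) * (Y \<omega> \<bullet> i) \<partial>M) =
          (\<integral>\<omega>. (norm (u \<omega>) ^ (2 * n) * (u \<omega> \<bullet> i)) * (b (X \<omega>) \<bullet> i) \<partial>M)" if "i \<in> Basis" for i
        by (rule call_inner[OF M G call X _ _ that]) (use uF in \<open>auto intro!: mom\<close>)
      have i1: "integrable M (\<lambda>\<omega>. (norm (u \<omega>) ^ (2 * n) * (u \<omega> \<bullet> i)) * (Y \<omega> \<bullet> i))" for i by (intro int mom)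
      have i2: "integrable M (\<lambda>\<omega>. (norm (u \<omega>) ^ (2 * n) * (u \<omega> \<bullet> i)) * (b (X \<omega>) \<bullet> i))" for i
        by (intro int mom vector_moments_inner[OF bX])
      have exp: "norm (u \<omega>) ^ (2 * n) * (u \<omega> \<bullet> w) = (\<Sum>i\<in>Basis. (norm (u \<omega>) ^ (2 * n) * (u \<omega> \<bullet> i)) * (w \<bullet> i))" for \<omega> w
        by (subst euclidean_inner) (simp add: sum_distrib_left mult.assoc)
      show "integrable M (\<lambda>\<omega>. norm (u \<omega>) ^ (2 * n) * (u \<omega> \<bullet> Y \<omega>))"
        "integrable M (\<lambda>\<omega>. norm (u \<omega>) ^ (2 * n) * (u \<omega> \<bullet> b (X \<omega>)))"
        unfolding exp[of _ "Y _"] exp[of _ "b _"] using i1 i2 by auto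
      show "(\<integral>\<omega>. norm (u \<omega>) ^ (2 * n) * (u \<omega> \<bullet> Y \<omega>) \<partial>M) = (\<integral>\<omega>. norm (u \<omega>) ^ (2 * n) * (u \<omega> \<bullet> b (X \<omega>)) \<partial>M)"
        unfolding exp[of _ "Y _"] exp[of _ "b _"] using i1 i2 summand by (simp add: Bochner_Integration.integral_sum)
    qed
    have int2: "integrable M (\<lambda>\<omega>. norm (u \<omega>) ^ (2 * n) * norm (Y \<omega>) ^ 2)"
      and int3: "integrable M (\<lambda>\<omega>. norm (Y \<omega>) ^ N)" by (intro int mom)+
    have "(\<integral>\<omega>. norm (u \<omega> + r *\<^sub>R Y \<omega>) ^ N \<partial>M) \<le> (\<integral>\<omega>. norm (u \<omega>) ^ N
        + (2 * (real n + 1) * r) * (norm (u \<omega>) ^ (2 * n) * (u \<omega> \<bullet> Y \<omega>))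
        + ((real n + 1 + D) * r\<^sup>2) * (norm (u \<omega>) ^ (2 * n) * norm (Y \<omega>) ^ 2) + (D * r ^ N) * norm (Y \<omega>) ^ N \<partial>M)"
    proof (rule integral_mono)
      show "integrable M (\<lambda>\<omega>. norm (u \<omega> + r *\<^sub>R Y \<omega>) ^ N)"
        by (intro int mom vector_moments_norm vector_moments_add vector_moments_scaleR u Y)
      show "integrable M (\<lambda>\<omega>. norm (u \<omega>) ^ N
        + (2 * (real n + 1) * r) * (norm (u \<omega>) ^ (2 * n) * (u \<omega> \<bullet> Y \<omega>))
        + ((real n + 1 + D) * r\<^sup>2) * (norm (u \<omega>) ^ (2 * n) * norm (Y \<omega>) ^ 2) + (D * r ^ N) * norm (Y \<omega>) ^ N)"
        using U_int cross_int int2 int3 by (intro Bochner_Integration.integrable_add integrable_mult_right)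
      have "\<bar>r\<bar> ^ N = r ^ N" by (simp add: N_def power_even_abs)
      then have dN: "norm (r *\<^sub>R v) ^ N = r ^ N * norm v ^ N" "norm (r *\<^sub>R v) ^ 2 = r\<^sup>2 * norm v ^ 2" for v :: 'a
        by (simp_all add: power_mult_distrib)
      have "norm (u \<omega> + r *\<^sub>R Y \<omega>) ^ N \<le> norm (u \<omega>) ^ N
        + 2 * (real n + 1) * (norm (u \<omega>) ^ (2 * n) * (u \<omega> \<bullet> r *\<^sub>R Y \<omega>))
        + (real n + 1 + D) * (norm (u \<omega>) ^ (2 * n) * norm (r *\<^sub>R Y \<omega>) ^ 2) + D * norm (r *\<^sub>R Y \<omega>) ^ N" for \<omega>
        using norm_power_perturbation[of "u \<omega>" "r *\<^sub>R Y \<omega>" n] by (simp only: N_def D_def)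
      then show "norm (u \<omega> + r *\<^sub>R Y \<omega>) ^ N \<le> norm (u \<omega>) ^ N
        + (2 * (real n + 1) * r) * (norm (u \<omega>) ^ (2 * n) * (u \<omega> \<bullet> Y \<omega>))
        + ((real n + 1 + D) * r\<^sup>2) * (norm (u \<omega>) ^ (2 * n) * norm (Y \<omega>) ^ 2) + (D * r ^ N) * norm (Y \<omega>) ^ N" for \<omega>
        unfolding dN inner_scaleR_right by (simp only: mult_ac)
    qed
    also have "\<dots> = U + (2 * (real n + 1) * r) * (\<integral>\<omega>. norm (u \<omega>) ^ (2 * n) * (u \<omega> \<bullet> b (X \<omega>)) \<partial>M)
        + ((real n + 1 + D) * r\<^sup>2) * (\<integral>\<omega>. norm (u \<omega>) ^ (2 * n) * norm (Y \<omega>) ^ 2 \<partial>M)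
        + (D * r ^ N) * (\<integral>\<omega>. norm (Y \<omega>) ^ N \<partial>M)"
      using U_int cross_int int2 int3 by (simp add: U_def cross)
    also have "\<dots> \<le> U + (2 * (real n + 1) * (R * lam\<^sup>2)) * (K * I (2 * n + 1))
        + ((real n + 1 + D) * (R\<^sup>2 * lam\<^sup>2)) * (Mo 2 * I (2 * n)) + D * (R ^ N * lam\<^sup>2) * (Mo N * V)"
    proof (intro add_mono order_refl)
      have "\<bar>\<integral>\<omega>. norm (u \<omega>) ^ (2 * n) * (u \<omega> \<bullet> b (X \<omega>)) \<partial>M\<bar> \<le> (\<integral>\<omega>. \<bar>norm (u \<omega>) ^ (2 * n) * (u \<omega> \<bullet> b (X \<omega>))\<bar> \<partial>M)"
        by (rule integral_abs_bound)
      also have "\<dots> \<le> (\<integral>\<omega>. K * (norm (u \<omega>) ^ (2 * n + 1) * (1 + norm (X \<omega>)) ^ 1) \<partial>M)"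
      proof (rule integral_mono)
        fix \<omega>
        have "\<bar>u \<omega> \<bullet> b (X \<omega>)\<bar> \<le> norm (u \<omega>) * (K * (1 + norm (X \<omega>)))"
          using Cauchy_Schwarz_ineq2[of "u \<omega>" "b (X \<omega>)"] mult_left_mono[OF drift_le[of "X \<omega>"], of "norm (u \<omega>)"] by simp
        then have "norm (u \<omega>) ^ (2 * n) * \<bar>u \<omega> \<bullet> b (X \<omega>)\<bar> \<le> norm (u \<omega>) ^ (2 * n) * (norm (u \<omega>) * (K * (1 + norm (X \<omega>))))"
          by (intro mult_left_mono) auto
        then show "\<bar>norm (u \<omega>) ^ (2 * n) * (u \<omega> \<bullet> b (X \<omega>))\<bar> \<le> K * (norm (u \<omega>) ^ (2 * n + 1) * (1 + norm (X \<omega>)) ^ 1)"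
          by (simp add: abs_mult mult_ac)
      qed (use cross_int' intN[of "2 * n + 1" 1] in \<open>auto simp del: power_one_right\<close>)
      also have "\<dots> = K * I (2 * n + 1)" by (simp add: I_def N_def)
      finally have 1: "\<bar>\<integral>\<omega>. norm (u \<omega>) ^ (2 * n) * (u \<omega> \<bullet> b (X \<omega>)) \<partial>M\<bar> \<le> K * I (2 * n + 1)" .
      have "R * lam * e \<le> R * lam * lam" using e R lam0 by (intro mult_left_mono) auto
      then have "\<bar>r\<bar> \<le> R * lam\<^sup>2" using r by (simp add: power2_eq_square)
      with 1 have "\<bar>r\<bar> * \<bar>\<integral>\<omega>. norm (u \<omega>) ^ (2 * n) * (u \<omega> \<bullet> b (X \<omega>)) \<partial>M\<bar> \<le> (R * lam\<^sup>2) * (K * I (2 * n + 1))"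
        by (intro mult_mono) auto
      then have "r * (\<integral>\<omega>. norm (u \<omega>) ^ (2 * n) * (u \<omega> \<bullet> b (X \<omega>)) \<partial>M) \<le> (R * lam\<^sup>2) * (K * I (2 * n + 1))"
        by (rule order_trans[OF abs_ge_self ord_eq_le_trans[OF abs_mult]])
      from mult_left_mono[OF this, of "2 * (real n + 1)"]
      show "(2 * (real n + 1) * r) * (\<integral>\<omega>. norm (u \<omega>) ^ (2 * n) * (u \<omega> \<bullet> b (X \<omega>)) \<partial>M) \<le> (2 * (real n + 1) * (R * lam\<^sup>2)) * (K * I (2 * n + 1))"
        by (simp add: mult_ac add_ac)
      \<comment> \<open>The growth \<open>1 / e ^ p\<close> of the moments is paid for by the factor
        \<open>e ^ p\<close> in the bound on \<open>r ^ p\<close>, and of the remaining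
        \<open>lam ^ p\<close> only \<open>lam\<^sup>2\<close> is kept. Evenness of \<open>p\<close>
        takes care of negative \<open>r\<close>.\<close>
      have rp: "r ^ p * (Mo p / e ^ p * J) \<le> R ^ p * lam\<^sup>2 * (Mo p * J)" if "0 \<le> J" "even p" "2 \<le> p" for p J
      proof -
        have "r ^ p = \<bar>r\<bar> ^ p" using that by (simp add: power_even_abs)
        also have "\<dots> \<le> (R * lam * e) ^ p" using r by (intro power_mono) auto
        finally have "r ^ p * (Mo p / e ^ p * J) \<le> (R * lam * e) ^ p * (Mo p / e ^ p * J)"
          using that Mo e0 by (intro mult_right_mono) auto
        also have "\<dots> = R ^ p * lam ^ p * (Mo p * J)" using e0 by (simp add: power_mult_distrib)
        also have "\<dots> \<le> R ^ p * lam\<^sup>2 * (Mo p * J)"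
          using that Mo R lam lam0 by (intro mult_right_mono mult_left_mono power_decreasing) auto
        finally show ?thesis .
      qed
      have I0: "0 \<le> I (2 * n)" by (simp add: I_def integral_nonneg)
      have "(\<integral>\<omega>. norm (u \<omega>) ^ (2 * n) * norm (Y \<omega>) ^ 2 \<partial>M) \<le> Mo 2 / e ^ 2 * I (2 * n)"
        unfolding I_def using call_norm_power[OF M G call X _ all_moments_power[OF nu], of "2 * n" 2] uF
        by (simp add: N_def)
      then have "r\<^sup>2 * (\<integral>\<omega>. norm (u \<omega>) ^ (2 * n) * norm (Y \<omega>) ^ 2 \<partial>M) \<le> r\<^sup>2 * (Mo 2 / e ^ 2 * I (2 * n))"
        by (intro mult_left_mono) auto
      also have "\<dots> \<le> R\<^sup>2 * lam\<^sup>2 * (Mo 2 * I (2 * n))" by (rule rp[OF I0]) auto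
      finally have "(real n + 1 + D) * (r\<^sup>2 * (\<integral>\<omega>. norm (u \<omega>) ^ (2 * n) * norm (Y \<omega>) ^ 2 \<partial>M)) \<le>
          (real n + 1 + D) * (R\<^sup>2 * lam\<^sup>2 * (Mo 2 * I (2 * n)))" using D0 by (intro mult_left_mono) auto
      then show "((real n + 1 + D) * r\<^sup>2) * (\<integral>\<omega>. norm (u \<omega>) ^ (2 * n) * norm (Y \<omega>) ^ 2 \<partial>M) \<le> ((real n + 1 + D) * (R\<^sup>2 * lam\<^sup>2)) * (Mo 2 * I (2 * n))"
        by (simp only: mult.assoc)
      have "(\<integral>\<omega>. norm (Y \<omega>) ^ N \<partial>M) \<le> Mo N / e ^ N * V"
        unfolding V_def using call_norm_power[OF M G call X _ all_moments_const[of 1], of N] by simp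
      then have "r ^ N * (\<integral>\<omega>. norm (Y \<omega>) ^ N \<partial>M) \<le> r ^ N * (Mo N / e ^ N * V)"
        by (rule mult_left_mono[OF _ zero_le_even_power]) (simp add: N_def)
      also have "\<dots> \<le> R ^ N * lam\<^sup>2 * (Mo N * V)" by (rule rp[OF V0]) (auto simp: N_def)
      finally have "D * (r ^ N * (\<integral>\<omega>. norm (Y \<omega>) ^ N \<partial>M)) \<le> D * (R ^ N * lam\<^sup>2 * (Mo N * V))"
        using D0 by (intro mult_left_mono) auto
      then show "(D * r ^ N) * (\<integral>\<omega>. norm (Y \<omega>) ^ N \<partial>M) \<le> D * (R ^ N * lam\<^sup>2) * (Mo N * V)"
        by (simp only: mult.assoc)
    qed
    also have "\<dots> \<le> U + (2 * (real n + 1) * (R * lam\<^sup>2)) * (K * (\<tau> * U + (1 / \<tau>) ^ N * V))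
        + ((real n + 1 + D) * (R\<^sup>2 * lam\<^sup>2)) * (Mo 2 * (\<tau> * U + (1 / \<tau>) ^ N * V)) + D * (R ^ N * lam\<^sup>2) * (Mo N * V)"
      using R K0 D0 Mo by (intro add_mono order_refl mult_left_mono young) (auto simp: N_def)
    also have "\<dots> = U + lam\<^sup>2 * (c1 * \<tau> * U) + C * lam\<^sup>2 * V"
      by (simp add: c1_def C_def algebra_simps)
    also have "\<dots> \<le> U + lam\<^sup>2 * (\<theta> * U) + C * lam\<^sup>2 * V"
      using \<tau> by (intro add_mono order_refl mult_left_mono mult_right_mono) (auto simp: U_def integral_nonneg)
    also have "\<dots> = (1 + \<theta> * lam\<^sup>2) * U + C * lam\<^sup>2 * V" by (simp add: algebra_simps)
    finally show "(\<integral>\<omega>. norm (u \<omega> + r *\<^sub>R Y \<omega>) ^ (2 * n + 2) \<partial>M) \<le>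
      (1 + \<theta> * lam\<^sup>2) * (\<integral>\<omega>. norm (u \<omega>) ^ (2 * n + 2) \<partial>M) + C * lam\<^sup>2 * (\<integral>\<omega>. (1 + norm (X \<omega>)) ^ (2 * n + 2) \<partial>M)"
      unfolding U_def V_def N_def .
  qed
qed

end

lemma vector_moments_cong:
  assumes "\<And>\<omega>. \<omega> \<in> space M \<Longrightarrow> X \<omega> = Y \<omega>" "vector_moments M Y"
  shows "vector_moments M X"
proof -
  have "integrable M (\<lambda>\<omega>. \<bar>norm (X \<omega>)\<bar> ^ p) \<longleftrightarrow> integrable M (\<lambda>\<omega>. \<bar>norm (Y \<omega>)\<bar> ^ p)" for p :: nat
    by (intro Bochner_Integration.integrable_cong) (auto simp: assms(1))
  moreover have "X \<in> borel_measurable M \<longleftrightarrow> Y \<in> borel_measurable M"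
    by (intro measurable_cong assms(1))
  ultimately show ?thesis using assms(2) unfolding vector_moments_def all_moments_def by simp
qed

lemma (in finite_measure) vector_moments_const: "vector_moments M (\<lambda>_. v)"
  by (simp add: vector_moments_def all_moments_const)

context diffusion
begin

text \<open>Covers both algorithms: SGD is the case \<open>d = 0\<close>, where \<open>m\<close> does not influence the iterates.
  Typically \<open>e = sqrt \<eta>\<close> and \<open>\<kappa> = \<eta> powr (\<alpha> / 2)\<close>; \<open>c\<close> is the squared noise scale.\<close>

definition momentum_run ::
  "real \<Rightarrow> real \<Rightarrow> (nat \<Rightarrow> real) \<Rightarrow> (nat \<Rightarrow> real) \<Rightarrow> 'a \<Rightarrow> real \<Rightarrow> real \<Rightarrow> real \<Rightarrow> 'w measure \<Rightarrow>
    ('a \<Rightarrow> 'a measure) \<Rightarrow> (nat \<Rightarrow> 'w measure) \<Rightarrow> (nat \<Rightarrow> real) \<Rightarrow> (nat \<Rightarrow> real) \<Rightarrow> (nat \<Rightarrow> real) \<Rightarrow>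
    (nat \<Rightarrow> 'w \<Rightarrow> 'a) \<Rightarrow> (nat \<Rightarrow> 'w \<Rightarrow> 'a) \<Rightarrow> (nat \<Rightarrow> 'w \<Rightarrow> 'a) \<Rightarrow> (nat \<Rightarrow> 'w \<Rightarrow> 'a) \<Rightarrow> bool" where
  "momentum_run R l Mo Mi x0 e \<kappa> c M G F a d \<beta> g m y x \<longleftrightarrow>
     prob_space M \<and> e \<le> \<kappa> \<and> \<kappa> \<le> 1 \<and> 0 \<le> c \<and> c * e\<^sup>2 \<le> 1 \<and> oracle_kernel Mo e c G \<and>
     (\<forall>k. oracle_call M (F k) G (x k) (g k) \<and> y k \<in> borel_measurable (F k) \<and> m k \<in> borel_measurable (F k)) \<and>
     (\<forall>k. 0 \<le> a k \<and> a k \<le> R * e\<^sup>2 \<and> \<bar>d k\<bar> \<le> R * (e / \<kappa>)\<^sup>2 \<and> 0 \<le> \<beta> k \<and> l * \<kappa>\<^sup>2 \<le> 1 - \<beta> k \<and> 1 - \<beta> k \<le> \<kappa>\<^sup>2) \<and>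
     (\<forall>\<omega>\<in>space M. x 0 \<omega> = x0) \<and>
     (\<forall>k. \<forall>\<omega>\<in>space M. y (Suc k) \<omega> = y k \<omega> - a k *\<^sub>R g k \<omega> \<and>
        m (Suc k) \<omega> = \<beta> k *\<^sub>R m k \<omega> + (1 - \<beta> k) *\<^sub>R g k \<omega> \<and> x k \<omega> = y k \<omega> + d k *\<^sub>R m k \<omega>) \<and>
     vector_moments M (m 0) \<and> (\<forall>p. (\<integral>\<omega>. norm (m 0 \<omega>) ^ p \<partial>M) \<le> Mi p)"

context
  fixes R l Mo Mi x0 e \<kappa> c and M :: "'w measure" and G F a d \<beta> g m y x
  assumes run: "momentum_run R l Mo Mi x0 e \<kappa> c M G F a d \<beta> g m y x"
begin

lemma run_prob_space: "prob_space M"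
  and run_kernel: "oracle_kernel Mo e c G"
  and run_call: "oracle_call M (F k) G (x k) (g k)"
  and run_adapted: "y k \<in> borel_measurable (F k)" "m k \<in> borel_measurable (F k)"
  and run_scales: "0 < e" "e \<le> \<kappa>" "\<kappa> \<le> 1" "0 < \<kappa>" "0 \<le> c" "c * e\<^sup>2 \<le> 1"
  and run_rates: "0 \<le> a k" "a k \<le> R * e\<^sup>2" "\<bar>d k\<bar> \<le> R * (e / \<kappa>)\<^sup>2"
    "0 \<le> \<beta> k" "l * \<kappa>\<^sup>2 \<le> 1 - \<beta> k" "1 - \<beta> k \<le> \<kappa>\<^sup>2"
  and run_start: "\<omega> \<in> space M \<Longrightarrow> x 0 \<omega> = x0"
  and run_equations: "\<omega> \<in> space M \<Longrightarrow> y (Suc k) \<omega> = y k \<omega> - a k *\<^sub>R g k \<omega>"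
    "\<omega> \<in> space M \<Longrightarrow> m (Suc k) \<omega> = \<beta> k *\<^sub>R m k \<omega> + (1 - \<beta> k) *\<^sub>R g k \<omega>"
    "\<omega> \<in> space M \<Longrightarrow> x k \<omega> = y k \<omega> + d k *\<^sub>R m k \<omega>"
  and run_initial: "vector_moments M (m 0)" "(\<integral>\<omega>. norm (m 0 \<omega>) ^ p \<partial>M) \<le> Mi p"
  using run unfolding momentum_run_def oracle_kernel_def by auto

interpretation prob_space M by (rule run_prob_space)

text \<open>Finiteness of all moments for each \<open>k\<close> separately, without any uniformity.
  It justifies the integrals in which the quantitative bounds are then stated.\<close>

lemma run_vector_moments:
  "vector_moments M (y k)" "vector_moments M (m k)" "vector_moments M (x k)" "vector_moments M (g k)"
proof -
  have sub: "vector_moments M (\<lambda>\<omega>. X \<omega> + r *\<^sub>R Y \<omega>)" if "vector_moments M X" "vector_moments M Y" for X Y r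
    by (intro vector_moments_add vector_moments_scaleR that)
  have xg: "vector_moments M (x k) \<and> vector_moments M (g k)" if ym: "vector_moments M (y k)" "vector_moments M (m k)" for k
  proof -
    have "vector_moments M (x k)"
      by (rule vector_moments_cong[OF _ sub[OF ym, of "d k"]]) (rule run_equations(3))
    then show ?thesis using call_moments[OF run_prob_space run_kernel run_call] by blast
  qed
  have "vector_moments M (y k) \<and> vector_moments M (m k)" for k
  proof (induction k)
    case 0
    have "vector_moments M (y 0)"
      by (rule vector_moments_cong[OF _ sub[OF vector_moments_const run_initial(1), of x0 "- d 0"]])
        (use run_start run_equations(3)[of _ 0] in \<open>auto simp: algebra_simps\<close>)
    then show ?case using run_initial by blast
  next
    case (Suc k)
    then have ym: "vector_moments M (y k)" "vector_moments M (m k)" by auto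
    have g: "vector_moments M (g k)" using xg[OF ym] by blast
    have "vector_moments M (y (Suc k))"
      by (rule vector_moments_cong[OF _ sub[OF ym(1) g, of "- a k"]]) (simp add: run_equations(1))
    moreover have "vector_moments M (m (Suc k))"
      by (rule vector_moments_cong[OF _ sub[OF vector_moments_scaleR[OF ym(2), of "\<beta> k"] g, of "1 - \<beta> k"]])
        (simp add: run_equations(2))
    ultimately show ?case by blast
  qed
  then show "vector_moments M (y k)" "vector_moments M (m k)" "vector_moments M (x k)" "vector_moments M (g k)"
    using xg by blast+
qed

lemma run_ratio: "0 < e / \<kappa>" "e / \<kappa> \<le> 1"
  using run_scales by auto

text \<open>The noise amplitude of the chain is of order \<open>e\<close> although \<open>c\<close>
  may be as large as \<open>1 / e^2\<close>, since \<open>a k\<close> is of order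
  \<open>e^2\<close>. The crude \<open>sqrt DIM('a) \<le> DIM('a)\<close> lets one constant
  \<open>R * DIM('a)\<close> serve for the rates and the amplitudes.\<close>

lemma run_noise_scale: "\<bar>a k * sqrt (c * DIM('a))\<bar> \<le> R * DIM('a) * e"
proof -
  have N1: "1 \<le> real DIM('a)" by (metis DIM_positive One_nat_def Suc_leI of_nat_1 of_nat_mono)
  note sc = run_scales and rt = run_rates[of k]
  have "sqrt (c * DIM('a)) * e = sqrt (c * e\<^sup>2) * sqrt DIM('a)"
    using sc by (simp add: real_sqrt_mult)
  also have "\<dots> \<le> 1 * real DIM('a)"
  proof (intro mult_mono)
    have "sqrt (real DIM('a)) \<le> sqrt ((real DIM('a))\<^sup>2)"
      using N1 by (intro real_sqrt_le_mono) (simp add: power2_eq_square)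
    then show "sqrt (real DIM('a)) \<le> real DIM('a)" by simp
  qed (use sc in auto)
  finally have "a k * sqrt (c * DIM('a)) * e \<le> a k * DIM('a)"
    using rt(1) mult_left_mono[of _ _ "a k"] by (simp add: mult.assoc)
  also have "\<dots> \<le> R * e\<^sup>2 * DIM('a)" using rt(2) by (intro mult_right_mono) auto
  finally have "a k * sqrt (c * DIM('a)) * e \<le> R * DIM('a) * e * e" by (simp add: power2_eq_square mult_ac)
  then have "a k * sqrt (c * DIM('a)) \<le> R * DIM('a) * e" using sc by simp
  moreover have "0 \<le> a k * sqrt (c * DIM('a))" using rt(1) sc by simp
  ultimately show ?thesis by simp
qed

text \<open>One of the two factors \<open>e / \<kappa>\<close> in the bound for \<open>d k\<close>
  is assigned to the momentum, which has bounded moments after this rescaling. The other one is the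
  final rate.\<close>

lemma run_difference:
  assumes "\<omega> \<in> space M" "0 \<le> R"
  shows "norm (x k \<omega> - y k \<omega>) \<le> R * (e / \<kappa>) * norm ((e / \<kappa>) *\<^sub>R m k \<omega>)"
proof -
  have "norm (x k \<omega> - y k \<omega>) = \<bar>d k\<bar> * norm (m k \<omega>)" using run_equations(3)[OF assms(1), of k] by simp
  also have "\<dots> \<le> R * (e / \<kappa>)\<^sup>2 * norm (m k \<omega>)" using run_rates(3) by (intro mult_right_mono) auto
  finally show ?thesis using run_scales by (simp add: power2_eq_square)
qed

end

text \<open>\<open>moment_step\<close> is applied to \<open>y\<close> with growth rate 1 and to the
  rescaled momentum with growth rate \<open>l / 2\<close>, half of its contraction rate. Even powers
  are used, as the expansion of norms is available for them.\<close>

lemma run_moments: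
  fixes R l T :: real
  assumes R: "1 \<le> R" and l: "0 < l" "l \<le> 1" and Mo: "\<And>p. 0 \<le> Mo p" and Mi: "\<And>p. 0 \<le> Mi p"
  shows "\<exists>C\<ge>0. \<forall>e \<kappa> c (M :: 'w measure) G F a d \<beta> g m y x k.
    momentum_run R l Mo Mi x0 e \<kappa> c M G F a d \<beta> g m y x \<longrightarrow> real k * e\<^sup>2 \<le> T \<longrightarrow>
    (\<integral>\<omega>. norm (y k \<omega>) ^ (2 * n + 2) \<partial>M) \<le> C \<and> (\<integral>\<omega>. norm ((e / \<kappa>) *\<^sub>R m k \<omega>) ^ (2 * n + 2) \<partial>M) \<le> C"
proof -
  define N where "N = 2 * n + 2"
  have R0: "0 \<le> R" using R by simp
  obtain C1 where C1: "0 \<le> C1" and step1: "\<And>(M :: 'w measure) F G X Y u e lam c r. prob_space M \<Longrightarrow> oracle_kernel Mo e c G \<Longrightarrow>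
    oracle_call M F G X Y \<Longrightarrow> u \<in> borel_measurable F \<Longrightarrow> vector_moments M u \<Longrightarrow> vector_moments M X \<Longrightarrow>
    e \<le> lam \<Longrightarrow> lam \<le> 1 \<Longrightarrow> \<bar>r\<bar> \<le> R * lam * e \<Longrightarrow>
    (\<integral>\<omega>. norm (u \<omega> + r *\<^sub>R Y \<omega>) ^ N \<partial>M) \<le>
      (1 + 1 * lam\<^sup>2) * (\<integral>\<omega>. norm (u \<omega>) ^ N \<partial>M) + C1 * lam\<^sup>2 * (\<integral>\<omega>. (1 + norm (X \<omega>)) ^ N \<partial>M)"
    using moment_step[where n=n and Mo=Mo, OF R0 zero_less_one Mo] unfolding N_def by blast
  have l2: "0 < l / 2" using l by simp
  obtain C2 where C2: "0 \<le> C2" and step2: "\<And>(M :: 'w measure) F G X Y u e lam c r. prob_space M \<Longrightarrow> oracle_kernel Mo e c G \<Longrightarrow>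
    oracle_call M F G X Y \<Longrightarrow> u \<in> borel_measurable F \<Longrightarrow> vector_moments M u \<Longrightarrow> vector_moments M X \<Longrightarrow>
    e \<le> lam \<Longrightarrow> lam \<le> 1 \<Longrightarrow> \<bar>r\<bar> \<le> R * lam * e \<Longrightarrow>
    (\<integral>\<omega>. norm (u \<omega> + r *\<^sub>R Y \<omega>) ^ N \<partial>M) \<le>
      (1 + l / 2 * lam\<^sup>2) * (\<integral>\<omega>. norm (u \<omega>) ^ N \<partial>M) + C2 * lam\<^sup>2 * (\<integral>\<omega>. (1 + norm (X \<omega>)) ^ N \<partial>M)"
    using moment_step[where n=n and Mo=Mo, OF R0 l2 Mo] unfolding N_def by blast
  \<comment> \<open>\<open>D'\<close> bounds the moments of the query \<open>x\<close> by those of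
    \<open>y\<close> and of the rescaled momentum, \<open>D\<close> also contains the constants of
    both moment steps, \<open>A0\<close> bounds both moments at time 0, and \<open>W\<close> and
    \<open>H\<close> are those of \<open>moment_recursion\<close>.\<close>
  define D' where "D' = 2 ^ N * (2 * R) ^ N"
  define D where "D = (C1 + C2) * D'"
  define A0 where "A0 = 2 ^ N * (norm x0 ^ N + R ^ N * Mi N) + Mi N"
  define W where "W = 1 + 2 * D / l"
  define H where "H = 1 + D * (1 + W)"
  define C where "C = W * ((1 + A0) * exp (H * T))"
  have D': "0 \<le> D'" using R by (simp add: D'_def)
  have D: "0 \<le> D" using C1 C2 D' by (simp add: D_def)
  have A0: "0 \<le> A0" using R Mi by (simp add: A0_def)
  have W: "1 \<le> W" using D l by (simp add: W_def)
  have H: "0 \<le> H" using D W by (simp add: H_def)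
  show ?thesis
  proof (intro exI[of _ C] conjI allI impI)
    show "0 \<le> C" using W A0 by (simp add: C_def)
    fix e \<kappa> c M G F a d \<beta> g m y x k
    assume run: "momentum_run R l Mo Mi x0 e \<kappa> c (M :: 'w measure) G F a d \<beta> g m y x" and T: "real k * e\<^sup>2 \<le> T"
    interpret prob_space M by (rule run_prob_space[OF run])
    note sc = run_scales[OF run] and rt = run_rates[OF run] and vm = run_vector_moments[OF run]
      and ratio = run_ratio[OF run]
    define \<gamma> where "\<gamma> = e / \<kappa>"
    have \<gamma>: "0 < \<gamma>" "\<gamma> \<le> 1" "\<kappa>\<^sup>2 * \<gamma>\<^sup>2 = e\<^sup>2" using ratio sc by (auto simp: \<gamma>_def power_divide)
    have \<gamma>N: "\<gamma> ^ N \<le> \<gamma>\<^sup>2" using \<gamma> by (intro power_decreasing) (auto simp: N_def)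
    define q where "q k \<omega> = \<gamma> *\<^sub>R m k \<omega>" for k \<omega>
    have vq: "vector_moments M (q k)" for k unfolding q_def by (intro vector_moments_scaleR vm)
    define A where "A k = (\<integral>\<omega>. norm (y k \<omega>) ^ N \<partial>M)" for k
    define B where "B k = (\<integral>\<omega>. norm (q k \<omega>) ^ N \<partial>M)" for k
    define V where "V k = (\<integral>\<omega>. (1 + norm (x k \<omega>)) ^ N \<partial>M)" for k
    have ip: "integrable M (\<lambda>\<omega>. norm (X \<omega>) ^ p)" if "vector_moments M X" for X :: "'w \<Rightarrow> 'a" and p
      by (intro all_moments_integrable all_moments_power vector_moments_norm that)
    have nn: "0 \<le> A k" "0 \<le> B k" for k by (auto simp: A_def B_def)
    \<comment> \<open>The small factor \<open>\<gamma>\<^sup>2\<close> before \<open>B k\<close> is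
      retained: in the recursion for \<open>B\<close> it is multiplied by
      \<open>\<kappa>\<^sup>2\<close>, and the product is \<open>e\<^sup>2\<close>, a rate that is
      harmless over the whole run.\<close>
    have V: "V k \<le> D' * (1 + A k + \<gamma>\<^sup>2 * B k)" for k
    proof -
      have "V k \<le> (\<integral>\<omega>. D' * (1 + norm (y k \<omega>) ^ N + \<gamma>\<^sup>2 * norm (q k \<omega>) ^ N) \<partial>M)"
        unfolding V_def
      proof (rule integral_mono)
        show "integrable M (\<lambda>\<omega>. (1 + norm (x k \<omega>)) ^ N)"
          by (intro all_moments_integrable all_moments_power all_moments_add all_moments_const vector_moments_norm vm)
        show "integrable M (\<lambda>\<omega>. D' * (1 + norm (y k \<omega>) ^ N + \<gamma>\<^sup>2 * norm (q k \<omega>) ^ N))"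
          using ip[OF vm(1)] ip[OF vq] by auto
        fix \<omega> assume \<omega>: "\<omega> \<in> space M"
        have "norm (x k \<omega>) \<le> norm (y k \<omega>) + norm (x k \<omega> - y k \<omega>)" by (rule norm_triangle_sub)
        also have "norm (x k \<omega> - y k \<omega>) \<le> R * \<gamma> * norm (q k \<omega>)"
          using run_difference[OF run \<omega> R0, of k] by (simp add: q_def \<gamma>_def)
        finally have "(1 + norm (x k \<omega>)) ^ N \<le> (1 + (norm (y k \<omega>) + R * \<gamma> * norm (q k \<omega>))) ^ N"
          by (intro power_mono) auto
        also have "\<dots> \<le> 2 ^ N * (1 ^ N + (norm (y k \<omega>) + R * \<gamma> * norm (q k \<omega>)) ^ N)"
          using R0 \<gamma> by (intro power_sum_le) auto
        also have "\<dots> \<le> 2 ^ N * (1 ^ N + 2 ^ N * (norm (y k \<omega>) ^ N + (R * \<gamma> * norm (q k \<omega>)) ^ N))"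
          using R0 \<gamma> by (intro mult_left_mono add_left_mono power_sum_le) auto
        also have "\<dots> \<le> 2 ^ N * ((2 * R) ^ N * 1 + 2 ^ N * (R ^ N * norm (y k \<omega>) ^ N + R ^ N * \<gamma>\<^sup>2 * norm (q k \<omega>) ^ N))"
        proof (intro mult_left_mono add_mono)
          show "1 ^ N \<le> (2 * R) ^ N * 1" using R one_le_power[of "2 * R" N] by simp
          show "norm (y k \<omega>) ^ N \<le> R ^ N * norm (y k \<omega>) ^ N"
            using R mult_right_mono[of 1 "R ^ N" "norm (y k \<omega>) ^ N"] by (simp add: one_le_power)
          show "(R * \<gamma> * norm (q k \<omega>)) ^ N \<le> R ^ N * \<gamma>\<^sup>2 * norm (q k \<omega>) ^ N"
            unfolding power_mult_distrib using \<gamma>N R0 by (intro mult_right_mono mult_left_mono) auto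
        qed auto
        also have "\<dots> = D' * (1 + norm (y k \<omega>) ^ N + \<gamma>\<^sup>2 * norm (q k \<omega>) ^ N)"
          unfolding D'_def by (simp add: power_mult_distrib algebra_simps)
        finally show "(1 + norm (x k \<omega>)) ^ N \<le> D' * (1 + norm (y k \<omega>) ^ N + \<gamma>\<^sup>2 * norm (q k \<omega>) ^ N)" .
      qed
      also have "\<dots> = D' * (1 + A k + \<gamma>\<^sup>2 * B k)"
        using ip[OF vm(1)] ip[OF vq] by (simp add: A_def B_def prob_space)
      finally show ?thesis .
    qed
    have recA: "A (Suc k) \<le> (1 + e\<^sup>2) * A k + D * e\<^sup>2 * (1 + A k + B k)" for k
    proof -
      have "A (Suc k) = (\<integral>\<omega>. norm (y k \<omega> + (- a k) *\<^sub>R g k \<omega>) ^ N \<partial>M)"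
        unfolding A_def by (intro Bochner_Integration.integral_cong) (simp_all add: run_equations(1)[OF run])
      also have "\<dots> \<le> (1 + 1 * e\<^sup>2) * A k + C1 * e\<^sup>2 * V k"
        unfolding A_def V_def
        by (rule step1[OF run_prob_space[OF run] run_kernel[OF run] run_call[OF run] run_adapted(1)[OF run]])
          (use vm sc rt[of k] in \<open>auto simp: power2_eq_square mult.assoc\<close>)
      also have "C1 * e\<^sup>2 * V k \<le> D * e\<^sup>2 * (1 + A k + B k)"
      proof -
        have "\<gamma>\<^sup>2 * B k \<le> 1 * B k" using \<gamma> nn by (intro mult_right_mono power_le_one) auto
        then have "D' * (1 + A k + \<gamma>\<^sup>2 * B k) \<le> D' * (1 + A k + B k)"
          using D' by (intro mult_left_mono add_left_mono) auto
        with V[of k] have "V k \<le> D' * (1 + A k + B k)" by linarith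
        then have "C1 * e\<^sup>2 * V k \<le> C1 * e\<^sup>2 * (D' * (1 + A k + B k))" using C1 by (intro mult_left_mono) auto
        also have "\<dots> \<le> (C1 + C2) * e\<^sup>2 * (D' * (1 + A k + B k))"
          using C2 D' nn[of k] by (intro mult_right_mono) auto
        finally show ?thesis by (simp add: D_def mult_ac)
      qed
      finally show ?thesis by simp
    qed
    have recB: "B (Suc k) \<le> (1 - l / 2 * \<kappa>\<^sup>2) * B k + D * \<kappa>\<^sup>2 * (1 + A k) + D * e\<^sup>2 * B k" for k
    proof -
      have \<beta>: "0 \<le> \<beta> k" "l * \<kappa>\<^sup>2 \<le> 1 - \<beta> k" "1 - \<beta> k \<le> \<kappa>\<^sup>2" using rt by auto
      have l\<kappa>: "0 \<le> l * \<kappa>\<^sup>2" using l by simp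
      have \<beta>1: "\<beta> k \<le> 1" using \<beta> l\<kappa> by linarith
      have mF: "(\<lambda>\<omega>. \<beta> k *\<^sub>R q k \<omega>) \<in> borel_measurable (F k)"
        using run_adapted(2)[OF run] by (simp add: q_def)
      have "B (Suc k) = (\<integral>\<omega>. norm (\<beta> k *\<^sub>R q k \<omega> + ((1 - \<beta> k) * \<gamma>) *\<^sub>R g k \<omega>) ^ N \<partial>M)"
        unfolding B_def q_def
        by (intro Bochner_Integration.integral_cong)
          (simp_all add: run_equations(2)[OF run] scaleR_add_right mult.commute)
      also have "\<dots> \<le> (1 + l / 2 * \<kappa>\<^sup>2) * (\<integral>\<omega>. norm (\<beta> k *\<^sub>R q k \<omega>) ^ N \<partial>M) + C2 * \<kappa>\<^sup>2 * V k"
        unfolding V_def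
      proof (rule step2[OF run_prob_space[OF run] run_kernel[OF run] run_call[OF run] mF])
        \<comment> \<open>The rescaled momentum receives the gradient with weight
          \<open>(1 - \<beta> k) * \<gamma>\<close>, which is at most \<open>\<kappa> * e\<close>,
          the size that \<open>moment_step\<close> demands for
          \<open>lam = \<kappa>\<close>.\<close>
        have "(1 - \<beta> k) * \<gamma> \<le> \<kappa>\<^sup>2 * \<gamma>" using \<beta> \<gamma> by (intro mult_right_mono) auto
        also have "\<dots> = 1 * (\<kappa> * e)" using sc by (simp add: \<gamma>_def power2_eq_square)
        also have "\<dots> \<le> R * (\<kappa> * e)" using R sc by (intro mult_right_mono) auto
        finally show "\<bar>(1 - \<beta> k) * \<gamma>\<bar> \<le> R * \<kappa> * e" using \<beta>1 \<gamma> by (simp add: mult.assoc)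
      qed (use vm vq sc in \<open>auto intro: vector_moments_scaleR\<close>)
      also have "(\<integral>\<omega>. norm (\<beta> k *\<^sub>R q k \<omega>) ^ N \<partial>M) = \<beta> k ^ N * B k"
        using \<beta> by (simp add: B_def power_mult_distrib)
      also have "(1 + l / 2 * \<kappa>\<^sup>2) * (\<beta> k ^ N * B k) \<le> (1 - l / 2 * \<kappa>\<^sup>2) * B k"
      proof -
        \<comment> \<open>One factor of contraction is enough:
          \<open>(1 + l / 2 * \<kappa>\<^sup>2) * (1 - l * \<kappa>\<^sup>2)\<close> stays below
          \<open>1 - l / 2 * \<kappa>\<^sup>2\<close>, so half of the contraction pays for the
          growth and half survives.\<close>
        have "\<beta> k ^ N \<le> \<beta> k ^ 1" using \<beta> \<beta>1 by (intro power_decreasing) (auto simp: N_def)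
        then have "\<beta> k ^ N \<le> 1 - l * \<kappa>\<^sup>2" using \<beta> by simp
        then have "(1 + l / 2 * \<kappa>\<^sup>2) * \<beta> k ^ N \<le> (1 + l / 2 * \<kappa>\<^sup>2) * (1 - l * \<kappa>\<^sup>2)"
          using l by (intro mult_left_mono) auto
        also have "\<dots> = (1 - l / 2 * \<kappa>\<^sup>2) - (l * \<kappa>\<^sup>2)\<^sup>2 / 2" by (simp add: field_simps power2_eq_square)
        also have "\<dots> \<le> 1 - l / 2 * \<kappa>\<^sup>2" by simp
        finally have "(1 + l / 2 * \<kappa>\<^sup>2) * \<beta> k ^ N * B k \<le> (1 - l / 2 * \<kappa>\<^sup>2) * B k"
          using nn by (intro mult_right_mono)
        then show ?thesis by (simp only: mult.assoc)
      qed
      also have "C2 * \<kappa>\<^sup>2 * V k \<le> D * \<kappa>\<^sup>2 * (1 + A k) + D * e\<^sup>2 * B k"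
      proof -
        have "C2 * \<kappa>\<^sup>2 * V k \<le> C2 * \<kappa>\<^sup>2 * (D' * (1 + A k + \<gamma>\<^sup>2 * B k))"
          using C2 V[of k] by (intro mult_left_mono) auto
        also have "\<dots> \<le> (C1 + C2) * \<kappa>\<^sup>2 * (D' * (1 + A k + \<gamma>\<^sup>2 * B k))"
          using C1 D' nn[of k] by (intro mult_right_mono) auto
        also have "\<dots> = D * \<kappa>\<^sup>2 * (1 + A k) + D * (\<kappa>\<^sup>2 * \<gamma>\<^sup>2) * B k"
          by (simp add: D_def algebra_simps)
        finally show ?thesis unfolding \<gamma> .
      qed
      finally show ?thesis by simp
    qed
    have \<kappa>2: "\<kappa>\<^sup>2 \<le> 1" using sc by (intro power_le_one) auto
    have \<kappa>l: "l / 2 * \<kappa>\<^sup>2 \<le> 1" using \<kappa>2 l mult_mono[of "l / 2" 1 "\<kappa>\<^sup>2" 1] by simp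
    have mi: "integrable M (\<lambda>\<omega>. norm (m 0 \<omega>) ^ N)" by (rule ip[OF vm(2)])
    have B0: "B 0 \<le> Mi N"
    proof -
      have "B 0 = \<gamma> ^ N * (\<integral>\<omega>. norm (m 0 \<omega>) ^ N \<partial>M)" using \<gamma> by (simp add: B_def q_def power_mult_distrib)
      also have "\<dots> \<le> 1 * Mi N"
        using \<gamma> run_initial(2)[OF run] by (intro mult_mono power_le_one) (auto simp: integral_nonneg)
      finally show ?thesis by simp
    qed
    have "A 0 \<le> (\<integral>\<omega>. 2 ^ N * (norm x0 ^ N + R ^ N * norm (m 0 \<omega>) ^ N) \<partial>M)"
      unfolding A_def
    proof (rule integral_mono)
      fix \<omega> assume \<omega>: "\<omega> \<in> space M"
      have "y 0 \<omega> = x0 - d 0 *\<^sub>R m 0 \<omega>" using run_equations(3)[OF run \<omega>, of 0] run_start[OF run \<omega>] by simp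
      then have "norm (y 0 \<omega>) \<le> norm x0 + \<bar>d 0\<bar> * norm (m 0 \<omega>)"
        using norm_triangle_ineq4[of x0 "d 0 *\<^sub>R m 0 \<omega>"] by simp
      also have "\<bar>d 0\<bar> \<le> R"
      proof -
        have "R * \<gamma>\<^sup>2 \<le> R * 1" using \<gamma> R by (intro mult_left_mono power_le_one) auto
        then show ?thesis using rt(3)[of 0, folded \<gamma>_def] by linarith
      qed
      finally have "norm (y 0 \<omega>) \<le> norm x0 + R * norm (m 0 \<omega>)" by (simp add: mult_right_mono)
      then have "norm (y 0 \<omega>) ^ N \<le> (norm x0 + R * norm (m 0 \<omega>)) ^ N"
        by (intro power_mono) auto
      also have "\<dots> \<le> 2 ^ N * (norm x0 ^ N + (R * norm (m 0 \<omega>)) ^ N)" using R by (intro power_sum_le) auto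
      finally show "norm (y 0 \<omega>) ^ N \<le> 2 ^ N * (norm x0 ^ N + R ^ N * norm (m 0 \<omega>) ^ N)"
        by (simp add: power_mult_distrib)
    qed (use mi ip[OF vm(1)] in auto)
    also have "\<dots> = 2 ^ N * (norm x0 ^ N + R ^ N * (\<integral>\<omega>. norm (m 0 \<omega>) ^ N \<partial>M))" using mi by (simp add: prob_space)
    also have "\<dots> \<le> 2 ^ N * (norm x0 ^ N + R ^ N * Mi N)"
      using R run_initial(2)[OF run] by (intro mult_left_mono add_left_mono) auto
    finally have A00: "A 0 \<le> A0" using Mi[of N] by (simp add: A0_def)
    have B00: "B 0 \<le> A0" using B0 R Mi[of N] by (auto simp: A0_def intro: add_increasing)
    have "1 + A k \<le> (1 + A0) * (1 + H * e\<^sup>2) ^ k \<and> B k \<le> W * ((1 + A0) * (1 + H * e\<^sup>2) ^ k)"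
      unfolding H_def W_def
      by (rule moment_recursion[where A=A and B=B and l=l and D=D and \<kappa>=\<kappa> and e=e and ?A0.0=A0, OF l(1) D \<kappa>l recA recB A0 A00 B00 nn])
    moreover have "(1 + H * e\<^sup>2) ^ k \<le> exp (H * T)"
    proof -
      have "(1 + H * e\<^sup>2) ^ k \<le> exp (H * e\<^sup>2) ^ k"
        using H by (intro power_mono exp_ge_add_one_self) auto
      also have "\<dots> = exp (H * (real k * e\<^sup>2))" by (simp add: exp_of_nat_mult[symmetric] mult_ac)
      also have "\<dots> \<le> exp (H * T)" using T H by (simp add: mult_left_mono)
      finally show ?thesis .
    qed
    then have le: "(1 + A0) * (1 + H * e\<^sup>2) ^ k \<le> (1 + A0) * exp (H * T)" using A0 by (intro mult_left_mono) auto
    moreover have "1 * ((1 + A0) * exp (H * T)) \<le> C" unfolding C_def using W A0 by (intro mult_right_mono) auto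
    moreover have "W * ((1 + A0) * (1 + H * e\<^sup>2) ^ k) \<le> C" unfolding C_def using W mult_left_mono[OF le, of W] by simp
    ultimately have "A k \<le> C" "B k \<le> C" by linarith+
    then show "(\<integral>\<omega>. norm (y k \<omega>) ^ (2 * n + 2) \<partial>M) \<le> C" "(\<integral>\<omega>. norm ((e / \<kappa>) *\<^sub>R m k \<omega>) ^ (2 * n + 2) \<partial>M) \<le> C"
      unfolding A_def B_def q_def \<gamma>_def N_def by auto
  qed
qed

lemma run_size_moments:
  fixes R l T :: real
  assumes R: "1 \<le> R" and l: "0 < l" "l \<le> 1" and Mo: "\<And>p. 0 \<le> Mo p" and Mi: "\<And>p. 0 \<le> Mi p"
  shows "\<exists>C\<ge>0. \<forall>e \<kappa> c (M :: 'w measure) G F a d \<beta> g m y x k.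
    momentum_run R l Mo Mi x0 e \<kappa> c M G F a d \<beta> g m y x \<longrightarrow> real k * e\<^sup>2 \<le> T \<longrightarrow>
    (\<integral>\<omega>. (1 + norm (x k \<omega>) + norm (y k \<omega>) + norm ((e / \<kappa>) *\<^sub>R m k \<omega>)) ^ p \<partial>M) \<le> C"
proof -
  \<comment> \<open>The quantity to be estimated is at least 1, so its power \<open>p\<close> is
    below its power \<open>N\<close>, which is even and covered by
    \<open>run_moments\<close>.\<close>
  define N where "N = 2 * p + 2"
  have R0: "0 \<le> R" using R by simp
  obtain C where C: "0 \<le> C" and bd: "\<And>e \<kappa> c (M :: 'w measure) G F a d \<beta> g m y x k.
    momentum_run R l Mo Mi x0 e \<kappa> c M G F a d \<beta> g m y x \<Longrightarrow> real k * e\<^sup>2 \<le> T \<Longrightarrow>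
    (\<integral>\<omega>. norm (y k \<omega>) ^ N \<partial>M) \<le> C \<and> (\<integral>\<omega>. norm ((e / \<kappa>) *\<^sub>R m k \<omega>) ^ N \<partial>M) \<le> C"
    using run_moments[where n=p and T=T and ?x0.0=x0 and Mo=Mo and Mi=Mi, OF R l Mo Mi] unfolding N_def by blast
  define E where "E = (2 + R) ^ N * (2 ^ N * 2 ^ N)"
  have E: "0 \<le> E" using R by (simp add: E_def)
  show ?thesis
  proof (intro exI[of _ "E * (1 + C + C)"] conjI allI impI)
    show "0 \<le> E * (1 + C + C)" using E C by simp
    fix e \<kappa> c M G F a d \<beta> g m y x k
    assume run: "momentum_run R l Mo Mi x0 e \<kappa> c (M :: 'w measure) G F a d \<beta> g m y x" and T: "real k * e\<^sup>2 \<le> T"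
    interpret prob_space M by (rule run_prob_space[OF run])
    note vm = run_vector_moments[OF run] and ratio = run_ratio[OF run]
    have vq: "vector_moments M (\<lambda>\<omega>. (e / \<kappa>) *\<^sub>R m k \<omega>)" by (intro vector_moments_scaleR vm)
    have ip: "integrable M (\<lambda>\<omega>. norm (X \<omega>) ^ j)" if "vector_moments M X" for X :: "'w \<Rightarrow> 'a" and j
      by (intro all_moments_integrable all_moments_power vector_moments_norm that)
    have "(\<integral>\<omega>. (1 + norm (x k \<omega>) + norm (y k \<omega>) + norm ((e / \<kappa>) *\<^sub>R m k \<omega>)) ^ p \<partial>M) \<le>
      (\<integral>\<omega>. E * (1 + norm (y k \<omega>) ^ N + norm ((e / \<kappa>) *\<^sub>R m k \<omega>) ^ N) \<partial>M)"
    proof (rule integral_mono)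
      show "integrable M (\<lambda>\<omega>. (1 + norm (x k \<omega>) + norm (y k \<omega>) + norm ((e / \<kappa>) *\<^sub>R m k \<omega>)) ^ p)"
        by (intro all_moments_integrable all_moments_power all_moments_add all_moments_const
            vector_moments_norm[OF vm(1)] vector_moments_norm[OF vm(3)] vector_moments_norm[OF vq])
      show "integrable M (\<lambda>\<omega>. E * (1 + norm (y k \<omega>) ^ N + norm ((e / \<kappa>) *\<^sub>R m k \<omega>) ^ N))"
        using ip[of _ N, OF vm(1)] ip[of _ N, OF vq] by (intro integrable_mult_right Bochner_Integration.integrable_add) auto
      fix \<omega> assume \<omega>: "\<omega> \<in> space M"
      define Y where "Y = norm (y k \<omega>)"
      define Q where "Q = norm ((e / \<kappa>) *\<^sub>R m k \<omega>)"
      have YQ: "0 \<le> Y" "0 \<le> Q" by (auto simp: Y_def Q_def)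
      have "norm (x k \<omega>) \<le> Y + norm (x k \<omega> - y k \<omega>)" unfolding Y_def by (rule norm_triangle_sub)
      also have "norm (x k \<omega> - y k \<omega>) \<le> R * (e / \<kappa>) * Q" using run_difference[OF run \<omega> R0] by (simp add: Q_def)
      also have "R * (e / \<kappa>) * Q \<le> R * 1 * Q" using ratio R0 YQ by (intro mult_mono mult_left_mono) auto
      finally have "1 + norm (x k \<omega>) + Y + Q \<le> 1 + 2 * Y + (1 + R) * Q" by (simp add: algebra_simps)
      also have "\<dots> \<le> (2 + R) * (1 + (Y + Q))" using R YQ by (simp add: algebra_simps add_increasing)
      finally have b: "1 + norm (x k \<omega>) + Y + Q \<le> (2 + R) * (1 + (Y + Q))" .
      have "(1 + norm (x k \<omega>) + Y + Q) ^ p \<le> (1 + norm (x k \<omega>) + Y + Q) ^ N"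
        using YQ by (intro power_increasing) (auto simp: N_def add_nonneg_nonneg)
      also have "\<dots> \<le> ((2 + R) * (1 + (Y + Q))) ^ N"
        using b YQ by (intro power_mono) (auto simp: add_nonneg_nonneg)
      also have "\<dots> = (2 + R) ^ N * (1 + (Y + Q)) ^ N" by (simp add: power_mult_distrib)
      also have "\<dots> \<le> (2 + R) ^ N * (2 ^ N * (1 ^ N + 2 ^ N * (Y ^ N + Q ^ N)))"
      proof (rule mult_left_mono)
        have "(1 + (Y + Q)) ^ N \<le> 2 ^ N * (1 ^ N + (Y + Q) ^ N)" using YQ by (intro power_sum_le) auto
        also have "\<dots> \<le> 2 ^ N * (1 ^ N + 2 ^ N * (Y ^ N + Q ^ N))"
          using YQ by (intro mult_left_mono add_left_mono power_sum_le) auto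
        finally show "(1 + (Y + Q)) ^ N \<le> 2 ^ N * (1 ^ N + 2 ^ N * (Y ^ N + Q ^ N))" .
      qed (use R in simp)
      also have "\<dots> \<le> (2 + R) ^ N * (2 ^ N * (2 ^ N * 1 + 2 ^ N * (Y ^ N + Q ^ N)))"
        using R one_le_power[of "2 :: real" N] by (intro mult_left_mono add_right_mono) auto
      also have "\<dots> = E * (1 + Y ^ N + Q ^ N)" by (simp add: E_def algebra_simps)
      finally show "(1 + norm (x k \<omega>) + norm (y k \<omega>) + norm ((e / \<kappa>) *\<^sub>R m k \<omega>)) ^ p \<le>
        E * (1 + norm (y k \<omega>) ^ N + norm ((e / \<kappa>) *\<^sub>R m k \<omega>) ^ N)" unfolding Y_def Q_def .
    qed
    also have "\<dots> = E * (1 + (\<integral>\<omega>. norm (y k \<omega>) ^ N \<partial>M) + (\<integral>\<omega>. norm ((e / \<kappa>) *\<^sub>R m k \<omega>) ^ N \<partial>M))"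
      using ip[of _ N, OF vm(1)] ip[of _ N, OF vq]
      by (simp add: prob_space del: norm_scaleR)
    also have "\<dots> \<le> E * (1 + C + C)"
      using bd[OF run T] E by (intro mult_left_mono add_mono) auto
    finally show "(\<integral>\<omega>. (1 + norm (x k \<omega>) + norm (y k \<omega>) + norm ((e / \<kappa>) *\<^sub>R m k \<omega>)) ^ p \<partial>M) \<le> E * (1 + C + C)" .
  qed
qed

end

section \<open>Weak error of momentum runs\<close>

lemma smooth_test_measurable:
  assumes "smooth_test B m f f1 f2 f3"
  shows "f \<in> borel_measurable borel" "(\<lambda>x. f1 x v) \<in> borel_measurable borel" "(\<lambda>x. f2 x v w) \<in> borel_measurable borel"
proof -
  have j: "jet3 f f1 f2 f3" using assms by (simp add: smooth_test_def)
  have "g \<in> borel_measurable borel" if "\<And>x. (g has_derivative g' x) (at x)" for g :: "'a \<Rightarrow> real" and g'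
    by (intro borel_measurable_continuous_onI has_derivative_continuous_on[where f'=g'])
      (use that in simp)
  from this[OF jet3D(1)[OF j]] this[OF jet3D(2)[OF j]] this[OF jet3D(3)[OF j]]
  show "f \<in> borel_measurable borel" "(\<lambda>x. f1 x v) \<in> borel_measurable borel" "(\<lambda>x. f2 x v w) \<in> borel_measurable borel" .
qed

lemma (in prob_space) smooth_test_all_moments:
  assumes f: "smooth_test B m f f1 f2 f3" and B: "0 \<le> B" and X: "vector_moments M X"
  shows "all_moments M (\<lambda>\<omega>. f (X \<omega>))" "all_moments M (\<lambda>\<omega>. f1 (X \<omega>) v)" "all_moments M (\<lambda>\<omega>. f2 (X \<omega>) v w)"
proof -
  have \<rho>: "rho (X \<omega>) ^ m \<le> (1 + norm (X \<omega>)) ^ (2 * m)" for \<omega> by (rule rho_power_le) simp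
  have dom: "all_moments M (\<lambda>\<omega>. C * (1 + norm (X \<omega>)) ^ (2 * m))" for C
    by (intro all_moments_mult all_moments_const all_moments_power all_moments_add vector_moments_norm X)
  have gen: "all_moments M (\<lambda>\<omega>. g (X \<omega>))"
    if g: "g \<in> borel_measurable borel" "\<And>x. \<bar>g x\<bar> \<le> B * rho x ^ m * C" and C: "0 \<le> C" for g C
  proof (rule all_moments_bound[OF dom[of "B * C"]])
    show "(\<lambda>\<omega>. g (X \<omega>)) \<in> borel_measurable M"
      using measurable_compose[OF vector_moments_measurable[OF X] g(1)] .
    fix \<omega>
    have "\<bar>g (X \<omega>)\<bar> \<le> B * rho (X \<omega>) ^ m * C" by (rule g)
    also have "\<dots> \<le> B * (1 + norm (X \<omega>)) ^ (2 * m) * C" using \<rho> B C by (intro mult_right_mono mult_left_mono) auto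
    also have "\<dots> \<le> \<bar>B * C * (1 + norm (X \<omega>)) ^ (2 * m)\<bar>" by (simp add: mult_ac)
    finally show "\<bar>g (X \<omega>)\<bar> \<le> \<bar>B * C * (1 + norm (X \<omega>)) ^ (2 * m)\<bar>" .
  qed
  note b = f[unfolded smooth_test_def] and meas = smooth_test_measurable[OF f]
  show "all_moments M (\<lambda>\<omega>. f (X \<omega>))" by (rule gen[OF meas(1), of 1]) (use b in auto)
  show "all_moments M (\<lambda>\<omega>. f1 (X \<omega>) v)" by (rule gen[OF meas(2), of _ "norm v"]) (use b in auto)
  show "all_moments M (\<lambda>\<omega>. f2 (X \<omega>) v w)" by (rule gen[OF meas(3), of _ _ "norm v * norm w"]) (use b in \<open>auto simp: mult.assoc\<close>)
qed

lemma (in prob_space) coefficient_vector_moments: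
  fixes f :: "'b::euclidean_space \<Rightarrow> 'b"
  assumes f: "coefficient K q f f1 f2 f3" and K: "0 \<le> K" and X: "vector_moments M X"
  shows "vector_moments M (\<lambda>\<omega>. f (X \<omega>))"
proof -
  have "continuous_on UNIV f"
    using f unfolding coefficient_def jet3_def by (intro has_derivative_continuous_on[where f'=f1]) simp
  then have "f \<in> borel_measurable borel" by (rule borel_measurable_continuous_onI)
  then have m: "(\<lambda>\<omega>. f (X \<omega>)) \<in> borel_measurable M"
    using measurable_compose[OF vector_moments_measurable[OF X]] by blast
  moreover have "all_moments M (\<lambda>\<omega>. norm (f (X \<omega>)))"
  proof (rule all_moments_bound)
    show "all_moments M (\<lambda>\<omega>. K * (1 + norm (X \<omega>)))"
      by (intro all_moments_mult all_moments_const all_moments_add vector_moments_norm X)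
    show "\<bar>norm (f (X \<omega>))\<bar> \<le> \<bar>K * (1 + norm (X \<omega>))\<bar>" for \<omega>
      using f K unfolding coefficient_def by (simp add: abs_mult)
  qed (use m in simp)
  ultimately show ?thesis by (simp add: vector_moments_def)
qed

lemma jet3_bilinear_expansion:
  fixes f :: "'a::euclidean_space \<Rightarrow> real"
  assumes "jet3 f f1 f2 f3"
  shows "f2 y v w = (\<Sum>i\<in>Basis. \<Sum>j\<in>Basis. f2 y i j * ((v \<bullet> i) * (w \<bullet> j)))"
proof -
  note l = jet3_linear[OF assms]
  have "f2 y v w = (\<Sum>i\<in>Basis. (v \<bullet> i) *\<^sub>R f2 y i w)" by (rule linear_basis_expansion[OF l(2)])
  also have "\<dots> = (\<Sum>i\<in>Basis. (v \<bullet> i) *\<^sub>R (\<Sum>j\<in>Basis. (w \<bullet> j) *\<^sub>R f2 y i j))"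
    by (intro sum.cong refl arg_cong2[where f="(*\<^sub>R)"] linear_basis_expansion[OF l(3)])
  finally show ?thesis by (simp add: sum_distrib_left mult_ac)
qed

context diffusion
begin

text \<open>Expanding \<open>f1\<close> and \<open>f2\<close> in coordinates separates factors known
  before the call from coordinates of the answer. The kernel prescribes the first and second moments
  of the latter in terms of the query \<open>X\<close>, so the derivatives stay at \<open>U\<close>
  while drift and noise are taken at \<open>X\<close>.\<close>

lemma call_generator:
  fixes M :: "'w measure" and X Y U :: "'w \<Rightarrow> 'a" and r :: real
  assumes M: "prob_space M" and G: "oracle_kernel Mo e c G" and call: "oracle_call M F G X Y"
    and X: "vector_moments M X" and U: "vector_moments M U" "U \<in> borel_measurable F"
    and f: "smooth_test B m f f1 f2 f3" and B: "0 \<le> B"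
  shows "integrable M (\<lambda>\<omega>. - r * f1 (U \<omega>) (Y \<omega>) + r\<^sup>2 / 2 * f2 (U \<omega>) (Y \<omega>) (Y \<omega>))"
    and "integrable M (\<lambda>\<omega>. generator r c f1 f2 (U \<omega>) (X \<omega>))"
    and "(\<integral>\<omega>. - r * f1 (U \<omega>) (Y \<omega>) + r\<^sup>2 / 2 * f2 (U \<omega>) (Y \<omega>) (Y \<omega>) \<partial>M) =
      (\<integral>\<omega>. generator r c f1 f2 (U \<omega>) (X \<omega>) \<partial>M)"
proof -
  interpret prob_space M by (rule M)
  have j: "jet3 f f1 f2 f3" using f by (simp add: smooth_test_def)
  have K0: "0 \<le> K" using K by simp
  note l = jet3_linear[OF j] and am = smooth_test_all_moments[OF f B U(1)]
  have Y: "vector_moments M Y" by (rule call_moments[OF M G call X])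
  have bX: "vector_moments M (\<lambda>\<omega>. b (X \<omega>))" by (rule coefficient_vector_moments[OF drift K0 X])
  have sX: "i \<in> Basis \<Longrightarrow> vector_moments M (\<lambda>\<omega>. s i (X \<omega>))" for i
    by (rule coefficient_vector_moments[OF noise K0 X])
  have fF: "(\<lambda>\<omega>. f1 (U \<omega>) v) \<in> borel_measurable F" "(\<lambda>\<omega>. f2 (U \<omega>) v w) \<in> borel_measurable F" for v w
    using measurable_compose[OF U(2) smooth_test_measurable(2)[OF f]]
      measurable_compose[OF U(2) smooth_test_measurable(3)[OF f]] by auto
  note int = all_moments_integrable
  have e1: "f1 (U \<omega>) v = (\<Sum>i\<in>Basis. f1 (U \<omega>) i * (v \<bullet> i))" for \<omega> v
    using linear_basis_expansion[OF l(1), of "U \<omega>" v] by (simp add: mult.commute)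
  have e2: "f2 (U \<omega>) v w = (\<Sum>i\<in>Basis. \<Sum>k\<in>Basis. f2 (U \<omega>) i k * ((v \<bullet> i) * (w \<bullet> k)))" for \<omega> v w
    by (rule jet3_bilinear_expansion[OF j])
  have i1: "integrable M (\<lambda>\<omega>. f1 (U \<omega>) i * (Z \<omega> \<bullet> i))" if "vector_moments M Z" for Z i
    by (intro int all_moments_mult am vector_moments_inner that)
  have i2: "integrable M (\<lambda>\<omega>. f2 (U \<omega>) i k * ((Z \<omega> \<bullet> i) * (Z \<omega> \<bullet> k)))" if "vector_moments M Z" for Z i k
    by (intro int all_moments_mult am vector_moments_inner that)
  have I1: "integrable M (\<lambda>\<omega>. f1 (U \<omega>) (Z \<omega>))" if "vector_moments M Z" for Z
  proof -
    have "integrable M (\<lambda>\<omega>. \<Sum>i\<in>Basis. f1 (U \<omega>) i * (Z \<omega> \<bullet> i))" using i1[OF that] by auto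
    then show ?thesis unfolding e1[symmetric] .
  qed
  have I2: "integrable M (\<lambda>\<omega>. f2 (U \<omega>) (Z \<omega>) (Z \<omega>))" if "vector_moments M Z" for Z
  proof -
    have "integrable M (\<lambda>\<omega>. \<Sum>i\<in>Basis. \<Sum>k\<in>Basis. f2 (U \<omega>) i k * ((Z \<omega> \<bullet> i) * (Z \<omega> \<bullet> k)))"
      using i2[OF that] by auto
    then show ?thesis unfolding e2[symmetric] .
  qed
  have Q: "integrable M (\<lambda>\<omega>. f2 (U \<omega>) (b (X \<omega>)) (b (X \<omega>)) + c * (\<Sum>l\<in>Basis. f2 (U \<omega>) (s l (X \<omega>)) (s l (X \<omega>))))"
    using I2[OF bX] I2[OF sX] by auto
  show "integrable M (\<lambda>\<omega>. - r * f1 (U \<omega>) (Y \<omega>) + r\<^sup>2 / 2 * f2 (U \<omega>) (Y \<omega>) (Y \<omega>))"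
    using I1[OF Y] I2[OF Y] by (intro Bochner_Integration.integrable_add integrable_mult_right)
  show "integrable M (\<lambda>\<omega>. generator r c f1 f2 (U \<omega>) (X \<omega>))"
    unfolding generator_def
    by (rule Bochner_Integration.integrable_add[OF integrable_mult_right[OF I1[OF bX]] integrable_mult_right[OF Q]])
  have E1: "(\<integral>\<omega>. f1 (U \<omega>) (Y \<omega>) \<partial>M) = (\<integral>\<omega>. f1 (U \<omega>) (b (X \<omega>)) \<partial>M)"
  proof -
    have sums: "(\<integral>\<omega>. f1 (U \<omega>) (Z \<omega>) \<partial>M) = (\<Sum>i\<in>Basis. \<integral>\<omega>. f1 (U \<omega>) i * (Z \<omega> \<bullet> i) \<partial>M)"
      if "vector_moments M Z" for Z
    proof -
      have "(\<integral>\<omega>. f1 (U \<omega>) (Z \<omega>) \<partial>M) = (\<integral>\<omega>. (\<Sum>i\<in>Basis. f1 (U \<omega>) i * (Z \<omega> \<bullet> i)) \<partial>M)"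
        by (intro Bochner_Integration.integral_cong refl e1)
      also have "\<dots> = (\<Sum>i\<in>Basis. \<integral>\<omega>. f1 (U \<omega>) i * (Z \<omega> \<bullet> i) \<partial>M)"
        by (rule Bochner_Integration.integral_sum) (rule i1[OF that])
      finally show ?thesis .
    qed
    show ?thesis unfolding sums[OF Y] sums[OF bX]
      by (intro sum.cong refl call_inner[OF M G call X] fF am)
  qed
  \<comment> \<open>Pairing the bilinear form with the sum of the dyads of the vectors
    \<open>t l\<close> gives the sum of its values on these vectors. This is how the covariance
    becomes a sum over columns.\<close>
  have alg: "(\<Sum>i\<in>Basis. \<Sum>k\<in>Basis. f2 (U \<omega>) i k * ((v \<bullet> i) * (v \<bullet> k) + c * (\<Sum>l\<in>Basis. (t l \<bullet> i) * (t l \<bullet> k)))) =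
      f2 (U \<omega>) v v + c * (\<Sum>l\<in>Basis. f2 (U \<omega>) (t l) (t l))" for \<omega> v and t :: "'a \<Rightarrow> 'a"
  proof -
    have "(\<Sum>l\<in>(Basis::'a set). f2 (U \<omega>) (t l) (t l)) =
        (\<Sum>i\<in>Basis. \<Sum>k\<in>Basis. \<Sum>l\<in>(Basis::'a set). f2 (U \<omega>) i k * ((t l \<bullet> i) * (t l \<bullet> k)))"
    proof -
      have "(\<Sum>l\<in>(Basis::'a set). f2 (U \<omega>) (t l) (t l)) =
        (\<Sum>l\<in>(Basis::'a set). \<Sum>i\<in>Basis. \<Sum>k\<in>Basis. f2 (U \<omega>) i k * ((t l \<bullet> i) * (t l \<bullet> k)))"
        by (intro sum.cong refl e2)
      also have "\<dots> = (\<Sum>i\<in>Basis. \<Sum>l\<in>(Basis::'a set). \<Sum>k\<in>Basis. f2 (U \<omega>) i k * ((t l \<bullet> i) * (t l \<bullet> k)))"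
        by (rule sum.swap)
      also have "\<dots> = (\<Sum>i\<in>Basis. \<Sum>k\<in>Basis. \<Sum>l\<in>(Basis::'a set). f2 (U \<omega>) i k * ((t l \<bullet> i) * (t l \<bullet> k)))"
        by (intro sum.cong refl sum.swap)
      finally show ?thesis .
    qed
    then have "f2 (U \<omega>) v v + c * (\<Sum>l\<in>Basis. f2 (U \<omega>) (t l) (t l)) =
      (\<Sum>i\<in>Basis. \<Sum>k\<in>Basis. f2 (U \<omega>) i k * ((v \<bullet> i) * (v \<bullet> k)))
      + c * (\<Sum>i\<in>Basis. \<Sum>k\<in>Basis. \<Sum>l\<in>(Basis::'a set). f2 (U \<omega>) i k * ((t l \<bullet> i) * (t l \<bullet> k)))"
      using e2[of \<omega> v v] by simp
    then show ?thesis
      by (simp add: distrib_left sum.distrib sum_distrib_left mult.left_commute)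
  qed
  have E2: "(\<integral>\<omega>. f2 (U \<omega>) (Y \<omega>) (Y \<omega>) \<partial>M) =
    (\<integral>\<omega>. f2 (U \<omega>) (b (X \<omega>)) (b (X \<omega>)) + c * (\<Sum>l\<in>Basis. f2 (U \<omega>) (s l (X \<omega>)) (s l (X \<omega>))) \<partial>M)"
  proof -
    let ?V = "\<lambda>i k \<omega>. (b (X \<omega>) \<bullet> i) * (b (X \<omega>) \<bullet> k) + c * (\<Sum>l\<in>Basis. (s l (X \<omega>) \<bullet> i) * (s l (X \<omega>) \<bullet> k))"
    have i3: "integrable M (\<lambda>\<omega>. f2 (U \<omega>) i k * ?V i k \<omega>)" for i k
    proof -
      have "integrable M (\<lambda>\<omega>. f2 (U \<omega>) i k * ((b (X \<omega>) \<bullet> i) * (b (X \<omega>) \<bullet> k))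
          + c * (\<Sum>l\<in>Basis. f2 (U \<omega>) i k * ((s l (X \<omega>) \<bullet> i) * (s l (X \<omega>) \<bullet> k))))"
        using i2[OF bX] i2[OF sX] by auto
      then show ?thesis by (simp add: distrib_left sum_distrib_left mult.left_commute)
    qed
    have "(\<integral>\<omega>. f2 (U \<omega>) (Y \<omega>) (Y \<omega>) \<partial>M) = (\<Sum>i\<in>Basis. \<Sum>k\<in>Basis. \<integral>\<omega>. f2 (U \<omega>) i k * ((Y \<omega> \<bullet> i) * (Y \<omega> \<bullet> k)) \<partial>M)"
    proof -
      have "(\<integral>\<omega>. f2 (U \<omega>) (Y \<omega>) (Y \<omega>) \<partial>M) = (\<integral>\<omega>. (\<Sum>i\<in>Basis. \<Sum>k\<in>Basis. f2 (U \<omega>) i k * ((Y \<omega> \<bullet> i) * (Y \<omega> \<bullet> k))) \<partial>M)"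
        by (intro Bochner_Integration.integral_cong refl e2)
      then show ?thesis using i2[OF Y] by (simp add: Bochner_Integration.integral_sum)
    qed
    also have "\<dots> = (\<Sum>i\<in>Basis. \<Sum>k\<in>Basis. \<integral>\<omega>. f2 (U \<omega>) i k * ?V i k \<omega> \<partial>M)"
      by (intro sum.cong refl call_inner_inner[OF M G call X] fF am)
    also have "\<dots> = (\<integral>\<omega>. (\<Sum>i\<in>Basis. \<Sum>k\<in>Basis. f2 (U \<omega>) i k * ?V i k \<omega>) \<partial>M)"
      using i3 by (simp add: Bochner_Integration.integral_sum)
    finally show ?thesis unfolding alg .
  qed
  show "(\<integral>\<omega>. - r * f1 (U \<omega>) (Y \<omega>) + r\<^sup>2 / 2 * f2 (U \<omega>) (Y \<omega>) (Y \<omega>) \<partial>M) =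
      (\<integral>\<omega>. generator r c f1 f2 (U \<omega>) (X \<omega>) \<partial>M)"
    unfolding generator_def
    unfolding Bochner_Integration.integral_add[OF integrable_mult_right[OF I1[OF Y]] integrable_mult_right[OF I2[OF Y]]]
      Bochner_Integration.integral_add[OF integrable_mult_right[OF I1[OF bX]] integrable_mult_right[OF Q]]
    by (simp only: integral_mult_right_zero E1 E2)
qed


lemma step_measurable:
  assumes "f \<in> borel_measurable borel"
  shows "step a d f \<in> borel_measurable borel"
proof -
  have c: "continuous_on UNIV g" if "coefficient K q g g1 g2 g3" for g :: "'a \<Rightarrow> 'a" and g1 g2 g3
    using that unfolding coefficient_def jet3_def
    by (intro has_derivative_continuous_on[where f'=g1]) simp
  have "(\<lambda>x. f (x - a *\<^sub>R b x + d *\<^sub>R s i x) + f (x - a *\<^sub>R b x - d *\<^sub>R s i x)) \<in> borel_measurable borel"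
    if "i \<in> Basis" for i
    by (intro borel_measurable_add measurable_compose[OF _ assms] borel_measurable_continuous_onI
        continuous_intros c[OF drift] c[OF noise[OF that]])
  then show ?thesis unfolding step_def by measurable
qed

text \<open>The oracle step is compared with the generator at \<open>y k\<close> and query
  \<open>x k\<close>, the chain step with the generator at \<open>y k\<close> alone. Three errors
  remain: the two Taylor remainders \<open>rem\<close> and \<open>st\<close> and the displacement
  \<open>gd\<close> of the query. The remainders of order \<open>e ^ 3\<close> fit into
  \<open>e\<^sup>2 * (e / \<kappa>)\<close> because \<open>\<kappa> \<le> 1\<close>.\<close>

lemma run_one_step:
  fixes R :: real
  assumes run: "momentum_run R l Mo Mi x0 e \<kappa> c M G F a d \<beta> g m y x"
    and f: "smooth_test B p f f1 f2 f3" and B: "0 \<le> B" and R: "1 \<le> R" and Mo: "\<And>p. 0 \<le> Mo p"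
  defines "S \<equiv> \<lambda>k \<omega>. 1 + norm (x k \<omega>) + norm (y k \<omega>) + norm ((e / \<kappa>) *\<^sub>R m k \<omega>)"
    and "P \<equiv> R * DIM('a)"
  shows "\<bar>(\<integral>\<omega>. f (y (Suc k) \<omega>) \<partial>M) - (\<integral>\<omega>. step (a k) (a k * sqrt (c * DIM('a))) f (y k \<omega>) \<partial>M)\<bar> \<le>
    (B * 4 ^ p * (R ^ 3 * Mo 3 + R ^ (2 * p + 3) * Mo (2 * p + 3))
      + 2 * B * K\<^sup>2 * (P + P\<^sup>2 + P\<^sup>2 * DIM('a)) * R
      + B * (1 + 2 * P * K) ^ (2 * p) * (2 * P * K) ^ 3)
    * (e\<^sup>2 * (e / \<kappa>)) * (\<integral>\<omega>. S k \<omega> ^ (2 * p + 3) \<partial>M)"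
proof -
  interpret prob_space M by (rule run_prob_space[OF run])
  note sc = run_scales[OF run] and rt = run_rates[OF run, of k] and vm = run_vector_moments[OF run]
    and ratio = run_ratio[OF run]
  have R0: "0 \<le> R" using R by simp
  define \<gamma> where "\<gamma> = e / \<kappa>"
  define J where "J = (\<integral>\<omega>. S k \<omega> ^ (2 * p + 3) \<partial>M)"
  define r where "r = a k"
  define dd where "dd = r * sqrt (c * DIM('a))"
  have N1: "1 \<le> real DIM('a)" by (metis DIM_positive One_nat_def Suc_leI of_nat_1 of_nat_mono)
  have r: "0 \<le> r" "r \<le> R * e\<^sup>2" using rt by (auto simp: r_def)
  have P: "R \<le> P" "0 \<le> P" using N1 R mult_left_mono[OF N1 R0] by (auto simp: P_def)
  have e1: "e \<le> 1" "0 \<le> e" using sc by auto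
  have eg: "e \<le> \<gamma>" "0 \<le> \<gamma>" using sc by (auto simp: \<gamma>_def field_simps intro: mult_left_le)
  have rP: "\<bar>r\<bar> \<le> P * e\<^sup>2" using r P(1) mult_right_mono[OF P(1), of "e\<^sup>2"] by simp
  have dP: "\<bar>dd\<bar> \<le> P * e"
    using run_noise_scale[OF run, of k] by (simp add: dd_def r_def P_def)
  have dc: "dd\<^sup>2 = r\<^sup>2 * c * DIM('a)" using sc by (simp add: dd_def power_mult_distrib)
  have rc: "r\<^sup>2 * c \<le> P\<^sup>2 * e\<^sup>2"
  proof -
    have "r\<^sup>2 * c \<le> (R * e\<^sup>2)\<^sup>2 * c" using r sc by (intro mult_right_mono power_mono) auto
    also have "\<dots> = R\<^sup>2 * e\<^sup>2 * (c * e\<^sup>2)" by (simp add: power2_eq_square mult_ac)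
    also have "\<dots> \<le> P\<^sup>2 * e\<^sup>2 * 1" using sc P R0 by (intro mult_mono power_mono) auto
    finally show ?thesis by simp
  qed
  define rem where "rem \<omega> = f (y k \<omega> + (- r) *\<^sub>R g k \<omega>) - f (y k \<omega>) - f1 (y k \<omega>) ((- r) *\<^sub>R g k \<omega>)
    - f2 (y k \<omega>) ((- r) *\<^sub>R g k \<omega>) ((- r) *\<^sub>R g k \<omega>) / 2" for \<omega>
  define lin where "lin \<omega> = - r * f1 (y k \<omega>) (g k \<omega>) + r\<^sup>2 / 2 * f2 (y k \<omega>) (g k \<omega>) (g k \<omega>)" for \<omega>
  have j: "jet3 f f1 f2 f3" using f by (simp add: smooth_test_def)
  note lj = jet3_linear[OF j]
  have frem: "f (y k \<omega> + (- r) *\<^sub>R g k \<omega>) = rem \<omega> + f (y k \<omega>) + lin \<omega>" for \<omega>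
    unfolding rem_def lin_def linear_scale[OF lj(1)] linear_scale[OF lj(2)] linear_scale[OF lj(3)]
    by (simp add: power2_eq_square)
  have lin: "integrable M lin" "integrable M (\<lambda>\<omega>. generator r c f1 f2 (y k \<omega>) (x k \<omega>))"
    "(\<integral>\<omega>. lin \<omega> \<partial>M) = (\<integral>\<omega>. generator r c f1 f2 (y k \<omega>) (x k \<omega>) \<partial>M)"
    unfolding lin_def using call_generator[OF run_prob_space[OF run] run_kernel[OF run] run_call[OF run] vm(3) vm(1) run_adapted(1)[OF run] f B]
    by auto
  have yn: "vector_moments M (\<lambda>\<omega>. y k \<omega> + (- r) *\<^sub>R g k \<omega>)" by (intro vector_moments_add vector_moments_scaleR vm)
  have fy: "integrable M (\<lambda>\<omega>. f (y k \<omega>))" and fyn: "integrable M (\<lambda>\<omega>. f (y k \<omega> + (- r) *\<^sub>R g k \<omega>))"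
    using smooth_test_all_moments(1)[OF f B] vm(1) yn by (auto intro: all_moments_integrable)
  have irem: "integrable M rem"
  proof -
    have "integrable M (\<lambda>\<omega>. f (y k \<omega> + (- r) *\<^sub>R g k \<omega>) - f (y k \<omega>) - lin \<omega>)" using fy fyn lin by auto
    then show ?thesis unfolding frem by simp
  qed
  have amS: "all_moments M (S k)" unfolding S_def
    by (intro all_moments_add all_moments_const vector_moments_norm vm vector_moments_scaleR)
  have S1: "1 \<le> S k \<omega>" for \<omega> by (simp add: S_def add_nonneg_nonneg)
  have S0: "0 \<le> S k \<omega>" for \<omega> using S1[of \<omega>] by linarith
  have iS: "integrable M (\<lambda>\<omega>. S k \<omega> ^ i)" for i by (intro all_moments_integrable all_moments_power amS)
  have J0: "0 \<le> J" unfolding J_def using S0 by (intro Bochner_Integration.integral_nonneg) auto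
  have Sx: "1 + norm (x k \<omega>) \<le> S k \<omega>" "1 + norm (y k \<omega>) \<le> S k \<omega>" "norm ((e / \<kappa>) *\<^sub>R m k \<omega>) \<le> S k \<omega>"
    "1 + norm (x k \<omega>) + norm (y k \<omega>) \<le> S k \<omega>" for \<omega>
    by (auto simp: S_def)
  have e3: "e ^ 3 \<le> e\<^sup>2 * \<gamma>" using eg mult_left_mono[OF eg(1), of "e\<^sup>2"] by (simp add: power3_eq_cube power2_eq_square)

  \<comment> \<open>Every term of the remainder contains the gradient to a power
    \<open>h \<ge> 3\<close>. The factor \<open>r ^ h\<close> of order \<open>e ^ (2 * h)\<close>
    against moments of order \<open>1 / e ^ h\<close> leaves \<open>e ^ h\<close>, which is at most
    \<open>e ^ 3\<close>.\<close>
  have part1: "\<bar>\<integral>\<omega>. rem \<omega> \<partial>M\<bar> \<le> B * 4 ^ p * (R ^ 3 * Mo 3 + R ^ (2 * p + 3) * Mo (2 * p + 3)) * (e\<^sup>2 * \<gamma>) * J"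
  proof -
    have ig: "integrable M (\<lambda>\<omega>. (1 + norm (y k \<omega>)) ^ i * norm (g k \<omega>) ^ h)" for i h
      by (intro all_moments_integrable all_moments_mult all_moments_power all_moments_add all_moments_const vector_moments_norm vm)
    have gb: "r ^ h * (\<integral>\<omega>. (1 + norm (y k \<omega>)) ^ i * norm (g k \<omega>) ^ h \<partial>M) \<le> R ^ h * Mo h * (e\<^sup>2 * \<gamma>) * J"
      if h: "3 \<le> h" "i + h = 2 * p + 3" for i h
    proof -
      have F: "(\<lambda>\<omega>. (1 + norm (y k \<omega>)) ^ i) \<in> borel_measurable (F k)"
        using run_adapted(1)[OF run] by measurable
      have am: "all_moments M (\<lambda>\<omega>. (1 + norm (y k \<omega>)) ^ i)"
        by (intro all_moments_power all_moments_add all_moments_const vector_moments_norm vm)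
      have "(\<integral>\<omega>. (1 + norm (y k \<omega>)) ^ i * norm (g k \<omega>) ^ h \<partial>M) \<le>
          Mo h / e ^ h * (\<integral>\<omega>. (1 + norm (y k \<omega>)) ^ i * (1 + norm (x k \<omega>)) ^ h \<partial>M)"
        by (rule call_norm_power[OF run_prob_space[OF run] run_kernel[OF run] run_call[OF run] vm(3) F am]) simp
      also have "\<dots> \<le> Mo h / e ^ h * J"
      proof (rule mult_left_mono)
        show "(\<integral>\<omega>. (1 + norm (y k \<omega>)) ^ i * (1 + norm (x k \<omega>)) ^ h \<partial>M) \<le> J"
          unfolding J_def
        proof (rule integral_mono)
          show "integrable M (\<lambda>\<omega>. (1 + norm (y k \<omega>)) ^ i * (1 + norm (x k \<omega>)) ^ h)"
            by (intro all_moments_integrable all_moments_mult all_moments_power all_moments_add all_moments_const vector_moments_norm vm)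
          fix \<omega>
          have "(1 + norm (y k \<omega>)) ^ i * (1 + norm (x k \<omega>)) ^ h \<le> S k \<omega> ^ i * S k \<omega> ^ h"
            using Sx S0 by (intro mult_mono power_mono) auto
          then show "(1 + norm (y k \<omega>)) ^ i * (1 + norm (x k \<omega>)) ^ h \<le> S k \<omega> ^ (2 * p + 3)"
            using h(2) by (simp flip: power_add)
        qed (rule iS)
      qed (use Mo sc in simp)
      finally have "r ^ h * (\<integral>\<omega>. (1 + norm (y k \<omega>)) ^ i * norm (g k \<omega>) ^ h \<partial>M) \<le> (R * e\<^sup>2) ^ h * (Mo h / e ^ h * J)"
        using r R0 by (intro mult_mono power_mono) (auto intro!: Bochner_Integration.integral_nonneg)
      also have "(R * e\<^sup>2) ^ h = R ^ h * (e ^ h * e ^ h)" by (simp add: power2_eq_square power_mult_distrib)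
      also have "R ^ h * (e ^ h * e ^ h) * (Mo h / e ^ h * J) = R ^ h * Mo h * e ^ h * J" using sc by simp
      also have "\<dots> \<le> R ^ h * Mo h * (e\<^sup>2 * \<gamma>) * J"
      proof (intro mult_right_mono mult_left_mono J0)
        have "e ^ h \<le> e ^ 3" using e1 h by (intro power_decreasing) auto
        then show "e ^ h \<le> e\<^sup>2 * \<gamma>" using e3 by linarith
      qed (use R0 Mo in simp)
      finally show ?thesis .
    qed
    have "\<bar>\<integral>\<omega>. rem \<omega> \<partial>M\<bar> \<le> (\<integral>\<omega>. \<bar>rem \<omega>\<bar> \<partial>M)" by (rule integral_abs_bound)
    also have "\<dots> \<le> (\<integral>\<omega>. B * 4 ^ p * (r ^ 3 * ((1 + norm (y k \<omega>)) ^ (2 * p) * norm (g k \<omega>) ^ 3)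
        + r ^ (2 * p + 3) * ((1 + norm (y k \<omega>)) ^ 0 * norm (g k \<omega>) ^ (2 * p + 3))) \<partial>M)"
    proof (rule integral_mono)
      show "integrable M (\<lambda>\<omega>. \<bar>rem \<omega>\<bar>)" using irem by simp
      show "integrable M (\<lambda>\<omega>. B * 4 ^ p * (r ^ 3 * ((1 + norm (y k \<omega>)) ^ (2 * p) * norm (g k \<omega>) ^ 3)
        + r ^ (2 * p + 3) * ((1 + norm (y k \<omega>)) ^ 0 * norm (g k \<omega>) ^ (2 * p + 3))))"
        by (intro integrable_mult_right Bochner_Integration.integrable_add ig)
      fix \<omega>
      define D where "D = r * norm (g k \<omega>)"
      have D0: "0 \<le> D" using r by (simp add: D_def)
      have nD: "norm ((- r) *\<^sub>R g k \<omega>) = D" using r by (simp add: D_def)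
      have "\<bar>rem \<omega>\<bar> \<le> B * (1 + norm (y k \<omega>) + D) ^ (2 * p) * D ^ 3"
        using smooth_test_taylor[OF f B, of "y k \<omega>" "(- r) *\<^sub>R g k \<omega>"] unfolding rem_def nD .
      \<comment> \<open>The power of the sum is split so that the known factor and the gradient
        appear as a product of powers, with total degree \<open>2 * p + 3\<close> in both terms;
        this is the form needed for conditioning.\<close>
      also have "\<dots> \<le> B * (2 ^ (2 * p) * ((1 + norm (y k \<omega>)) ^ (2 * p) + D ^ (2 * p))) * D ^ 3"
        using B D0 by (intro mult_right_mono mult_left_mono power_sum_le) auto
      also have "\<dots> = B * 4 ^ p * (D ^ 3 * (1 + norm (y k \<omega>)) ^ (2 * p) + D ^ (2 * p + 3))"
      proof -
        have "(2 :: real) ^ (2 * p) = 4 ^ p" by (simp add: power_mult)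
        then show ?thesis by (simp only: power_add[of D] distrib_left distrib_right mult_ac)
      qed
      also have "\<dots> = B * 4 ^ p * (r ^ 3 * ((1 + norm (y k \<omega>)) ^ (2 * p) * norm (g k \<omega>) ^ 3)
        + r ^ (2 * p + 3) * ((1 + norm (y k \<omega>)) ^ 0 * norm (g k \<omega>) ^ (2 * p + 3)))"
        unfolding D_def power_mult_distrib by (simp add: mult_ac)
      finally show "\<bar>rem \<omega>\<bar> \<le> B * 4 ^ p * (r ^ 3 * ((1 + norm (y k \<omega>)) ^ (2 * p) * norm (g k \<omega>) ^ 3)
        + r ^ (2 * p + 3) * ((1 + norm (y k \<omega>)) ^ 0 * norm (g k \<omega>) ^ (2 * p + 3)))" .
    qed
    also have "\<dots> = B * 4 ^ p * (r ^ 3 * (\<integral>\<omega>. (1 + norm (y k \<omega>)) ^ (2 * p) * norm (g k \<omega>) ^ 3 \<partial>M)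
        + r ^ (2 * p + 3) * (\<integral>\<omega>. (1 + norm (y k \<omega>)) ^ 0 * norm (g k \<omega>) ^ (2 * p + 3) \<partial>M))"
      unfolding integral_mult_right_zero
        Bochner_Integration.integral_add[OF integrable_mult_right[OF ig] integrable_mult_right[OF ig]] ..
    also have "\<dots> \<le> B * 4 ^ p * (R ^ 3 * Mo 3 * (e\<^sup>2 * \<gamma>) * J + R ^ (2 * p + 3) * Mo (2 * p + 3) * (e\<^sup>2 * \<gamma>) * J)"
      using B by (intro mult_left_mono add_mono gb) auto
    also have "\<dots> = B * 4 ^ p * (R ^ 3 * Mo 3 + R ^ (2 * p + 3) * Mo (2 * p + 3)) * (e\<^sup>2 * \<gamma>) * J"
      by (simp only: distrib_left distrib_right mult.assoc)
    finally show ?thesis .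
  qed

  define gd where "gd \<omega> = generator r c f1 f2 (y k \<omega>) (x k \<omega>) - generator r c f1 f2 (y k \<omega>) (y k \<omega>)" for \<omega>
  define st where "st \<omega> = step r dd f (y k \<omega>) - f (y k \<omega>) - generator r c f1 f2 (y k \<omega>) (y k \<omega>)" for \<omega>
  define C2 where "C2 = 2 * B * K\<^sup>2 * (P + P\<^sup>2 + P\<^sup>2 * DIM('a))"
  define C3 where "C3 = B * (1 + 2 * P * K) ^ (2 * p) * (2 * P * K) ^ 3"
  have C20: "0 \<le> C2" using B P by (simp add: C2_def)
  have C30: "0 \<le> C3" using B P K by (simp add: C3_def)
  have gdb: "\<bar>gd \<omega>\<bar> \<le> C2 * R * (e\<^sup>2 * \<gamma>) * S k \<omega> ^ (2 * p + 3)" if \<omega>: "\<omega> \<in> space M" for \<omega>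
  proof -
    have "\<bar>gd \<omega>\<bar> \<le> C2 * e\<^sup>2 * (1 + norm (x k \<omega>) + norm (y k \<omega>)) ^ (2 * p + 1) * norm (x k \<omega> - y k \<omega>)"
      unfolding gd_def C2_def by (rule generator_diff[OF f B P(2) e1(2,1) rP sc(5) rc])
    also have "\<dots> \<le> C2 * e\<^sup>2 * S k \<omega> ^ (2 * p + 1) * (R * \<gamma> * S k \<omega>)"
    proof (intro mult_mono mult_left_mono power_mono Sx)
      have "R * \<gamma> * norm ((e / \<kappa>) *\<^sub>R m k \<omega>) \<le> R * \<gamma> * S k \<omega>" using R0 eg Sx by (intro mult_left_mono) auto
      then show "norm (x k \<omega> - y k \<omega>) \<le> R * \<gamma> * S k \<omega>"
        using run_difference[OF run \<omega> R0, of k] unfolding \<gamma>_def by linarith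
    qed (use C20 S0 e1 in auto)
    also have "\<dots> = C2 * R * (e\<^sup>2 * \<gamma>) * S k \<omega> ^ (2 * p + 2)" by (simp add: power_add power2_eq_square mult_ac)
    also have "\<dots> \<le> C2 * R * (e\<^sup>2 * \<gamma>) * S k \<omega> ^ (2 * p + 3)"
      using C20 R0 eg S1 by (intro mult_left_mono power_increasing) auto
    finally show ?thesis .
  qed
  have stb: "\<bar>st \<omega>\<bar> \<le> C3 * (e\<^sup>2 * \<gamma>) * S k \<omega> ^ (2 * p + 3)" for \<omega>
  proof -
    have "\<bar>st \<omega>\<bar> \<le> C3 * e ^ 3 * (1 + norm (y k \<omega>)) ^ (2 * p + 3)"
      unfolding st_def C3_def by (rule step_generator[OF f B P(2) e1(2,1) rP dP dc])
    also have "\<dots> \<le> C3 * (e\<^sup>2 * \<gamma>) * S k \<omega> ^ (2 * p + 3)"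
      using C30 eg Sx S0 by (intro mult_mono mult_left_mono power_mono e3) auto
    finally show ?thesis .
  qed
  \<comment> \<open>Integrability with query and base point both at \<open>y k\<close> is deduced
    from that with query \<open>x k\<close>: the difference \<open>gd\<close> is dominated by a
    power of \<open>S k\<close>. Measurability is obtained separately from the coordinate
    expansions.\<close>
  have gyy: "integrable M (\<lambda>\<omega>. generator r c f1 f2 (y k \<omega>) (y k \<omega>))"
  proof -
    have meas: "(\<lambda>\<omega>. generator r c f1 f2 (y k \<omega>) (y k \<omega>)) \<in> borel_measurable M"
    proof -
      have bl: "f2 v w w' = (\<Sum>i\<in>Basis. \<Sum>k\<in>Basis. f2 v i k * ((w \<bullet> i) * (w' \<bullet> k)))" for v w w'
        by (rule jet3_bilinear_expansion[OF j])
      have l1: "f1 v w = (\<Sum>i\<in>Basis. (w \<bullet> i) *\<^sub>R f1 v i)" for v w by (rule linear_basis_expansion[OF lj(1)])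
      have vb: "vector_moments M (\<lambda>\<omega>. b (y k \<omega>))" and vs: "i \<in> Basis \<Longrightarrow> vector_moments M (\<lambda>\<omega>. s i (y k \<omega>))" for i
        using coefficient_vector_moments[OF drift _ vm(1)] coefficient_vector_moments[OF noise _ vm(1)] K by auto
      note am = smooth_test_all_moments[OF f B vm(1), THEN all_moments_measurable]
      have f2m: "(\<lambda>\<omega>. f2 (y k \<omega>) (w \<omega>) (w \<omega>)) \<in> borel_measurable M" if "vector_moments M w" for w
      proof -
        have "(\<lambda>\<omega>. \<Sum>i\<in>Basis. \<Sum>h\<in>Basis. f2 (y k \<omega>) i h * ((w \<omega> \<bullet> i) * (w \<omega> \<bullet> h))) \<in> borel_measurable M"
          using am vector_moments_measurable[OF that] by measurable
        then show ?thesis unfolding bl[symmetric] .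
      qed
      have f1m: "(\<lambda>\<omega>. f1 (y k \<omega>) (b (y k \<omega>))) \<in> borel_measurable M"
      proof -
        have "(\<lambda>\<omega>. \<Sum>i\<in>Basis. (b (y k \<omega>) \<bullet> i) *\<^sub>R f1 (y k \<omega>) i) \<in> borel_measurable M"
          using am vector_moments_measurable[OF vb] by measurable
        then show ?thesis unfolding l1[symmetric] .
      qed
      show ?thesis unfolding generator_def using f1m f2m[OF vb] f2m[OF vs] by measurable
    qed
    have "integrable M gd"
    proof (rule Bochner_Integration.integrable_bound[OF integrable_mult_right[OF iS[of "2 * p + 3"], of "C2 * R * (e\<^sup>2 * \<gamma>)"]])
      show "gd \<in> borel_measurable M" unfolding gd_def using borel_measurable_integrable[OF lin(2)] meas by measurable
      show "AE \<omega> in M. norm (gd \<omega>) \<le> norm (C2 * R * (e\<^sup>2 * \<gamma>) * S k \<omega> ^ (2 * p + 3))"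
        using gdb by (intro AE_I2) (auto intro: order_trans[OF _ abs_ge_self])
    qed
    then have "integrable M (\<lambda>\<omega>. generator r c f1 f2 (y k \<omega>) (x k \<omega>) - gd \<omega>)" using lin(2) by auto
    then show ?thesis by (simp add: gd_def)
  qed
  have igd: "integrable M gd" unfolding gd_def using gyy lin(2) by auto
  have ist: "integrable M st"
  proof (rule Bochner_Integration.integrable_bound[OF integrable_mult_right[OF iS[of "2 * p + 3"], of "C3 * (e\<^sup>2 * \<gamma>)"]])
    show "st \<in> borel_measurable M"
      unfolding st_def
      using measurable_compose[OF vector_moments_measurable[OF vm(1)] step_measurable[OF smooth_test_measurable(1)[OF f]]]
        borel_measurable_integrable[OF gyy] borel_measurable_integrable[OF fy] by measurable
    show "AE \<omega> in M. norm (st \<omega>) \<le> norm (C3 * (e\<^sup>2 * \<gamma>) * S k \<omega> ^ (2 * p + 3))"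
      using stb by (intro AE_I2) (auto intro: order_trans[OF _ abs_ge_self])
  qed
  have "\<bar>\<integral>\<omega>. gd \<omega> \<partial>M\<bar> \<le> (\<integral>\<omega>. C2 * R * (e\<^sup>2 * \<gamma>) * S k \<omega> ^ (2 * p + 3) \<partial>M)"
    using igd gdb iS by (intro order_trans[OF integral_abs_bound] integral_mono integrable_abs integrable_mult_right)
  then have part2: "\<bar>\<integral>\<omega>. gd \<omega> \<partial>M\<bar> \<le> C2 * R * (e\<^sup>2 * \<gamma>) * J" by (simp add: J_def)
  have "\<bar>\<integral>\<omega>. st \<omega> \<partial>M\<bar> \<le> (\<integral>\<omega>. C3 * (e\<^sup>2 * \<gamma>) * S k \<omega> ^ (2 * p + 3) \<partial>M)"
    using ist stb iS by (intro order_trans[OF integral_abs_bound] integral_mono integrable_abs integrable_mult_right)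
  then have part3: "\<bar>\<integral>\<omega>. st \<omega> \<partial>M\<bar> \<le> C3 * (e\<^sup>2 * \<gamma>) * J" by (simp add: J_def)
  have "(\<integral>\<omega>. f (y (Suc k) \<omega>) \<partial>M) = (\<integral>\<omega>. rem \<omega> + f (y k \<omega>) + lin \<omega> \<partial>M)"
    by (intro Bochner_Integration.integral_cong refl) (simp add: run_equations(1)[OF run] r_def frem[symmetric])
  also have "\<dots> = (\<integral>\<omega>. rem \<omega> \<partial>M) + (\<integral>\<omega>. f (y k \<omega>) \<partial>M) + (\<integral>\<omega>. generator r c f1 f2 (y k \<omega>) (x k \<omega>) \<partial>M)"
    using irem fy lin by simp
  finally have L: "(\<integral>\<omega>. f (y (Suc k) \<omega>) \<partial>M) = (\<integral>\<omega>. rem \<omega> \<partial>M) + (\<integral>\<omega>. f (y k \<omega>) \<partial>M)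
      + (\<integral>\<omega>. generator r c f1 f2 (y k \<omega>) (x k \<omega>) \<partial>M)" .
  have "(\<integral>\<omega>. step r dd f (y k \<omega>) \<partial>M) = (\<integral>\<omega>. st \<omega> + f (y k \<omega>) + (generator r c f1 f2 (y k \<omega>) (x k \<omega>) - gd \<omega>) \<partial>M)"
    by (intro Bochner_Integration.integral_cong refl) (simp add: st_def gd_def)
  also have "\<dots> = (\<integral>\<omega>. st \<omega> \<partial>M) + (\<integral>\<omega>. f (y k \<omega>) \<partial>M)
      + ((\<integral>\<omega>. generator r c f1 f2 (y k \<omega>) (x k \<omega>) \<partial>M) - (\<integral>\<omega>. gd \<omega> \<partial>M))"
    using ist fy lin igd by simp
  finally have "(\<integral>\<omega>. f (y (Suc k) \<omega>) \<partial>M) - (\<integral>\<omega>. step r dd f (y k \<omega>) \<partial>M) =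
    (\<integral>\<omega>. rem \<omega> \<partial>M) - (\<integral>\<omega>. st \<omega> \<partial>M) + (\<integral>\<omega>. gd \<omega> \<partial>M)" unfolding L by simp
  then have "\<bar>(\<integral>\<omega>. f (y (Suc k) \<omega>) \<partial>M) - (\<integral>\<omega>. step r dd f (y k \<omega>) \<partial>M)\<bar> \<le>
    B * 4 ^ p * (R ^ 3 * Mo 3 + R ^ (2 * p + 3) * Mo (2 * p + 3)) * (e\<^sup>2 * \<gamma>) * J
    + C2 * R * (e\<^sup>2 * \<gamma>) * J + C3 * (e\<^sup>2 * \<gamma>) * J"
    using part1 part2 part3 by linarith
  also have "\<dots> = (B * 4 ^ p * (R ^ 3 * Mo 3 + R ^ (2 * p + 3) * Mo (2 * p + 3)) + C2 * R + C3) * (e\<^sup>2 * \<gamma>) * J"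
    by (simp only: distrib_right)
  finally show ?thesis unfolding C2_def C3_def J_def \<gamma>_def r_def dd_def .
qed


text \<open>Needed at both ends of a run: at the final time to return from \<open>y\<close> to the
  actual iterate, and at time 0, where \<open>y\<close> differs from the starting point by the
  effect of the initial momentum.\<close>

lemma run_query_difference:
  fixes R :: real
  assumes run: "momentum_run R l Mo Mi x0 e \<kappa> c M G F a d \<beta> g m y x"
    and f: "smooth_test B p f f1 f2 f3" and B: "0 \<le> B" and R: "0 \<le> R"
  shows "\<bar>(\<integral>\<omega>. f (x k \<omega>) \<partial>M) - (\<integral>\<omega>. f (y k \<omega>) \<partial>M)\<bar> \<le> B * R * (e / \<kappa>) *
    (\<integral>\<omega>. (1 + norm (x k \<omega>) + norm (y k \<omega>) + norm ((e / \<kappa>) *\<^sub>R m k \<omega>)) ^ (2 * p + 1) \<partial>M)"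
proof -
  interpret prob_space M by (rule run_prob_space[OF run])
  note vm = run_vector_moments[OF run] and sc = run_scales[OF run]
  define S where "S \<omega> = 1 + norm (x k \<omega>) + norm (y k \<omega>) + norm ((e / \<kappa>) *\<^sub>R m k \<omega>)" for \<omega>
  have S0: "0 \<le> S \<omega>" for \<omega> by (simp add: S_def add_nonneg_nonneg)
  have iS: "integrable M (\<lambda>\<omega>. S \<omega> ^ i)" for i unfolding S_def
    by (intro all_moments_integrable all_moments_power all_moments_add all_moments_const
        vector_moments_norm vector_moments_scaleR vm)
  have fx: "integrable M (\<lambda>\<omega>. f (x k \<omega>))" and fy: "integrable M (\<lambda>\<omega>. f (y k \<omega>))"
    using smooth_test_all_moments(1)[OF f B] vm by (auto intro: all_moments_integrable)
  have "\<bar>(\<integral>\<omega>. f (x k \<omega>) \<partial>M) - (\<integral>\<omega>. f (y k \<omega>) \<partial>M)\<bar> = \<bar>\<integral>\<omega>. f (x k \<omega>) - f (y k \<omega>) \<partial>M\<bar>"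
    using fx fy by simp
  also have "\<dots> \<le> (\<integral>\<omega>. \<bar>f (x k \<omega>) - f (y k \<omega>)\<bar> \<partial>M)" by (rule integral_abs_bound)
  also have "\<dots> \<le> (\<integral>\<omega>. B * R * (e / \<kappa>) * S \<omega> ^ (2 * p + 1) \<partial>M)"
  proof (rule integral_mono)
    fix \<omega> assume \<omega>: "\<omega> \<in> space M"
    have "\<bar>f (x k \<omega>) - f (y k \<omega>)\<bar> \<le> B * (1 + norm (x k \<omega>) + norm (y k \<omega>)) ^ (2 * p) * norm (x k \<omega> - y k \<omega>)"
      by (rule smooth_test_lipschitz[OF f B])
    also have "\<dots> \<le> B * S \<omega> ^ (2 * p) * (R * (e / \<kappa>) * S \<omega>)"
    proof (rule mult_mono)
      show "B * (1 + norm (x k \<omega>) + norm (y k \<omega>)) ^ (2 * p) \<le> B * S \<omega> ^ (2 * p)"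
        using B by (intro mult_left_mono power_mono) (auto simp: S_def)
      have "R * (e / \<kappa>) * norm ((e / \<kappa>) *\<^sub>R m k \<omega>) \<le> R * (e / \<kappa>) * S \<omega>"
        using R sc by (intro mult_left_mono) (auto simp: S_def)
      then show "norm (x k \<omega> - y k \<omega>) \<le> R * (e / \<kappa>) * S \<omega>"
        using run_difference[OF run \<omega> R, of k] by linarith
    qed (use B S0 in auto)
    also have "\<dots> = B * R * (e / \<kappa>) * S \<omega> ^ (2 * p + 1)" by (simp add: mult_ac)
    finally show "\<bar>f (x k \<omega>) - f (y k \<omega>)\<bar> \<le> B * R * (e / \<kappa>) * S \<omega> ^ (2 * p + 1)" .
  qed (intro integrable_abs Bochner_Integration.integrable_diff fx fy integrable_mult_right iS)+
  finally show ?thesis by (simp add: S_def)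
qed

text \<open>The reference value depends only on the rates, the noise scale, \<open>h\<close>, the
  number of steps and the starting point. SGD and SGDM have all of these in common, so applying the
  lemma to each of them compares the two, even on different probability spaces.\<close>

lemma run_weak_error:
  fixes R l T B :: real
  assumes R: "1 \<le> R" and l: "0 < l" "l \<le> 1" and Mo: "\<And>p. 0 \<le> Mo p" and Mi: "\<And>p. 0 \<le> Mi p"
    and h: "smooth_test B p h h1 h2 h3" and B: "0 \<le> B"
  shows "\<exists>C\<ge>0. \<forall>e \<kappa> c (M :: 'w measure) G F a d \<beta> g m y x n.
    momentum_run R l Mo Mi x0 e \<kappa> c M G F a d \<beta> g m y x \<longrightarrow> real n * e\<^sup>2 \<le> T \<longrightarrow>
    \<bar>(\<integral>\<omega>. h (x n \<omega>) \<partial>M) - evolve a (\<lambda>k. a k * sqrt (c * DIM('a))) h 0 n x0\<bar> \<le> C * (e / \<kappa>)"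
proof -
  have R0: "0 \<le> R" using R by simp
  have N1: "1 \<le> real DIM('a)" by (metis DIM_positive One_nat_def Suc_leI of_nat_1 of_nat_mono)
  define P where "P = R * DIM('a)"
  have P: "R \<le> P" "0 \<le> P" using N1 R mult_left_mono[OF N1 R0] by (auto simp: P_def)
  obtain B' p' where B': "0 \<le> B'" and ev: "\<And>e a d j k. 0 \<le> e \<Longrightarrow> e \<le> 1 \<Longrightarrow> (\<And>k. \<bar>a k\<bar> \<le> P * e\<^sup>2) \<Longrightarrow>
    (\<And>k. \<bar>d k\<bar> \<le> P * e) \<Longrightarrow> real j * e\<^sup>2 \<le> T \<Longrightarrow> \<exists>f1 f2 f3. smooth_test B' p' (evolve a d h k j) f1 f2 f3"
    using evolve_smooth_test[OF h P(2), of T] by blast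
  define Q where "Q = B' * 4 ^ p' * (R ^ 3 * Mo 3 + R ^ (2 * p' + 3) * Mo (2 * p' + 3))
      + 2 * B' * K\<^sup>2 * (P + P\<^sup>2 + P\<^sup>2 * DIM('a)) * R
      + B' * (1 + 2 * P * K) ^ (2 * p') * (2 * P * K) ^ 3"
  have Q: "0 \<le> Q" using B' R0 Mo P K by (simp add: Q_def)
  have sz: "\<exists>C\<ge>0. \<forall>e \<kappa> c (M :: 'w measure) G F a d \<beta> g m y x k.
    momentum_run R l Mo Mi x0 e \<kappa> c M G F a d \<beta> g m y x \<longrightarrow> real k * e\<^sup>2 \<le> T \<longrightarrow>
    (\<integral>\<omega>. (1 + norm (x k \<omega>) + norm (y k \<omega>) + norm ((e / \<kappa>) *\<^sub>R m k \<omega>)) ^ i \<partial>M) \<le> C" for i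
    by (rule run_size_moments[OF R l Mo Mi])
  obtain C1 where C1: "0 \<le> C1" "\<And>e \<kappa> c (M :: 'w measure) G F a d \<beta> g m y x k.
    momentum_run R l Mo Mi x0 e \<kappa> c M G F a d \<beta> g m y x \<Longrightarrow> real k * e\<^sup>2 \<le> T \<Longrightarrow>
    (\<integral>\<omega>. (1 + norm (x k \<omega>) + norm (y k \<omega>) + norm ((e / \<kappa>) *\<^sub>R m k \<omega>)) ^ (2 * p' + 3) \<partial>M) \<le> C1"
    using sz[of "2 * p' + 3"] by blast
  obtain C2 where C2: "0 \<le> C2" "\<And>e \<kappa> c (M :: 'w measure) G F a d \<beta> g m y x k.
    momentum_run R l Mo Mi x0 e \<kappa> c M G F a d \<beta> g m y x \<Longrightarrow> real k * e\<^sup>2 \<le> T \<Longrightarrow>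
    (\<integral>\<omega>. (1 + norm (x k \<omega>) + norm (y k \<omega>) + norm ((e / \<kappa>) *\<^sub>R m k \<omega>)) ^ (2 * p' + 1) \<partial>M) \<le> C2"
    using sz[of "2 * p' + 1"] by blast
  obtain C3 where C3: "0 \<le> C3" "\<And>e \<kappa> c (M :: 'w measure) G F a d \<beta> g m y x k.
    momentum_run R l Mo Mi x0 e \<kappa> c M G F a d \<beta> g m y x \<Longrightarrow> real k * e\<^sup>2 \<le> T \<Longrightarrow>
    (\<integral>\<omega>. (1 + norm (x k \<omega>) + norm (y k \<omega>) + norm ((e / \<kappa>) *\<^sub>R m k \<omega>)) ^ (2 * p + 1) \<partial>M) \<le> C3"
    using sz[of "2 * p + 1"] by blast
  define C where "C = B * R * C3 + \<bar>T\<bar> * Q * C1 + B' * R * C2"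
  show ?thesis
  proof (intro exI[of _ C] conjI allI impI)
    show "0 \<le> C" using B B' R0 Q C1 C2 C3 by (simp add: C_def)
    fix e \<kappa> c M G F a d \<beta> g m y x n
    assume run: "momentum_run R l Mo Mi x0 e \<kappa> c (M :: 'w measure) G F a d \<beta> g m y x" and T: "real n * e\<^sup>2 \<le> T"
    interpret prob_space M by (rule run_prob_space[OF run])
    note sc = run_scales[OF run] and rt = run_rates[OF run] and ratio = run_ratio[OF run]
    define \<gamma> where "\<gamma> = e / \<kappa>"
    have \<gamma>0: "0 \<le> \<gamma>" using ratio by (simp add: \<gamma>_def)
    define dd where "dd k = a k * sqrt (c * DIM('a))" for k
    have aP: "\<bar>a k\<bar> \<le> P * e\<^sup>2" for k
      using rt(1,2)[of k] mult_right_mono[OF P(1), of "e\<^sup>2"] by simp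
    have dP: "\<bar>dd k\<bar> \<le> P * e" for k
      using run_noise_scale[OF run, of k] by (simp add: dd_def P_def)
    have le: "real k * e\<^sup>2 \<le> T" if "k \<le> n" for k
      using that T mult_right_mono[of "real k" "real n" "e\<^sup>2"] by simp
    \<comment> \<open>The value still expected from the chain at time \<open>k\<close>, with
      \<open>n - k\<close> steps to go. It equals \<open>h\<close> at time \<open>n\<close>, and one
      chain step leads from \<open>u (Suc k)\<close> to \<open>u k\<close>, so the differences of
      the expectations of \<open>u k\<close> at \<open>y k\<close> telescope.\<close>
    define u where "u k = evolve a dd h k (n - k)" for k
    have u: "\<exists>f1 f2 f3. smooth_test B' p' (u k) f1 f2 f3" for k
      unfolding u_def by (rule ev[OF _ _ aP dP le]) (use sc in auto)
    have "\<bar>(\<integral>\<omega>. u k (y k \<omega>) \<partial>M) - (\<integral>\<omega>. u 0 (y 0 \<omega>) \<partial>M)\<bar> \<le> real k * (Q * (e\<^sup>2 * \<gamma>) * C1)" if "k \<le> n" for k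
      using that
    proof (induction k)
      case (Suc k)
      have us: "u k = step (a k) (dd k) (u (Suc k))"
      proof -
        have "n - k = Suc (n - Suc k)" using Suc.prems by simp
        then show ?thesis by (simp add: u_def)
      qed
      obtain f1 f2 f3 where f: "smooth_test B' p' (u (Suc k)) f1 f2 f3" using u by blast
      have "\<bar>(\<integral>\<omega>. u (Suc k) (y (Suc k) \<omega>) \<partial>M) - (\<integral>\<omega>. u k (y k \<omega>) \<partial>M)\<bar> \<le> Q * (e\<^sup>2 * \<gamma>) *
         (\<integral>\<omega>. (1 + norm (x k \<omega>) + norm (y k \<omega>) + norm ((e / \<kappa>) *\<^sub>R m k \<omega>)) ^ (2 * p' + 3) \<partial>M)"
        unfolding us using run_one_step[OF run f B' R Mo, of k] unfolding Q_def P_def \<gamma>_def dd_def .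
      also have "\<dots> \<le> Q * (e\<^sup>2 * \<gamma>) * C1"
        using Q \<gamma>0 C1(2)[OF run le[of k]] Suc.prems by (intro mult_left_mono) auto
      finally show ?case using Suc by (simp add: algebra_simps)
    qed simp
    from this[of n] have tele: "\<bar>(\<integral>\<omega>. h (y n \<omega>) \<partial>M) - (\<integral>\<omega>. u 0 (y 0 \<omega>) \<partial>M)\<bar> \<le> real n * (Q * (e\<^sup>2 * \<gamma>) * C1)"
      by (simp add: u_def)
    also have "\<dots> = (real n * e\<^sup>2) * (Q * C1 * \<gamma>)" by (simp add: mult_ac)
    also have "\<dots> \<le> \<bar>T\<bar> * (Q * C1 * \<gamma>)" using T Q C1 \<gamma>0 by (intro mult_right_mono) auto
    finally have 1: "\<bar>(\<integral>\<omega>. h (y n \<omega>) \<partial>M) - (\<integral>\<omega>. u 0 (y 0 \<omega>) \<partial>M)\<bar> \<le> \<bar>T\<bar> * (Q * C1 * \<gamma>)" .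
    have "\<bar>(\<integral>\<omega>. h (x n \<omega>) \<partial>M) - (\<integral>\<omega>. h (y n \<omega>) \<partial>M)\<bar> \<le> B * R * (e / \<kappa>) *
      (\<integral>\<omega>. (1 + norm (x n \<omega>) + norm (y n \<omega>) + norm ((e / \<kappa>) *\<^sub>R m n \<omega>)) ^ (2 * p + 1) \<partial>M)"
      by (rule run_query_difference[OF run h B R0])
    also have "\<dots> \<le> B * R * (e / \<kappa>) * C3"
      using B R0 sc by (intro mult_left_mono C3(2)[OF run T]) auto
    finally have 2: "\<bar>(\<integral>\<omega>. h (x n \<omega>) \<partial>M) - (\<integral>\<omega>. h (y n \<omega>) \<partial>M)\<bar> \<le> B * R * \<gamma> * C3" by (simp add: \<gamma>_def)
    obtain f1 f2 f3 where f: "smooth_test B' p' (u 0) f1 f2 f3" using u by blast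
    have "\<bar>(\<integral>\<omega>. u 0 (x 0 \<omega>) \<partial>M) - (\<integral>\<omega>. u 0 (y 0 \<omega>) \<partial>M)\<bar> \<le> B' * R * (e / \<kappa>) *
      (\<integral>\<omega>. (1 + norm (x 0 \<omega>) + norm (y 0 \<omega>) + norm ((e / \<kappa>) *\<^sub>R m 0 \<omega>)) ^ (2 * p' + 1) \<partial>M)"
      by (rule run_query_difference[OF run f B' R0])
    also have "\<dots> \<le> B' * R * (e / \<kappa>) * C2"
      using B' R0 sc by (intro mult_left_mono C2(2)[OF run le]) auto
    also have "(\<integral>\<omega>. u 0 (x 0 \<omega>) \<partial>M) = (\<integral>\<omega>. u 0 x0 \<partial>M)"
      by (intro Bochner_Integration.integral_cong refl) (simp add: run_start[OF run])
    finally have 3: "\<bar>u 0 x0 - (\<integral>\<omega>. u 0 (y 0 \<omega>) \<partial>M)\<bar> \<le> B' * R * \<gamma> * C2" by (simp add: \<gamma>_def prob_space)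
    have "\<bar>(\<integral>\<omega>. h (x n \<omega>) \<partial>M) - u 0 x0\<bar> \<le> B * R * \<gamma> * C3 + \<bar>T\<bar> * (Q * C1 * \<gamma>) + B' * R * \<gamma> * C2"
      using 1 2 3 by linarith
    also have "\<dots> = C * \<gamma>" by (simp add: C_def algebra_simps)
    finally show "\<bar>(\<integral>\<omega>. h (x n \<omega>) \<partial>M) - evolve a (\<lambda>k. a k * sqrt (c * DIM('a))) h 0 n x0\<bar> \<le> C * (e / \<kappa>)"
      by (simp add: u_def dd_def[abs_def] \<gamma>_def)
  qed
qed

end

section \<open>Smoothness assumptions\<close>

lemma jet3_directional_derivative:
  assumes "C_infinity f"
  shows "jet3 f (\<lambda>x v. directional_derivative v f x)
    (\<lambda>x v w. directional_derivative w (directional_derivative v f) x)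
    (\<lambda>x v w z. directional_derivative z (directional_derivative w (directional_derivative v f)) x)"
proof -
  have c: "C_k (Suc (Suc (Suc 0))) f" using assms unfolding C_infinity_def by blast
  have d: "(g has_derivative (\<lambda>v. directional_derivative v g x)) (at x)" if "\<forall>x. g differentiable (at x)" for g :: "'a \<Rightarrow> 'b" and x
    using that by (simp add: directional_derivative_def frechet_derivative_works[symmetric])
  show ?thesis
    using c by (intro jet3I d) (auto simp del: One_nat_def)
qed

lemma polynomial_growth_rho:
  assumes "polynomial_growth f"
  shows "\<exists>C m. 0 \<le> C \<and> (\<forall>x. norm (f x) \<le> C * rho x ^ m)"
proof -
  obtain k1 k2 where k: "0 < k1" "0 < k2" "\<And>x. norm (f x) \<le> k1 * (1 + norm x powr k2)"
    using assms unfolding polynomial_growth_def by blast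
  define m where "m = nat \<lceil>k2\<rceil>"
  have km: "k2 \<le> real m" using k(2) by (simp add: m_def)
  have "norm (f x) \<le> 2 * k1 * rho x ^ m" for x
  proof -
    have "norm x powr k2 \<le> rho x ^ m"
    proof (cases "norm x \<le> 1")
      case True
      then have "norm x powr k2 \<le> 1" using k by (simp add: powr_le1)
      then show ?thesis using rho_power_ge_1(1)[of x m] by linarith
    next
      case False
      then have "norm x powr k2 \<le> norm x powr real m" using km by (intro powr_mono) auto
      also have "\<dots> = norm x ^ m"
      proof (rule powr_realpow)
        show "0 < norm x" using False by linarith
      qed
      also have "\<dots> \<le> rho x ^ m"
      proof (rule power_mono)
        have "norm x * 1 \<le> norm x * norm x" using False by (intro mult_left_mono) auto
        then show "norm x \<le> rho x" by (simp add: rho_def power2_eq_square)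
      qed simp
      finally show ?thesis .
    qed
    then have "k1 * (1 + norm x powr k2) \<le> k1 * (rho x ^ m + rho x ^ m)"
      using k(1) by (intro mult_left_mono add_mono) auto
    with k(3)[of x] show ?thesis by simp
  qed
  then show ?thesis using k(1) by (intro exI[of _ "2 * k1"] exI[of _ m]) auto
qed

lemma uniform_rho_bound:
  assumes "finite I" "\<And>i. i \<in> I \<Longrightarrow> \<exists>C m. 0 \<le> C \<and> (\<forall>x. norm (g i x) \<le> C * rho x ^ m)"
  shows "\<exists>C m. 0 \<le> C \<and> (\<forall>i\<in>I. \<forall>x. norm (g i x) \<le> C * rho x ^ m)"
  using assms
proof (induction I rule: finite_induct)
  case (insert i I)
  have "\<exists>C m. 0 \<le> C \<and> (\<forall>i\<in>I. \<forall>x. norm (g i x) \<le> C * rho x ^ m)"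
    by (rule insert.IH) (use insert.prems in blast)
  then obtain C m where C: "0 \<le> C" "\<And>i x. i \<in> I \<Longrightarrow> norm (g i x) \<le> C * rho x ^ m" by blast
  obtain D n where D: "0 \<le> D" "\<And>x. norm (g i x) \<le> D * rho x ^ n" using insert.prems by blast
  have "C * rho x ^ m \<le> (C + D) * rho x ^ (m + n)" "D * rho x ^ n \<le> (C + D) * rho x ^ (m + n)" for x
    using C(1) D(1) by (auto intro!: mult_mono power_increasing)
  then have "norm (g k x) \<le> (C + D) * rho x ^ (m + n)" if "k \<in> insert i I" for k x
    using that C(2)[of k x] D(2)[of x] by (auto intro: order_trans)
  then show ?case using C(1) D(1) by (intro exI[of _ "C + D"] exI[of _ "m + n"]) auto
qed auto

lemma linear_basis_bound:
  fixes f :: "'a::euclidean_space \<Rightarrow> 'b::real_normed_vector" and D :: real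
  assumes "linear f" "\<And>i. i \<in> Basis \<Longrightarrow> norm (f i) \<le> D"
  shows "norm (f v) \<le> DIM('a) * D * norm v"
proof -
  have "norm (f v) \<le> (\<Sum>i\<in>Basis. norm ((v \<bullet> i) *\<^sub>R f i))"
    by (subst linear_basis_expansion[OF assms(1)]) (rule norm_sum)
  also have "\<dots> \<le> (\<Sum>i\<in>(Basis::'a set). norm v * D)"
    unfolding norm_scaleR using assms(2) by (intro sum_mono mult_mono) (auto simp: Basis_le_norm)
  finally show ?thesis by (simp add: mult_ac)
qed

text \<open>Growth is assumed for basis directions only, and there are finitely many lists of at
  most three of them. Multilinearity carries a common bound over to all directions at the price of a
  factor \<open>DIM('a)\<close> per argument, hence \<open>N ^ 3\<close>.\<close>

lemma jet3_polynomial_growth: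
  fixes f :: "'a::euclidean_space \<Rightarrow> 'b::real_normed_vector"
  assumes f: "C_infinity f" and g: "\<And>n. n \<le> 3 \<Longrightarrow> partials_polynomial_growth n f"
  obtains f1 f2 f3 C m where "jet3 f f1 f2 f3" "0 \<le> C"
    "\<And>x. norm (f x) \<le> C * rho x ^ m"
    "\<And>x v. norm (f1 x v) \<le> C * rho x ^ m * norm v"
    "\<And>x v w. norm (f2 x v w) \<le> C * rho x ^ m * norm v * norm w"
    "\<And>x v w z. norm (f3 x v w z) \<le> C * rho x ^ m * norm v * norm w * norm z"
proof -
  define f1 where "f1 x v = directional_derivative v f x" for x v
  define f2 where "f2 x v w = directional_derivative w (directional_derivative v f) x" for x v w
  define f3 where "f3 x v w z = directional_derivative z (directional_derivative w (directional_derivative v f)) x" for x v w z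
  have j: "jet3 f f1 f2 f3"
    using jet3_directional_derivative[OF f] unfolding f1_def[abs_def] f2_def[abs_def] f3_def[abs_def] .
  note l = jet3_linear[OF j]
  define I :: "'a list set" where "I = {bs. set bs \<subseteq> Basis \<and> length bs \<le> 3}"
  have "finite I" unfolding I_def by (intro finite_lists_length_le) simp
  moreover have "\<exists>C m. 0 \<le> C \<and> (\<forall>x. norm (partial_derivative bs f x) \<le> C * rho x ^ m)" if "bs \<in> I" for bs
    using that g[of "length bs"] unfolding I_def partials_polynomial_growth_def by (intro polynomial_growth_rho) auto
  ultimately obtain C m where C: "0 \<le> C" and b: "\<And>bs x. bs \<in> I \<Longrightarrow> norm (partial_derivative bs f x) \<le> C * rho x ^ m"
    using uniform_rho_bound[of I "\<lambda>bs. partial_derivative bs f"] by blast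
  define D where "D x = C * rho x ^ m" for x :: 'a
  have D0: "0 \<le> D x" for x using C by (simp add: D_def)
  define N where "N = real DIM('a)"
  have N: "1 \<le> N" unfolding N_def by (metis DIM_positive One_nat_def Suc_leI of_nat_1 of_nat_mono)
  have b0: "norm (f x) \<le> D x" for x using b[of "[]" x] by (simp add: I_def partial_derivative_def D_def)
  have b1: "norm (f1 x v) \<le> N * D x * norm v" for x v
    unfolding N_def
  proof (rule linear_basis_bound[OF l(1)])
    fix i :: 'a assume "i \<in> Basis"
    then show "norm (f1 x i) \<le> D x"
      using b[of "[i]" x] by (auto simp: I_def partial_derivative_def f1_def D_def)
  qed
  have b2: "norm (f2 x v w) \<le> N * (N * D x * norm w) * norm v" for x v w
    unfolding N_def
  proof (rule linear_basis_bound[OF l(2)], rule linear_basis_bound[OF l(3)])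
    fix i j :: 'a assume "i \<in> Basis" "j \<in> Basis"
    \<comment> \<open>\<open>partial_derivative\<close> differentiates along the last element of the
      list first, whereas the arguments of \<open>f2\<close> are in order of differentiation; hence
      the reversed list.\<close>
    then show "norm (f2 x i j) \<le> D x"
      using b[of "[j, i]" x] by (auto simp: I_def partial_derivative_def f2_def D_def)
  qed
  have b3: "norm (f3 x v w z) \<le> N * (N * (N * D x * norm z) * norm w) * norm v" for x v w z
    unfolding N_def
  proof (rule linear_basis_bound[OF l(4)], rule linear_basis_bound[OF l(5)], rule linear_basis_bound[OF l(6)])
    fix i j k :: 'a assume "i \<in> Basis" "j \<in> Basis" "k \<in> Basis"
    then show "norm (f3 x i j k) \<le> D x"
      using b[of "[k, j, i]" x] by (auto simp: I_def partial_derivative_def f3_def D_def)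
  qed
  have pw: "1 \<le> N ^ 3" "N \<le> N ^ 3" "N * N \<le> N ^ 3"
    using N power_increasing[of 0 3 N] power_increasing[of 1 3 N] power_increasing[of 2 3 N]
    by (auto simp: power2_eq_square)
  show thesis
  proof (rule that[OF j, of "N ^ 3 * C" m])
    show "0 \<le> N ^ 3 * C" using C N by simp
    have le: "D x * t \<le> N ^ 3 * C * rho x ^ m * t" "N * D x * t \<le> N ^ 3 * C * rho x ^ m * t"
      "N * N * D x * t \<le> N ^ 3 * C * rho x ^ m * t" if "0 \<le> t" for x t
    proof -
      have "0 \<le> D x * t" using D0 that by simp
      from mult_right_mono[OF pw(1) this] mult_right_mono[OF pw(2) this] mult_right_mono[OF pw(3) this]
      show "D x * t \<le> N ^ 3 * C * rho x ^ m * t" "N * D x * t \<le> N ^ 3 * C * rho x ^ m * t"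
        "N * N * D x * t \<le> N ^ 3 * C * rho x ^ m * t" by (simp_all add: D_def mult.assoc)
    qed
    show "norm (f x) \<le> N ^ 3 * C * rho x ^ m" for x using b0[of x] le(1)[of 1 x] by simp
    show "norm (f1 x v) \<le> N ^ 3 * C * rho x ^ m * norm v" for x v using b1[of x v] le(2)[of "norm v" x] by simp
    show "norm (f2 x v w) \<le> N ^ 3 * C * rho x ^ m * norm v * norm w" for x v w
      using b2[of x v w] le(3)[of "norm v * norm w" x] by (simp add: mult_ac)
    show "norm (f3 x v w z) \<le> N ^ 3 * C * rho x ^ m * norm v * norm w * norm z" for x v w z
      using b3[of x v w z] by (simp add: D_def power3_eq_cube mult_ac)
  qed
qed

lemma test_function_imp_smooth_test:
  assumes "test_function h"
  obtains B m h1 h2 h3 where "0 \<le> B" "smooth_test B m h h1 h2 h3"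
proof -
  have "C_infinity h" "\<And>n. n \<le> 3 \<Longrightarrow> partials_polynomial_growth n h" using assms by (auto simp: test_function_def)
  from jet3_polynomial_growth[OF this] obtain h1 h2 h3 C m where "jet3 h h1 h2 h3" "0 \<le> C"
    "\<And>x. norm (h x) \<le> C * rho x ^ m"
    "\<And>x v. norm (h1 x v) \<le> C * rho x ^ m * norm v"
    "\<And>x v w. norm (h2 x v w) \<le> C * rho x ^ m * norm v * norm w"
    "\<And>x v w z. norm (h3 x v w z) \<le> C * rho x ^ m * norm v * norm w * norm z" by blast
  then have "smooth_test C m h h1 h2 h3" by (auto simp: smooth_test_def power3_eq_cube mult.assoc)
  with \<open>0 \<le> C\<close> show thesis by (rule that)
qed

text \<open>The derivative in direction \<open>v\<close> is a limit of difference quotients, each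
  bounded by the Lipschitz constant. An arbitrary error is allowed so that one sufficiently small
  increment \<open>t\<close> suffices.\<close>

lemma lipschitz_on_derivative_bound:
  assumes L: "C-lipschitz_on UNIV f" and d: "(f has_derivative f') (at x)"
  shows "norm (f' v) \<le> C * norm v"
proof (rule field_le_epsilon)
  fix \<epsilon> :: real assume \<epsilon>: "0 < \<epsilon>"
  interpret f': linear f' using has_derivative_linear[OF d] .
  define \<delta> where "\<delta> = \<epsilon> / (1 + norm v)"
  have nv: "0 < 1 + norm v" by (simp add: add_pos_nonneg)
  have \<delta>: "0 < \<delta>" "\<delta> * norm v \<le> \<epsilon>"
    using \<epsilon> nv by (auto simp: \<delta>_def field_simps)
  obtain r where r: "0 < r" "\<And>y. norm (y - x) < r \<Longrightarrow> norm (f y - f x - f' (y - x)) \<le> \<delta> * norm (y - x)"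
    using d \<delta>(1) unfolding has_derivative_within_alt by auto
  define t where "t = r / (1 + norm v)"
  have t: "0 < t" using r nv by (simp add: t_def)
  have "t * norm v < r" using r nv by (simp add: t_def field_simps)
  then have "norm (f (x + t *\<^sub>R v) - f x - f' (t *\<^sub>R v)) \<le> \<delta> * norm (t *\<^sub>R v)"
    using r(2)[of "x + t *\<^sub>R v"] t by simp
  moreover have "norm (f (x + t *\<^sub>R v) - f x) \<le> C * norm (t *\<^sub>R v)"
    using lipschitz_onD[OF L, of "x + t *\<^sub>R v" x] by (simp add: dist_norm)
  moreover have "norm (f' (t *\<^sub>R v)) \<le> norm (f (x + t *\<^sub>R v) - f x) + norm (f (x + t *\<^sub>R v) - f x - f' (t *\<^sub>R v))"
    by (metis norm_triangle_sub norm_minus_commute)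
  ultimately have "t * norm (f' v) \<le> C * (t * norm v) + \<delta> * (t * norm v)"
    using t by (simp add: f'.scale)
  then have "t * norm (f' v) \<le> t * (C * norm v + \<delta> * norm v)" by (simp add: algebra_simps)
  then have "norm (f' v) \<le> C * norm v + \<delta> * norm v" using t by simp
  then show "norm (f' v) \<le> C * norm v + \<epsilon>" using \<delta> by linarith
qed

lemma coefficient_mono:
  assumes "coefficient K q f f1 f2 f3" "K \<le> K'" "q \<le> q'" "0 \<le> K"
  shows "coefficient K' q' f f1 f2 f3"
proof -
  note c = assms(1)[unfolded coefficient_def]
  have 1: "K * t \<le> K' * t" if "0 \<le> t" for t using assms(2) that by (rule mult_right_mono)
  have 2: "K * rho x ^ q * t \<le> K' * rho x ^ q' * t" if "0 \<le> t" for x :: 'a and t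
    using assms that by (intro mult_right_mono mult_mono power_increasing) auto
  show ?thesis unfolding coefficient_def
  proof (intro conjI allI)
    show "jet3 f f1 f2 f3" using c by blast
    show "norm (f x) \<le> K' * (1 + norm x)" for x using c 1[of "1 + norm x"] by (meson order_trans add_nonneg_nonneg norm_ge_zero zero_le_one)
    show "norm (f1 x v) \<le> K' * norm v" for x v using c 1[of "norm v"] by (meson order_trans norm_ge_zero)
    show "norm (f2 x v w) \<le> K' * rho x ^ q' * norm v * norm w" for x v w
    proof -
      have "norm (f2 x v w) \<le> K * rho x ^ q * norm v * norm w" using c by blast
      then show ?thesis using 2[of "norm v * norm w" x] by (simp add: mult.assoc)
    qed
    show "norm (f3 x v w z) \<le> K' * rho x ^ q' * norm v * norm w * norm z" for x v w z
    proof -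
      have "norm (f3 x v w z) \<le> K * rho x ^ q * norm v * norm w * norm z" using c by blast
      then show ?thesis using 2[of "norm v * norm w * norm z" x] by (simp add: mult.assoc)
    qed
  qed
qed

text \<open>The Lipschitz hypothesis supplies linear growth and the bounded first derivative,
  polynomial growth of the partial derivatives supplies the bounds of orders two and three.\<close>

lemma coefficient_exists:
  fixes f :: "'a::euclidean_space \<Rightarrow> 'b::real_normed_vector"
  assumes "C_infinity f" "\<And>n. n \<le> 3 \<Longrightarrow> partials_polynomial_growth n f" and L: "C-lipschitz_on UNIV f"
  obtains K q f1 f2 f3 where "1 \<le> K" "coefficient K q f f1 f2 f3"
proof -
  obtain f1 f2 f3 D m where j: "jet3 f f1 f2 f3" and D: "0 \<le> D"
    and b2: "\<And>x v w. norm (f2 x v w) \<le> D * rho x ^ m * norm v * norm w"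
    and b3: "\<And>x v w z. norm (f3 x v w z) \<le> D * rho x ^ m * norm v * norm w * norm z"
    using jet3_polynomial_growth[OF assms(1,2)] by metis
  have C: "0 \<le> C" by (rule lipschitz_on_nonneg[OF L])
  define K where "K = 1 + norm (f 0) + C + D"
  have K: "1 \<le> K" "D \<le> K" "C \<le> K" "norm (f 0) \<le> K" using C D by (auto simp: K_def)
  have "coefficient K m f f1 f2 f3" unfolding coefficient_def
  proof (intro conjI allI j)
    show "norm (f x) \<le> K * (1 + norm x)" for x
    proof -
      have "norm (f x) \<le> norm (f 0) + norm (f x - f 0)" by (rule norm_triangle_sub)
      also have "norm (f x - f 0) \<le> C * norm x" using lipschitz_onD[OF L, of x 0] by (simp add: dist_norm)
      also have "norm (f 0) + C * norm x \<le> K + K * norm x" using K by (intro add_mono mult_right_mono) auto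
      finally show ?thesis by (simp add: algebra_simps)
    qed
    show "norm (f1 x v) \<le> K * norm v" for x v
    proof -
      have "norm (f1 x v) \<le> C * norm v" by (rule lipschitz_on_derivative_bound[OF L jet3D(1)[OF j]])
      also have "\<dots> \<le> K * norm v" using K by (intro mult_right_mono) auto
      finally show ?thesis .
    qed
    show "norm (f2 x v w) \<le> K * rho x ^ m * norm v * norm w" for x v w
      by (rule order_trans[OF b2]) (use K in \<open>intro mult_right_mono; simp\<close>)
    show "norm (f3 x v w z) \<le> K * rho x ^ m * norm v * norm w * norm z" for x v w z
      by (rule order_trans[OF b3]) (use K in \<open>intro mult_right_mono; simp\<close>)
  qed
  with K(1) show thesis by (rule that)
qed

lemma coefficient_bounded_linear:
  assumes f: "coefficient K q f f1 f2 f3" and T: "bounded_linear T" and C: "\<And>v. norm (T v) \<le> C * norm v" "0 \<le> C"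
  shows "coefficient (C * K) q (\<lambda>x. T (f x)) (\<lambda>x v. T (f1 x v)) (\<lambda>x v w. T (f2 x v w)) (\<lambda>x v w z. T (f3 x v w z))"
proof -
  note c = f[unfolded coefficient_def]
  have b: "norm (T v) \<le> C * t" if "norm v \<le> t" for v t
    using C(1)[of v] mult_left_mono[OF that C(2)] by linarith
  show ?thesis unfolding coefficient_def
  proof (intro conjI allI)
    show "jet3 (\<lambda>x. T (f x)) (\<lambda>x v. T (f1 x v)) (\<lambda>x v w. T (f2 x v w)) (\<lambda>x v w z. T (f3 x v w z))"
      using c by (intro jet3_bounded_linear[OF T]) blast
    show "norm (T (f x)) \<le> C * K * (1 + norm x)" for x unfolding mult.assoc using c by (intro b) blast
    show "norm (T (f1 x v)) \<le> C * K * norm v" for x v unfolding mult.assoc using c by (intro b) blast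
    show "norm (T (f2 x v w)) \<le> C * K * rho x ^ q * norm v * norm w" for x v w
      using b[of "f2 x v w" "K * rho x ^ q * norm v * norm w"] c by (simp add: mult.assoc)
    show "norm (T (f3 x v w z)) \<le> C * K * rho x ^ q * norm v * norm w * norm z" for x v w z
      using b[of "f3 x v w z" "K * rho x ^ q * norm v * norm w * norm z"] c by (simp add: mult.assoc)
  qed
qed

section \<open>Oracles and schedules\<close>

lemma Basis_vec_axis: "i \<in> (Basis :: (real ^ 'n) set) \<Longrightarrow> \<exists>p. i = axis p 1"
  by (auto simp: Basis_vec_def)

text \<open>By symmetry of \<open>S\<close> each factor is a coordinate of \<open>S *v i\<close> or
  \<open>S *v j\<close>, so the sum is Parseval's formula for their inner product. Hence random
  columns of \<open>S\<close> have covariance proportional to \<open>A\<close>.\<close>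

lemma psd_sqrt_columns:
  fixes S A :: "real ^ 'n ^ 'n"
  assumes "is_psd_sqrt S A"
  shows "(\<Sum>l\<in>Basis. ((S *v l) \<bullet> i) * ((S *v l) \<bullet> j)) = i \<bullet> (A *v j)"
proof -
  have sym: "transpose S = S" and A: "S ** S = A" using assms by (auto simp: is_psd_sqrt_def)
  have adj: "(S *v l) \<bullet> k = l \<bullet> (S *v k)" for l k
  proof -
    have "(S *v l) \<bullet> k = (l v* S) \<bullet> k" using transpose_matrix_vector[of S l] sym by simp
    then show ?thesis by (simp add: dot_lmul_matrix)
  qed
  have "(\<Sum>l\<in>Basis. ((S *v l) \<bullet> i) * ((S *v l) \<bullet> j)) = (\<Sum>l\<in>Basis. ((S *v i) \<bullet> l) * ((S *v j) \<bullet> l))"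
  proof (intro sum.cong refl)
    fix l
    have "(S *v l) \<bullet> k = (S *v k) \<bullet> l" for k by (rule trans[OF adj inner_commute])
    then show "((S *v l) \<bullet> i) * ((S *v l) \<bullet> j) = ((S *v i) \<bullet> l) * ((S *v j) \<bullet> l)" by simp
  qed
  also have "\<dots> = (S *v i) \<bullet> (S *v j)" by (rule euclidean_inner[symmetric])
  also have "\<dots> = i \<bullet> (A *v j)" unfolding adj A[symmetric] matrix_vector_mul_assoc ..
  finally show ?thesis .
qed

lemma inner_covariance_matrix:
  fixes Z :: "(real ^ 'n) measure"
  assumes mean: "(\<integral>v. v \<partial>Z) = 0" and i: "i \<in> Basis" "j \<in> Basis"
  shows "(\<integral>v. (v \<bullet> i) * (v \<bullet> j) \<partial>Z) = i \<bullet> (covariance_matrix Z *v j)"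
proof -
  obtain p r where "i = axis p 1" "j = axis r 1" using i Basis_vec_axis by metis
  then show ?thesis
    by (simp add: inner_axis inner_axis' matrix_vector_mult_basis column_def covariance_matrix_def mean)
qed

text \<open>The assumption controls even moments of positive order. Other orders are interpolated at
  the scale \<open>1 + norm \<theta>\<close>, which preserves the homogeneity of the bound; order 0
  is the total mass.\<close>

lemma bounded_moments_all:
  fixes Z :: "real \<Rightarrow> real ^ 'n \<Rightarrow> (real ^ 'n) measure"
  assumes "bounded_moments Z" and Z: "\<And>\<sigma> \<theta>. 0 < \<sigma> \<Longrightarrow> prob_space (Z \<sigma> \<theta>) \<and> sets (Z \<sigma> \<theta>) = sets borel"
  obtains V where "\<And>p. 0 \<le> V p" "\<And>p \<sigma> \<theta>. 0 < \<sigma> \<Longrightarrow> integrable (Z \<sigma> \<theta>) (\<lambda>v. norm v ^ p)"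
    "\<And>p \<sigma> \<theta>. 0 < \<sigma> \<Longrightarrow> (\<integral>v. norm v ^ p \<partial>Z \<sigma> \<theta>) \<le> V p * (1 + norm \<theta>) ^ p"
proof -
  have "\<exists>V\<ge>0. \<forall>\<sigma>>0. \<forall>\<theta>. integrable (Z \<sigma> \<theta>) (\<lambda>v. norm v ^ p) \<and> (\<integral>v. norm v ^ p \<partial>Z \<sigma> \<theta>) \<le> V * (1 + norm \<theta>) ^ p" for p
  proof (cases "p = 0")
    case True
    have "integrable (Z \<sigma> \<theta>) (\<lambda>v. norm v ^ p) \<and> (\<integral>v. norm v ^ p \<partial>Z \<sigma> \<theta>) \<le> 1 * (1 + norm \<theta>) ^ p" if "0 < \<sigma>" for \<sigma> \<theta>
    proof -
      interpret prob_space "Z \<sigma> \<theta>" using Z that by blast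
      show ?thesis using True by (simp add: prob_space)
    qed
    then show ?thesis by (intro exI[of _ 1]) auto
  next
    case False
    then obtain C where C: "\<And>\<sigma> \<theta>. 0 < \<sigma> \<Longrightarrow> integrable (Z \<sigma> \<theta>) (\<lambda>v. norm v ^ (2 * p))"
      "\<And>\<sigma> \<theta>. 0 < \<sigma> \<Longrightarrow> root (2 * p) (\<integral>v. norm v ^ (2 * p) \<partial>Z \<sigma> \<theta>) \<le> C * (1 + norm \<theta>)"
      using assms(1) unfolding bounded_moments_def by (metis One_nat_def Suc_leI gr0I)
    have "integrable (Z \<sigma> \<theta>) (\<lambda>v. norm v ^ p) \<and> (\<integral>v. norm v ^ p \<partial>Z \<sigma> \<theta>) \<le> (1 + C ^ (2 * p)) * (1 + norm \<theta>) ^ p"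
      if \<sigma>: "0 < \<sigma>" for \<sigma> \<theta>
    proof -
      interpret prob_space "Z \<sigma> \<theta>" using Z \<sigma> by blast
      define X where "X = 1 + norm \<theta>"
      have X: "0 < X" by (simp add: X_def add_pos_nonneg)
      define I where "I = (\<integral>v. norm v ^ (2 * p) \<partial>Z \<sigma> \<theta>)"
      have I0: "0 \<le> I" by (simp add: I_def)
      have "root (2 * p) I ^ (2 * p) \<le> (C * X) ^ (2 * p)"
        using C(2)[OF \<sigma>, of \<theta>] False I0 by (intro power_mono) (auto simp: I_def X_def)
      then have I: "I \<le> C ^ (2 * p) * X ^ (2 * p)" using I0 False by (simp add: power_mult_distrib)
      \<comment> \<open>Below the scale \<open>X\<close> the first summand dominates, above it the
        second one. This replaces Jensen's inequality at the cost of an additive 1 in the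
        constant.\<close>
      have pt: "norm v ^ p \<le> X ^ p + norm v ^ (2 * p) / X ^ p" for v :: "real ^ 'n"
      proof (cases "norm v \<le> X")
        case True
        then have "norm v ^ p \<le> X ^ p" by (intro power_mono) auto
        then show ?thesis using X by (simp add: add_increasing2)
      next
        case False
        then have "X ^ p \<le> norm v ^ p" using X by (intro power_mono) auto
        then have "norm v ^ p * X ^ p \<le> norm v ^ p * norm v ^ p" by (intro mult_left_mono) auto
        then have "norm v ^ p \<le> norm v ^ (2 * p) / X ^ p" using X by (simp add: pos_le_divide_eq mult_2 power_add)
        then show ?thesis using X by (simp add: add_increasing)
      qed
      have ip: "integrable (Z \<sigma> \<theta>) (\<lambda>v. norm v ^ p)"
      proof (rule Bochner_Integration.integrable_bound)
        show "integrable (Z \<sigma> \<theta>) (\<lambda>v. X ^ p + norm v ^ (2 * p) / X ^ p)" using C(1)[OF \<sigma>] by auto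
        have "(\<lambda>v :: real ^ 'n. norm v ^ p) \<in> borel_measurable borel" by measurable
        then show "(\<lambda>v. norm v ^ p) \<in> borel_measurable (Z \<sigma> \<theta>)"
          using Z[OF \<sigma>, of \<theta>] measurable_cong_sets[of "Z \<sigma> \<theta>" borel borel borel] by blast
        show "AE v in Z \<sigma> \<theta>. norm (norm v ^ p) \<le> norm (X ^ p + norm v ^ (2 * p) / X ^ p)"
          using pt by (intro AE_I2) (auto intro: order_trans[OF _ abs_ge_self])
      qed
      have "(\<integral>v. norm v ^ p \<partial>Z \<sigma> \<theta>) \<le> (\<integral>v. X ^ p + norm v ^ (2 * p) / X ^ p \<partial>Z \<sigma> \<theta>)"
        using ip C(1)[OF \<sigma>] pt by (intro integral_mono) auto
      also have "\<dots> = X ^ p + I / X ^ p" using C(1)[OF \<sigma>, of \<theta>] by (simp add: I_def prob_space)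
      also have "\<dots> \<le> X ^ p + C ^ (2 * p) * X ^ (2 * p) / X ^ p" using I X by (simp add: divide_right_mono)
      also have "C ^ (2 * p) * X ^ (2 * p) / X ^ p = C ^ (2 * p) * X ^ p" using X by (simp add: mult_2[of p] power_add)
      also have "X ^ p + C ^ (2 * p) * X ^ p = (1 + C ^ (2 * p)) * X ^ p" by (simp add: distrib_right)
      finally show ?thesis using ip unfolding X_def by blast
    qed
    then show ?thesis by (intro exI[of _ "1 + C ^ (2 * p)"]) (auto simp: zero_le_even_power add_nonneg_nonneg)
  qed
  then obtain V where "\<And>p. 0 \<le> V p \<and> (\<forall>\<sigma>>0. \<forall>\<theta>. integrable (Z \<sigma> \<theta>) (\<lambda>v. norm v ^ p) \<and>
      (\<integral>v. norm v ^ p \<partial>Z \<sigma> \<theta>) \<le> V p * (1 + norm \<theta>) ^ p)" by metis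
  then show thesis by (intro that[of V]) blast+
qed

lemma NGOS_prob_space:
  assumes "NGOS L \<Sigma> Z" "0 < \<sigma>"
  shows "prob_space (Z \<sigma> \<theta>) \<and> sets (Z \<sigma> \<theta>) = sets borel"
proof -
  have "Z \<sigma> \<in> borel \<rightarrow>\<^sub>M prob_algebra borel" using assms by (simp add: NGOS_def)
  from measurable_space[OF this, of \<theta>] show ?thesis by (auto simp: space_prob_algebra)
qed

text \<open>Gradient and noise both fit the common scale \<open>(1 + norm \<theta>) / e\<close>: the
  gradient because \<open>e \<le> 1\<close>, the noise because \<open>\<sigma> \<le> 1 / e\<close>.
  Splitting the power of their sum gives the constant \<open>2 ^ p * (K ^ p + V p)\<close>.\<close>

lemma oracle_law_kernel:
  fixes L :: "real ^ 'n \<Rightarrow> real"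
  assumes D: "diffusion K q (gradient L) b1 b2 b3 s s1 s2 s3" and N: "NGOS L \<Sigma> Z"
    and s: "\<And>\<theta> i j. i \<in> Basis \<Longrightarrow> j \<in> Basis \<Longrightarrow> (\<Sum>l\<in>Basis. (s l \<theta> \<bullet> i) * (s l \<theta> \<bullet> j)) = i \<bullet> (\<Sigma> \<theta> *v j)"
    and V: "\<And>p. 0 \<le> V p" "\<And>p \<sigma> \<theta>. 0 < \<sigma> \<Longrightarrow> integrable (Z \<sigma> \<theta>) (\<lambda>v. norm v ^ p)"
      "\<And>p \<sigma> \<theta>. 0 < \<sigma> \<Longrightarrow> (\<integral>v. norm v ^ p \<partial>Z \<sigma> \<theta>) \<le> V p * (1 + norm \<theta>) ^ p"
    and e: "0 < e" "e \<le> 1" and \<sigma>: "0 < \<sigma>" "\<sigma> \<le> 1 / e"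
  shows "diffusion.oracle_kernel (gradient L) s (\<lambda>p. 2 ^ p * (K ^ p + V p)) e (\<sigma>\<^sup>2) (oracle_law L Z \<sigma>)"
proof -
  interpret diffusion K q "gradient L" b1 b2 b3 s s1 s2 s3 by (rule D)
  have K0: "0 \<le> K" using K by simp
  have "continuous_on UNIV (gradient L)"
    using drift unfolding coefficient_def jet3_def by (intro has_derivative_continuous_on[where f'=b1]) simp
  then have gm: "gradient L \<in> borel_measurable borel" by (rule borel_measurable_continuous_onI)
  have Zk: "Z \<sigma> \<in> borel \<rightarrow>\<^sub>M prob_algebra borel" using N \<sigma> by (simp add: NGOS_def)
  note Zp = NGOS_prob_space[OF N \<sigma>(1)]
  have Zm: "f \<in> borel_measurable (Z \<sigma> \<theta>)" if "f \<in> borel_measurable borel" for f :: "real ^ 'n \<Rightarrow> 'c::topological_space" and \<theta>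
    using that Zp measurable_cong_sets[of "Z \<sigma> \<theta>" borel borel borel] by blast
  have tm: "(\<lambda>v. gradient L \<theta> + \<sigma> *\<^sub>R v) \<in> borel_measurable (Z \<sigma> \<theta>)" for \<theta> by (rule Zm) measurable
  have int: "(\<integral>g. f g \<partial>oracle_law L Z \<sigma> \<theta>) = (\<integral>v. f (gradient L \<theta> + \<sigma> *\<^sub>R v) \<partial>Z \<sigma> \<theta>)"
    if "f \<in> borel_measurable borel" for f :: "real ^ 'n \<Rightarrow> real" and \<theta>
    unfolding oracle_law_def by (rule integral_distr[OF tm that])
  have vi: "integrable (Z \<sigma> \<theta>) (\<lambda>v. v)" for \<theta>
  proof -
    have "integrable (Z \<sigma> \<theta>) (\<lambda>v. norm v)" using V(2)[OF \<sigma>(1), of \<theta> 1] by simp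
    then show ?thesis by (rule integrable_norm_cancel) (rule Zm, simp)
  qed
  have mean: "(\<integral>v. v \<partial>Z \<sigma> \<theta>) = 0" and cov: "covariance_matrix (Z \<sigma> \<theta>) = \<Sigma> \<theta>" for \<theta>
    using N \<sigma> by (auto simp: NGOS_def)
  have vim: "(\<integral>v. v \<bullet> i \<partial>Z \<sigma> \<theta>) = 0" for i \<theta> using integral_inner_left[OF vi, of \<theta> i] by (simp add: mean)
  have vii: "integrable (Z \<sigma> \<theta>) (\<lambda>v. v \<bullet> i)" for i \<theta> by (intro integrable_inner_left vi)
  have vij: "integrable (Z \<sigma> \<theta>) (\<lambda>v. (v \<bullet> i) * (v \<bullet> j))" if "i \<in> Basis" "j \<in> Basis" for i j \<theta>
  proof (rule Bochner_Integration.integrable_bound[OF V(2)[OF \<sigma>(1), of \<theta> 2]])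
    show "(\<lambda>v. (v \<bullet> i) * (v \<bullet> j)) \<in> borel_measurable (Z \<sigma> \<theta>)" by (rule Zm) measurable
    have "norm ((v \<bullet> i) * (v \<bullet> j)) \<le> norm (norm v ^ 2)" for v :: "real ^ 'n"
      using that Basis_le_norm[of i v] Basis_le_norm[of j v] by (simp add: abs_mult power2_eq_square mult_mono)
    then show "AE v in Z \<sigma> \<theta>. norm ((v \<bullet> i) * (v \<bullet> j)) \<le> norm (norm v ^ 2)" by simp
  qed
  show ?thesis unfolding oracle_kernel_def
  proof (intro conjI allI ballI e)
    show "oracle_law L Z \<sigma> \<in> borel \<rightarrow>\<^sub>M prob_algebra borel"
      unfolding oracle_law_def[abs_def]
      by (rule measurable_distr_prob_space2[OF Zk]) (use gm in measurable)
    fix \<theta> and p :: nat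
    interpret Z: prob_space "Z \<sigma> \<theta>" using Zp by blast
    have pt: "norm (gradient L \<theta> + \<sigma> *\<^sub>R v) ^ p \<le> 2 ^ p * ((K * ((1 + norm \<theta>) / e)) ^ p + (1 / e) ^ p * norm v ^ p)" for v
    proof -
      have "norm (gradient L \<theta>) \<le> K * (1 + norm \<theta>)" by (rule drift_le)
      also have "\<dots> \<le> K * ((1 + norm \<theta>) / e)" using e K0
        by (intro mult_left_mono) (auto simp: le_divide_eq mult_left_le)
      finally have 1: "norm (gradient L \<theta>) \<le> K * ((1 + norm \<theta>) / e)" .
      have 2: "norm (\<sigma> *\<^sub>R v) \<le> 1 / e * norm v" using \<sigma> mult_right_mono[OF \<sigma>(2), of "norm v"] by simp
      have "norm (gradient L \<theta> + \<sigma> *\<^sub>R v) ^ p \<le> (K * ((1 + norm \<theta>) / e) + 1 / e * norm v) ^ p"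
        by (intro power_mono order_trans[OF norm_triangle_ineq] add_mono 1 2) simp
      also have "\<dots> \<le> 2 ^ p * ((K * ((1 + norm \<theta>) / e)) ^ p + (1 / e * norm v) ^ p)"
        using K0 e by (intro power_sum_le) auto
      finally show ?thesis by (simp add: power_mult_distrib power_divide)
    qed
    have bi: "integrable (Z \<sigma> \<theta>) (\<lambda>v. 2 ^ p * ((K * ((1 + norm \<theta>) / e)) ^ p + (1 / e) ^ p * norm v ^ p))"
      using V(2)[OF \<sigma>(1)] by auto
    have ni: "integrable (Z \<sigma> \<theta>) (\<lambda>v. norm (gradient L \<theta> + \<sigma> *\<^sub>R v) ^ p)"
    proof (rule Bochner_Integration.integrable_bound[OF bi])
      show "(\<lambda>v. norm (gradient L \<theta> + \<sigma> *\<^sub>R v) ^ p) \<in> borel_measurable (Z \<sigma> \<theta>)" by (rule Zm) measurable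
      show "AE v in Z \<sigma> \<theta>. norm (norm (gradient L \<theta> + \<sigma> *\<^sub>R v) ^ p) \<le>
          norm (2 ^ p * ((K * ((1 + norm \<theta>) / e)) ^ p + (1 / e) ^ p * norm v ^ p))"
        using pt by (intro AE_I2) (simp only: real_norm_def abs_of_nonneg[OF zero_le_power[OF norm_ge_zero]],
            rule order_trans[OF _ abs_ge_self])
    qed
    show "integrable (oracle_law L Z \<sigma> \<theta>) (\<lambda>g. norm g ^ p)"
      unfolding oracle_law_def using ni by (subst integrable_distr_eq[OF tm]) auto
    have "(\<integral>g. norm g ^ p \<partial>oracle_law L Z \<sigma> \<theta>) = (\<integral>v. norm (gradient L \<theta> + \<sigma> *\<^sub>R v) ^ p \<partial>Z \<sigma> \<theta>)"
      by (rule int) measurable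
    also have "\<dots> \<le> (\<integral>v. 2 ^ p * ((K * ((1 + norm \<theta>) / e)) ^ p + (1 / e) ^ p * norm v ^ p) \<partial>Z \<sigma> \<theta>)"
      by (rule integral_mono[OF ni bi pt])
    also have "\<dots> = 2 ^ p * ((K * ((1 + norm \<theta>) / e)) ^ p + (1 / e) ^ p * (\<integral>v. norm v ^ p \<partial>Z \<sigma> \<theta>))"
      using V(2)[OF \<sigma>(1), of \<theta> p] by (simp add: Z.prob_space)
    also have "\<dots> \<le> 2 ^ p * ((K * ((1 + norm \<theta>) / e)) ^ p + (1 / e) ^ p * (V p * (1 + norm \<theta>) ^ p))"
      using e V(3)[OF \<sigma>(1)] by (intro mult_left_mono add_left_mono) auto
    also have "\<dots> = 2 ^ p * (K ^ p + V p) * ((1 + norm \<theta>) / e) ^ p"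
      unfolding power_mult_distrib[of K] power_divide by (simp add: distrib_left distrib_right add_divide_distrib mult.assoc)
    finally show "(\<integral>g. norm g ^ p \<partial>oracle_law L Z \<sigma> \<theta>) \<le> 2 ^ p * (K ^ p + V p) * ((1 + norm \<theta>) / e) ^ p" .
    fix i :: "real ^ 'n" assume i: "i \<in> Basis"
    have "(\<integral>g. g \<bullet> i \<partial>oracle_law L Z \<sigma> \<theta>) = (\<integral>v. (gradient L \<theta> + \<sigma> *\<^sub>R v) \<bullet> i \<partial>Z \<sigma> \<theta>)"
      by (rule int) measurable
    also have "\<dots> = gradient L \<theta> \<bullet> i" using vii by (simp add: inner_add_left vim Z.prob_space)
    finally show "(\<integral>g. g \<bullet> i \<partial>oracle_law L Z \<sigma> \<theta>) = gradient L \<theta> \<bullet> i" .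
    fix j :: "real ^ 'n" assume j: "j \<in> Basis"
    have "(\<integral>g. (g \<bullet> i) * (g \<bullet> j) \<partial>oracle_law L Z \<sigma> \<theta>) =
        (\<integral>v. ((gradient L \<theta> + \<sigma> *\<^sub>R v) \<bullet> i) * ((gradient L \<theta> + \<sigma> *\<^sub>R v) \<bullet> j) \<partial>Z \<sigma> \<theta>)"
      by (rule int) measurable
    also have "\<dots> = (\<integral>v. (gradient L \<theta> \<bullet> i) * (gradient L \<theta> \<bullet> j) + ((gradient L \<theta> \<bullet> i) * \<sigma>) * (v \<bullet> j)
        + ((gradient L \<theta> \<bullet> j) * \<sigma>) * (v \<bullet> i) + \<sigma>\<^sup>2 * ((v \<bullet> i) * (v \<bullet> j)) \<partial>Z \<sigma> \<theta>)"
      by (intro Bochner_Integration.integral_cong refl) (simp add: inner_add_left power2_eq_square algebra_simps)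
    also have "\<dots> = (gradient L \<theta> \<bullet> i) * (gradient L \<theta> \<bullet> j) + \<sigma>\<^sup>2 * (\<integral>v. (v \<bullet> i) * (v \<bullet> j) \<partial>Z \<sigma> \<theta>)"
      using vii vij[OF i j] by (simp add: vim Z.prob_space)
    also have "(\<integral>v. (v \<bullet> i) * (v \<bullet> j) \<partial>Z \<sigma> \<theta>) = (\<Sum>l\<in>Basis. (s l \<theta> \<bullet> i) * (s l \<theta> \<bullet> j))"
      using inner_covariance_matrix[OF mean i j] by (simp add: cov s[OF i j])
    finally show "(\<integral>g. (g \<bullet> i) * (g \<bullet> j) \<partial>oracle_law L Z \<sigma> \<theta>) =
      (gradient L \<theta> \<bullet> i) * (gradient L \<theta> \<bullet> j) + \<sigma>\<^sup>2 * (\<Sum>l\<in>Basis. (s l \<theta> \<bullet> i) * (s l \<theta> \<bullet> j))" .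
  qed
qed

text \<open>Total displacement per unit of gradient weight in the \<open>k\<close>-th momentum; the summation index is \<open>s - k\<close>.\<close>

definition future_lr :: "(nat \<Rightarrow> real) \<Rightarrow> (nat \<Rightarrow> real) \<Rightarrow> nat \<Rightarrow> real" where
  "future_lr lr \<beta> k = (\<Sum>j. lr (k + j) * (\<Prod>\<tau>=k+1..k+j. \<beta> \<tau>))"

section \<open>Displacement still to come from the momentum\<close>

context
  fixes lr \<beta> :: "nat \<Rightarrow> real" and E r :: real
  assumes lr: "\<And>k. 0 \<le> lr k" "\<And>k. lr k \<le> E" and \<beta>: "\<And>k. 0 \<le> \<beta> k" "\<And>k. \<beta> k \<le> r" and r: "r < 1"
begin

lemma future_lr_term: "0 \<le> lr (k + j) * (\<Prod>\<tau>=k+1..k+j. \<beta> \<tau>)"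
  "lr (k + j) * (\<Prod>\<tau>=k+1..k+j. \<beta> \<tau>) \<le> E * r ^ j"
proof -
  have "(\<Prod>\<tau>=k+1..k+j. \<beta> \<tau>) \<le> (\<Prod>\<tau>=k+1..k+j. r)" using \<beta> by (intro prod_mono) auto
  then have p: "0 \<le> (\<Prod>\<tau>=k+1..k+j. \<beta> \<tau>)" "(\<Prod>\<tau>=k+1..k+j. \<beta> \<tau>) \<le> r ^ j" using \<beta> by (auto intro: prod_nonneg)
  show "0 \<le> lr (k + j) * (\<Prod>\<tau>=k+1..k+j. \<beta> \<tau>)" using lr p by simp
  show "lr (k + j) * (\<Prod>\<tau>=k+1..k+j. \<beta> \<tau>) \<le> E * r ^ j"
    using lr p order_trans[OF lr] by (intro mult_mono) auto
qed

lemma future_lr_geometric: "(\<lambda>j. E * r ^ j) sums (E / (1 - r))"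
proof -
  have "0 \<le> r" using \<beta>[of 0] by linarith
  then show ?thesis using sums_mult[OF geometric_sums[of r], of E] r by simp
qed

lemma future_lr_summable: "summable (\<lambda>j. lr (k + j) * (\<Prod>\<tau>=k+1..k+j. \<beta> \<tau>))"
  by (rule summable_comparison_test'[OF sums_summable[OF future_lr_geometric], of 0])
    (use future_lr_term[of k] in auto)

lemma future_lr_bounds: "0 \<le> future_lr lr \<beta> k" "future_lr lr \<beta> k \<le> E / (1 - r)"
  unfolding future_lr_def
  using suminf_nonneg[OF future_lr_summable future_lr_term(1)]
    suminf_le[OF future_lr_term(2) future_lr_summable sums_summable[OF future_lr_geometric]]
    sums_unique[OF future_lr_geometric] by simp_all

lemma averaged_lr_eq: "averaged_lr lr \<beta> k = (1 - \<beta> k) * future_lr lr \<beta> k"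
  unfolding averaged_lr_def future_lr_def using suminf_mult2[OF future_lr_summable[of k], of "1 - \<beta> k"]
  by (simp add: mult.commute)

text \<open>The identity behind the change of variables: a unit of momentum first acts with the
  current learning rate, then shrinks by \<open>\<beta> (Suc k)\<close> and acts on as momentum of
  the next step.\<close>

lemma future_lr_Suc: "future_lr lr \<beta> k = lr k + \<beta> (Suc k) * future_lr lr \<beta> (Suc k)"
proof -
  have p: "(\<Prod>\<tau>=k+1..k+Suc j. \<beta> \<tau>) = \<beta> (Suc k) * (\<Prod>\<tau>=Suc k+1..Suc k+j. \<beta> \<tau>)" for j
    using prod.atLeast_Suc_atMost[of "k + 1" "k + Suc j" \<beta>] by simp
  have "future_lr lr \<beta> k = lr k + (\<Sum>j. lr (k + Suc j) * (\<Prod>\<tau>=k+1..k+Suc j. \<beta> \<tau>))"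
    unfolding future_lr_def by (subst suminf_split_head[OF future_lr_summable]) simp
  also have "(\<Sum>j. lr (k + Suc j) * (\<Prod>\<tau>=k+1..k+Suc j. \<beta> \<tau>)) =
      (\<Sum>j. \<beta> (Suc k) * (lr (Suc k + j) * (\<Prod>\<tau>=Suc k+1..Suc k+j. \<beta> \<tau>)))"
    unfolding p by (simp add: mult_ac)
  also have "\<dots> = \<beta> (Suc k) * future_lr lr \<beta> (Suc k)"
    unfolding future_lr_def by (rule suminf_mult[OF future_lr_summable])
  finally show ?thesis .
qed

end

section \<open>SGDM and SGD as momentum runs\<close>

context
  fixes K :: real and q :: nat and b :: "real ^ 'n \<Rightarrow> real ^ 'n" and b1 b2 b3 s s1 s2 s3
    and M :: "'w measure" and G and lr \<beta> :: "nat \<Rightarrow> real" and x0 :: "real ^ 'n"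
    and l Mo e \<kappa> c
  assumes D: "diffusion K q b b1 b2 b3 s s1 s2 s3"
    and kernel: "diffusion.oracle_kernel b s Mo e c G"
    and scales: "e \<le> \<kappa>" "\<kappa> \<le> 1" "0 \<le> c" "c * e\<^sup>2 \<le> 1"
    and \<beta>: "\<And>k. 0 \<le> \<beta> k" "\<And>k. l * \<kappa>\<^sup>2 \<le> 1 - \<beta> k" "\<And>k. 1 - \<beta> k \<le> \<kappa>\<^sup>2" and l: "0 < l"
begin

interpretation diffusion K q b b1 b2 b3 s s1 s2 s3 by (rule D)

lemma scale_positive: "0 < e"
  using kernel by (simp add: oracle_kernel_def)

lemma SGDM_momentum_run:
  assumes traj: "SGDM_trajectory M G lr \<beta> m0 x0 x"
    and lr: "\<And>k. 0 \<le> lr k" "\<And>k. lr k \<le> E * e\<^sup>2" and R: "E / l \<le> R"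
    and m0: "\<And>p::nat. integrable M (\<lambda>\<omega>. norm (m0 \<omega>) ^ p)" "\<And>p. (\<integral>\<omega>. norm (m0 \<omega>) ^ p \<partial>M) \<le> Mi p"
  shows "\<exists>F d g m y. momentum_run R l Mo Mi x0 e \<kappa> c M G F (averaged_lr lr \<beta>) d \<beta> g m y x"
proof -
  obtain F g m where M: "prob_space M" and oa: "oracle_answers M F G x g" and m0F: "m0 \<in> borel_measurable (F 0)"
    and init: "\<And>\<omega>. \<omega> \<in> space M \<Longrightarrow> m 0 \<omega> = m0 \<omega> \<and> x 0 \<omega> = x0"
    and eqs: "\<And>\<omega> k. \<omega> \<in> space M \<Longrightarrow> m (Suc k) \<omega> = \<beta> k *\<^sub>R m k \<omega> + (1 - \<beta> k) *\<^sub>R g k \<omega> \<and>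
                x (Suc k) \<omega> = x k \<omega> - lr k *\<^sub>R m (Suc k) \<omega>"
    using traj unfolding SGDM_trajectory_def by blast
  interpret prob_space M by (rule M)
  have fil: "filtration (space M) F" and sub: "\<And>k. subalgebra M (F k)" and xF: "\<And>k. x k \<in> borel_measurable (F k)"
    and gF: "\<And>k. g k \<in> borel_measurable (F (Suc k))" and law: "\<And>k. has_conditional_law M (F k) (g k) (\<lambda>\<omega>. G (x k \<omega>))"
    using oa unfolding oracle_answers_def by blast+
  have spF: "space (F k) = space M" for k using sub by (simp add: subalgebra_def)
  have up: "f \<in> borel_measurable (F (Suc k))" if "f \<in> borel_measurable (F k)" for f :: "'w \<Rightarrow> real ^ 'n" and k
    using filtration.sets_F_mono[OF fil, of k "Suc k"] spF that by (intro measurable_from_subalg[of "F (Suc k)" "F k"]) (auto simp: subalgebra_def)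
  have mF: "m k \<in> borel_measurable (F k)" for k
  proof (induction k)
    case 0
    have "m 0 \<in> borel_measurable (F 0) \<longleftrightarrow> m0 \<in> borel_measurable (F 0)"
      by (intro measurable_cong) (simp add: spF init)
    then show ?case using m0F by simp
  next
    case (Suc k)
    have "m (Suc k) \<in> borel_measurable (F (Suc k)) \<longleftrightarrow>
        (\<lambda>\<omega>. \<beta> k *\<^sub>R m k \<omega> + (1 - \<beta> k) *\<^sub>R g k \<omega>) \<in> borel_measurable (F (Suc k))"
      by (intro measurable_cong) (simp add: spF eqs)
    then show ?case using up[OF Suc] gF[of k] by simp
  qed
  have e: "0 < e" by (rule scale_positive)
  have \<kappa>: "0 < \<kappa>" using e scales by linarith
  define A where "A = future_lr lr \<beta>"
  \<comment> \<open>A common upper bound for the momentum factors. The geometric series gives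
    \<open>E * e\<^sup>2 / (l * \<kappa>\<^sup>2)\<close> for the future displacement, whence the
    constant \<open>E / l\<close>.\<close>
  define r where "r = 1 - l * \<kappa>\<^sup>2"
  have br: "\<And>k. \<beta> k \<le> r" "r < 1" using \<beta>(2) l \<kappa> by (auto simp: r_def algebra_simps)
  have Ab: "0 \<le> A k" "A k \<le> R * (e / \<kappa>)\<^sup>2" for k
  proof -
    show "0 \<le> A k" unfolding A_def by (rule future_lr_bounds[OF lr \<beta>(1) br])
    have "A k \<le> E * e\<^sup>2 / (1 - r)" unfolding A_def by (rule future_lr_bounds[OF lr \<beta>(1) br])
    also have "\<dots> = E / l * (e / \<kappa>)\<^sup>2" by (simp add: r_def power_divide)
    also have "\<dots> \<le> R * (e / \<kappa>)\<^sup>2" using R by (intro mult_right_mono) auto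
    finally show "A k \<le> R * (e / \<kappa>)\<^sup>2" .
  qed
  have Asuc: "A k = lr k + \<beta> (Suc k) * A (Suc k)" for k unfolding A_def by (rule future_lr_Suc[OF lr \<beta>(1) br])
  have av: "averaged_lr lr \<beta> k = (1 - \<beta> k) * A k" for k unfolding A_def by (rule averaged_lr_eq[OF lr \<beta>(1) br])
  have \<beta>1: "0 \<le> 1 - \<beta> k" "\<beta> k \<le> 1" for k
  proof -
    have "0 \<le> l * \<kappa>\<^sup>2" using l by simp
    then show "0 \<le> 1 - \<beta> k" "\<beta> k \<le> 1" using \<beta>(2)[of k] by linarith+
  qed
  \<comment> \<open>\<open>m k\<close> is the momentum before step \<open>k\<close> and acts only
    after multiplication by \<open>\<beta> k\<close>, so a unit of it still causes the displacement
    \<open>\<beta> k * A k\<close>.\<close>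
  define d where "d k = \<beta> k * A k" for k
  define y where "y k \<omega> = x k \<omega> - d k *\<^sub>R m k \<omega>" for k \<omega>
  have "momentum_run R l Mo Mi x0 e \<kappa> c M G F (averaged_lr lr \<beta>) d \<beta> g m y x"
    unfolding momentum_run_def
  proof (intro conjI allI ballI M scales kernel \<beta>)
    fix k
    show "oracle_call M (F k) G (x k) (g k)"
      unfolding oracle_call_def using sub xF law measurable_from_subalg[OF sub gF] by blast
    show "y k \<in> borel_measurable (F k)" unfolding y_def using xF[of k] mF[of k] by simp
    show "m k \<in> borel_measurable (F k)" by (rule mF)
    show "0 \<le> averaged_lr lr \<beta> k" unfolding av using \<beta>1 Ab by simp
    have "(1 - \<beta> k) * A k \<le> \<kappa>\<^sup>2 * (R * (e / \<kappa>)\<^sup>2)" using \<beta> \<beta>1 Ab by (intro mult_mono) auto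
    then show "averaged_lr lr \<beta> k \<le> R * e\<^sup>2" unfolding av using \<kappa> by (simp add: power_divide)
    have "\<beta> k * A k \<le> 1 * A k" using \<beta>1 Ab by (intro mult_right_mono) auto
    moreover have "0 \<le> \<beta> k * A k" using \<beta> Ab by simp
    ultimately show "\<bar>d k\<bar> \<le> R * (e / \<kappa>)\<^sup>2" unfolding d_def using Ab(2)[of k] by linarith
    fix \<omega> assume \<omega>: "\<omega> \<in> space M"
    show "x 0 \<omega> = x0" using init \<omega> by blast
    show "x k \<omega> = y k \<omega> + d k *\<^sub>R m k \<omega>" by (simp add: y_def)
    show ms: "m (Suc k) \<omega> = \<beta> k *\<^sub>R m k \<omega> + (1 - \<beta> k) *\<^sub>R g k \<omega>" using eqs \<omega> by blast
    \<comment> \<open>By the recursion for \<open>A\<close>, the current displacement and the later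
      ones combine to \<open>A k\<close> times the new momentum. In this expression the part of
      \<open>m k\<close> is exactly what \<open>y k\<close> already subtracts, so only the gradient
      with weight \<open>(1 - \<beta> k) * A k\<close> is left.\<close>
    have "y (Suc k) \<omega> = x k \<omega> - A k *\<^sub>R m (Suc k) \<omega>"
      using eqs[OF \<omega>, of k] Asuc[of k] by (simp add: y_def d_def algebra_simps)
    then show "y (Suc k) \<omega> = y k \<omega> - averaged_lr lr \<beta> k *\<^sub>R g k \<omega>"
      unfolding av ms by (simp add: y_def d_def algebra_simps)
  next
    have "vector_moments M m0"
      unfolding vector_moments_def all_moments_def
      using measurable_from_subalg[OF sub m0F] m0(1) by simp
    then show "vector_moments M (m 0)" by (rule vector_moments_cong[rotated]) (simp add: init)
    fix p :: nat
    have "(\<integral>\<omega>. norm (m 0 \<omega>) ^ p \<partial>M) = (\<integral>\<omega>. norm (m0 \<omega>) ^ p \<partial>M)"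
      by (intro Bochner_Integration.integral_cong refl) (simp add: init)
    then show "(\<integral>\<omega>. norm (m 0 \<omega>) ^ p \<partial>M) \<le> Mi p" using m0(2)[of p] by simp
  qed
  then show ?thesis by blast
qed

lemma SGD_momentum_run:
  assumes traj: "SGD_trajectory M G lr x0 x"
    and lr: "\<And>k. 0 \<le> lr k" "\<And>k. lr k \<le> R * e\<^sup>2" and R: "0 \<le> R"
  shows "\<exists>F d g m y. momentum_run R l Mo (\<lambda>_. 1) x0 e \<kappa> c M G F lr d \<beta> g m y x"
proof -
  obtain F g where M: "prob_space M" and oa: "oracle_answers M F G x g"
    and init: "\<And>\<omega>. \<omega> \<in> space M \<Longrightarrow> x 0 \<omega> = x0"
    and eqs: "\<And>\<omega> k. \<omega> \<in> space M \<Longrightarrow> x (Suc k) \<omega> = x k \<omega> - lr k *\<^sub>R g k \<omega>"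
    using traj unfolding SGD_trajectory_def by blast
  interpret prob_space M by (rule M)
  have fil: "filtration (space M) F" and sub: "\<And>k. subalgebra M (F k)" and xF: "\<And>k. x k \<in> borel_measurable (F k)"
    and gF: "\<And>k. g k \<in> borel_measurable (F (Suc k))" and law: "\<And>k. has_conditional_law M (F k) (g k) (\<lambda>\<omega>. G (x k \<omega>))"
    using oa unfolding oracle_answers_def by blast+
  have spF: "space (F k) = space M" for k using sub by (simp add: subalgebra_def)
  have up: "f \<in> borel_measurable (F (Suc k))" if "f \<in> borel_measurable (F k)" for f :: "'w \<Rightarrow> real ^ 'n" and k
    using filtration.sets_F_mono[OF fil, of k "Suc k"] spF that by (intro measurable_from_subalg[of "F (Suc k)" "F k"]) (auto simp: subalgebra_def)
  \<comment> \<open>An auxiliary momentum, started at zero and driven by the same answers, puts SGD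
    in the form of a run with \<open>y = x\<close>. Its initial moments are bounded by 1 and not by
    0 because of the power \<open>0 ^ 0 = 1\<close>.\<close>
  define m where "m = rec_nat (\<lambda>_. 0) (\<lambda>k mk \<omega>. \<beta> k *\<^sub>R mk \<omega> + (1 - \<beta> k) *\<^sub>R g k \<omega>)"
  have m: "m 0 = (\<lambda>_. 0)" "\<And>k. m (Suc k) = (\<lambda>\<omega>. \<beta> k *\<^sub>R m k \<omega> + (1 - \<beta> k) *\<^sub>R g k \<omega>)"
    by (simp_all add: m_def)
  have mF: "m k \<in> borel_measurable (F k)" for k
  proof (induction k)
    case (Suc k)
    then show ?case unfolding m using up[OF Suc] gF[of k] by simp
  qed (simp add: m)
  have "momentum_run R l Mo (\<lambda>_. 1) x0 e \<kappa> c M G F lr (\<lambda>_. 0) \<beta> g m x x"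
    unfolding momentum_run_def
  proof (intro conjI allI ballI M scales kernel \<beta> lr xF mF)
    fix k
    show "oracle_call M (F k) G (x k) (g k)"
      unfolding oracle_call_def using sub xF law measurable_from_subalg[OF sub gF] by blast
    show "\<bar>0\<bar> \<le> R * (e / \<kappa>)\<^sup>2" using R by simp
    show "vector_moments M (m 0)" unfolding m by (rule vector_moments_const)
    fix p :: nat
    show "(\<integral>\<omega>. norm (m 0 \<omega>) ^ p \<partial>M) \<le> 1" unfolding m by (simp add: power_0_left prob_space)
  qed (use init eqs in \<open>auto simp: m\<close>)
  then show ?thesis by blast
qed

end

lemma well_behaved_diffusion:
  assumes "well_behaved L \<Sigma>"
  obtains K q b1 b2 b3 s s1 s2 s3 where "diffusion K q (gradient L) b1 b2 b3 s s1 s2 s3"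
    "\<And>\<theta> i j. (\<Sum>l\<in>Basis. (s l \<theta> \<bullet> i) * (s l \<theta> \<bullet> j)) = i \<bullet> (\<Sigma> \<theta> *v j)"
proof -
  obtain CL CS S where gL: "CL-lipschitz_on UNIV (gradient L)" "C_infinity (gradient L)"
      "\<And>n. n \<le> 3 \<Longrightarrow> partials_polynomial_growth n (gradient L)"
    and S: "\<And>\<theta>. is_psd_sqrt (S \<theta>) (\<Sigma> \<theta>)" "CS-lipschitz_on UNIV S" "C_infinity S"
      "\<And>n. n \<le> 3 \<Longrightarrow> partials_polynomial_growth n S"
    using assms unfolding well_behaved_def by blast
  obtain K1 q1 b1 b2 b3 where K1: "1 \<le> K1" and b: "coefficient K1 q1 (gradient L) b1 b2 b3"
    using coefficient_exists[OF gL(2,3,1)] by blast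
  obtain K2 q2 S1 S2 S3 where K2: "1 \<le> K2" and cS: "coefficient K2 q2 S S1 S2 S3"
    using coefficient_exists[OF S(3,4,2)] by blast
  have lin: "bounded_linear (\<lambda>A :: real ^ 'a ^ 'a. A *v l)" for l
    by (intro linear_conv_bounded_linear[THEN iffD1] linearI)
      (simp_all add: matrix_vector_mult_add_rdistrib scaleR_matrix_vector_assoc)
  have "\<forall>l. \<exists>C\<ge>0. \<forall>A :: real ^ 'a ^ 'a. norm (A *v l) \<le> C * norm A"
    using bounded_linear.nonneg_bounded[OF lin] by (metis mult.commute)
  then obtain C where C: "\<And>l. 0 \<le> C l" "\<And>l (A :: real ^ 'a ^ 'a). norm (A *v l) \<le> C l * norm A" by metis
  \<comment> \<open>A sum instead of a maximum over the finitely many columns; it dominates the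
    constant of the drift and of every column.\<close>
  define K where "K = K1 + (\<Sum>l\<in>Basis. C l * K2)"
  define q where "q = max q1 q2"
  have le: "C l * K2 \<le> K" if "l \<in> Basis" for l
  proof -
    have "C l * K2 \<le> (\<Sum>l\<in>Basis. C l * K2)" using C(1) K2 that by (intro member_le_sum) auto
    then show ?thesis using K1 by (simp add: K_def)
  qed
  have sumC: "0 \<le> (\<Sum>l\<in>(Basis :: (real ^ 'a) set). C l * K2)" using C(1) K2 by (intro sum_nonneg) auto
  show thesis
  proof (rule that)
    show "diffusion K q (gradient L) b1 b2 b3 (\<lambda>l x. S x *v l) (\<lambda>l x v. S1 x v *v l) (\<lambda>l x v w. S2 x v w *v l)
        (\<lambda>l x v w z. S3 x v w z *v l)"
    proof
      show "1 \<le> K" using K1 sumC by (simp add: K_def)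
      show "coefficient K q (gradient L) b1 b2 b3"
        by (rule coefficient_mono[OF b]) (use K1 sumC in \<open>auto simp: K_def q_def\<close>)
      fix l :: "real ^ 'a" assume l: "l \<in> Basis"
      show "coefficient K q (\<lambda>x. S x *v l) (\<lambda>x v. S1 x v *v l) (\<lambda>x v w. S2 x v w *v l) (\<lambda>x v w z. S3 x v w z *v l)"
        by (rule coefficient_mono[OF coefficient_bounded_linear[OF cS lin C(2,1)] le[OF l]])
          (use C(1) K2 in \<open>auto simp: q_def\<close>)
    qed
    show "(\<Sum>l\<in>Basis. ((S \<theta> *v l) \<bullet> i) * ((S \<theta> *v l) \<bullet> j)) = i \<bullet> (\<Sigma> \<theta> *v j)" for \<theta> i j
      by (rule psd_sqrt_columns[OF S(1)])
  qed
qed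

lemma averaged_lr_constant:
  assumes "0 \<le> b" "b < 1" "\<And>k. lr k = \<eta>" "\<And>k. \<beta> k = b"
  shows "averaged_lr lr \<beta> k = \<eta>"
proof -
  have "(\<lambda>j. \<eta> * (1 - b) * b ^ j) sums (\<eta> * (1 - b) * (1 / (1 - b)))"
    using assms by (intro sums_mult geometric_sums) auto
  then have "(\<lambda>j. lr (k + j) * (\<Prod>\<tau>=k+1..k+j. \<beta> \<tau>) * (1 - \<beta> k)) sums \<eta>"
    using assms by (simp add: mult_ac)
  then show ?thesis unfolding averaged_lr_def by (rule sums_unique[symmetric])
qed

lemma Max_interval_le:
  fixes f :: "nat \<Rightarrow> real"
  assumes "\<And>k. real k * \<eta> \<le> T \<Longrightarrow> f k \<le> B" "0 < \<eta>" "0 < T"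
  shows "(MAX k\<in>{0..nat \<lfloor>T / \<eta>\<rfloor>}. f k) \<le> B"
proof (rule Max.boundedI)
  fix t assume "t \<in> f ` {0..nat \<lfloor>T / \<eta>\<rfloor>}"
  then obtain k where k: "k \<le> nat \<lfloor>T / \<eta>\<rfloor>" "t = f k" by auto
  have "real k \<le> real (nat \<lfloor>T / \<eta>\<rfloor>)" using k(1) by simp
  also have "\<dots> \<le> T / \<eta>" using assms by (intro of_nat_floor) simp
  finally have "real k \<le> T / \<eta>" .
  then have "real k * \<eta> \<le> T" using assms by (simp add: pos_le_divide_eq)
  then show "t \<le> B" using assms k by simp
qed auto

theorem theorem3p5:
  fixes L :: "real ^ 'n \<Rightarrow> real"
    and \<Sigma> :: "real ^ 'n \<Rightarrow> real ^ 'n ^ 'n"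
    and Z :: "real \<Rightarrow> real ^ 'n \<Rightarrow> (real ^ 'n) measure"
    and x0 :: "real ^ 'n"
    and \<alpha> \<eta>0 :: real
    and \<sigma> :: "real \<Rightarrow> real"
    and lr \<beta> :: "real \<Rightarrow> nat \<Rightarrow> real"
    and M :: "real \<Rightarrow> 'w measure"
    and m0 :: "real \<Rightarrow> 'w \<Rightarrow> real ^ 'n"
    and x :: "real \<Rightarrow> nat \<Rightarrow> 'w \<Rightarrow> real ^ 'n"
    and N :: "real \<Rightarrow> 'u measure"
    and z :: "real \<Rightarrow> nat \<Rightarrow> 'u \<Rightarrow> real ^ 'n"
  assumes "0 \<le> \<alpha>" and "\<alpha> < 1" and "0 < \<eta>0"
    and "NGOS L \<Sigma> Z" and "well_behaved L \<Sigma>" and "bounded_moments Z"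
    and "scaled_schedules \<eta>0 \<alpha> lr \<beta>"
    and "\<And>\<eta>. \<eta> \<in> {0<..\<eta>0} \<Longrightarrow> 0 < \<sigma> \<eta> \<and> \<sigma> \<eta> \<le> \<eta> powr (-1/2)"
    and "\<And>\<eta>. \<eta> \<in> {0<..\<eta>0} \<Longrightarrow>
           SGDM_trajectory (M \<eta>) (oracle_law L Z (\<sigma> \<eta>)) (lr \<eta>) (\<beta> \<eta>) (m0 \<eta>) x0 (x \<eta>)"
    and "\<And>p::nat. p \<ge> 1 \<Longrightarrow> \<exists>C\<ge>0. \<forall>\<eta>\<in>{0<..\<eta>0}.
           integrable (M \<eta>) (\<lambda>\<omega>. norm (m0 \<eta> \<omega>) ^ p) \<and> (\<integral>\<omega>. norm (m0 \<eta> \<omega>) ^ p \<partial>M \<eta>) \<le> C"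
    and "\<And>\<eta>. \<eta> \<in> {0<..\<eta>0} \<Longrightarrow>
           SGD_trajectory (N \<eta>) (oracle_law L Z (\<sigma> \<eta>)) (averaged_lr (lr \<eta>) (\<beta> \<eta>)) x0 (z \<eta>)"
  shows "weak_approximation ((1 - \<alpha>) / 2) M x N z \<and>
         (\<forall>b :: real \<Rightarrow> real.
            (\<forall>\<eta>\<in>{0<..\<eta>0}. \<forall>k. lr \<eta> k = \<eta> \<and> \<beta> \<eta> k = b \<eta>) \<longrightarrow>
              (\<forall>\<eta>\<in>{0<..\<eta>0}. \<forall>k. averaged_lr (lr \<eta>) (\<beta> \<eta>) k = \<eta>) \<and>
              weak_approximation_rate (\<lambda>\<eta>. sqrt (\<eta> / (1 - b \<eta>))) M x N z)"
proof -
  note NGOS = assms(4) and sigma = assms(8) and SGDM = assms(9) and SGD = assms(11)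
  obtain K q b1 b2 b3 s s1 s2 s3 where D: "diffusion K q (gradient L) b1 b2 b3 s s1 s2 s3"
    and cov: "\<And>\<theta> i j. (\<Sum>l\<in>Basis. (s l \<theta> \<bullet> i) * (s l \<theta> \<bullet> j)) = i \<bullet> (\<Sigma> \<theta> *v j)"
    using well_behaved_diffusion[OF assms(5)] by blast
  interpret diffusion K q "gradient L" b1 b2 b3 s s1 s2 s3 by (rule D)
  obtain V where V: "\<And>p. 0 \<le> V p" "\<And>p \<sigma> \<theta>. 0 < \<sigma> \<Longrightarrow> integrable (Z \<sigma> \<theta>) (\<lambda>v. norm v ^ p)"
    "\<And>p \<sigma> \<theta>. 0 < \<sigma> \<Longrightarrow> (\<integral>v. norm v ^ p \<partial>Z \<sigma> \<theta>) \<le> V p * (1 + norm \<theta>) ^ p"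
    using bounded_moments_all[OF assms(6) NGOS_prob_space[OF NGOS]] by blast
  define Mo where "Mo p = 2 ^ p * (K ^ p + V p)" for p
  have Mo: "0 \<le> Mo p" for p using V(1) K by (simp add: Mo_def)
  \<comment> \<open>The hypothesis on the initial momentum starts at order 1; order 0 is the total
    mass of a probability measure.\<close>
  have "\<exists>C\<ge>0. \<forall>\<eta>\<in>{0<..\<eta>0}. integrable (M \<eta>) (\<lambda>\<omega>. norm (m0 \<eta> \<omega>) ^ p) \<and> (\<integral>\<omega>. norm (m0 \<eta> \<omega>) ^ p \<partial>M \<eta>) \<le> C" for p
  proof (cases "p = 0")
    case True
    have "integrable (M \<eta>) (\<lambda>\<omega>. norm (m0 \<eta> \<omega>) ^ p) \<and> (\<integral>\<omega>. norm (m0 \<eta> \<omega>) ^ p \<partial>M \<eta>) \<le> 1" if "\<eta> \<in> {0<..\<eta>0}" for \<eta>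
    proof -
      interpret prob_space "M \<eta>" using SGDM[OF that] by (simp add: SGDM_trajectory_def)
      show ?thesis using True by (simp add: prob_space)
    qed
    then show ?thesis by (intro exI[of _ 1]) auto
  next
    case False
    then show ?thesis using assms(10)[of p] by simp
  qed
  then obtain Mi where Mi0: "\<And>p. 0 \<le> Mi p"
    and Mi: "\<And>p \<eta>. \<eta> \<in> {0<..\<eta>0} \<Longrightarrow> integrable (M \<eta>) (\<lambda>\<omega>. norm (m0 \<eta> \<omega>) ^ p)"
      "\<And>p \<eta>. \<eta> \<in> {0<..\<eta>0} \<Longrightarrow> (\<integral>\<omega>. norm (m0 \<eta> \<omega>) ^ p \<partial>M \<eta>) \<le> Mi p"
    by metis
  obtain E l lmax where l0: "0 < l" and lmax: "lmax < 1"
    and \<beta>01: "\<And>\<eta> k. \<eta> \<in> {0<..\<eta>0} \<Longrightarrow> 0 < \<beta> \<eta> k" "\<And>\<eta> k. \<eta> \<in> {0<..\<eta>0} \<Longrightarrow> \<beta> \<eta> k < 1"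
    and lrb: "\<And>\<eta> k. \<eta> \<in> {0<..\<eta>0} \<Longrightarrow> 0 \<le> lr \<eta> k / \<eta>" "\<And>\<eta> k. \<eta> \<in> {0<..\<eta>0} \<Longrightarrow> lr \<eta> k / \<eta> < E"
    and \<beta>b: "\<And>\<eta> k. \<eta> \<in> {0<..\<eta>0} \<Longrightarrow> l \<le> (1 - \<beta> \<eta> k) / \<eta> powr \<alpha>"
      "\<And>\<eta> k. \<eta> \<in> {0<..\<eta>0} \<Longrightarrow> (1 - \<beta> \<eta> k) / \<eta> powr \<alpha> \<le> lmax"
    using assms(7) unfolding scaled_schedules_def by blast
  have \<eta>0: "\<eta>0 \<in> {0<..\<eta>0}" using assms(3) by simp
  have l1: "l \<le> 1" using \<beta>b(1)[OF \<eta>0, of 0] \<beta>b(2)[OF \<eta>0, of 0] lmax by linarith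
  have E0: "0 \<le> E" using lrb(1)[OF \<eta>0, of 0] lrb(2)[OF \<eta>0, of 0] by linarith
  \<comment> \<open>\<open>E / l\<close> bounds the future displacement and thereby the averaged
    rates; the added 1 gives \<open>1 \<le> R\<close>, as the moment bounds require.\<close>
  define R where "R = 1 + E / l"
  have R: "1 \<le> R" "E / l \<le> R" using E0 l0 by (auto simp: R_def)
  have momentum_bound: "1 - \<beta> \<eta> k \<le> \<eta> powr \<alpha>" if "\<eta> \<in> {0<..\<eta>0}" for \<eta> k
  proof -
    have "(1 - \<beta> \<eta> k) / \<eta> powr \<alpha> \<le> 1" using \<beta>b(2)[OF that, of k] lmax by linarith
    then show ?thesis using that by (simp add: divide_le_eq_1)
  qed
  \<comment> \<open>The threshold combines the range of the schedules with
    \<open>\<eta> \<le> 1\<close>, which makes both scales \<open>e\<close> and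
    \<open>\<kappa>\<close> at most 1.\<close>
  have main: "\<exists>C\<ge>0. \<forall>\<eta>. 0 < \<eta> \<and> \<eta> \<le> min \<eta>0 1 \<longrightarrow>
       (MAX k\<in>{0..nat \<lfloor>T / \<eta>\<rfloor>}. \<bar>(\<integral>\<omega>. h (x \<eta> k \<omega>) \<partial>M \<eta>) - (\<integral>\<omega>. h (z \<eta> k \<omega>) \<partial>N \<eta>)\<bar>)
         \<le> C * \<eta> powr ((1 - \<alpha>) / 2)"
    if T: "0 < T" and h: "test_function h" for T and h :: "real ^ 'n \<Rightarrow> real"
  proof -
    obtain B p h1 h2 h3 where B: "0 \<le> B" and h': "smooth_test B p h h1 h2 h3"
      using test_function_imp_smooth_test[OF h] by blast
    obtain C1 where C1: "0 \<le> C1" and w1: "\<And>e \<kappa> c (M :: 'w measure) G F a d \<beta> g m y x n.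
      momentum_run R l Mo Mi x0 e \<kappa> c M G F a d \<beta> g m y x \<Longrightarrow> real n * e\<^sup>2 \<le> T \<Longrightarrow>
      \<bar>(\<integral>\<omega>. h (x n \<omega>) \<partial>M) - evolve a (\<lambda>k. a k * sqrt (c * DIM(real ^ 'n))) h 0 n x0\<bar> \<le> C1 * (e / \<kappa>)"
      using run_weak_error[where Mo=Mo and Mi=Mi and ?x0.0=x0 and T=T, OF R(1) l0 l1 Mo Mi0 h' B] by blast
    \<comment> \<open>A separate instance for SGD, whose probability spaces may be of another type
      and whose auxiliary momentum has its own moment bounds.\<close>
    obtain C2 where C2: "0 \<le> C2" and w2: "\<And>e \<kappa> c (M :: 'u measure) G F a d \<beta> g m y x n.
      momentum_run R l Mo (\<lambda>_. 1) x0 e \<kappa> c M G F a d \<beta> g m y x \<Longrightarrow> real n * e\<^sup>2 \<le> T \<Longrightarrow>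
      \<bar>(\<integral>\<omega>. h (x n \<omega>) \<partial>M) - evolve a (\<lambda>k. a k * sqrt (c * DIM(real ^ 'n))) h 0 n x0\<bar> \<le> C2 * (e / \<kappa>)"
      using run_weak_error[where Mo=Mo and Mi="\<lambda>_. 1" and ?x0.0=x0 and T=T, OF R(1) l0 l1 Mo _ h' B] by fastforce
    show ?thesis
    proof (intro exI[of _ "C1 + C2"] conjI allI impI)
      show "0 \<le> C1 + C2" using C1 C2 by simp
      fix \<eta> assume "0 < \<eta> \<and> \<eta> \<le> min \<eta>0 1"
      then have \<eta>: "\<eta> \<in> {0<..\<eta>0}" "0 < \<eta>" "\<eta> \<le> 1" by auto
      \<comment> \<open>With these scales \<open>e\<^sup>2\<close> is the learning rate and
        \<open>\<kappa>\<^sup>2\<close> the order of \<open>1 - \<beta> \<eta> k\<close>. Then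
        \<open>\<alpha> < 1\<close> gives \<open>e \<le> \<kappa>\<close>, and
        \<open>e / \<kappa>\<close> is the rate to be proved.\<close>
      define e where "e = sqrt \<eta>"
      define \<kappa> where "\<kappa> = \<eta> powr (\<alpha> / 2)"
      define c where "c = (\<sigma> \<eta>)\<^sup>2"
      have e: "0 < e" "e \<le> 1" "e\<^sup>2 = \<eta>" "e = \<eta> powr (1 / 2)" using \<eta> by (auto simp: e_def powr_half_sqrt)
      have \<kappa>: "\<kappa> \<le> 1" "\<kappa>\<^sup>2 = \<eta> powr \<alpha>"
      proof -
        show "\<kappa> \<le> 1" unfolding \<kappa>_def using \<eta> assms(1) by (intro powr_le1) auto
        show "\<kappa>\<^sup>2 = \<eta> powr \<alpha>" using \<eta> by (simp add: \<kappa>_def power2_eq_square powr_add[symmetric])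
      qed
      have e\<kappa>: "e \<le> \<kappa>" unfolding e(4) \<kappa>_def using \<eta> assms(2) by (intro powr_mono') auto
      have ratio: "e / \<kappa> = \<eta> powr ((1 - \<alpha>) / 2)"
        unfolding e(4) \<kappa>_def by (simp add: powr_diff[symmetric] diff_divide_distrib)
      have \<sigma>: "0 < \<sigma> \<eta>" "\<sigma> \<eta> \<le> 1 / e"
      proof -
        show "0 < \<sigma> \<eta>" using sigma[OF \<eta>(1)] by blast
        have "\<eta> powr (- 1 / 2) = 1 / e" unfolding e(4) by (simp add: powr_minus_divide)
        then show "\<sigma> \<eta> \<le> 1 / e" using sigma[OF \<eta>(1)] by simp
      qed
      have c: "0 \<le> c" "c * e\<^sup>2 \<le> 1"
      proof -
        have "\<sigma> \<eta> * e \<le> 1" using \<sigma> e by (simp add: pos_le_divide_eq)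
        then have "(\<sigma> \<eta> * e)\<^sup>2 \<le> 1" using \<sigma> e by (intro power_le_one) auto
        then show "c * e\<^sup>2 \<le> 1" by (simp add: c_def power_mult_distrib)
      qed (simp add: c_def)
      have ker: "oracle_kernel Mo e c (oracle_law L Z (\<sigma> \<eta>))"
        unfolding c_def Mo_def by (rule oracle_law_kernel[OF D NGOS cov V e(1,2) \<sigma>])
      have bb: "\<And>k. 0 \<le> \<beta> \<eta> k" "\<And>k. l * \<kappa>\<^sup>2 \<le> 1 - \<beta> \<eta> k" "\<And>k. 1 - \<beta> \<eta> k \<le> \<kappa>\<^sup>2"
        using \<beta>01[OF \<eta>(1)] \<beta>b(1)[OF \<eta>(1)] momentum_bound[OF \<eta>(1)] \<eta> unfolding \<kappa>(2)
        by (auto simp: less_imp_le pos_le_divide_eq)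
      have lr: "\<And>k. 0 \<le> lr \<eta> k" "\<And>k. lr \<eta> k \<le> E * e\<^sup>2"
      proof -
        show "0 \<le> lr \<eta> k" for k using lrb(1)[OF \<eta>(1), of k] \<eta> by (simp add: zero_le_divide_iff)
        show "lr \<eta> k \<le> E * e\<^sup>2" for k using lrb(2)[OF \<eta>(1), of k] \<eta> unfolding e(3) by (simp add: pos_divide_less_eq)
      qed
      obtain F d g m y where run1: "momentum_run R l Mo Mi x0 e \<kappa> c (M \<eta>) (oracle_law L Z (\<sigma> \<eta>)) F
          (averaged_lr (lr \<eta>) (\<beta> \<eta>)) d (\<beta> \<eta>) g m y (x \<eta>)"
        using SGDM_momentum_run[OF D ker e\<kappa> \<kappa>(1) c bb l0 SGDM[OF \<eta>(1)] lr R(2) Mi(1)[OF \<eta>(1)] Mi(2)[OF \<eta>(1)]] by blast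
      \<comment> \<open>The bounds on the averaged rates required for SGD are read off from the run
        just constructed for SGDM.\<close>
      obtain F' d' g' m' y' where run2: "momentum_run R l Mo (\<lambda>_. 1) x0 e \<kappa> c (N \<eta>) (oracle_law L Z (\<sigma> \<eta>)) F'
          (averaged_lr (lr \<eta>) (\<beta> \<eta>)) d' (\<beta> \<eta>) g' m' y' (z \<eta>)"
        using SGD_momentum_run[OF D ker e\<kappa> \<kappa>(1) c bb l0 SGD[OF \<eta>(1)] run_rates(1,2)[OF run1]] R(1) by fastforce
      have "\<bar>(\<integral>\<omega>. h (x \<eta> k \<omega>) \<partial>M \<eta>) - (\<integral>\<omega>. h (z \<eta> k \<omega>) \<partial>N \<eta>)\<bar> \<le> (C1 + C2) * \<eta> powr ((1 - \<alpha>) / 2)"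
        if "real k * \<eta> \<le> T" for k
        using w1[OF run1, of k] w2[OF run2, of k] that unfolding e(3) ratio distrib_right by linarith
      then show "(MAX k\<in>{0..nat \<lfloor>T / \<eta>\<rfloor>}. \<bar>(\<integral>\<omega>. h (x \<eta> k \<omega>) \<partial>M \<eta>) - (\<integral>\<omega>. h (z \<eta> k \<omega>) \<partial>N \<eta>)\<bar>)
         \<le> (C1 + C2) * \<eta> powr ((1 - \<alpha>) / 2)"
        using \<eta>(2) T by (rule Max_interval_le)
    qed
  qed
  have thr: "0 < min \<eta>0 1" using assms(3) by simp
  \<comment> \<open>Both conclusions follow from the same estimate, as any rate above the power of
    \<open>\<eta>\<close> will do.\<close>
  have approx: "weak_approximation_rate r M x N z"
    if r: "\<And>\<eta>. 0 < \<eta> \<Longrightarrow> \<eta> \<le> min \<eta>0 1 \<Longrightarrow> \<eta> powr ((1 - \<alpha>) / 2) \<le> r \<eta>" for r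
    unfolding weak_approximation_rate_def
  proof (rule exI[of _ "min \<eta>0 1"], intro conjI thr allI impI)
    fix T :: real and h :: "real ^ 'n \<Rightarrow> real" assume "0 < T" "test_function h"
    from main[OF this] obtain C where "0 \<le> C" and C: "\<And>\<eta>. 0 < \<eta> \<and> \<eta> \<le> min \<eta>0 1 \<Longrightarrow>
       (MAX k\<in>{0..nat \<lfloor>T / \<eta>\<rfloor>}. \<bar>(\<integral>\<omega>. h (x \<eta> k \<omega>) \<partial>M \<eta>) - (\<integral>\<omega>. h (z \<eta> k \<omega>) \<partial>N \<eta>)\<bar>)
         \<le> C * \<eta> powr ((1 - \<alpha>) / 2)" by blast
    moreover have "C * \<eta> powr ((1 - \<alpha>) / 2) \<le> C * r \<eta>" if "0 < \<eta> \<and> \<eta> \<le> min \<eta>0 1" for \<eta>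
      using r that \<open>0 \<le> C\<close> by (intro mult_left_mono) auto
    ultimately show "\<exists>C. \<forall>\<eta>. 0 < \<eta> \<and> \<eta> \<le> min \<eta>0 1 \<longrightarrow>
       (MAX k\<in>{0..nat \<lfloor>T / \<eta>\<rfloor>}. \<bar>(\<integral>\<omega>. h (x \<eta> k \<omega>) \<partial>M \<eta>) - (\<integral>\<omega>. h (z \<eta> k \<omega>) \<partial>N \<eta>)\<bar>) \<le> C * r \<eta>"
      by (meson order_trans)
  qed
  show ?thesis
  proof (intro conjI allI impI ballI)
    show "weak_approximation ((1 - \<alpha>) / 2) M x N z"
      unfolding weak_approximation_def by (rule approx) simp
    fix b assume b: "\<forall>\<eta>\<in>{0<..\<eta>0}. \<forall>k. lr \<eta> k = \<eta> \<and> \<beta> \<eta> k = b \<eta>"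
    show "averaged_lr (lr \<eta>) (\<beta> \<eta>) k = \<eta>" if "\<eta> \<in> {0<..\<eta>0}" for \<eta> k
      using b that \<beta>01[OF that, of 0] by (intro averaged_lr_constant[of "b \<eta>"]) auto
    show "weak_approximation_rate (\<lambda>\<eta>. sqrt (\<eta> / (1 - b \<eta>))) M x N z"
    proof (rule approx)
      fix \<eta> assume "0 < \<eta>" "\<eta> \<le> min \<eta>0 1"
      then have \<eta>: "\<eta> \<in> {0<..\<eta>0}" "0 < \<eta>" by auto
      \<comment> \<open>The upper scaling bound with constant below 1 gives
        \<open>1 - b \<eta> \<le> \<eta> powr \<alpha>\<close>, so the rate in terms of
        \<open>b \<eta>\<close> is at least the power of \<open>\<eta>\<close> already
        proved.\<close>
      have b1: "0 < 1 - b \<eta>" "1 - b \<eta> \<le> \<eta> powr \<alpha>"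
        using b \<eta> \<beta>01(2)[OF \<eta>(1), of 0] momentum_bound[OF \<eta>(1), of 0] by auto
      have "\<eta> powr ((1 - \<alpha>) / 2) = sqrt (\<eta> powr (1 - \<alpha>))"
        using \<eta> by (simp add: powr_half_sqrt[symmetric] powr_powr)
      also have "\<eta> powr (1 - \<alpha>) = \<eta> / \<eta> powr \<alpha>" using \<eta> by (simp add: powr_diff)
      also have "sqrt (\<eta> / \<eta> powr \<alpha>) \<le> sqrt (\<eta> / (1 - b \<eta>))"
        using b1 \<eta> by (intro real_sqrt_le_mono divide_left_mono) auto
      finally show "\<eta> powr ((1 - \<alpha>) / 2) \<le> sqrt (\<eta> / (1 - b \<eta>))" .
    qed
  qed
qed

end
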